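(* Let $1<p<\infty$, $\omega\in\widehat{\mathcal{D}}$ and $\nu$ a radial weight. Then the following statements are equivalent: (i) $P^+_\omega:L^p_\nu\to L^p_\nu$ is bounded; (ii) $P_\omega:L^p_\nu\to L^p_\nu$ is bounded and $\nu\in\mathcal{M}$; (iii) $A_p(\omega,\nu)<\infty$ and $\omega,\nu\in\mathcal{D}$; (iv) $M_p(\omega,\nu)<\infty$ and $\omega,\nu\in\mathcal{D}$. Moreover, when these equivalent conditions hold, $$M_p^{1-\frac1p}(\omega,\nu)\lesssim A_p(\omega,\nu)\lesssim\|P_\omega\|_{L^p_\nu\to L^p_\nu}\le\|P^+_\omega\|_{L^p_\nu\to L^p_\nu}\lesssim M_p^{2-\frac1p}(\omega,\nu).$$
   Context: $\mathbb{D}$ is the open unit disc of $\mathbb{C}$ and $dA(z)=\frac{dx\,dy}{\pi}$. A radial weight is a nonnegative function $\omega\in L^1([0,1))$ extended to $\mathbb{D}$ by $\omega(z)=\omega(|z|)$; it is assumed throughout that $\widehat{\omega}(z)=\int_{|z|}^1\omega(s)\,ds>0$ for all $z\in\mathbb{D}$ (likewise for $\nu$). Write $\omega_x=\int_0^1r^x\omega(r)\,dr$ for $x\ge0$. Classes of radial weights: $\omega\in\widehat{\mathcal{D}}$ if there is $C\ge1$ with $\widehat{\omega}(r)\le C\widehat{\omega}\left(\frac{1+r}{2}\right)$ for all $0\le r<1$; $\omega\in\check{\mathcal{D}}$ if there are $K>1$ and $C>1$ with $\widehat{\omega}(r)\ge C\widehat{\omega}\left(1-\frac{1-r}{K}\right)$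 for all $0\le r<1$; $\mathcal{D}=\widehat{\mathcal{D}}\cap\check{\mathcal{D}}$; $\omega\in\mathcal{M}$ if there are $C>1$ and $K>1$ with $\omega_x\ge C\omega_{Kx}$ for all $x\ge1$. $L^p_\nu$ is the space of measurable $f$ on $\mathbb{D}$ with $\|f\|_{L^p_\nu}^p=\int_{\mathbb{D}}|f(z)|^p\nu(z)\,dA(z)<\infty$. With $B^\omega_z(\zeta)=\sum_{n=0}^\infty\frac{(\overline{z}\zeta)^n}{2\omega_{2n+1}}$, the Bergman projection and the maximal Bergman projection are $P_\omega(f)(z)=\int_{\mathbb{D}}f(\zeta)\overline{B^\omega_z(\zeta)}\,\omega(\zeta)\,dA(\zeta)$ and $P^+_\omega(f)(z)=\int_{\mathbb{D}}f(\zeta)|B^\omega_z(\zeta)|\,\omega(\zeta)\,dA(\zeta)$; boundedness includes that the defining integrals make sense for all $f\in L^p_\nu$. $p'$ is the conjugate exponent, $\frac1p+\frac1{p'}=1$. Let $\sigma(r)=\sigma_{p,\omega,\nu}(r)=r\left(\frac{\omega(r)}{\nu(r)^{1/p}}\right)^{p'}$ for $0\le r<1$ (with conventions $0/0=0$ and $a/0=\infty$ for $a>0$), $\widehat{\sigma}(r)=\int_r^1\sigma(s)\,ds$, and $$A_p(\omega,\nu)=\sup_{0\le r<1}\frac{\widehat{\nu}(r)^{\frac1p}\,\widehat{\sigma}(r)^{\frac1{p'}}}{\widehat{\omega}(r)},\qquad M_p(\omega,\nu)=\sup_{0<r<1}\left(\int_0^r\frac{\nu(s)}{\widehat{\omega}(s)^p}\,s\,ds+1\right)^{\frac1p}\widehat{\sigma}(r)^{\frac1{p'}}.$$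 $a\lesssim b$ means $a\le Cb$ for a constant $C>0$, which may depend on the parameters $p,\omega,\nu$. *)

theory Defs
  imports "HOL-Analysis.Analysis"
begin

section \<open>Radial weights\<close>

text \<open>A radial weight is represented by its profile \<open>\<omega> :: real \<Rightarrow> real\<close>; only the values on
  \<open>[0,1)\<close> matter, and the weight on the unit disc is \<open>\<lambda>z. \<omega> (cmod z)\<close>.\<close>

definition tail :: "(real \<Rightarrow> real) \<Rightarrow> real \<Rightarrow> real" where
  "tail \<omega> r = (LINT s:{r..<1}|lebesgue. \<omega> s)"

definition radial_weight :: "(real \<Rightarrow> real) \<Rightarrow> bool" where
  "radial_weight \<omega> \<longleftrightarrow>
     (\<forall>r\<in>{0..<1}. 0 \<le> \<omega> r) \<and> set_integrable lebesgue {0..<1} \<omega> \<and> (\<forall>r\<in>{0..<1}. 0 < tail \<omega> r)"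

definition moment :: "(real \<Rightarrow> real) \<Rightarrow> real \<Rightarrow> real" where
  "moment \<omega> x = (LINT r:{0..<1}|lebesgue. r powr x * \<omega> r)"

definition class_Dhat :: "(real \<Rightarrow> real) set" where
  "class_Dhat = {\<omega>. radial_weight \<omega> \<and>
     (\<exists>C\<ge>1. \<forall>r\<in>{0..<1}. tail \<omega> r \<le> C * tail \<omega> ((1 + r) / 2))}"

definition class_Dcheck :: "(real \<Rightarrow> real) set" where
  "class_Dcheck = {\<omega>. radial_weight \<omega> \<and>
     (\<exists>K>1. \<exists>C>1. \<forall>r\<in>{0..<1}. tail \<omega> r \<ge> C * tail \<omega> (1 - (1 - r) / K))}"

definition class_D :: "(real \<Rightarrow> real) set" where
  "class_D = class_Dhat \<inter> class_Dcheck"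

definition class_M :: "(real \<Rightarrow> real) set" where
  "class_M = {\<omega>. radial_weight \<omega> \<and>
     (\<exists>C>1. \<exists>K>1. \<forall>x\<ge>1. moment \<omega> x \<ge> C * moment \<omega> (K * x))}"


section \<open>Weighted Lebesgue spaces on the disc\<close>

text \<open>Real powers of extended nonnegative reals, used for exponents \<open>a > 0\<close> only.\<close>

definition epowr :: "ennreal \<Rightarrow> real \<Rightarrow> ennreal" (infixr "epowr" 80) where
  "x epowr a = (if x = \<infinity> then \<infinity> else ennreal (enn2real x powr a))"

definition disc_area :: "complex measure" where
  "disc_area = density (lebesgue_on (ball 0 1)) (\<lambda>_. ennreal (1 / pi))"

definition Lp_norm :: "real \<Rightarrow> (real \<Rightarrow> real) \<Rightarrow> (complex \<Rightarrow> complex) \<Rightarrow> ennreal" where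
  "Lp_norm p \<nu> f = (\<integral>\<^sup>+z. ennreal (cmod (f z) powr p * \<nu> (cmod z)) \<partial>disc_area) epowr (1 / p)"

definition Lp_space :: "real \<Rightarrow> (real \<Rightarrow> real) \<Rightarrow> (complex \<Rightarrow> complex) set" where
  "Lp_space p \<nu> = {f. f \<in> borel_measurable disc_area \<and> Lp_norm p \<nu> f < \<infinity>}"

definition Lp_opnorm ::
    "real \<Rightarrow> (real \<Rightarrow> real) \<Rightarrow> ((complex \<Rightarrow> complex) \<Rightarrow> (complex \<Rightarrow> complex)) \<Rightarrow> ennreal" where
  "Lp_opnorm p \<nu> T = (SUP f\<in>{f \<in> Lp_space p \<nu>. Lp_norm p \<nu> f \<le> 1}. Lp_norm p \<nu> (T f))"


section \<open>The Bergman projection and the maximal Bergman projection\<close>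

definition bergman_kernel :: "(real \<Rightarrow> real) \<Rightarrow> complex \<Rightarrow> complex \<Rightarrow> complex" where
  "bergman_kernel \<omega> z \<zeta> =
     (\<Sum>n. (cnj z * \<zeta>) ^ n / complex_of_real (2 * moment \<omega> (2 * real n + 1)))"

definition integral_op ::
    "(real \<Rightarrow> real) \<Rightarrow> (complex \<Rightarrow> complex \<Rightarrow> complex) \<Rightarrow> (complex \<Rightarrow> complex) \<Rightarrow> complex \<Rightarrow> complex" where
  "integral_op \<omega> k f z = (LINT \<zeta>|disc_area. f \<zeta> * k z \<zeta> * complex_of_real (\<omega> (cmod \<zeta>)))"

text \<open>The Bochner integral is \<open>0\<close> for non-integrable functions, so boundedness has to demand
  explicitly that all the defining integrals converge.\<close>

definition integral_op_bounded ::
    "real \<Rightarrow> (real \<Rightarrow> real) \<Rightarrow> (real \<Rightarrow> real) \<Rightarrow> (complex \<Rightarrow> complex \<Rightarrow> complex) \<Rightarrow> bool" where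
  "integral_op_bounded p \<nu> \<omega> k \<longleftrightarrow>
     (\<forall>f\<in>Lp_space p \<nu>. \<forall>z\<in>ball 0 1.
        integrable disc_area (\<lambda>\<zeta>. f \<zeta> * k z \<zeta> * complex_of_real (\<omega> (cmod \<zeta>)))) \<and>
     (\<forall>f\<in>Lp_space p \<nu>. integral_op \<omega> k f \<in> Lp_space p \<nu>) \<and>
     (\<exists>C\<ge>0. \<forall>f\<in>Lp_space p \<nu>. Lp_norm p \<nu> (integral_op \<omega> k f) \<le> ennreal C * Lp_norm p \<nu> f)"

definition bergman_proj :: "(real \<Rightarrow> real) \<Rightarrow> (complex \<Rightarrow> complex) \<Rightarrow> complex \<Rightarrow> complex" where
  "bergman_proj \<omega> = integral_op \<omega> (\<lambda>z \<zeta>. cnj (bergman_kernel \<omega> z \<zeta>))"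

definition max_bergman_proj :: "(real \<Rightarrow> real) \<Rightarrow> (complex \<Rightarrow> complex) \<Rightarrow> complex \<Rightarrow> complex" where
  "max_bergman_proj \<omega> = integral_op \<omega> (\<lambda>z \<zeta>. complex_of_real (cmod (bergman_kernel \<omega> z \<zeta>)))"

definition bergman_proj_bounded :: "real \<Rightarrow> (real \<Rightarrow> real) \<Rightarrow> (real \<Rightarrow> real) \<Rightarrow> bool" where
  "bergman_proj_bounded p \<omega> \<nu> \<longleftrightarrow>
     integral_op_bounded p \<nu> \<omega> (\<lambda>z \<zeta>. cnj (bergman_kernel \<omega> z \<zeta>))"

definition max_bergman_proj_bounded :: "real \<Rightarrow> (real \<Rightarrow> real) \<Rightarrow> (real \<Rightarrow> real) \<Rightarrow> bool" where
  "max_bergman_proj_bounded p \<omega> \<nu> \<longleftrightarrow>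
     integral_op_bounded p \<nu> \<omega> (\<lambda>z \<zeta>. complex_of_real (cmod (bergman_kernel \<omega> z \<zeta>)))"


section \<open>The two Muckenhoupt-type constants\<close>

definition conj_exponent :: "real \<Rightarrow> real" where
  "conj_exponent p = p / (p - 1)"

text \<open>Division in \<^typ>\<open>ennreal\<close> satisfies \<open>0 / 0 = 0\<close> and \<open>a / 0 = \<infinity>\<close> for \<open>a > 0\<close>, which are exactly
  the conventions needed where \<open>\<nu>\<close> vanishes.\<close>

definition sigma_weight :: "real \<Rightarrow> (real \<Rightarrow> real) \<Rightarrow> (real \<Rightarrow> real) \<Rightarrow> real \<Rightarrow> ennreal" where
  "sigma_weight p \<omega> \<nu> r =
     ennreal r * (ennreal (\<omega> r) / ennreal (\<nu> r powr (1 / p))) epowr conj_exponent p"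

definition sigma_tail :: "real \<Rightarrow> (real \<Rightarrow> real) \<Rightarrow> (real \<Rightarrow> real) \<Rightarrow> real \<Rightarrow> ennreal" where
  "sigma_tail p \<omega> \<nu> r = (\<integral>\<^sup>+s\<in>{r..<1}. sigma_weight p \<omega> \<nu> s \<partial>lebesgue)"

definition A_const :: "real \<Rightarrow> (real \<Rightarrow> real) \<Rightarrow> (real \<Rightarrow> real) \<Rightarrow> ennreal" where
  "A_const p \<omega> \<nu> = (SUP r\<in>{0..<1}.
     ennreal (tail \<nu> r powr (1 / p)) * sigma_tail p \<omega> \<nu> r epowr (1 / conj_exponent p)
       / ennreal (tail \<omega> r))"

definition M_const :: "real \<Rightarrow> (real \<Rightarrow> real) \<Rightarrow> (real \<Rightarrow> real) \<Rightarrow> ennreal" where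
  "M_const p \<omega> \<nu> = (SUP r\<in>{0<..<1}.
     ((\<integral>\<^sup>+s\<in>{0..r}. ennreal (\<nu> s / tail \<omega> s powr p * s) \<partial>lebesgue) + 1) epowr (1 / p)
       * sigma_tail p \<omega> \<nu> r epowr (1 / conj_exponent p))"

end

theory Submission
  imports Defs "HOL-Real_Asymp.Real_Asymp"
begin

text \<open>Hoelder's inequality gives \<open>tail \<omega> \<lesssim> (tail \<nu>)\<^sup>1\<^sup>/\<^sup>p (tail \<sigma>)\<^sup>1\<^sup>/\<^sup>q\<close> away from the
  origin, and finiteness of \<open>A_const\<close> is the reverse estimate. The product of the two tails is therefore comparable
  to \<open>tail \<omega>\<close>, and doubling and geometric decay pass between \<open>\<omega>\<close>, \<open>\<nu>\<close> and \<open>\<sigma>\<close>. Sufficiency is a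
  Schur test: for \<open>\<omega> \<in> class_D\<close> the kernel has circle means at most a constant over \<open>tail \<omega>\<close>, because its
  increments between dyadic circles obey such a bound and geometric decay lets them be summed. For necessity, radial test functions
  times monomials already force \<open>A_const\<close> to be finite, and Hardy's inequality bounds the circle means of the kernel
  from below by a sum whose logarithmic growth is incompatible with boundedness unless \<open>\<omega> \<in> class_Dcheck\<close>.\<close>

section \<open>Tails and moments of radial weights\<close>

text \<open>Doubling of \<open>\<omega>\<close> makes the kernel coefficient of order
  \<open>n\<close> comparable to \<open>1 / tail \<omega> r\<close> for \<open>n\<close> about
  \<open>1 / (1 - r)\<close>; a monomial of that degree therefore tests exactly the quotient in
  \<open>A_const\<close>. Properties pass between the weights because \<open>fN\<close> and
  \<open>fE\<close>, the two factors of its numerator, both decrease: combined with the monotonicity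
  of one factor, an estimate for the product yields the same kind of estimate for the other.
  Geometric decay, on which the kernel bound rests, is not among the hypotheses. When only
  \<open>bergman_proj\<close> is known to be bounded, the decay enters through \<open>\<nu>\<close>,
  whose membership in \<open>class_M\<close> becomes membership in \<open>class_Dcheck\<close> once
  \<open>\<nu>\<close> is known to be doubling. Two obstacles shape the details. The factor
  \<open>r\<close> in \<open>\<sigma>\<close> breaks Hoelder's inequality for tails near the origin,
  which explains the threshold \<open>1/2\<close> in \<open>weight_holder\<close> and its
  consequences. The weights are merely Lebesgue measurable on \<open>{0..<1}\<close> and
  \<open>\<nu>\<close> may vanish, which explains the indicators, the Borel representatives and the
  extended-valued quotient of \<open>\<omega>\<close> by \<open>\<nu> powr (1 / p)\<close>.\<close>

lemma radial_weight_integrable: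
  assumes "radial_weight \<omega>" "A \<subseteq> {0..<1}" "A \<in> sets lebesgue"
  shows "set_integrable lebesgue A \<omega>"
  using assms by (auto simp: radial_weight_def intro: set_integrable_subset)

text \<open>The weight is constrained only on \<open>{0..<1}\<close>, so measurability can be
  claimed only after multiplication by the indicator; later measurability arguments carry this
  product along.\<close>

lemma radial_weight_measurable:
  assumes "radial_weight \<omega>"
  shows "(\<lambda>t. ennreal (\<omega> t) * indicator {0..<1} t) \<in> borel_measurable lebesgue"
proof -
  have "(\<lambda>t. indicator {0..<1} t *\<^sub>R \<omega> t) \<in> borel_measurable lebesgue"
    using assms by (auto simp: radial_weight_def set_integrable_def)
  then have "(\<lambda>t. ennreal (indicator {0..<1} t *\<^sub>R \<omega> t)) \<in> borel_measurable lebesgue"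
    by simp
  also have "(\<lambda>t. ennreal (indicator {0..<1} t *\<^sub>R \<omega> t)) = (\<lambda>t. ennreal (\<omega> t) * indicator {0..<1} t)"
    by (auto simp: indicator_def)
  finally show ?thesis .
qed

lemma set_nn_integral_eq_integral:
  fixes f :: "real \<Rightarrow> real"
  assumes "set_integrable lebesgue A f" "\<And>t. t \<in> A \<Longrightarrow> 0 \<le> f t"
  shows "(\<integral>\<^sup>+t\<in>A. ennreal (f t) \<partial>lebesgue) = ennreal (LINT t:A|lebesgue. f t)"
proof -
  have "(\<integral>\<^sup>+t\<in>A. ennreal (f t) \<partial>lebesgue) = (\<integral>\<^sup>+t. ennreal (indicator A t *\<^sub>R f t) \<partial>lebesgue)"
    by (intro nn_integral_cong) (auto simp: indicator_def)
  also have "\<dots> = ennreal (LINT t:A|lebesgue. f t)"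
    unfolding set_lebesgue_integral_def
    by (rule nn_integral_eq_integral) (use assms in \<open>auto simp: set_integrable_def indicator_def\<close>)
  finally show ?thesis .
qed

lemma tail_nn:
  assumes "radial_weight \<omega>" "0 \<le> r"
  shows "(\<integral>\<^sup>+s\<in>{r..<1}. ennreal (\<omega> s) \<partial>lebesgue) = ennreal (tail \<omega> r)"
  unfolding tail_def using assms
  by (intro set_nn_integral_eq_integral radial_weight_integrable) (auto simp: radial_weight_def)

lemma tail_pos: "radial_weight \<omega> \<Longrightarrow> 0 \<le> r \<Longrightarrow> r < 1 \<Longrightarrow> 0 < tail \<omega> r"
  by (auto simp: radial_weight_def)

lemma tail_antimono:
  assumes "radial_weight \<omega>" "0 \<le> r" "r \<le> s"
  shows "tail \<omega> s \<le> tail \<omega> r"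
proof (cases "s < 1")
  case True
  have "ennreal (tail \<omega> s) \<le> ennreal (tail \<omega> r)"
    unfolding tail_nn[symmetric, OF assms(1,2)] tail_nn[symmetric, OF assms(1) order_trans[OF assms(2,3)]]
    using assms(3) by (intro nn_integral_mono) (auto simp: indicator_def)
  then show ?thesis
    using tail_pos[OF assms(1,2)] True assms by (subst (asm) ennreal_le_iff) auto
next
  case False
  then have "tail \<omega> s = 0" by (simp add: tail_def set_lebesgue_integral_def)
  moreover have "0 \<le> tail \<omega> r"
    unfolding tail_def set_lebesgue_integral_def
    using assms by (intro Bochner_Integration.integral_nonneg) (auto simp: indicator_def radial_weight_def)
  ultimately show ?thesis by simp
qed

lemma moment_integrable:
  assumes "radial_weight \<omega>" "0 \<le> x"
  shows "set_integrable lebesgue {0..<1} (\<lambda>r. r powr x * \<omega> r)"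
proof -
  have i: "integrable lebesgue (\<lambda>t. indicator {0..<1} t *\<^sub>R \<omega> t)"
    using assms by (auto simp: radial_weight_def set_integrable_def)
  show ?thesis unfolding set_integrable_def
  proof (rule Bochner_Integration.integrable_bound[OF i])
    have m: "(\<lambda>t::real. t powr x) \<in> borel_measurable lebesgue"
      by (intro measurable_completion) auto
    have "(\<lambda>t. t powr x * (indicator {0..<1} t *\<^sub>R \<omega> t)) \<in> borel_measurable lebesgue"
      by (intro borel_measurable_times m borel_measurable_integrable[OF i])
    then show "(\<lambda>t. indicator {0..<1} t *\<^sub>R (t powr x * \<omega> t)) \<in> borel_measurable lebesgue"
      by (simp add: mult_ac)
    show "AE t in lebesgue. norm (indicator {0..<1} t *\<^sub>R (t powr x * \<omega> t)) \<le> norm (indicator {0..<1} t *\<^sub>R \<omega> t)"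
      using assms by (auto intro!: AE_I2 mult_left_le_one_le powr_le1 simp: indicator_def abs_mult)
  qed
qed

lemma moment_nn:
  assumes "radial_weight \<omega>" "0 \<le> x"
  shows "(\<integral>\<^sup>+r\<in>{0..<1}. ennreal (r powr x * \<omega> r) \<partial>lebesgue) = ennreal (moment \<omega> x)"
  unfolding moment_def using assms
  by (intro set_nn_integral_eq_integral moment_integrable) (auto simp: radial_weight_def)

text \<open>A comparison on the open interval suffices: at \<open>r = 0\<close> both integrands
  vanish, because \<open>0 powr x = 0\<close> even for \<open>x = 0\<close>.\<close>

lemma moment_le_moment:
  assumes "radial_weight \<omega>" "0 \<le> x" "0 \<le> y" "\<And>r. 0 < r \<Longrightarrow> r < 1 \<Longrightarrow> r powr x \<le> a * r powr y"
  shows "moment \<omega> x \<le> a * moment \<omega> y"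
proof -
  have "moment \<omega> x \<le> (LINT r:{0..<1}|lebesgue. a * (r powr y * \<omega> r))"
    unfolding moment_def
  proof (rule set_integral_mono)
    show "r powr x * \<omega> r \<le> a * (r powr y * \<omega> r)" if "r \<in> {0..<1}" for r
    proof (cases "r = 0")
      case False
      then have "r powr x * \<omega> r \<le> (a * r powr y) * \<omega> r"
        using assms that by (intro mult_right_mono) (auto simp: radial_weight_def)
      then show ?thesis by (simp add: mult_ac)
    qed simp
  qed (use assms moment_integrable in auto)
  also have "\<dots> = a * moment \<omega> y" by (simp add: moment_def)
  finally show ?thesis .
qed

lemma moment_antimono:
  assumes "radial_weight \<omega>" "0 \<le> x" "x \<le> y"
  shows "moment \<omega> y \<le> moment \<omega> x"
  using moment_le_moment[of \<omega> y x 1] assms by (simp add: powr_mono')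

text \<open>Discards the part of the moment below \<open>r\<close> and uses that
  \<open>s powr x\<close> increases in \<open>s\<close>. It is sharp enough when
  \<open>r powr x\<close> stays bounded below, that is for \<open>x\<close> of order at most
  \<open>1 / (1 - r)\<close>.\<close>

lemma tail_le_moment:
  assumes "radial_weight \<omega>" "0 < r" "r < 1" "0 \<le> x"
  shows "r powr x * tail \<omega> r \<le> moment \<omega> x"
proof -
  have "ennreal (r powr x * tail \<omega> r) = ennreal (r powr x) * (\<integral>\<^sup>+s\<in>{r..<1}. ennreal (\<omega> s) \<partial>lebesgue)"
    using assms by (simp add: tail_nn ennreal_mult' )
  also have "\<dots> = (\<integral>\<^sup>+s. ennreal (r powr x) * (ennreal (\<omega> s) * indicator {0..<1} s * indicator {r..<1} s) \<partial>lebesgue)"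
    using assms radial_weight_measurable[OF assms(1)]
    by (subst nn_integral_cmult)
       (auto intro!: arg_cong[where f = "(*) (ennreal (r powr x))"] nn_integral_cong borel_measurable_times_ennreal borel_measurable_indicator split: split_indicator)
  also have "\<dots> \<le> (\<integral>\<^sup>+s\<in>{0..<1}. ennreal (s powr x * \<omega> s) \<partial>lebesgue)"
  proof (intro nn_integral_mono, simp split: split_indicator, safe)
    fix s assume "r \<le> s" "s < 1" "0 \<le> s"
    then have "r powr x * \<omega> s \<le> s powr x * \<omega> s"
      using assms by (intro mult_right_mono powr_mono2) (auto simp: radial_weight_def)
    then show "ennreal (r powr x) * ennreal (\<omega> s) \<le> ennreal (s powr x * \<omega> s)"
      using assms \<open>0 \<le> s\<close> \<open>s < 1\<close> by (simp add: ennreal_mult'[symmetric] ennreal_leI)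
  qed
  also have "\<dots> = ennreal (moment \<omega> x)" using assms by (simp add: moment_nn)
  finally show ?thesis
    by (rule ennreal_le_iff[THEN iffD1, rotated])
       (use assms in \<open>auto simp: moment_def radial_weight_def set_lebesgue_integral_def indicator_def intro!: Bochner_Integration.integral_nonneg\<close>)
qed

lemma moment_pos:
  assumes "radial_weight \<omega>" "0 \<le> x"
  shows "0 < moment \<omega> x"
proof -
  have "0 < (1/2) powr x * tail \<omega> (1/2)" using assms tail_pos[of \<omega> "1/2"] by simp
  also have "\<dots> \<le> moment \<omega> x" using assms by (intro tail_le_moment) auto
  finally show ?thesis .
qed

text \<open>From \<open>1 / r \<le> exp ((1 - r) / r)\<close>, where \<open>1 / r \<le> 2\<close>.
  It keeps powers of \<open>r\<close> away from 0 while the exponent is of order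
  \<open>1 / (1 - r)\<close>, as in \<open>tail_le_moment_Dhat\<close> and
  \<open>floor_inverse_power\<close>.\<close>

lemma powr_ge_exp:
  fixes r y :: real
  assumes "1/2 \<le> r" "r \<le> 1" "0 \<le> y"
  shows "exp (- 2 * (1 - r) * y) \<le> r powr y"
proof -
  have "1 / r = 1 + (1 - r) / r" using assms by (simp add: field_simps)
  also have "\<dots> \<le> exp ((1 - r) / r)" by (rule exp_ge_add_one_self)
  also have "(1 - r) / r \<le> 2 * (1 - r)"
    using assms mult_nonneg_nonneg[of "1 - r" "2 * r - 1"] by (simp add: field_simps)
  finally have "1 / r \<le> exp (2 * (1 - r))" by simp
  then have "exp (- 2 * (1 - r)) \<le> r"
  proof -
    have "exp (- 2 * (1 - r)) = 1 / exp (2 * (1 - r))"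
      using exp_minus[of "2 * (1 - r)"] by (simp add: inverse_eq_divide)
    also have "\<dots> \<le> r" using \<open>1 / r \<le> exp (2 * (1 - r))\<close> assms
      by (simp add: divide_le_eq mult.commute)
    finally show ?thesis .
  qed
  then have "exp (- 2 * (1 - r)) powr y \<le> r powr y"
    using assms by (intro powr_mono2) auto
  then show ?thesis by (simp add: exp_powr_real)
qed

section \<open>Doubling weights: comparison of tails and moments\<close>

lemma Dhat_radial: "\<omega> \<in> class_Dhat \<Longrightarrow> radial_weight \<omega>"
  by (simp add: class_Dhat_def)

text \<open>One application of the doubling condition halves the distance to the boundary, so
  \<open>k\<close> of them cost \<open>C ^ k\<close>. The dependence on \<open>k\<close> is kept
  explicit because later sums play it against exponential decay in \<open>2 ^ k\<close>.\<close>

lemma Dhat_power: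
  assumes "\<omega> \<in> class_Dhat"
  obtains C where "C \<ge> 1" "\<And>r k. 0 \<le> r \<Longrightarrow> r < 1 \<Longrightarrow> tail \<omega> r \<le> C ^ k * tail \<omega> (1 - (1 - r) / 2 ^ k)"
proof -
  from assms obtain C where C: "C \<ge> 1" "\<And>r. 0 \<le> r \<Longrightarrow> r < 1 \<Longrightarrow> tail \<omega> r \<le> C * tail \<omega> ((1 + r) / 2)"
    by (auto simp: class_Dhat_def)
  have "tail \<omega> r \<le> C ^ k * tail \<omega> (1 - (1 - r) / 2 ^ k)" if r: "0 \<le> r" "r < 1" for r k
  proof (induction k)
    case (Suc k)
    let ?s = "1 - (1 - r) / 2 ^ k"
    have pos: "(1 - r) / 2 ^ k > 0" using r by simp
    have "(1 - r) \<le> 2 ^ k" using r one_le_power[of "2::real" k] by linarith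
    then have le: "(1 - r) / 2 ^ k \<le> 1" by (simp add: divide_simps)
    have "tail \<omega> ?s \<le> C * tail \<omega> ((1 + ?s) / 2)" using pos le by (intro C(2)) auto
    moreover have "(1 + ?s) / 2 = 1 - (1 - r) / 2 ^ Suc k" by (simp add: field_simps)
    ultimately have "tail \<omega> ?s \<le> C * tail \<omega> (1 - (1 - r) / 2 ^ Suc k)" by metis
    then have "C ^ k * tail \<omega> ?s \<le> C ^ k * (C * tail \<omega> (1 - (1 - r) / 2 ^ Suc k))"
      using C(1) by (intro mult_left_mono) auto
    with Suc show ?case by (simp add: mult_ac)
  qed simp
  with C(1) show ?thesis using that by blast
qed

text \<open>Rounds the ratio \<open>K\<close> of distances to the boundary up to a power of two, so
  the constant depends on \<open>K\<close> only. The point \<open>s\<close> may lie on either side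
  of \<open>r\<close>.\<close>

lemma Dhat_ratio:
  assumes "\<omega> \<in> class_Dhat" "K \<ge> 1"
  obtains C where "C \<ge> 1" "\<And>r s. 0 \<le> r \<Longrightarrow> r < 1 \<Longrightarrow> 1 - r \<le> K * (1 - s) \<Longrightarrow> 0 \<le> s \<Longrightarrow> tail \<omega> r \<le> C * tail \<omega> s"
proof -
  obtain C where C: "C \<ge> 1" "\<And>r k. 0 \<le> r \<Longrightarrow> r < 1 \<Longrightarrow> tail \<omega> r \<le> C ^ k * tail \<omega> (1 - (1 - r) / 2 ^ k)"
    using Dhat_power[OF assms(1)] by blast
  obtain k where k: "K < 2 ^ k" using real_arch_pow[of 2 K] by auto
  have "tail \<omega> r \<le> C ^ k * tail \<omega> s" if r: "0 \<le> r" "r < 1" and s: "1 - r \<le> K * (1 - s)" "0 \<le> s" for r s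
  proof -
    have "0 < 1 - s" using r s assms(2) by (smt (verit) mult_nonneg_nonpos)
    then have "1 - r \<le> 2 ^ k * (1 - s)" using s k by (smt (verit) mult_right_mono)
    then have "(1 - r) / 2 ^ k \<le> 1 - s" by (simp add: field_simps)
    then have "tail \<omega> (1 - (1 - r) / 2 ^ k) \<le> tail \<omega> s"
      using assms Dhat_radial s by (intro tail_antimono) auto
    then show ?thesis using C(2)[OF r, of k] C(1)
      by (smt (verit) mult_left_mono zero_le_power)
  qed
  then show ?thesis using that C(1) one_le_power by blast
qed

text \<open>Balances the doubling loss \<open>C ^ k\<close> at the \<open>k\<close>-th dyadic scale
  against the decay of a high power there, which is exponential in \<open>2 ^ k\<close>. The divisor
  8 is the weaker of the two rates that \<open>moment_le_tail\<close> and
  \<open>bcoef_growth\<close> deliver.\<close>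

lemma exp_double_exp_bounded:
  assumes "1 \<le> (C::real)"
  obtains B where "B > 0" "\<And>k::nat. C ^ k * exp (- (2 ^ k / 8)) \<le> B"
proof -
  have "(\<lambda>k::nat. C ^ k * exp (- (2 ^ k / 8))) \<longlonglongrightarrow> 0"
  proof (cases "C = 1")
    case False
    with assms have "C > 1" by simp
    then show ?thesis by real_asymp
  qed (simp, real_asymp)
  then have "Bseq (\<lambda>k::nat. C ^ k * exp (- (2 ^ k / 8)))"
    by (rule convergent_imp_Bseq[OF convergentI])
  then show ?thesis using that unfolding Bseq_def by (metis abs_le_D1 real_norm_def)
qed

text \<open>Splits \<open>{0..<1}\<close> at the points \<open>1 - 2 ^ k / x\<close>. At the
  \<open>k\<close>-th scale \<open>r powr x\<close> is at most about
  \<open>exp (- (2 ^ k) / 2)\<close>, while by doubling the tail exceeds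
  \<open>tail \<omega> (1 - 1 / x)\<close> by at most \<open>C ^ k\<close>; the sum over
  \<open>k\<close> stays bounded.\<close>

lemma moment_le_tail:
  assumes "\<omega> \<in> class_Dhat"
  obtains C where "C > 0" "\<And>x. x \<ge> 1 \<Longrightarrow> moment \<omega> x \<le> C * tail \<omega> (1 - 1 / x)"
proof -
  note rw = Dhat_radial[OF assms]
  obtain C where C: "C \<ge> 1" "\<And>r k. 0 \<le> r \<Longrightarrow> r < 1 \<Longrightarrow> tail \<omega> r \<le> C ^ k * tail \<omega> (1 - (1 - r) / 2 ^ k)"
    using Dhat_power[OF assms(1)] by blast
  \<comment> \<open>Using \<open>2 * C\<close> in place of \<open>C\<close> leaves a factor
    \<open>(1/2) ^ k\<close> over, which makes the final sum geometric.\<close>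
  obtain B where B: "B > 0" "\<And>k::nat. (2 * C) ^ k * exp (- (2 ^ k / 8)) \<le> B"
    using exp_double_exp_bounded[of "2 * C"] C(1) by auto
  \<comment> \<open>The extra 1 in the exponent makes \<open>a 0 \<ge> 1\<close>, so that the same
    formula serves the scale \<open>k = 0\<close>, where only \<open>r powr x \<le> 1\<close> is
    known.\<close>
  define a where "a k = exp (1 - 2 ^ k / 2 :: real)" for k :: nat
  have aC: "a k * C ^ k \<le> (exp 1 * B) * (1/2) ^ k" for k
  proof -
    have "exp (1 - 2 ^ k / 2 :: real) \<le> exp 1 * exp (- (2 ^ k / 8))"
      by (simp add: mult_exp_exp)
    then have "a k * C ^ k \<le> exp 1 * exp (- (2 ^ k / 8)) * C ^ k"
      unfolding a_def using C(1) by (intro mult_right_mono) auto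
    also have "\<dots> = exp 1 * ((2 * C) ^ k * exp (- (2 ^ k / 8))) * (1/2) ^ k"
      by (simp add: power_mult_distrib power_divide)
    also have "\<dots> \<le> exp 1 * B * (1/2) ^ k"
      using B by (intro mult_right_mono mult_left_mono) auto
    finally show ?thesis .
  qed
  have "moment \<omega> x \<le> (2 * (exp 1 * B)) * tail \<omega> (1 - 1 / x)" if x: "x \<ge> 1" for x
  proof -
    obtain m where m: "x < 2 ^ m" using real_arch_pow[of 2 x] by auto
    \<comment> \<open>The cut-off points are truncated at 0 once \<open>2 ^ k\<close> exceeds
      \<open>x\<close>; for these \<open>k\<close> the bound on \<open>tail \<omega> 0\<close> goes
      through the point \<open>1 - 1 / 2 ^ k\<close> instead.\<close>
    define s where "s k = max 0 (1 - 2 ^ k / x)" for k :: nat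
    have pw: "r powr x \<le> (\<Sum>k\<le>m. a k * indicator {s k..<1} r)" if r: "0 \<le> r" "r < 1" for r
    proof -
      define k where "k = (LEAST k. 1 - 2 ^ k / x \<le> r)"
      have "1 \<le> 2 ^ m / x" using m x by (simp add: field_simps)
      then have m': "1 - 2 ^ m / x \<le> r" using r by linarith
      have k1: "1 - 2 ^ k / x \<le> r" unfolding k_def by (rule LeastI[of "\<lambda>k. 1 - 2 ^ k / x \<le> r", OF m'])
      have k2: "k \<le> m" unfolding k_def by (rule Least_le[of "\<lambda>k. 1 - 2 ^ k / x \<le> r", OF m'])
      have "r powr x \<le> a k"
      proof (cases k)
        case 0
        have "r powr x \<le> 1" using r x by (intro powr_le1) auto
        also have "1 \<le> a k" by (simp add: 0 a_def)
        finally show ?thesis .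
      next
        case (Suc j)
        have "\<not> 1 - 2 ^ j / x \<le> r"
          using not_less_Least[of j "\<lambda>k. 1 - 2 ^ k / x \<le> r"] Suc k_def by auto
        then have "r \<le> 1 + - (2 ^ j / x)" by simp
        also have "\<dots> \<le> exp (- (2 ^ j / x))" by (rule exp_ge_add_one_self)
        finally have "r powr x \<le> exp (- (2 ^ j / x)) powr x" using r x by (intro powr_mono2) auto
        also have "\<dots> = exp (- (2 ^ j))" using x by (simp add: exp_powr_real)
        also have "\<dots> \<le> a k" by (simp add: a_def Suc)
        finally show ?thesis .
      qed
      also have "a k = (\<Sum>i\<in>{k}. a i * indicator {s i..<1} r)"
        using k1 r by (simp add: s_def)
      also have "\<dots> \<le> (\<Sum>k\<le>m. a k * indicator {s k..<1} r)"
        using k2 by (intro sum_mono2) (auto simp: a_def)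
      finally show ?thesis .
    qed
    have "ennreal (moment \<omega> x) = (\<integral>\<^sup>+r\<in>{0..<1}. ennreal (r powr x * \<omega> r) \<partial>lebesgue)"
      using rw x by (simp add: moment_nn)
    also have "\<dots> \<le> (\<integral>\<^sup>+r. (\<Sum>k\<le>m. ennreal (a k) * (ennreal (\<omega> r) * indicator {0..<1} r * indicator {s k..<1} r)) \<partial>lebesgue)"
    proof (intro nn_integral_mono)
      fix r :: real
      show "ennreal (r powr x * \<omega> r) * indicator {0..<1} r \<le>
          (\<Sum>k\<le>m. ennreal (a k) * (ennreal (\<omega> r) * indicator {0..<1} r * indicator {s k..<1} r))"
      proof (cases "r \<in> {0..<1}")
        case True
        then have nn: "\<omega> r \<ge> 0" using rw by (auto simp: radial_weight_def)
        have "ennreal (r powr x * \<omega> r) \<le> ennreal ((\<Sum>k\<le>m. a k * indicator {s k..<1} r) * \<omega> r)"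
          using pw[of r] True nn by (intro ennreal_leI mult_right_mono) auto
        also have "\<dots> = (\<Sum>k\<le>m. ennreal (a k * indicator {s k..<1} r * \<omega> r))"
          unfolding sum_distrib_right using nn by (subst sum_ennreal) (auto simp: a_def)
        also have "\<dots> = (\<Sum>k\<le>m. ennreal (a k) * (ennreal (\<omega> r) * indicator {0..<1} r * indicator {s k..<1} r))"
          using True nn by (intro sum.cong refl) (auto simp: indicator_def ennreal_mult a_def)
        finally show ?thesis using True by simp
      qed simp
    qed
    also have "\<dots> = (\<Sum>k\<le>m. ennreal (a k) * (\<integral>\<^sup>+r. ennreal (\<omega> r) * indicator {0..<1} r * indicator {s k..<1} r \<partial>lebesgue))"
      using radial_weight_measurable[OF rw]
      by (subst nn_integral_sum) (auto intro!: sum.cong nn_integral_cmult borel_measurable_times_ennreal borel_measurable_indicator)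
    also have "\<dots> = (\<Sum>k\<le>m. ennreal (a k) * ennreal (tail \<omega> (s k)))"
    proof (intro sum.cong refl arg_cong2[of _ _ _ _ "(*)"])
      fix k
      have "ennreal (tail \<omega> (s k)) = (\<integral>\<^sup>+r\<in>{s k..<1}. ennreal (\<omega> r) \<partial>lebesgue)"
        using rw by (simp add: tail_nn s_def)
      also have "\<dots> = (\<integral>\<^sup>+r. ennreal (\<omega> r) * indicator {0..<1} r * indicator {s k..<1} r \<partial>lebesgue)"
        by (intro nn_integral_cong) (auto simp: indicator_def s_def)
      finally show "(\<integral>\<^sup>+r. ennreal (\<omega> r) * indicator {0..<1} r * indicator {s k..<1} r \<partial>lebesgue) = ennreal (tail \<omega> (s k))" ..
    qed
    also have "\<dots> \<le> (\<Sum>k\<le>m. ennreal ((exp 1 * B) * (1/2) ^ k * tail \<omega> (1 - 1 / x)))"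
    proof (intro sum_mono)
      fix k
      have t0: "0 \<le> tail \<omega> (1 - 1/x)" using tail_pos[OF rw, of "1 - 1/x"] x by (auto intro: less_imp_le)
      have "tail \<omega> (s k) \<le> C ^ k * tail \<omega> (1 - 1 / x)"
      proof (cases "0 \<le> 1 - 2 ^ k / x")
        case True
        then show ?thesis using C(2)[of "s k" k] x by (simp add: s_def)
      next
        case False
        then have "x \<le> 2 ^ k" using x by (simp add: field_simps)
        then have "1 / 2 ^ k \<le> 1 / x" using x by (intro divide_left_mono) auto
        then have "tail \<omega> (1 - 1 / 2 ^ k) \<le> tail \<omega> (1 - 1 / x)"
          using x by (intro tail_antimono rw) auto
        moreover have "tail \<omega> 0 \<le> C ^ k * tail \<omega> (1 - 1 / 2 ^ k)" using C(2)[of 0 k] by simp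
        moreover have "s k = 0" using False by (simp add: s_def)
        ultimately show ?thesis using C(1) by (smt (verit) mult_left_mono zero_le_power)
      qed
      then have "a k * tail \<omega> (s k) \<le> a k * (C ^ k * tail \<omega> (1 - 1 / x))" by (simp add: a_def)
      also have "\<dots> = (a k * C ^ k) * tail \<omega> (1 - 1 / x)" by simp
      also have "\<dots> \<le> ((exp 1 * B) * (1/2) ^ k) * tail \<omega> (1 - 1 / x)"
        using aC t0 by (rule mult_right_mono)
      finally show "ennreal (a k) * ennreal (tail \<omega> (s k)) \<le> ennreal ((exp 1 * B) * (1/2) ^ k * tail \<omega> (1 - 1 / x))"
        by (subst ennreal_mult'[symmetric]) (auto simp: a_def ennreal_leI)
    qed
    also have "\<dots> = ennreal (\<Sum>k\<le>m. (exp 1 * B) * (1/2) ^ k * tail \<omega> (1 - 1 / x))"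
      using B(1) tail_pos[OF rw, of "1 - 1/x"] x by (intro sum_ennreal) (auto intro: less_imp_le)
    also have "(\<Sum>k\<le>m. (exp 1 * B) * (1/2) ^ k * tail \<omega> (1 - 1 / x)) = (exp 1 * B) * tail \<omega> (1 - 1 / x) * (\<Sum>k\<le>m. (1/2) ^ k)"
      by (simp add: sum_distrib_left mult_ac)
    also have "(\<Sum>k\<le>m. (1/2) ^ k :: real) \<le> 2"
      using sum_gp[of "1/2::real" 0 m] by (simp add: atMost_atLeast0)
    then have "ennreal ((exp 1 * B) * tail \<omega> (1 - 1 / x) * (\<Sum>k\<le>m. (1/2) ^ k)) \<le> ennreal ((exp 1 * B) * tail \<omega> (1 - 1 / x) * 2)"
      using B(1) tail_pos[OF rw, of "1 - 1/x"] x by (intro ennreal_leI mult_left_mono) auto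
    finally show ?thesis
      using B(1) tail_pos[OF rw, of "1 - 1/x"] x by (subst (asm) ennreal_le_iff) (auto simp: mult_ac)
  qed
  then show ?thesis using that[of "2 * (exp 1 * B)"] B(1) by auto
qed

text \<open>The tail at \<open>1 - 1 / x\<close> is first moved by doubling to
  \<open>1 - 1 / (2 * x)\<close>, which is at least \<open>1/2\<close>, so that its power of order
  \<open>2 * x\<close> is at least \<open>exp (- 2)\<close> even for \<open>x = 1\<close>.\<close>

lemma tail_le_moment_Dhat:
  assumes "\<omega> \<in> class_Dhat"
  obtains C where "C > 0" "\<And>x. x \<ge> 1 \<Longrightarrow> tail \<omega> (1 - 1 / x) \<le> C * moment \<omega> x"
proof -
  note rw = Dhat_radial[OF assms]
  obtain C where C: "C \<ge> 1" "\<And>r s. 0 \<le> r \<Longrightarrow> r < 1 \<Longrightarrow> 1 - r \<le> 2 * (1 - s) \<Longrightarrow> 0 \<le> s \<Longrightarrow> tail \<omega> r \<le> C * tail \<omega> s"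
    using Dhat_ratio[OF assms, of 2] by auto
  have "tail \<omega> (1 - 1 / x) \<le> (C * exp 2) * moment \<omega> x" if x: "x \<ge> 1" for x
  proof -
    let ?s = "1 - 1 / (2 * x)"
    have s: "1/2 \<le> ?s" "?s < 1" using x by (auto simp: field_simps)
    have "exp (-2) \<le> ?s powr (2 * x)"
      using powr_ge_exp[of ?s "2 * x"] s x by simp
    then have "exp (-2) * tail \<omega> ?s \<le> ?s powr (2 * x) * tail \<omega> ?s"
      using tail_pos[OF rw, of ?s] s by (intro mult_right_mono) auto
    also have "\<dots> \<le> moment \<omega> (2 * x)" using s x by (intro tail_le_moment rw) auto
    also have "\<dots> \<le> moment \<omega> x" using x by (intro moment_antimono rw) auto
    finally have "tail \<omega> ?s \<le> exp 2 * moment \<omega> x" by (simp add: exp_minus field_simps)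
    moreover have "tail \<omega> (1 - 1 / x) \<le> C * tail \<omega> ?s"
      using x by (intro C(2)) (auto simp: field_simps)
    ultimately show ?thesis using C(1) by (smt (verit) mult.assoc mult_left_mono)
  qed
  then show ?thesis using that[of "C * exp 2"] C(1) by auto
qed

text \<open>The factor 3 is chosen for \<open>bcoef_diff\<close>, where a moment of order
  \<open>n + 1\<close> is compared with one of order
  \<open>2 * n + 1 \<le> 3 * (n + 1)\<close>.\<close>

lemma moment_doubling:
  assumes "\<omega> \<in> class_Dhat"
  obtains C where "C > 0" "\<And>x. x \<ge> 1 \<Longrightarrow> moment \<omega> x \<le> C * moment \<omega> (3 * x)"
proof -
  note rw = Dhat_radial[OF assms]
  obtain A where A: "A > 0" "\<And>x. x \<ge> 1 \<Longrightarrow> moment \<omega> x \<le> A * tail \<omega> (1 - 1 / x)"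
    using moment_le_tail[OF assms] by auto
  obtain B where B: "B > 0" "\<And>x. x \<ge> 1 \<Longrightarrow> tail \<omega> (1 - 1 / x) \<le> B * moment \<omega> x"
    using tail_le_moment_Dhat[OF assms] by auto
  obtain C where C: "C \<ge> 1" "\<And>r s. 0 \<le> r \<Longrightarrow> r < 1 \<Longrightarrow> 1 - r \<le> 3 * (1 - s) \<Longrightarrow> 0 \<le> s \<Longrightarrow> tail \<omega> r \<le> C * tail \<omega> s"
    using Dhat_ratio[OF assms, of 3] by auto
  have "moment \<omega> x \<le> (A * C * B) * moment \<omega> (3 * x)" if x: "x \<ge> 1" for x
  proof -
    have "moment \<omega> x \<le> A * tail \<omega> (1 - 1 / x)" using A x by auto
    also have "tail \<omega> (1 - 1 / x) \<le> C * tail \<omega> (1 - 1 / (3 * x))"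
      using x by (intro C(2)) (auto simp: field_simps)
    also have "tail \<omega> (1 - 1 / (3 * x)) \<le> B * moment \<omega> (3 * x)"
      using B(2)[of "3 * x"] x by auto
    finally show ?thesis using A(1) C(1) by (simp add: mult_ac)
  qed
  then show ?thesis using that[of "A * C * B"] A(1) B(1) C(1) by auto
qed

section \<open>Taylor coefficients of the Bergman kernel in the variable
  \<open>cnj z * \<zeta>\<close>\<close>

definition bcoef :: "(real \<Rightarrow> real) \<Rightarrow> nat \<Rightarrow> real" where
  "bcoef \<omega> n = 1 / (2 * moment \<omega> (2 * real n + 1))"

lemma bcoef_pos: "radial_weight \<omega> \<Longrightarrow> 0 < bcoef \<omega> n"
  by (simp add: bcoef_def moment_pos)

lemma bcoef_mono: "radial_weight \<omega> \<Longrightarrow> m \<le> n \<Longrightarrow> bcoef \<omega> m \<le> bcoef \<omega> n"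
  unfolding bcoef_def by (intro divide_left_mono mult_left_mono moment_antimono mult_pos_pos moment_pos) auto

text \<open>Half of the decay of \<open>x ^ n\<close> is spent on the coefficient; the other factor
  \<open>sqrt x ^ n\<close> stays available for summation. In terms of
  \<open>u = (1 - x) * (2 * n + 1)\<close>, doubling loses roughly a power of \<open>u\<close>,
  while \<open>sqrt x ^ n\<close> gains about \<open>exp (- u / 4)\<close>.\<close>

lemma bcoef_growth:
  assumes "\<omega> \<in> class_Dhat"
  obtains C where "C > 0" "\<And>x n. 0 \<le> x \<Longrightarrow> x < 1 \<Longrightarrow> bcoef \<omega> n * sqrt x ^ n \<le> C / tail \<omega> x"
proof -
  note rw = Dhat_radial[OF assms]
  obtain C where C: "C \<ge> 1" "\<And>r k. 0 \<le> r \<Longrightarrow> r < 1 \<Longrightarrow> tail \<omega> r \<le> C ^ k * tail \<omega> (1 - (1 - r) / 2 ^ k)"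
    using Dhat_power[OF assms(1)] by blast
  obtain B where B: "B > 0" "\<And>k::nat. C ^ k * exp (- (2 ^ k / 8)) \<le> B"
    using exp_double_exp_bounded C(1) by auto
  obtain A where A: "A > 0" "\<And>x. x \<ge> 1 \<Longrightarrow> tail \<omega> (1 - 1 / x) \<le> A * moment \<omega> x"
    using tail_le_moment_Dhat[OF assms] by auto
  have "tail \<omega> x * sqrt x ^ n \<le> (B * exp 2 * A) * moment \<omega> (2 * real n + 1)" if x: "0 \<le> x" "x < 1" for x n
  proof -
    define u where "u = (1 - x) * (2 * real n + 1)"
    have u0: "u > 0" using x by (simp add: u_def)
    define j where "j = (LEAST j. u \<le> 2 ^ j)"
    obtain m where m: "u \<le> 2 ^ m" using real_arch_pow[of 2 u] by (auto intro: less_imp_le)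
    have j1: "u \<le> 2 ^ j" unfolding j_def by (rule LeastI[of "\<lambda>j. u \<le> 2 ^ j", OF m])
    \<comment> \<open>Minimality of \<open>j\<close> gives \<open>2 ^ j < 2 * u\<close> for
      \<open>j > 0\<close>; the summand 1 covers \<open>j = 0\<close>, where \<open>u\<close> may be
      arbitrarily small.\<close>
    have j2: "- (u / 4) \<le> 1 + - (2 ^ j / 8)"
    proof (cases j)
      case 0
      then show ?thesis using u0 by simp
    next
      case (Suc i)
      have "\<not> u \<le> 2 ^ i" using not_less_Least[of i "\<lambda>j. u \<le> 2 ^ j"] Suc j_def by auto
      then show ?thesis using Suc by simp
    qed
    have "x \<le> exp (- (1 - x))" using exp_ge_add_one_self[of "- (1 - x)"] by simp
    then have "sqrt x \<le> sqrt (exp (- (1 - x)))" by simp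
    also have "\<dots> = exp (- (1 - x) / 2)"
      by (rule real_sqrt_unique) (simp_all add: power2_eq_square mult_exp_exp)
    finally have "sqrt x ^ n \<le> exp (- (1 - x) / 2) ^ n" using x by (intro power_mono) auto
    \<comment> \<open>The exponent is \<open>- n * (1 - x) / 2\<close>, and
      \<open>2 * n * (1 - x) = u - (1 - x)\<close>.\<close>
    also have "\<dots> = exp (- (u / 4) + (1 - x) / 4)"
      by (simp add: exp_of_nat_mult[symmetric] u_def field_simps)
    also have "- (u / 4) + (1 - x) / 4 \<le> 2 + - (2 ^ j / 8)" using j2 x by argo
    then have "exp (- (u / 4) + (1 - x) / 4) \<le> exp (2 + - (2 ^ j / 8))" by simp
    also have "\<dots> = exp 2 * exp (- (2 ^ j / 8))" by (rule exp_add)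
    finally have s: "sqrt x ^ n \<le> exp 2 * exp (- (2 ^ j / 8))" .
    have "tail \<omega> x \<le> C ^ j * tail \<omega> (1 - (1 - x) / 2 ^ j)" using C(2) x by auto
    also have "tail \<omega> (1 - (1 - x) / 2 ^ j) \<le> tail \<omega> (1 - 1 / (2 * real n + 1))"
      using j1 x by (intro tail_antimono rw) (auto simp: u_def field_simps)
    also have "\<dots> \<le> A * moment \<omega> (2 * real n + 1)" by (rule A(2)) simp
    finally have t: "tail \<omega> x \<le> C ^ j * (A * moment \<omega> (2 * real n + 1))" using C(1) by simp
    have "tail \<omega> x * sqrt x ^ n \<le> (C ^ j * (A * moment \<omega> (2 * real n + 1))) * (exp 2 * exp (- (2 ^ j / 8)))"
      using A(1) C(1) moment_pos[OF rw, of "2 * real n + 1"] x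
      by (intro mult_mono s t) auto
    also have "\<dots> = (C ^ j * exp (- (2 ^ j / 8))) * (exp 2 * A * moment \<omega> (2 * real n + 1))" by simp
    also have "\<dots> \<le> B * (exp 2 * A * moment \<omega> (2 * real n + 1))"
      using B A(1) moment_pos[OF rw, of "2 * real n + 1"] by (intro mult_right_mono) auto
    finally show ?thesis by (simp add: mult_ac)
  qed
  then have "bcoef \<omega> n * sqrt x ^ n \<le> (B * exp 2 * A) / tail \<omega> x" if "0 \<le> x" "x < 1" for x n
  proof -
    let ?m = "moment \<omega> (2 * real n + 1)"
    have pos: "?m > 0" "tail \<omega> x > 0" using that rw moment_pos tail_pos by auto
    have "0 \<le> B * exp 2 * A * ?m" using A(1) B(1) pos by simp
    then have "tail \<omega> x * sqrt x ^ n \<le> 2 * (B * exp 2 * A * ?m)"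
      using \<open>\<And>x n. 0 \<le> x \<Longrightarrow> x < 1 \<Longrightarrow> tail \<omega> x * sqrt x ^ n \<le> (B * exp 2 * A) * moment \<omega> (2 * real n + 1)\<close>[OF that, of n]
      by linarith
    then show ?thesis using pos by (simp add: bcoef_def divide_simps mult_ac)
  qed
  then show ?thesis using that[of "B * exp 2 * A"] A(1) B(1) by auto
qed

text \<open>The difference of two consecutive moments is the integral of
  \<open>r ^ (2 * n + 1)\<close> times \<open>1 - r^2\<close> against \<open>\<omega>\<close>.
  Giving up \<open>r ^ n\<close> pays for a factor \<open>2 / (n + 1)\<close>, and what remains is a
  moment of order \<open>n + 1\<close>, comparable by doubling to the original one.\<close>

lemma bcoef_diff:
  assumes "\<omega> \<in> class_Dhat"
  obtains C where "C > 0" "\<And>n. real (Suc n) * (bcoef \<omega> (Suc n) - bcoef \<omega> n) \<le> C * bcoef \<omega> (Suc n)"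
proof -
  note rw = Dhat_radial[OF assms]
  obtain C where C: "C > 0" "\<And>x. x \<ge> 1 \<Longrightarrow> moment \<omega> x \<le> C * moment \<omega> (3 * x)"
    using moment_doubling[OF assms] by auto
  have "real (Suc n) * (bcoef \<omega> (Suc n) - bcoef \<omega> n) \<le> (2 * C) * bcoef \<omega> (Suc n)" for n
  proof -
    let ?N = "Suc n" let ?m1 = "moment \<omega> (2 * real n + 1)" let ?m2 = "moment \<omega> (2 * real ?N + 1)"
    have pos: "?m1 > 0" "?m2 > 0" using rw by (auto intro: moment_pos)
    have ptw: "r powr (2 * real n + 1) - r powr (2 * real ?N + 1) \<le> (2 / real ?N) * r powr (real ?N)"
      if r: "0 < r" "r < 1" for r
    proof -
      have 1: "r powr (2 * real n + 1) = r ^ Suc n * r ^ n"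
      proof -
        have "r powr (real (2*n+1)) = r ^ (2*n+1)" using r powr_realpow by blast
        moreover have "real (2*n+1) = 2 * real n + 1" by simp
        moreover have "2*n+1 = Suc n + n" by simp
        then have "r ^ (2*n+1) = r ^ Suc n * r ^ n" by (simp only: power_add)
        ultimately show ?thesis by metis
      qed
      have 2: "r powr (2 * real ?N + 1) = r ^ Suc n * r ^ n * r^2"
      proof -
        have "r powr (real (2*n+3)) = r ^ (2*n+3)" using r powr_realpow by blast
        moreover have "real (2*n+3) = 2 * real ?N + 1" by simp
        moreover have "2*n+3 = Suc n + n + 2" by simp
        then have "r ^ (2*n+3) = r ^ Suc n * r ^ n * r^2"
          by (simp only: power_add)
        ultimately show ?thesis by metis
      qed
      have 3: "r powr (real ?N) = r ^ Suc n" using r powr_realpow by blast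
      \<comment> \<open>Replacing \<open>N\<close> equal terms \<open>r ^ n\<close> by the larger
        geometric sum, which telescopes, shows that \<open>N * r ^ n * (1 - r)\<close> is at most
        1.\<close>
      have "(1 - r) * (real ?N * r ^ n) = (1 - r) * (\<Sum>i<?N. r ^ n)" by simp
      also have "\<dots> \<le> (1 - r) * (\<Sum>i<?N. r ^ i)"
        using r by (intro mult_left_mono sum_mono power_decreasing) auto
      also have "\<dots> = 1 - r ^ ?N" using one_diff_power_eq[of r ?N] by simp
      also have "\<dots> \<le> 1" using r by simp
      finally have "real ?N * r ^ n * (1 - r) \<le> 1" by (simp add: mult_ac)
      then have "real ?N * r ^ n * (1 - r) * (1 + r) \<le> 1 * 2" using r by (intro mult_mono) auto
      then have "r ^ n * (1 - r^2) \<le> 2 / real ?N" by (simp add: field_simps power2_eq_square)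
      then have "r ^ Suc n * (r ^ n * (1 - r^2)) \<le> r ^ Suc n * (2 / real ?N)" using r by (intro mult_left_mono) auto
      then show ?thesis unfolding 1 2 3 by (simp add: algebra_simps)
    qed
    have "?m1 \<le> (LINT r:{0..<1}|lebesgue. (r powr (2 * real ?N + 1) * \<omega> r + (2 / real ?N) * (r powr (real ?N) * \<omega> r)))"
      unfolding moment_def[of \<omega> "2 * real n + 1"]
    proof (rule set_integral_mono)
      show "set_integrable lebesgue {0..<1} (\<lambda>r. r powr (2 * real ?N + 1) * \<omega> r + (2 / real ?N) * (r powr (real ?N) * \<omega> r))"
        by (intro set_integral_add set_integrable_mult_right moment_integrable rw) auto
      show "r powr (2 * real n + 1) * \<omega> r \<le> r powr (2 * real ?N + 1) * \<omega> r + (2 / real ?N) * (r powr (real ?N) * \<omega> r)"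
        if "r \<in> {0..<1}" for r
      proof (cases "r = 0")
        case False
        then have "(r powr (2 * real n + 1) - r powr (2 * real ?N + 1)) * \<omega> r \<le> ((2 / real ?N) * r powr (real ?N)) * \<omega> r"
          using that rw ptw[of r] by (intro mult_right_mono) (auto simp: radial_weight_def)
        then show ?thesis by (simp only: algebra_simps)
      qed simp
    qed (use rw moment_integrable in auto)
    also have "\<dots> = ?m2 + (2 / real ?N) * moment \<omega> (real ?N)"
      unfolding moment_def
      by (subst set_integral_add) (auto intro!: set_integrable_mult_right moment_integrable rw)
    finally have 1: "?m1 \<le> ?m2 + (2 / real ?N) * moment \<omega> (real ?N)" .
    have "moment \<omega> (real ?N) \<le> C * moment \<omega> (3 * real ?N)" by (rule C(2)) simp
    also have "\<dots> \<le> C * ?m1" using C(1) by (intro mult_left_mono moment_antimono rw) auto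
    finally have "(2 / real ?N) * moment \<omega> (real ?N) \<le> (2 / real ?N) * (C * ?m1)" by (intro mult_left_mono) auto
    with 1 have "?m1 - ?m2 \<le> (2 / real ?N) * (C * ?m1)" by linarith
    then have m: "real ?N * (?m1 - ?m2) \<le> 2 * C * ?m1" by (simp add: field_simps)
    have "bcoef \<omega> ?N - bcoef \<omega> n = bcoef \<omega> ?N * ((?m1 - ?m2) / ?m1)"
      unfolding bcoef_def using pos by (simp add: field_simps)
    then have "real ?N * (bcoef \<omega> ?N - bcoef \<omega> n) = bcoef \<omega> ?N * (real ?N * (?m1 - ?m2) / ?m1)"
      by simp
    also have "\<dots> \<le> bcoef \<omega> ?N * (2 * C)"
      using m pos bcoef_pos[OF rw, of ?N] by (intro mult_left_mono) (auto simp: field_simps)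
    finally show ?thesis by (simp add: mult_ac)
  qed
  then show ?thesis using that[of "2 * C"] C(1) by auto
qed

section \<open>Radial and angular integration on the disc\<close>

text \<open>Polar coordinates for radial functions. Both measures are determined by the half-lines
  \<open>{..b}\<close>, where the area \<open>pi * b^2\<close> of a disc is the integral of
  \<open>2 * pi * t\<close>.\<close>

lemma distr_cmod:
  "distr lborel borel (cmod :: complex \<Rightarrow> real) = density lborel (\<lambda>t. ennreal (2 * pi * t * indicator {0..} t))"
proof (rule measure_eqI_generator_eq[where E = "range atMost" and \<Omega> = UNIV and A = "\<lambda>i. {..real i}"])
  show "Int_stable (range atMost :: real set set)"
    by (auto simp: Int_stable_def)
  show "sets (distr lborel borel (cmod :: complex \<Rightarrow> real)) = sigma_sets UNIV (range atMost)"
    by (simp add: borel_eq_atMost)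
  show "sets (density lborel (\<lambda>t. ennreal (2 * pi * t * indicator {0..} t))) = sigma_sets UNIV (range atMost)"
    by (simp add: borel_eq_atMost)
  have dist: "emeasure (distr lborel borel (cmod :: complex \<Rightarrow> real)) {..b} = ennreal (if b < 0 then 0 else pi * b^2)" for b
  proof (cases "b < 0")
    case True
    have "\<not> cmod z \<le> b" for z using norm_ge_zero[of z] True by linarith
    then have "cmod -` {..b} = {}" by auto
    then show ?thesis using True by (subst emeasure_distr) auto
  next
    case False
    have "cmod -` {..b} \<inter> space lborel = cball 0 b" by auto
    then show ?thesis using False
      by (subst emeasure_distr) (auto simp: emeasure_cball unit_ball_vol_2)
  qed
  show "emeasure (distr lborel borel cmod) X = emeasure (density lborel (\<lambda>t. ennreal (2 * pi * t * indicator {0..} t))) X"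
    if "X \<in> range atMost" for X
  proof -
    from that obtain b where X: "X = {..b}" by auto
    have "emeasure (density lborel (\<lambda>t. ennreal (2 * pi * t * indicator {0..} t))) {..b}
        = (\<integral>\<^sup>+t. ennreal (2 * pi * t) * indicator {0..b} t \<partial>lborel)"
      by (subst emeasure_density) (auto intro!: nn_integral_cong simp: indicator_def)
    also have "\<dots> = ennreal (if b < 0 then 0 else pi * b^2)"
    proof (cases "b < 0")
      case True
      then have "{0..b} = {}" by simp
      then show ?thesis using True by simp
    next
      case False
      have "(\<integral>\<^sup>+t. ennreal (2 * pi * t) * indicator {0..b} t \<partial>lborel) = ennreal (pi * b^2 - pi * 0^2)"
        using False by (intro nn_integral_FTC_Icc) (auto intro!: derivative_eq_intros)
      then show ?thesis using False by simp
    qed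
    finally show ?thesis unfolding X dist by simp
  qed
  show "emeasure (distr lborel borel (cmod :: complex \<Rightarrow> real)) {..real i} \<noteq> \<infinity>" for i
    unfolding dist by simp
  show "(\<Union>i. {..real i}) = UNIV" by (auto intro: real_arch_simple)
qed auto

text \<open>Weights are only Lebesgue measurable, so composing them with \<open>cmod\<close>
  requires preimages of null sets to be null; the density in \<open>distr_cmod\<close> gives
  this.\<close>

lemma cmod_measurable_lebesgue: "cmod \<in> lebesgue \<rightarrow>\<^sub>M lebesgue"
proof (rule completion.measurable_completion2)
  show "cmod \<in> lebesgue \<rightarrow>\<^sub>M lborel" by (simp add: measurable_completion)
  have "N \<in> null_sets (distr lborel borel cmod)" if N: "N \<in> null_sets lborel" for N
    unfolding distr_cmod using N AE_not_in[OF N]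
    by (subst null_sets_density_iff) (auto simp: null_sets_def elim!: eventually_mono)
  moreover have "distr lebesgue lborel cmod = distr lborel borel cmod"
    by (subst distr_completion) (auto intro: distr_cong)
  ultimately show "null_sets lborel \<subseteq> null_sets (distr lebesgue lborel cmod)" by auto
qed

lemma AE_lebesgue_cmod:
  assumes "AE t in lborel. P t"
  shows "AE z :: complex in lebesgue. P (cmod z)"
proof -
  from assms obtain N where N: "{t. \<not> P t} \<subseteq> N" "N \<in> null_sets lborel"
    by (auto elim!: AE_E simp: null_sets_def)
  have "N \<in> null_sets (distr lborel borel (cmod :: complex \<Rightarrow> real))"
    unfolding distr_cmod using N(2) AE_not_in[OF N(2)]
    by (subst null_sets_density_iff) (auto simp: null_sets_def elim!: eventually_mono)
  then have "(cmod :: complex \<Rightarrow> real) -` N \<in> null_sets lborel"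
    by (subst (asm) null_sets_distr_iff) auto
  then have "AE z :: complex in lborel. z \<notin> cmod -` N" by (rule AE_not_in)
  then show ?thesis
    unfolding AE_completion_iff by (rule eventually_mono) (use N in auto)
qed

text \<open>The integrand is replaced by a Borel function equal to it almost everywhere, and back
  again at the end; the exceptional set stays null after composition with
  \<open>cmod\<close>.\<close>

lemma nn_integral_cmod:
  assumes "g \<in> borel_measurable lebesgue"
  shows "(\<integral>\<^sup>+z. g (cmod z) \<partial>lebesgue) = (\<integral>\<^sup>+t. ennreal (2 * pi * t * indicator {0..} t) * g t \<partial>lebesgue)"
proof -
  obtain g' where g': "g' \<in> borel_measurable lborel" "AE t in lborel. g t = g' t"
    using completion_ex_borel_measurable[OF assms] by auto
  then have ae: "AE z in lebesgue. g (cmod z) = g' (cmod z)"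
    using AE_lebesgue_cmod[OF g'(2)] by simp
  have "(\<integral>\<^sup>+z. g (cmod z) \<partial>lebesgue) = (\<integral>\<^sup>+z. g' (cmod z) \<partial>lebesgue)"
    using ae by (intro nn_integral_cong_AE) auto
  also have "\<dots> = (\<integral>\<^sup>+t. g' t \<partial>distr lborel borel cmod)"
    using g' by (subst nn_integral_distr) (auto simp: nn_integral_completion)
  also have "\<dots> = (\<integral>\<^sup>+t. ennreal (2 * pi * t * indicator {0..} t) * g' t \<partial>lborel)"
    unfolding distr_cmod using g' by (subst nn_integral_density) auto
  also have "\<dots> = (\<integral>\<^sup>+t. ennreal (2 * pi * t * indicator {0..} t) * g t \<partial>lborel)"
    using g'(2) by (intro nn_integral_cong_AE) auto
  finally show ?thesis by (simp add: nn_integral_completion)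
qed

lemma sets_disc_area: "sets disc_area = sets (lebesgue_on (ball 0 1))"
  by (simp add: disc_area_def)

lemma space_disc_area [simp]: "space disc_area = ball 0 1"
  by (simp add: disc_area_def)

lemma measurable_disc_area_iff: "f \<in> measurable disc_area M \<longleftrightarrow> f \<in> measurable (lebesgue_on (ball 0 1)) M"
  by (rule arg_cong2[where f="(\<in>)"]) (auto intro!: measurable_cong_sets sets_disc_area)

lemma borel_measurable_disc_areaI: "f \<in> borel \<rightarrow>\<^sub>M M \<Longrightarrow> f \<in> disc_area \<rightarrow>\<^sub>M M"
  unfolding measurable_disc_area_iff by (intro measurable_restrict_space1 measurable_completion) auto

lemma nn_integral_disc_area:
  assumes "F \<in> borel_measurable disc_area"
  shows "(\<integral>\<^sup>+z. F z \<partial>disc_area) = (\<integral>\<^sup>+z. ennreal (1 / pi) * (F z * indicator (ball 0 1) z) \<partial>lebesgue)"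
proof -
  have m: "F \<in> borel_measurable (lebesgue_on (ball 0 1))" using assms by (simp add: measurable_disc_area_iff)
  have "(\<integral>\<^sup>+z. F z \<partial>disc_area) = (\<integral>\<^sup>+z. ennreal (1 / pi) * F z \<partial>lebesgue_on (ball 0 1))"
    unfolding disc_area_def using m by (subst nn_integral_density) auto
  also have "\<dots> = (\<integral>\<^sup>+z. ennreal (1 / pi) * F z * indicator (ball 0 1) z \<partial>lebesgue)"
    by (subst nn_integral_restrict_space) auto
  finally show ?thesis by (simp add: mult.assoc)
qed

lemma radial_measurable:
  fixes g :: "real \<Rightarrow> ennreal"
  assumes "(\<lambda>t. g t * indicator {0..<1} t) \<in> borel_measurable lebesgue"
  shows "(\<lambda>z. g (cmod z)) \<in> borel_measurable disc_area"
proof -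
  have "(\<lambda>z. g (cmod z) * indicator {0..<1} (cmod z)) \<in> borel_measurable (lebesgue_on (ball 0 1))"
    by (intro measurable_restrict_space1 measurable_compose[OF cmod_measurable_lebesgue assms])
  then show ?thesis unfolding measurable_disc_area_iff
    by (rule measurable_cong[THEN iffD1, rotated]) (auto simp: indicator_def)
qed

lemma nn_integral_radial:
  fixes g :: "real \<Rightarrow> ennreal"
  assumes m: "(\<lambda>t. g t * indicator {0..<1} t) \<in> borel_measurable lebesgue"
  shows "(\<integral>\<^sup>+z. g (cmod z) \<partial>disc_area) = (\<integral>\<^sup>+t\<in>{0..<1}. ennreal (2 * t) * g t \<partial>lebesgue)"
proof -
  have "(\<integral>\<^sup>+z. g (cmod z) \<partial>disc_area) = (\<integral>\<^sup>+z. ennreal (1 / pi) * (g (cmod z) * indicator {0..<1} (cmod z)) \<partial>lebesgue)"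
    by (subst nn_integral_disc_area[OF radial_measurable[OF m]])
       (auto intro!: nn_integral_cong simp: indicator_def)
  also have "\<dots> = (\<integral>\<^sup>+t. ennreal (2 * pi * t * indicator {0..} t) * (ennreal (1 / pi) * (g t * indicator {0..<1} t)) \<partial>lebesgue)"
    by (rule nn_integral_cmod) (intro borel_measurable_times_ennreal m, auto)
  also have "\<dots> = (\<integral>\<^sup>+t\<in>{0..<1}. ennreal (2 * t) * g t \<partial>lebesgue)"
    by (intro nn_integral_cong) 
       (auto simp: indicator_def mult.assoc[symmetric] ennreal_mult'[symmetric])
  finally show ?thesis .
qed

lemma AE_disc_area_cmod:
  assumes "AE t in lborel. P t"
  shows "AE z in disc_area. P (cmod z)"
  using AE_lebesgue_cmod[OF assms] unfolding disc_area_def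
  by (auto simp: AE_density AE_restrict_space_iff elim!: eventually_mono)

section \<open>Rotation invariance and integration over circles\<close>

lemma unit_disc_borel [measurable]: "ball (0::complex) 1 \<in> sets borel"
  by simp

lemma nn_integral_lborel_translate:
  fixes h :: "'a::euclidean_space \<Rightarrow> ennreal"
  assumes "h \<in> borel_measurable borel"
  shows "(\<integral>\<^sup>+x. h (a + x) \<partial>lborel) = (\<integral>\<^sup>+x. h x \<partial>lborel)"
proof -
  have "(\<integral>\<^sup>+x. h x \<partial>lborel) = (\<integral>\<^sup>+x. h x \<partial>distr lborel borel ((+) a))" by (simp add: lborel_distr_plus)
  also have "\<dots> = (\<integral>\<^sup>+x. h (a + x) \<partial>lborel)" using assms by (subst nn_integral_distr) auto
  finally show ?thesis ..
qed

text \<open>A convolution argument: for the unit disc \<open>D\<close>, the double integral of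
  \<open>indicator D x * h (x + c * y)\<close> is evaluated in both orders. Translation invariance
  gives the area of \<open>D\<close> times the integral of \<open>h (c * y)\<close> in one order and
  times the integral of \<open>h\<close> in the other, because multiplication by \<open>c\<close>
  maps discs to discs of the same radius. The area is positive and finite, hence cancels.\<close>

lemma nn_integral_lborel_rotate:
  fixes h :: "complex \<Rightarrow> ennreal"
  assumes [measurable]: "h \<in> borel_measurable borel" and c: "cmod c = 1"
  shows "(\<integral>\<^sup>+x. h (c * x) \<partial>lborel) = (\<integral>\<^sup>+x. h x \<partial>lborel)"
proof -
  have cc: "c * cnj c = 1" using c by (simp add: complex_norm_square[symmetric])
  define D where "D = ball (0::complex) 1"
  define V where "V = emeasure lborel D"
  have V: "V = ennreal pi" by (simp add: V_def D_def emeasure_ball unit_ball_vol_2)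
  have [measurable]: "D \<in> sets borel" by (simp add: D_def)
  have "V * (\<integral>\<^sup>+y. h (c * y) \<partial>lborel) = (\<integral>\<^sup>+x. indicator D x * (\<integral>\<^sup>+y. h (c * y) \<partial>lborel) \<partial>lborel)"
    unfolding V_def by (subst nn_integral_multc) auto
  also have "\<dots> = (\<integral>\<^sup>+x. (\<integral>\<^sup>+y. indicator D x * h (x + c * y) \<partial>lborel) \<partial>lborel)"
  proof (rule nn_integral_cong)
    fix x :: complex
    have "(\<integral>\<^sup>+y. h (c * y) \<partial>lborel) = (\<integral>\<^sup>+y. h (c * (cnj c * x + y)) \<partial>lborel)"
      by (rule nn_integral_lborel_translate[symmetric]) measurable
    also have "\<dots> = (\<integral>\<^sup>+y. h (x + c * y) \<partial>lborel)"
      by (simp add: distrib_left mult.assoc[symmetric] cc)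
    finally show "indicator D x * (\<integral>\<^sup>+y. h (c * y) \<partial>lborel) = (\<integral>\<^sup>+y. indicator D x * h (x + c * y) \<partial>lborel)"
      by (subst nn_integral_cmult) auto
  qed
  also have "\<dots> = (\<integral>\<^sup>+y. (\<integral>\<^sup>+x. indicator D x * h (x + c * y) \<partial>lborel) \<partial>lborel)"
    by (rule lborel_pair.Fubini') measurable
  also have "\<dots> = (\<integral>\<^sup>+y. (\<integral>\<^sup>+x. indicator D (x - c * y) * h x \<partial>lborel) \<partial>lborel)"
  proof (rule nn_integral_cong)
    fix y :: complex
    show "(\<integral>\<^sup>+x. indicator D x * h (x + c * y) \<partial>lborel) = (\<integral>\<^sup>+x. indicator D (x - c * y) * h x \<partial>lborel)"
      using nn_integral_lborel_translate[of "\<lambda>x. indicator D x * h (x + c * y)" "- (c * y)"]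
      by simp
  qed
  also have "\<dots> = (\<integral>\<^sup>+x. (\<integral>\<^sup>+y. indicator D (x - c * y) * h x \<partial>lborel) \<partial>lborel)"
    by (rule lborel_pair.Fubini') measurable
  also have "\<dots> = (\<integral>\<^sup>+x. V * h x \<partial>lborel)"
  proof (rule nn_integral_cong)
    fix x :: complex
    have eq: "indicator D (x - c * y) = (indicator (ball (cnj c * x) 1) y :: ennreal)" for y
    proof -
      have "cmod (x - c * y) = cmod (cnj c * (x - c * y))" using c by (simp add: norm_mult)
      also have "cnj c * (x - c * y) = cnj c * x - y" using cc by (simp add: algebra_simps)
      finally have "cmod (x - c * y) = cmod (cnj c * x - y)" .
      then show ?thesis by (simp add: D_def dist_norm indicator_def norm_minus_commute)
    qed
    have "(\<integral>\<^sup>+y. indicator D (x - c * y) * h x \<partial>lborel) = emeasure lborel (ball (cnj c * x) 1) * h x"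
      unfolding eq by (subst nn_integral_multc) (auto intro: borel_measurable_indicator)
    then show "(\<integral>\<^sup>+y. indicator D (x - c * y) * h x \<partial>lborel) = V * h x"
      by (simp add: V emeasure_ball unit_ball_vol_2)
  qed
  also have "\<dots> = V * (\<integral>\<^sup>+x. h x \<partial>lborel)" by (subst nn_integral_cmult) auto
  finally have "V * (\<integral>\<^sup>+y. h (c * y) \<partial>lborel) = V * (\<integral>\<^sup>+x. h x \<partial>lborel)" .
  then show ?thesis by (simp add: V ennreal_mult_cancel_left)
qed

lemma nn_integral_disc_area_borel:
  assumes "F \<in> borel_measurable borel"
  shows "(\<integral>\<^sup>+z. F z \<partial>disc_area) = (\<integral>\<^sup>+z. ennreal (1 / pi) * (F z * indicator (ball 0 1) z) \<partial>lborel)"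
  by (simp add: nn_integral_disc_area[OF borel_measurable_disc_areaI[OF assms]] nn_integral_completion)

lemma nn_integral_disc_area_rotate:
  fixes h :: "complex \<Rightarrow> ennreal"
  assumes [measurable]: "h \<in> borel_measurable borel" and c: "cmod c = 1"
  shows "(\<integral>\<^sup>+x. h (c * x) \<partial>disc_area) = (\<integral>\<^sup>+x. h x \<partial>disc_area)"
proof -
  have "(\<integral>\<^sup>+x. h (c * x) \<partial>disc_area) = (\<integral>\<^sup>+x. ennreal (1 / pi) * (h (c * x) * indicator (ball 0 1) (c * x)) \<partial>lborel)"
    by (subst nn_integral_disc_area_borel) (auto simp: indicator_def norm_mult c)
  also have "\<dots> = (\<integral>\<^sup>+x. ennreal (1 / pi) * (h x * indicator (ball 0 1) x) \<partial>lborel)"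
    by (rule nn_integral_lborel_rotate[OF _ c]) auto
  finally show ?thesis by (simp add: nn_integral_disc_area_borel)
qed

text \<open>The circle mean through \<open>w\<close> without the normalisation
  \<open>1 / (2 * pi)\<close>; the half-open interval is a fundamental domain for the angle.\<close>

definition circ :: "(complex \<Rightarrow> ennreal) \<Rightarrow> complex \<Rightarrow> ennreal" where
  "circ K w = (\<integral>\<^sup>+\<theta>\<in>{0..<2*pi}. K (cis \<theta> * w) \<partial>lborel)"

lemma cis_measurable [measurable]: "cis \<in> borel_measurable borel"
  by (intro borel_measurable_continuous_onI) (auto intro!: continuous_intros simp: cis_conv_exp)

lemma circ_measurable:
  assumes [measurable]: "K \<in> borel_measurable borel"
  shows "circ K \<in> borel_measurable borel"
  unfolding circ_def by measurable

text \<open>With \<open>a\<close> the argument of \<open>w\<close>, the angle runs over an interval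
  of length \<open>2 * pi\<close> starting at \<open>a\<close>; periodicity moves the part beyond
  \<open>2 * pi\<close> back to \<open>{0..<a}\<close>.\<close>

lemma circ_eq_cmod:
  assumes [measurable]: "K \<in> borel_measurable borel"
  shows "circ K w = circ K (complex_of_real (cmod w))"
proof -
  define a where "a = Arg2pi w"
  have a: "0 \<le> a" "a < 2 * pi" by (auto simp: a_def Arg2pi)
  have w: "w = complex_of_real (cmod w) * cis a"
    using Arg2pi_eq[of w] by (simp add: a_def cis_conv_exp mult.commute)
  define \<phi> where "\<phi> \<theta> = K (cis \<theta> * complex_of_real (cmod w))" for \<theta>
  have [measurable]: "\<phi> \<in> borel_measurable borel" unfolding \<phi>_def by measurable
  have per: "\<phi> (2 * pi + \<theta>) = \<phi> \<theta>" for \<theta>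
    by (simp add: \<phi>_def cis_mult[symmetric])
  have "K (cis \<theta> * w) = \<phi> (a + \<theta>)" for \<theta>
    by (subst w) (simp add: \<phi>_def cis_mult[symmetric] mult_ac)
  then have "circ K w = (\<integral>\<^sup>+\<theta>. \<phi> (a + \<theta>) * indicator {a..<2*pi+a} (a + \<theta>) \<partial>lborel)"
    unfolding circ_def by (intro nn_integral_cong) (auto simp: indicator_def)
  also have "\<dots> = (\<integral>\<^sup>+\<theta>. \<phi> \<theta> * indicator {a..<2*pi+a} \<theta> \<partial>lborel)"
    by (rule nn_integral_lborel_translate[of "\<lambda>\<theta>. \<phi> \<theta> * indicator {a..<2*pi+a} \<theta>"]) measurable
  also have "\<dots> = (\<integral>\<^sup>+\<theta>. \<phi> \<theta> * indicator {a..<2*pi} \<theta> + \<phi> \<theta> * indicator {2*pi..<2*pi+a} \<theta> \<partial>lborel)"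
    using a by (intro nn_integral_cong) (auto simp: indicator_def)
  also have "\<dots> = (\<integral>\<^sup>+\<theta>. \<phi> \<theta> * indicator {a..<2*pi} \<theta> \<partial>lborel) + (\<integral>\<^sup>+\<theta>. \<phi> \<theta> * indicator {2*pi..<2*pi+a} \<theta> \<partial>lborel)"
    by (rule nn_integral_add) measurable
  also have "(\<integral>\<^sup>+\<theta>. \<phi> \<theta> * indicator {2*pi..<2*pi+a} \<theta> \<partial>lborel)
      = (\<integral>\<^sup>+\<theta>. \<phi> (2*pi + \<theta>) * indicator {2*pi..<2*pi+a} (2*pi + \<theta>) \<partial>lborel)"
    by (rule nn_integral_lborel_translate[of "\<lambda>\<theta>. \<phi> \<theta> * indicator {2*pi..<2*pi+a} \<theta>", symmetric]) measurable
  also have "\<dots> = (\<integral>\<^sup>+\<theta>. \<phi> \<theta> * indicator {0..<a} \<theta> \<partial>lborel)"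
    unfolding per by (intro nn_integral_cong) (auto simp: indicator_def)
  also have "(\<integral>\<^sup>+\<theta>. \<phi> \<theta> * indicator {a..<2*pi} \<theta> \<partial>lborel) + (\<integral>\<^sup>+\<theta>. \<phi> \<theta> * indicator {0..<a} \<theta> \<partial>lborel)
      = (\<integral>\<^sup>+\<theta>. \<phi> \<theta> * indicator {a..<2*pi} \<theta> + \<phi> \<theta> * indicator {0..<a} \<theta> \<partial>lborel)"
    by (rule nn_integral_add[symmetric]) measurable
  also have "\<dots> = circ K (complex_of_real (cmod w))"
    unfolding circ_def \<phi>_def using a by (intro nn_integral_cong) (auto simp: indicator_def)
  finally show ?thesis .
qed

text \<open>Averages the rotation invariance of the disc over the angle and interchanges the two
  integrals.\<close>

lemma nn_integral_disc_area_circ: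
  assumes [measurable]: "F \<in> borel_measurable borel"
  shows "ennreal (2 * pi) * (\<integral>\<^sup>+z. F z \<partial>disc_area) = (\<integral>\<^sup>+z. circ F z \<partial>disc_area)"
proof -
  have "(\<integral>\<^sup>+z. circ F z \<partial>disc_area) =
      (\<integral>\<^sup>+z. (\<integral>\<^sup>+\<theta>. ennreal (1 / pi) * ((F (cis \<theta> * z) * indicator {0..<2*pi} \<theta>) * indicator (ball 0 1) z) \<partial>lborel) \<partial>lborel)"
    by (subst nn_integral_disc_area_borel[OF circ_measurable[OF assms]])
       (auto intro!: nn_integral_cong simp: circ_def nn_integral_cmult nn_integral_multc)
  also have "\<dots> = (\<integral>\<^sup>+\<theta>. (\<integral>\<^sup>+z. ennreal (1 / pi) * ((F (cis \<theta> * z) * indicator {0..<2*pi} \<theta>) * indicator (ball 0 1) z) \<partial>lborel) \<partial>lborel)"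
    by (rule lborel_pair.Fubini') measurable
  also have "\<dots> = (\<integral>\<^sup>+\<theta>. (\<integral>\<^sup>+z. F z \<partial>disc_area) * indicator {0..<2*pi} \<theta> \<partial>lborel)"
  proof (rule nn_integral_cong)
    fix \<theta> :: real
    have "(\<integral>\<^sup>+z. ennreal (1 / pi) * ((F (cis \<theta> * z) * indicator {0..<2*pi} \<theta>) * indicator (ball 0 1) z) \<partial>lborel)
      = (\<integral>\<^sup>+z. ennreal (1 / pi) * (F (cis \<theta> * z) * indicator (ball 0 1) z) * indicator {0..<2*pi} \<theta> \<partial>lborel)"
      by (simp add: mult_ac)
    also have "\<dots> = (\<integral>\<^sup>+z. F (cis \<theta> * z) \<partial>disc_area) * indicator {0..<2*pi} \<theta>"
      by (subst nn_integral_multc) (auto simp: nn_integral_disc_area_borel)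
    also have "(\<integral>\<^sup>+z. F (cis \<theta> * z) \<partial>disc_area) = (\<integral>\<^sup>+z. F z \<partial>disc_area)"
      by (rule nn_integral_disc_area_rotate) auto
    finally show "(\<integral>\<^sup>+z. ennreal (1 / pi) * ((F (cis \<theta> * z) * indicator {0..<2*pi} \<theta>) * indicator (ball 0 1) z) \<partial>lborel)
      = (\<integral>\<^sup>+z. F z \<partial>disc_area) * indicator {0..<2*pi} \<theta>" .
  qed
  also have "\<dots> = ennreal (2 * pi) * (\<integral>\<^sup>+z. F z \<partial>disc_area)"
    by (simp add: nn_integral_cmult mult.commute)
  finally show ?thesis ..
qed

text \<open>A radial factor is constant on circles and leaves the circle integral, which for the
  kernel depends on \<open>cmod w * cmod \<zeta>\<close> only. The density \<open>t / pi\<close> is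
  \<open>2 * t\<close> from radial integration divided by the length \<open>2 * pi\<close> of the
  angle interval.\<close>

lemma nn_integral_kernel_radial:
  fixes g :: "real \<Rightarrow> ennreal" and K :: "complex \<Rightarrow> ennreal"
  assumes g: "(\<lambda>t. g t * indicator {0..<1} t) \<in> borel_measurable lebesgue"
    and [measurable]: "K \<in> borel_measurable borel"
  shows "(\<integral>\<^sup>+\<zeta>. g (cmod \<zeta>) * K (w * \<zeta>) \<partial>disc_area)
       = (\<integral>\<^sup>+t\<in>{0..<1}. ennreal (t / pi) * (g t * circ K (complex_of_real (cmod w * t))) \<partial>lebesgue)"
proof -
  obtain g' where g': "g' \<in> borel_measurable lborel" "AE t in lborel. g t * indicator {0..<1} t = g' t"
    using completion_ex_borel_measurable[OF g] by auto
  have [measurable]: "g' \<in> borel_measurable borel" using g'(1) by simp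
  have ck [measurable]: "circ K \<in> borel_measurable borel" by (rule circ_measurable) measurable
  define F where "F \<zeta> = g' (cmod \<zeta>) * K (w * \<zeta>)" for \<zeta>
  have [measurable]: "F \<in> borel_measurable borel" unfolding F_def by measurable
  have "(\<integral>\<^sup>+\<zeta>. g (cmod \<zeta>) * K (w * \<zeta>) \<partial>disc_area) = (\<integral>\<^sup>+\<zeta>. F \<zeta> \<partial>disc_area)"
    using AE_disc_area_cmod[OF g'(2)] AE_space[of disc_area]
    by (intro nn_integral_cong_AE, eventually_elim) (auto simp: F_def)
  also have "\<dots> = ennreal (1 / (2 * pi)) * (ennreal (2 * pi) * (\<integral>\<^sup>+\<zeta>. F \<zeta> \<partial>disc_area))"
    by (simp add: mult.assoc[symmetric] ennreal_mult'[symmetric])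
  also have "\<dots> = ennreal (1 / (2 * pi)) * (\<integral>\<^sup>+\<zeta>. circ F \<zeta> \<partial>disc_area)"
    by (subst nn_integral_disc_area_circ) auto
  also have "circ F = (\<lambda>\<zeta>. g' (cmod \<zeta>) * circ K (complex_of_real (cmod w * cmod \<zeta>)))"
  proof
    fix \<zeta>
    have "circ F \<zeta> = g' (cmod \<zeta>) * circ K (w * \<zeta>)"
      unfolding circ_def F_def by (subst nn_integral_cmult[symmetric]) (auto simp: norm_mult mult_ac)
    also have "circ K (w * \<zeta>) = circ K (complex_of_real (cmod w * cmod \<zeta>))"
      by (subst circ_eq_cmod) (auto simp: norm_mult)
    finally show "circ F \<zeta> = g' (cmod \<zeta>) * circ K (complex_of_real (cmod w * cmod \<zeta>))" .
  qed
  also have "(\<integral>\<^sup>+\<zeta>. g' (cmod \<zeta>) * circ K (complex_of_real (cmod w * cmod \<zeta>)) \<partial>disc_area)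
      = (\<integral>\<^sup>+t\<in>{0..<1}. ennreal (2 * t) * (g' t * circ K (complex_of_real (cmod w * t))) \<partial>lebesgue)"
    by (rule nn_integral_radial) (intro measurable_completion, measurable)
  also have "ennreal (1 / (2 * pi)) * \<dots> = (\<integral>\<^sup>+t\<in>{0..<1}. ennreal (t / pi) * (g' t * circ K (complex_of_real (cmod w * t))) \<partial>lebesgue)"
    by (subst nn_integral_cmult[symmetric])
       (auto intro!: nn_integral_cong measurable_completion simp: indicator_def mult.assoc[symmetric] ennreal_mult'[symmetric])
  also have "\<dots> = (\<integral>\<^sup>+t\<in>{0..<1}. ennreal (t / pi) * (g t * circ K (complex_of_real (cmod w * t))) \<partial>lebesgue)"
    using AE_completion[OF g'(2)] by (intro nn_integral_cong_AE, eventually_elim) (auto simp: indicator_def)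
  finally show ?thesis .
qed

section \<open>Integral means of power series on circles\<close>

lemma circle_integral_Icc:
  "(\<integral>\<^sup>+\<theta>\<in>{0..<2*pi}. h \<theta> \<partial>lborel) = (\<integral>\<^sup>+\<theta>\<in>{0..2*pi}. h \<theta> \<partial>lborel)"
proof -
  have "AE \<theta> in lborel. \<theta> \<noteq> 2 * pi" by (rule AE_lborel_singleton)
  then show ?thesis by (intro nn_integral_cong_AE) (auto simp: indicator_def elim!: eventually_mono)
qed

lemma has_integral_cis_int:
  fixes k :: int
  shows "((\<lambda>\<theta>. cis (of_int k * \<theta>)) has_integral (if k = 0 then 2 * pi else 0)) {0..2*pi}"
proof (cases "k = 0")
  case True
  then show ?thesis using has_integral_const_real[of "1::complex" 0 "2*pi"] by (simp add: scaleR_conv_of_real)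
next
  case False
  let ?F = "\<lambda>\<theta>. cis (of_int k * \<theta>) / (\<i> * of_int k)"
  have "((\<lambda>\<theta>. cis (of_int k * \<theta>)) has_integral (?F (2*pi) - ?F 0)) {0..2*pi}"
  proof (rule fundamental_theorem_of_calculus)
    fix x :: real
    have "((\<lambda>\<theta>. exp (\<i> * of_real (of_int k * \<theta>)) / (\<i> * of_int k)) has_vector_derivative
        exp (\<i> * of_real (of_int k * x))) (at x within {0..2*pi})"
      using False by (auto intro!: derivative_eq_intros has_vector_derivative_real_field simp: field_simps)
    then show "(?F has_vector_derivative cis (of_int k * x)) (at x within {0..2*pi})"
      by (simp add: cis_conv_exp)
  qed simp
  moreover have "cis (of_int k * (2 * pi)) = 1"
    using cis_multiple_2pi[of "of_int k"] by (simp add: mult_ac)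
  ultimately show ?thesis using False by simp
qed

lemma parseval_finite:
  fixes a :: "nat \<Rightarrow> complex"
  shows "((\<lambda>\<theta>. (cmod (\<Sum>n<N. a n * cis \<theta> ^ n))\<^sup>2) has_integral (2 * pi * (\<Sum>n<N. (cmod (a n))\<^sup>2))) {0..2*pi}"
proof -
  have eq: "complex_of_real ((cmod (\<Sum>n<N. a n * cis \<theta> ^ n))\<^sup>2)
      = (\<Sum>m<N. \<Sum>n<N. (a m * cnj (a n)) * cis (of_int (int m - int n) * \<theta>))" for \<theta>
  proof -
    have "cis \<theta> ^ m * cnj (cis \<theta> ^ n) = cis (of_int (int m - int n) * \<theta>)" for m n
      by (simp add: Complex.DeMoivre cis_cnj cis_mult algebra_simps)
    then have "(a m * cis \<theta> ^ m) * cnj (a n * cis \<theta> ^ n) = (a m * cnj (a n)) * cis (of_int (int m - int n) * \<theta>)" for m n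
      by (metis (no_types, opaque_lifting) complex_cnj_mult mult.assoc mult.left_commute)
    then show ?thesis
      unfolding complex_norm_square cnj_sum sum_product by (intro sum.cong refl)
  qed
  have "((\<lambda>\<theta>. \<Sum>m<N. \<Sum>n<N. (a m * cnj (a n)) * cis (of_int (int m - int n) * \<theta>)) has_integral
      (\<Sum>m<N. \<Sum>n<N. (a m * cnj (a n)) * (if int m - int n = 0 then 2 * pi else 0))) {0..2*pi}"
    by (intro has_integral_sum finite_lessThan has_integral_mult_right has_integral_cis_int)
  also have "(\<Sum>m<N. \<Sum>n<N. (a m * cnj (a n)) * (if int m - int n = 0 then 2 * pi else 0))
      = complex_of_real (2 * pi * (\<Sum>n<N. (cmod (a n))\<^sup>2))"
  proof -
    have "(\<Sum>n<N. (a m * cnj (a n)) * (if int m - int n = 0 then 2 * pi else 0)) = 2 * pi * (cmod (a m))\<^sup>2" if "m < N" for m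
    proof -
      have "(\<Sum>n<N. (a m * cnj (a n)) * (if int m - int n = 0 then 2 * pi else 0)) = (\<Sum>n<N. if n = m then 2 * pi * (a m * cnj (a m)) else 0)"
        by (intro sum.cong) auto
      then show ?thesis using that by (simp add: complex_norm_square[symmetric])
    qed
    then show ?thesis by (simp add: sum_distrib_left)
  qed
  finally have "((\<lambda>\<theta>. complex_of_real ((cmod (\<Sum>n<N. a n * cis \<theta> ^ n))\<^sup>2)) has_integral
      complex_of_real (2 * pi * (\<Sum>n<N. (cmod (a n))\<^sup>2))) {0..2*pi}"
    unfolding eq .
  from has_integral_linear[OF this bounded_linear_Re] show ?thesis by (simp add: o_def)
qed

text \<open>Partial sums satisfy the identity exactly, absolute summability gives pointwise
  convergence on the circle, and Fatou's lemma passes to the limit.\<close>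

lemma parseval_le:
  fixes a :: "nat \<Rightarrow> complex"
  assumes "summable (\<lambda>n. cmod (a n))" and B: "\<And>N. (\<Sum>n<N. (cmod (a n))\<^sup>2) \<le> B"
  shows "(\<integral>\<^sup>+\<theta>\<in>{0..<2*pi}. ennreal ((cmod (\<Sum>n. a n * cis \<theta> ^ n))\<^sup>2) \<partial>lborel) \<le> ennreal (2 * pi * B)"
proof -
  have s: "summable (\<lambda>n. a n * cis \<theta> ^ n)" for \<theta>
    using assms(1) by (intro summable_norm_cancel[of "\<lambda>n. a n * cis \<theta> ^ n"]) (simp add: norm_mult norm_power)
  have fin: "(\<integral>\<^sup>+\<theta>\<in>{0..<2*pi}. ennreal ((cmod (\<Sum>n<N. a n * cis \<theta> ^ n))\<^sup>2) \<partial>lborel) \<le> ennreal (2 * pi * B)" for N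
  proof -
    have "(\<integral>\<^sup>+\<theta>\<in>{0..<2*pi}. ennreal ((cmod (\<Sum>n<N. a n * cis \<theta> ^ n))\<^sup>2) \<partial>lborel)
        = ennreal (2 * pi * (\<Sum>n<N. (cmod (a n))\<^sup>2))"
      unfolding circle_integral_Icc
      by (rule nn_integral_has_integral_lebesgue'[OF _ parseval_finite[of a N]]) simp
    also have "\<dots> \<le> ennreal (2 * pi * B)" using B[of N] by (intro ennreal_leI) auto
    finally show ?thesis .
  qed
  have "(\<integral>\<^sup>+\<theta>\<in>{0..<2*pi}. ennreal ((cmod (\<Sum>n. a n * cis \<theta> ^ n))\<^sup>2) \<partial>lborel)
      = (\<integral>\<^sup>+\<theta>. liminf (\<lambda>N. ennreal ((cmod (\<Sum>n<N. a n * cis \<theta> ^ n))\<^sup>2) * indicator {0..<2*pi} \<theta>) \<partial>lborel)"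
  proof (intro nn_integral_cong)
    fix \<theta> :: real
    have "(\<lambda>N. \<Sum>n<N. a n * cis \<theta> ^ n) \<longlonglongrightarrow> (\<Sum>n. a n * cis \<theta> ^ n)"
      using s[of \<theta>] by (rule summable_LIMSEQ)
    then have "(\<lambda>N. ennreal ((cmod (\<Sum>n<N. a n * cis \<theta> ^ n))\<^sup>2)) \<longlonglongrightarrow> ennreal ((cmod (\<Sum>n. a n * cis \<theta> ^ n))\<^sup>2)"
      by (intro tendsto_ennrealI tendsto_intros)
    then show "ennreal ((cmod (\<Sum>n. a n * cis \<theta> ^ n))\<^sup>2) * indicator {0..<2*pi} \<theta>
      = liminf (\<lambda>N. ennreal ((cmod (\<Sum>n<N. a n * cis \<theta> ^ n))\<^sup>2) * indicator {0..<2*pi} \<theta>)"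
      by (cases "\<theta> \<in> {0..<2*pi}") (auto intro!: lim_imp_Liminf[symmetric] Liminf_const)
  qed
  also have "\<dots> \<le> liminf (\<lambda>N. \<integral>\<^sup>+\<theta>. ennreal ((cmod (\<Sum>n<N. a n * cis \<theta> ^ n))\<^sup>2) * indicator {0..<2*pi} \<theta> \<partial>lborel)"
    by (rule nn_integral_liminf) measurable
  also have "\<dots> \<le> ennreal (2 * pi * B)"
    using fin by (intro Liminf_le) (auto intro: always_eventually)
  finally show ?thesis .
qed

text \<open>Multiplication by \<open>1 - w e\<^sup>i\<^sup>\<theta>\<close> turns the coefficients into differences, whose \<open>\<ell>\<^sup>2\<close> norm is small;
  the reciprocal factor costs only \<open>(1 - \<bar>w\<bar>\<^sup>2)\<^sup>-\<^sup>1\<^sup>/\<^sup>2\<close> in \<open>L\<^sup>2\<close>.\<close>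

lemma circle_mean_le:
  fixes a :: "nat \<Rightarrow> complex"
  assumes a: "summable (\<lambda>n. cmod (a n))" and w: "cmod w < 1" and l: "0 < l"
    and B: "\<And>N. (cmod (a 0))\<^sup>2 + (\<Sum>n<N. (cmod (a (Suc n) - w * a n))\<^sup>2) \<le> B"
  shows "(\<integral>\<^sup>+\<theta>\<in>{0..<2*pi}. ennreal (cmod (\<Sum>n. a n * cis \<theta> ^ n)) \<partial>lborel)
     \<le> ennreal (pi * (l * B + 1 / (l * (1 - (cmod w)\<^sup>2))))"
proof -
  define S where "S \<theta> = (\<Sum>n. a n * cis \<theta> ^ n)" for \<theta>
  define b where "b n = (case n of 0 \<Rightarrow> a 0 | Suc m \<Rightarrow> a (Suc m) - w * a m)" for n
  have w2: "(cmod w)\<^sup>2 < 1" using w by (simp add: power_less_one_iff abs_square_less_1)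
  have s: "summable (\<lambda>n. a n * cis \<theta> ^ n)" for \<theta>
    using a by (intro summable_norm_cancel[of "\<lambda>n. a n * cis \<theta> ^ n"]) (simp add: norm_mult norm_power)
  have bs: "summable (\<lambda>n. cmod (b n))"
  proof -
    have "summable (\<lambda>n. cmod (a (Suc n)) + cmod (w * a n))"
      using a summable_Suc_iff[of "\<lambda>n. cmod (a n)"] by (intro summable_add) (auto simp: norm_mult intro: summable_mult)
    then have "summable (\<lambda>n. cmod (b (Suc n)))"
      by (rule summable_comparison_test'[where N=0]) (auto simp: b_def intro: norm_triangle_ineq4)
    then show ?thesis using summable_Suc_iff[of "\<lambda>n. cmod (b n)"] by blast
  qed
  have bS: "(\<Sum>n. b n * cis \<theta> ^ n) = (1 - w * cis \<theta>) * S \<theta>" for \<theta>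
  proof -
    have sb: "summable (\<lambda>n. b n * cis \<theta> ^ n)"
      using bs by (intro summable_norm_cancel[of "\<lambda>n. b n * cis \<theta> ^ n"]) (simp add: norm_mult norm_power)
    have "(\<Sum>n. b n * cis \<theta> ^ n) = a 0 + (\<Sum>n. b (Suc n) * cis \<theta> ^ Suc n)"
      using suminf_split_head[OF sb] by (simp add: b_def)
    also have "(\<Sum>n. b (Suc n) * cis \<theta> ^ Suc n) = (\<Sum>n. a (Suc n) * cis \<theta> ^ Suc n - (w * cis \<theta>) * (a n * cis \<theta> ^ n))"
      by (simp add: b_def algebra_simps)
    also have "\<dots> = (\<Sum>n. a (Suc n) * cis \<theta> ^ Suc n) - (w * cis \<theta>) * S \<theta>"
    proof -
      have "summable (\<lambda>n. a (Suc n) * cis \<theta> ^ Suc n)"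
        using s[of \<theta>] summable_Suc_iff[of "\<lambda>n. a n * cis \<theta> ^ n"] by blast
      from suminf_diff[OF this summable_mult[OF s[of \<theta>], of "w * cis \<theta>"]]
      show ?thesis unfolding S_def suminf_mult[OF s[of \<theta>], of "w * cis \<theta>"] by simp
    qed
    also have "a 0 + \<dots> = (1 - w * cis \<theta>) * S \<theta>"
      using suminf_split_head[OF s[of \<theta>]] by (simp add: S_def algebra_simps)
    finally show ?thesis .
  qed
  have ne: "1 - w * cis \<theta> \<noteq> 0" for \<theta>
  proof
    assume "1 - w * cis \<theta> = 0"
    then have "cmod (w * cis \<theta>) = 1" by (metis eq_iff_diff_eq_0 norm_one)
    then show False using w by (simp add: norm_mult)
  qed
  have G: "(\<Sum>n. w ^ n * cis \<theta> ^ n) = 1 / (1 - w * cis \<theta>)" for \<theta>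
    using suminf_geometric[of "w * cis \<theta>"] w by (simp add: norm_mult power_mult_distrib)
  have I1: "(\<integral>\<^sup>+\<theta>\<in>{0..<2*pi}. ennreal ((cmod (\<Sum>n. b n * cis \<theta> ^ n))\<^sup>2) \<partial>lborel) \<le> ennreal (2 * pi * B)"
  proof (rule parseval_le[OF bs])
    fix N
    show "(\<Sum>n<N. (cmod (b n))\<^sup>2) \<le> B"
    proof (cases N)
      case 0
      have "(cmod (a 0))\<^sup>2 \<le> B" using B[of 0] by simp
      from order_trans[OF zero_le_power2 this] show ?thesis by (simp add: 0)
    next
      case (Suc M)
      then show ?thesis using B[of M] by (simp add: sum.lessThan_Suc_shift b_def del: sum.lessThan_Suc)
    qed
  qed
  have I2: "(\<integral>\<^sup>+\<theta>\<in>{0..<2*pi}. ennreal ((cmod (\<Sum>n. w ^ n * cis \<theta> ^ n))\<^sup>2) \<partial>lborel) \<le> ennreal (2 * pi * (1 / (1 - (cmod w)\<^sup>2)))"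
  proof (rule parseval_le)
    show "summable (\<lambda>n. cmod (w ^ n))" using w by (simp add: norm_power)
    fix N
    have "(\<Sum>n<N. (cmod (w ^ n))\<^sup>2) = (\<Sum>n<N. ((cmod w)\<^sup>2) ^ n)"
      by (simp add: norm_power power_mult[symmetric] mult.commute)
    also have "\<dots> \<le> (\<Sum>n. ((cmod w)\<^sup>2) ^ n)"
      using w2 by (intro sum_le_suminf) auto
    also have "\<dots> = 1 / (1 - (cmod w)\<^sup>2)" using w2 by (subst suminf_geometric) auto
    finally show "(\<Sum>n<N. (cmod (w ^ n))\<^sup>2) \<le> 1 / (1 - (cmod w)\<^sup>2)" .
  qed
  have Bnn: "B \<ge> 0" using B[of 0] by (smt (verit) sum.lessThan_Suc lessThan_0 sum.empty zero_le_power2)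
  \<comment> \<open>Cauchy-Schwarz in the form \<open>2 * x * y \<le> l * x^2 + y^2 / l\<close>; the
    weight \<open>l\<close> stays free so that the two integrals can be balanced in the
    application.\<close>
  have ptw: "ennreal (cmod (S \<theta>)) \<le> ennreal (l / 2) * ennreal ((cmod (\<Sum>n. b n * cis \<theta> ^ n))\<^sup>2)
      + ennreal (1 / (2 * l)) * ennreal ((cmod (\<Sum>n. w ^ n * cis \<theta> ^ n))\<^sup>2)" for \<theta>
  proof -
    let ?x = "cmod (\<Sum>n. b n * cis \<theta> ^ n)" let ?y = "cmod (\<Sum>n. w ^ n * cis \<theta> ^ n)"
    have "cmod (S \<theta>) = ?x * ?y"
      unfolding bS G using ne[of \<theta>] by (simp add: norm_mult norm_divide)
    also have "\<dots> \<le> l / 2 * ?x\<^sup>2 + 1 / (2 * l) * ?y\<^sup>2"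
    proof -
      have "0 \<le> (l * ?x - ?y)\<^sup>2" by simp
      then have "2 * (l * (?x * ?y)) \<le> l * (l * ?x\<^sup>2) + ?y\<^sup>2"
        by (simp add: power2_eq_square algebra_simps)
      then show ?thesis using l by (simp add: field_simps)
    qed
    finally show ?thesis
      using l by (simp add: ennreal_mult[symmetric] ennreal_plus[symmetric] del: ennreal_plus)
  qed
  have mS: "(\<lambda>\<theta>. \<Sum>n. c n * cis \<theta> ^ n) \<in> borel_measurable borel" for c :: "nat \<Rightarrow> complex"
    by measurable
  have "(\<integral>\<^sup>+\<theta>\<in>{0..<2*pi}. ennreal (cmod (S \<theta>)) \<partial>lborel) \<le>
     (\<integral>\<^sup>+\<theta>. ennreal (l / 2) * (ennreal ((cmod (\<Sum>n. b n * cis \<theta> ^ n))\<^sup>2) * indicator {0..<2*pi} \<theta>)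
      + ennreal (1 / (2 * l)) * (ennreal ((cmod (\<Sum>n. w ^ n * cis \<theta> ^ n))\<^sup>2) * indicator {0..<2*pi} \<theta>) \<partial>lborel)"
    using ptw by (intro nn_integral_mono) (auto simp: indicator_def)
  also have "\<dots> = ennreal (l / 2) * (\<integral>\<^sup>+\<theta>\<in>{0..<2*pi}. ennreal ((cmod (\<Sum>n. b n * cis \<theta> ^ n))\<^sup>2) \<partial>lborel)
     + ennreal (1 / (2 * l)) * (\<integral>\<^sup>+\<theta>\<in>{0..<2*pi}. ennreal ((cmod (\<Sum>n. w ^ n * cis \<theta> ^ n))\<^sup>2) \<partial>lborel)"
    by (subst nn_integral_add) (auto simp: nn_integral_cmult)
  also have "\<dots> \<le> ennreal (l / 2) * ennreal (2 * pi * B) + ennreal (1 / (2 * l)) * ennreal (2 * pi * (1 / (1 - (cmod w)\<^sup>2)))"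
    using I1 I2 by (intro add_mono mult_left_mono) auto
  also have "\<dots> = ennreal (l / 2 * (2 * pi * B) + 1 / (2 * l) * (2 * pi * (1 / (1 - (cmod w)\<^sup>2))))"
    using l Bnn w2 by (subst (1 2) ennreal_mult[symmetric]) (auto simp: ennreal_plus)
  also have "l / 2 * (2 * pi * B) + 1 / (2 * l) * (2 * pi * (1 / (1 - (cmod w)\<^sup>2))) = pi * (l * B + 1 / (l * (1 - (cmod w)\<^sup>2)))"
    using l w2 by (simp add: field_simps)
  finally show ?thesis by (simp add: S_def)
qed

text \<open>Integration by parts. For \<open>n > 0\<close> the integrals
  \<open>2 * pi * \<i> / n\<close> all have the same argument, so a series with nonnegative
  coefficients cannot cancel when tested against the sawtooth.\<close>

lemma has_integral_sawtooth_cis: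
  "((\<lambda>\<theta>. of_real (pi - \<theta>) * cis \<theta> ^ n) has_integral (if n = 0 then 0 else 2 * pi * \<i> / of_nat n)) {0..2*pi}"
proof (cases "n = 0")
  case True
  have "((\<lambda>\<theta>. pi - \<theta>) has_integral ((pi * (2*pi) - (2*pi)^2/2) - (pi * 0 - 0^2/2))) {0..2*pi}"
    by (rule fundamental_theorem_of_calculus)
       (auto intro!: derivative_eq_intros simp: has_real_derivative_iff_has_vector_derivative[symmetric])
  from has_integral_of_real[OF this] have "((\<lambda>\<theta>. complex_of_real (pi - \<theta>)) has_integral 0) {0..2*pi}"
    by (simp add: power2_eq_square del: of_real_diff)
  then show ?thesis using True by simp
next
  case False
  let ?F = "\<lambda>\<theta>. of_real (pi - \<theta>) * cis (of_nat n * \<theta>) / (\<i> * of_nat n) - cis (of_nat n * \<theta>) / (of_nat n)^2"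
  have "((\<lambda>\<theta>. of_real (pi - \<theta>) * cis (of_nat n * \<theta>)) has_integral (?F (2*pi) - ?F 0)) {0..2*pi}"
  proof (rule fundamental_theorem_of_calculus)
    fix x :: real
    have "((\<lambda>\<theta>. (pi - \<theta>) * exp (\<i> * (of_nat n * \<theta>)) / (\<i> * of_nat n) - exp (\<i> * (of_nat n * \<theta>)) / (of_nat n)^2)
        has_field_derivative (pi - x) * exp (\<i> * (of_nat n * x))) (at (of_real x))"
      using False by (auto intro!: derivative_eq_intros simp: field_simps power2_eq_square)
    from has_vector_derivative_real_field[OF this, of "{0..2*pi}"]
    show "(?F has_vector_derivative (of_real (pi - x) * cis (of_nat n * x))) (at x within {0..2*pi})"
      by (simp add: cis_conv_exp mult_ac)
  qed simp
  moreover have "cis (of_nat n * (2 * pi)) = 1"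
    using cis_multiple_2pi[of "of_nat n"] by (simp add: mult_ac)
  ultimately show ?thesis using False by (simp add: Complex.DeMoivre field_simps)
qed

text \<open>Tests against the sawtooth \<open>\<pi> - \<theta>\<close>.\<close>

lemma hardy_inequality:
  fixes a :: "nat \<Rightarrow> real"
  assumes a: "summable a" "\<And>n. 0 \<le> a n"
  shows "ennreal (2 * (\<Sum>n=1..M. a n / n)) \<le> (\<integral>\<^sup>+\<theta>\<in>{0..<2*pi}. ennreal (cmod (\<Sum>n. of_real (a n) * cis \<theta> ^ n)) \<partial>lborel)"
    (is "_ \<le> ?I")
\<comment> \<open>The series is cut at a finite \<open>N\<close>, at the price of an error of total
  mass \<open>e\<close>, so that the test integral becomes a finite sum.\<close>
proof (rule ennreal_le_epsilon)
  fix e :: real assume e: "e > 0"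
  have "(\<lambda>N. \<Sum>n. a (n + N)) \<longlonglongrightarrow> 0" using a(1) by (rule suminf_exist_split2)
  then have "eventually (\<lambda>N. \<bar>\<Sum>n. a (n + N)\<bar> < e / (2 * pi)) sequentially"
    using e by (auto simp: tendsto_iff dist_real_def)
  then obtain N0 where N0: "\<And>N. N \<ge> N0 \<Longrightarrow> \<bar>\<Sum>n. a (n + N)\<bar> < e / (2 * pi)" by (auto simp: eventually_sequentially)
  define N where "N = max N0 (Suc M)"
  define S where "S \<theta> = (\<Sum>n<N. of_real (a n) * cis \<theta> ^ n)" for \<theta>
  define f where "f \<theta> = (\<Sum>n. of_real (a n) * cis \<theta> ^ n)" for \<theta>
  have [measurable]: "S \<in> borel_measurable borel" "f \<in> borel_measurable borel" unfolding S_def f_def by measurable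
  have Sf: "cmod (S \<theta>) \<le> cmod (f \<theta>) + e / (2 * pi)" for \<theta>
  proof -
    have sn: "summable (\<lambda>n. cmod (of_real (a n) * cis \<theta> ^ n))" using a by (simp add: norm_mult norm_power)
    have sn': "summable (\<lambda>n. cmod (of_real (a (n + N)) * cis \<theta> ^ (n + N)))"
      using sn summable_iff_shift[of "\<lambda>n. cmod (of_real (a n) * cis \<theta> ^ n)" N] by blast
    have "f \<theta> = (\<Sum>n. of_real (a (n + N)) * cis \<theta> ^ (n + N)) + S \<theta>"
      unfolding f_def S_def by (rule suminf_split_initial_segment) (rule summable_norm_cancel[OF sn])
    then have "cmod (S \<theta>) \<le> cmod (f \<theta>) + cmod (\<Sum>n. of_real (a (n + N)) * cis \<theta> ^ (n + N))"
      by (metis add_diff_cancel_left' norm_triangle_ineq4)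
    also have "cmod (\<Sum>n. of_real (a (n + N)) * cis \<theta> ^ (n + N)) \<le> (\<Sum>n. cmod (of_real (a (n + N)) * cis \<theta> ^ (n + N)))"
      using sn' by (rule summable_norm)
    also have "\<dots> = (\<Sum>n. a (n + N))" using a(2) by (simp add: norm_mult norm_power)
    also have "\<dots> \<le> e / (2 * pi)" using N0[of N] by (simp add: N_def)
    finally show ?thesis by simp
  qed
  define J where "J = integral {0..2*pi} (\<lambda>\<theta>. pi * cmod (S \<theta>))"
  have cont: "continuous_on {0..2*pi} S" unfolding S_def cis_conv_exp by (intro continuous_intros)
  have J: "((\<lambda>\<theta>. pi * cmod (S \<theta>)) has_integral J) {0..2*pi}"
    unfolding J_def by (intro integrable_integral integrable_continuous_real continuous_intros cont)
  have "((\<lambda>\<theta>. \<Sum>n<N. of_real (a n) * (of_real (pi - \<theta>) * cis \<theta> ^ n)) has_integral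
      (\<Sum>n<N. of_real (a n) * (if n = 0 then 0 else 2 * pi * \<i> / of_nat n))) {0..2*pi}"
    by (intro has_integral_sum finite_lessThan has_integral_mult_right has_integral_sawtooth_cis)
  also have "(\<lambda>\<theta>. \<Sum>n<N. of_real (a n) * (of_real (pi - \<theta>) * cis \<theta> ^ n)) = (\<lambda>\<theta>. of_real (pi - \<theta>) * S \<theta>)"
    by (simp add: S_def sum_distrib_left mult_ac)
  finally have hI: "((\<lambda>\<theta>. of_real (pi - \<theta>) * S \<theta>) has_integral
      (\<Sum>n<N. of_real (a n) * (if n = 0 then 0 else 2 * pi * \<i> / of_nat n))) {0..2*pi}" .
  \<comment> \<open>\<open>\<bar>pi - \<theta>\<bar> \<le> pi\<close> on the whole interval; against
    the value \<open>2 * pi / n\<close> of the test this leaves the factor 2 of the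
    statement.\<close>
  have "cmod (integral {0..2*pi} (\<lambda>\<theta>. of_real (pi - \<theta>) * S \<theta>)) \<le> J"
    unfolding J_def
  proof (rule integral_norm_bound_integral)
    show "cmod (of_real (pi - \<theta>) * S \<theta>) \<le> pi * cmod (S \<theta>)" if "\<theta> \<in> {0..2*pi}" for \<theta>
      using that by (auto simp: norm_mult intro!: mult_right_mono simp del: of_real_diff)
  qed (use hI J in auto)
  also have "integral {0..2*pi} (\<lambda>\<theta>. of_real (pi - \<theta>) * S \<theta>) = (\<Sum>n<N. of_real (a n) * (if n = 0 then 0 else 2 * pi * \<i> / of_nat n))"
    using hI by (rule integral_unique)
  \<comment> \<open>The term \<open>n = 0\<close> is harmless: the sawtooth has mean 0, and
    \<open>a 0 / 0 = 0\<close>.\<close>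
  also have "\<dots> = of_real (2 * pi * (\<Sum>n<N. a n / n)) * \<i>"
    by (auto simp: sum_distrib_left sum_distrib_right intro!: sum.cong)
  finally have "cmod (of_real (2 * pi * (\<Sum>n<N. a n / n)) * \<i>) \<le> J" .
  then have "2 * pi * (\<Sum>n<N. a n / n) \<le> J"
    using a(2) by (simp only: norm_mult norm_of_real norm_ii)
  moreover have "(\<Sum>n=1..M. a n / n) \<le> (\<Sum>n<N. a n / n)"
    using a(2) by (intro sum_mono2) (auto simp: N_def)
  then have "2 * pi * (\<Sum>n=1..M. a n / n) \<le> 2 * pi * (\<Sum>n<N. a n / n)"
    by (intro mult_left_mono) auto
  ultimately have "pi * (2 * (\<Sum>n=1..M. a n / n)) \<le> J" by argo
  then have "ennreal pi * ennreal (2 * (\<Sum>n=1..M. a n / n)) \<le> ennreal J"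
    by (simp add: ennreal_mult'[symmetric] ennreal_leI)
  also have "ennreal J = (\<integral>\<^sup>+\<theta>\<in>{0..2*pi}. ennreal (pi * cmod (S \<theta>)) \<partial>lborel)"
    by (rule nn_integral_has_integral_lebesgue'[OF _ J, symmetric]) simp
  also have "\<dots> = ennreal pi * (\<integral>\<^sup>+\<theta>\<in>{0..2*pi}. ennreal (cmod (S \<theta>)) \<partial>lborel)"
    by (subst nn_integral_cmult[symmetric]) (auto intro!: nn_integral_cong simp: indicator_def ennreal_mult')
  finally have "ennreal (2 * (\<Sum>n=1..M. a n / n)) \<le> (\<integral>\<^sup>+\<theta>\<in>{0..2*pi}. ennreal (cmod (S \<theta>)) \<partial>lborel)"
    by (subst (asm) ennreal_mult_le_mult_iff) auto
  also have "\<dots> = (\<integral>\<^sup>+\<theta>\<in>{0..<2*pi}. ennreal (cmod (S \<theta>)) \<partial>lborel)" by (rule circle_integral_Icc[symmetric])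
  also have "\<dots> \<le> (\<integral>\<^sup>+\<theta>. ennreal (cmod (f \<theta>)) * indicator {0..<2*pi} \<theta> + ennreal (e / (2 * pi)) * indicator {0..<2*pi} \<theta> \<partial>lborel)"
    using Sf e by (intro nn_integral_mono) (auto simp: indicator_def ennreal_plus[symmetric] ennreal_leI simp del: ennreal_plus)
  also have "\<dots> = ?I + ennreal e"
    using e by (subst nn_integral_add) (auto simp: f_def nn_integral_cmult ennreal_mult'[symmetric])
  finally show "ennreal (2 * (\<Sum>n=1..M. a n / n)) \<le> ?I + ennreal e" .
qed

section \<open>Integral means of the Bergman kernel\<close>

definition bker :: "(real \<Rightarrow> real) \<Rightarrow> complex \<Rightarrow> complex" where
  "bker \<omega> w = (\<Sum>n. complex_of_real (bcoef \<omega> n) * w ^ n)"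

lemma bergman_kernel_eq: "bergman_kernel \<omega> z \<zeta> = bker \<omega> (cnj z * \<zeta>)"
  by (simp add: bergman_kernel_def bker_def bcoef_def)

lemma bker_measurable [measurable]: "bker \<omega> \<in> borel_measurable borel"
  unfolding bker_def[abs_def] by measurable

text \<open>Of the two factors \<open>sqrt x ^ n\<close> in \<open>x ^ n\<close>, one bounds the
  coefficient and the other is a convergent geometric series.\<close>

lemma bcoef_summable:
  assumes "\<omega> \<in> class_Dhat" "0 \<le> x" "x < 1"
  shows "summable (\<lambda>n. bcoef \<omega> n * x ^ n)"
proof -
  obtain C where C: "C > 0" "\<And>x n. 0 \<le> x \<Longrightarrow> x < 1 \<Longrightarrow> bcoef \<omega> n * sqrt x ^ n \<le> C / tail \<omega> x"
    using bcoef_growth[OF assms(1)] by auto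
  have pos: "0 < bcoef \<omega> n" for n using bcoef_pos Dhat_radial assms by auto
  show ?thesis
  proof (rule summable_comparison_test'[where N=0])
    show "summable (\<lambda>n. C / tail \<omega> x * sqrt x ^ n)"
      using assms by (intro summable_mult summable_geometric) auto
    fix n :: nat
    have "norm (bcoef \<omega> n * x ^ n) = (bcoef \<omega> n * sqrt x ^ n) * sqrt x ^ n"
      using assms pos[of n] by (simp add: abs_mult power_mult_distrib[symmetric])
    also have "\<dots> \<le> C / tail \<omega> x * sqrt x ^ n"
      using C(2)[of x n] assms by (intro mult_right_mono) auto
    finally show "norm (bcoef \<omega> n * x ^ n) \<le> C / tail \<omega> x * sqrt x ^ n" .
  qed
qed

lemma bker_summable_norm:
  assumes "\<omega> \<in> class_Dhat" "cmod w < 1"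
  shows "summable (\<lambda>n. cmod (complex_of_real (bcoef \<omega> n) * w ^ n))"
  using bcoef_summable[OF assms(1), of "cmod w"] bcoef_pos[OF Dhat_radial[OF assms(1)]] assms(2)
  by (simp add: norm_mult norm_power abs_of_pos)

lemma norm_bker_le:
  assumes "\<omega> \<in> class_Dhat" "cmod w \<le> x" "x < 1"
  shows "cmod (bker \<omega> w) \<le> (\<Sum>n. bcoef \<omega> n * x ^ n)"
proof -
  have x: "0 \<le> x" using assms(2) norm_ge_zero order_trans by blast
  have pos: "0 < bcoef \<omega> n" for n using bcoef_pos Dhat_radial assms by auto
  have "cmod (bker \<omega> w) \<le> (\<Sum>n. cmod (complex_of_real (bcoef \<omega> n) * w ^ n))"
    unfolding bker_def using assms by (intro summable_norm bker_summable_norm) auto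
  also have "\<dots> \<le> (\<Sum>n. bcoef \<omega> n * x ^ n)"
  proof (rule suminf_le)
    show "cmod (complex_of_real (bcoef \<omega> n) * w ^ n) \<le> bcoef \<omega> n * x ^ n" for n
      using pos[of n] assms by (simp add: norm_mult norm_power power_mono)
  qed (use assms x bker_summable_norm bcoef_summable in auto)
  finally show ?thesis .
qed

lemma circ_bker_lower:
  assumes "\<omega> \<in> class_Dhat" "0 \<le> x" "x < 1"
  shows "ennreal (2 * (\<Sum>n=1..M. bcoef \<omega> n * x ^ n / n)) \<le> circ (\<lambda>w. ennreal (cmod (bker \<omega> w))) (of_real x)"
proof -
  have pos: "0 \<le> bcoef \<omega> n" for n using bcoef_pos[OF Dhat_radial[OF assms(1)], of n] by simp
  have "ennreal (2 * (\<Sum>n=1..M. bcoef \<omega> n * x ^ n / n))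
    \<le> (\<integral>\<^sup>+\<theta>\<in>{0..<2*pi}. ennreal (cmod (\<Sum>n. of_real (bcoef \<omega> n * x ^ n) * cis \<theta> ^ n)) \<partial>lborel)"
    using assms pos by (intro hardy_inequality bcoef_summable) auto
  then show ?thesis
    by (simp add: circ_def bker_def power_mult_distrib mult_ac)
qed

text \<open>The increment has coefficients
  \<open>a n = bcoef \<omega> n * s ^ n * (1 - q ^ n)\<close>, and \<open>circle_mean_le\<close> is
  applied with \<open>w = s\<close>. In \<open>a (Suc n) - s * a n\<close> either the coefficient or
  the power of \<open>q\<close> is differenced, so every part carries a factor \<open>1 - q\<close>,
  at most \<open>K * (1 - s)\<close>. This pays for the two factors \<open>1 / sqrt (1 - s)\<close>
  that come from summing \<open>s ^ n\<close> and from the reciprocal of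
  \<open>1 - s * cis \<theta>\<close>.\<close>

lemma circ_bker_increment:
  assumes "\<omega> \<in> class_Dhat" "K \<ge> 1"
  obtains C where "C > 0" "\<And>s q. 1/2 \<le> s \<Longrightarrow> s < 1 \<Longrightarrow> 0 \<le> q \<Longrightarrow> q \<le> 1 \<Longrightarrow> 1 - q \<le> K * (1 - s) \<Longrightarrow>
      circ (\<lambda>u. ennreal (cmod (bker \<omega> u - bker \<omega> (of_real q * u)))) (of_real s) \<le> ennreal (C / tail \<omega> s)"
proof -
  note rw = Dhat_radial[OF assms(1)]
  have cpos: "0 < bcoef \<omega> n" for n using bcoef_pos rw by auto
  obtain C1 where C1: "C1 > 0" "\<And>n. real (Suc n) * (bcoef \<omega> (Suc n) - bcoef \<omega> n) \<le> C1 * bcoef \<omega> (Suc n)"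
    using bcoef_diff[OF assms(1)] by auto
  obtain C2 where C2: "C2 > 0" "\<And>x n. 0 \<le> x \<Longrightarrow> x < 1 \<Longrightarrow> bcoef \<omega> n * sqrt x ^ n \<le> C2 / tail \<omega> x"
    using bcoef_growth[OF assms(1)] by auto
  define D where "D = (K * (C1 + 1) * C2)\<^sup>2"
  have "circ (\<lambda>u. ennreal (cmod (bker \<omega> u - bker \<omega> (of_real q * u)))) (of_real s) \<le> ennreal (pi * (D + 1) / tail \<omega> s)"
    if s: "1/2 \<le> s" "s < 1" and q: "0 \<le> q" "q \<le> 1" "1 - q \<le> K * (1 - s)" for s q
  proof -
    have tp: "0 < tail \<omega> s" using tail_pos[OF rw] s by auto
    define a where "a n = bcoef \<omega> n * s ^ n * (1 - q ^ n)" for n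
    have sa: "summable a"
    proof -
      have "summable (\<lambda>n. bcoef \<omega> n * s ^ n - bcoef \<omega> n * (q * s) ^ n)"
        using s q by (intro summable_diff bcoef_summable assms) (auto intro: mult_le_one[THEN le_less_trans] simp: mult_le_cancel_right1 intro!: le_less_trans[of "q * s" s 1])
      then show ?thesis by (simp add: a_def[abs_def] algebra_simps power_mult_distrib)
    qed
    have q1: "q ^ n \<le> 1" for n using q by (simp add: power_le_one)
    have a0: "0 \<le> a n" for n unfolding a_def using s q1[of n] cpos[of n] by simp
    have step: "\<bar>a (Suc n) - s * a n\<bar> \<le> s ^ Suc n * ((1 - q) * ((C1 + 1) * bcoef \<omega> (Suc n)))" for n
    proof -
      have "1 - q ^ Suc n = (1 - q) * (\<Sum>i<Suc n. q ^ i)" by (rule one_diff_power_eq)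
      also have "\<dots> \<le> (1 - q) * (\<Sum>i<Suc n. 1)" using q q1 by (intro mult_left_mono sum_mono) auto
      finally have 1: "1 - q ^ Suc n \<le> (1 - q) * real (Suc n)" by simp
      have cm: "bcoef \<omega> n \<le> bcoef \<omega> (Suc n)" using rw by (intro bcoef_mono) auto
      \<comment> \<open>Product rule for differences. The increment of the coefficient is multiplied
        by \<open>1 - q ^ Suc n\<close>, at most \<open>(1 - q) * Suc n\<close>, and
        \<open>bcoef_diff\<close> absorbs the factor \<open>Suc n\<close>.\<close>
      have eq: "a (Suc n) - s * a n = s ^ Suc n * ((bcoef \<omega> (Suc n) - bcoef \<omega> n) * (1 - q ^ Suc n) + bcoef \<omega> n * (q ^ n * (1 - q)))"
        by (simp add: a_def algebra_simps)
      have nn: "0 \<le> (bcoef \<omega> (Suc n) - bcoef \<omega> n) * (1 - q ^ Suc n) + bcoef \<omega> n * (q ^ n * (1 - q))"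
        using cm cpos[of n] q q1[of "Suc n"] by (intro add_nonneg_nonneg mult_nonneg_nonneg) auto
      have "(bcoef \<omega> (Suc n) - bcoef \<omega> n) * (1 - q ^ Suc n) \<le> (bcoef \<omega> (Suc n) - bcoef \<omega> n) * ((1 - q) * real (Suc n))"
        using 1 cm by (intro mult_left_mono) auto
      also have "\<dots> = (1 - q) * (real (Suc n) * (bcoef \<omega> (Suc n) - bcoef \<omega> n))" by simp
      also have "\<dots> \<le> (1 - q) * (C1 * bcoef \<omega> (Suc n))" using q C1 by (intro mult_left_mono) auto
      finally have 2: "(bcoef \<omega> (Suc n) - bcoef \<omega> n) * (1 - q ^ Suc n) \<le> (1 - q) * (C1 * bcoef \<omega> (Suc n))" .
      have "q ^ n * (1 - q) \<le> 1 * (1 - q)" using q q1[of n] by (intro mult_right_mono) auto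
      then have 3: "bcoef \<omega> n * (q ^ n * (1 - q)) \<le> bcoef \<omega> (Suc n) * (1 - q)"
        using cm cpos[of n] cpos[of "Suc n"] q by (intro mult_mono) auto
      have "(bcoef \<omega> (Suc n) - bcoef \<omega> n) * (1 - q ^ Suc n) + bcoef \<omega> n * (q ^ n * (1 - q)) \<le> (1 - q) * ((C1 + 1) * bcoef \<omega> (Suc n))"
        using 2 3 by (simp add: algebra_simps)
      then show ?thesis unfolding eq using nn s by (simp add: abs_mult)
    qed
    define B where "B = (1 - s) * (D / (tail \<omega> s)\<^sup>2)"
    have Bsum: "(cmod (complex_of_real (a 0)))\<^sup>2 + (\<Sum>n<N. (cmod (complex_of_real (a (Suc n)) - of_real s * of_real (a n)))\<^sup>2) \<le> B" for N
    proof -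
      have "(cmod (complex_of_real (a (Suc n)) - of_real s * of_real (a n)))\<^sup>2 \<le> ((1 - s)\<^sup>2 * (D / (tail \<omega> s)\<^sup>2)) * s ^ n" for n
      proof -
        \<comment> \<open>One factor \<open>sqrt s ^ Suc n\<close> bounds the coefficient by
          \<open>C2 / tail \<omega> s\<close>; the other becomes \<open>s ^ Suc n\<close> after
          squaring and makes the sum over \<open>n\<close> converge.\<close>
        have "s ^ Suc n * bcoef \<omega> (Suc n) = (bcoef \<omega> (Suc n) * sqrt s ^ Suc n) * sqrt s ^ Suc n"
          using s by (simp add: power_mult_distrib[symmetric] mult_ac)
        also have "\<dots> \<le> (C2 / tail \<omega> s) * sqrt s ^ Suc n"
          using C2(2)[of s "Suc n"] s by (intro mult_right_mono) auto
        finally have c: "s ^ Suc n * bcoef \<omega> (Suc n) \<le> (C2 / tail \<omega> s) * sqrt s ^ Suc n" .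
        have "cmod (complex_of_real (a (Suc n)) - of_real s * of_real (a n)) = \<bar>a (Suc n) - s * a n\<bar>"
          by (metis norm_of_real of_real_diff of_real_mult)
        also have "\<dots> \<le> (1 - q) * ((C1 + 1) * (s ^ Suc n * bcoef \<omega> (Suc n)))"
          using step[of n] by (simp add: mult_ac)
        also have "\<dots> \<le> (K * (1 - s)) * ((C1 + 1) * ((C2 / tail \<omega> s) * sqrt s ^ Suc n))"
        proof (rule mult_mono[OF q(3) mult_left_mono[OF c]])
          have "0 \<le> s ^ Suc n * bcoef \<omega> (Suc n)" using s cpos[of "Suc n"] by simp
          then show "0 \<le> (C1 + 1) * (s ^ Suc n * bcoef \<omega> (Suc n))" using C1(1) by simp
        qed (use C1(1) s assms(2) in auto)
        also have "\<dots> = (1 - s) * (K * (C1 + 1) * C2) / tail \<omega> s * sqrt s ^ Suc n" by simp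
        finally have "(cmod (complex_of_real (a (Suc n)) - of_real s * of_real (a n)))\<^sup>2 \<le> ((1 - s) * (K * (C1 + 1) * C2) / tail \<omega> s * sqrt s ^ Suc n)\<^sup>2"
          by (intro power_mono) auto
        also have "\<dots> = ((1 - s)\<^sup>2 * (D / (tail \<omega> s)\<^sup>2)) * s ^ Suc n"
        proof -
          have "(sqrt s ^ Suc n)\<^sup>2 = s ^ Suc n" using s by (simp only: power_mult[symmetric] mult.commute[of _ 2]) (simp add: power_mult)
          then show ?thesis by (simp only: power_mult_distrib power_divide D_def times_divide_eq_left times_divide_eq_right)
        qed
        also have "\<dots> \<le> ((1 - s)\<^sup>2 * (D / (tail \<omega> s)\<^sup>2)) * s ^ n"
          using s by (intro mult_left_mono power_decreasing) (auto simp: D_def)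
        finally show ?thesis .
      qed
      then have "(\<Sum>n<N. (cmod (complex_of_real (a (Suc n)) - of_real s * of_real (a n)))\<^sup>2) \<le> (\<Sum>n<N. ((1 - s)\<^sup>2 * (D / (tail \<omega> s)\<^sup>2)) * s ^ n)"
        by (rule sum_mono)
      also have "\<dots> = ((1 - s)\<^sup>2 * (D / (tail \<omega> s)\<^sup>2)) * (\<Sum>n<N. s ^ n)" by (simp add: sum_distrib_left)
      also have "\<dots> \<le> ((1 - s)\<^sup>2 * (D / (tail \<omega> s)\<^sup>2)) * (1 / (1 - s))"
      proof (intro mult_left_mono)
        have "(\<Sum>n<N. s ^ n) \<le> (\<Sum>n. s ^ n)" using s by (intro sum_le_suminf) auto
        then show "(\<Sum>n<N. s ^ n) \<le> 1 / (1 - s)" using s by (simp add: suminf_geometric)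
      qed (auto simp: D_def)
      also have "\<dots> = B" using s by (simp add: B_def power2_eq_square)
      finally show ?thesis by (simp add: a_def)
    qed
    \<comment> \<open>This weight balances the two terms of \<open>circle_mean_le\<close>: both
      become constants over \<open>tail \<omega> s\<close>.\<close>
    define l where "l = tail \<omega> s / (1 - s)"
    have l: "l > 0" using tp s by (simp add: l_def)
    have bk: "cmod (bker \<omega> (cis \<theta> * of_real s) - bker \<omega> (of_real q * (cis \<theta> * of_real s)))
        = cmod (\<Sum>n. complex_of_real (a n) * cis \<theta> ^ n)" for \<theta>
    proof -
      have "q * s \<le> 1 * s" using q s by (intro mult_right_mono) auto
      then have "q * s < 1" using s by linarith
      then have qs: "cmod (of_real q * (cis \<theta> * of_real s)) < 1" using q s by (simp add: norm_mult)
      have "bker \<omega> (cis \<theta> * of_real s) - bker \<omega> (of_real q * (cis \<theta> * of_real s))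
        = (\<Sum>n. complex_of_real (bcoef \<omega> n) * (cis \<theta> * of_real s) ^ n - complex_of_real (bcoef \<omega> n) * (of_real q * (cis \<theta> * of_real s)) ^ n)"
        unfolding bker_def using s qs
        by (intro suminf_diff summable_norm_cancel[OF bker_summable_norm] assms) (auto simp: norm_mult)
      also have "\<dots> = (\<Sum>n. complex_of_real (a n) * cis \<theta> ^ n)"
        by (simp add: a_def power_mult_distrib algebra_simps)
      finally show ?thesis by simp
    qed
    have "circ (\<lambda>u. ennreal (cmod (bker \<omega> u - bker \<omega> (of_real q * u)))) (of_real s)
      = (\<integral>\<^sup>+\<theta>\<in>{0..<2*pi}. ennreal (cmod (\<Sum>n. complex_of_real (a n) * cis \<theta> ^ n)) \<partial>lborel)"
      unfolding circ_def bk ..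
    also have "\<dots> \<le> ennreal (pi * (l * B + 1 / (l * (1 - (cmod (complex_of_real s))\<^sup>2))))"
      using sa a0 s l Bsum by (intro circle_mean_le) auto
    also have "\<dots> \<le> ennreal (pi * (D + 1) / tail \<omega> s)"
    proof (intro ennreal_leI)
      have "l * B = D / tail \<omega> s" using s tp by (simp add: l_def B_def power2_eq_square)
      moreover have "1 / (l * (1 - (cmod (complex_of_real s))\<^sup>2)) \<le> 1 / tail \<omega> s"
      proof -
        have "tail \<omega> s \<le> tail \<omega> s * (1 + s)" using s tp by simp
        also have "\<dots> = l * (1 - s\<^sup>2)" using s by (simp add: l_def field_simps power2_eq_square)
        finally show ?thesis using tp s by (intro divide_left_mono) (auto simp: zero_less_mult_iff l abs_square_less_1)
      qed
      ultimately have "l * B + 1 / (l * (1 - (cmod (complex_of_real s))\<^sup>2)) \<le> (D + 1) / tail \<omega> s"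
        by (simp add: add_divide_distrib)
      then show "pi * (l * B + 1 / (l * (1 - (cmod (complex_of_real s))\<^sup>2))) \<le> pi * (D + 1) / tail \<omega> s"
        by (metis mult_left_mono pi_ge_zero times_divide_eq_right)
    qed
    finally show ?thesis .
  qed
  moreover have "pi * (D + 1) > 0" by (simp add: D_def add_nonneg_pos)
  ultimately show ?thesis using that by blast
qed

text \<open>Compares the circle at \<open>s\<close> with the one at
  \<open>r = 1 - K * (1 - s)\<close>. The increment costs \<open>C / tail \<omega> s\<close>, and by
  geometric decay \<open>A / tail \<omega> r\<close> is at most
  \<open>A / (C0 * tail \<omega> s)\<close>, so a constant with \<open>C + A / C0 \<le> A\<close> is
  reproduced by the induction.\<close>

lemma circ_bker_upper:
  assumes "\<omega> \<in> class_D"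
  obtains A where "A > 0" "\<And>x. 0 \<le> x \<Longrightarrow> x < 1 \<Longrightarrow> circ (\<lambda>u. ennreal (cmod (bker \<omega> u))) (of_real x) \<le> ennreal (A / tail \<omega> x)"
proof -
  have Dh: "\<omega> \<in> class_Dhat" using assms by (simp add: class_D_def)
  note rw = Dhat_radial[OF Dh]
  obtain K C0 where K: "K > 1" "C0 > 1" "\<And>r. 0 \<le> r \<Longrightarrow> r < 1 \<Longrightarrow> tail \<omega> r \<ge> C0 * tail \<omega> (1 - (1 - r) / K)"
    using assms by (auto simp: class_D_def class_Dcheck_def)
  obtain C where C: "C > 0" "\<And>s q. 1/2 \<le> s \<Longrightarrow> s < 1 \<Longrightarrow> 0 \<le> q \<Longrightarrow> q \<le> 1 \<Longrightarrow> 1 - q \<le> 2 * K * (1 - s) \<Longrightarrow>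
      circ (\<lambda>u. ennreal (cmod (bker \<omega> u - bker \<omega> (of_real q * u)))) (of_real s) \<le> ennreal (C / tail \<omega> s)"
    using circ_bker_increment[OF Dh, of "2 * K"] K(1) by auto
  \<comment> \<open>Beyond \<open>s0\<close> the previous circle satisfies
    \<open>1/2 \<le> r\<close>, so that \<open>q = r / s\<close> obeys
    \<open>1 - q \<le> 2 * K * (1 - s)\<close>, as the choice of \<open>C\<close> demands.\<close>
  define s0 where "s0 = 1 - 1 / (2 * K)"
  have s0: "1/2 \<le> s0" "s0 < 1" using K(1) by (auto simp: s0_def field_simps)
  define B0 where "B0 = (\<Sum>n. bcoef \<omega> n * s0 ^ n)"
  have t0: "tail \<omega> 0 > 0" using tail_pos[OF rw] by auto
  \<comment> \<open>The first entry serves the circles up to \<open>s0\<close>, where the kernel is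
    bounded by \<open>B0\<close>; the second is the solution of
    \<open>A = C + A / C0\<close>.\<close>
  define A where "A = max (2 * pi * B0 * tail \<omega> 0) (C * C0 / (C0 - 1))"
  have Apos: "A > 0" using K C(1) by (auto simp: A_def less_max_iff_disj)
  have base: "circ (\<lambda>u. ennreal (cmod (bker \<omega> u))) (of_real s) \<le> ennreal (A / tail \<omega> s)" if s: "0 \<le> s" "s \<le> s0" for s
  proof -
    have s1: "s < 1" using s s0 by simp
    have ts: "0 < tail \<omega> s" "tail \<omega> s \<le> tail \<omega> 0" using tail_pos[OF rw] tail_antimono[OF rw, of 0 s] s s1 by auto
    have "circ (\<lambda>u. ennreal (cmod (bker \<omega> u))) (of_real s) \<le> (\<integral>\<^sup>+\<theta>. ennreal B0 * indicator {0..<2*pi} \<theta> \<partial>lborel)"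
      unfolding circ_def B0_def using s s0 Dh
      by (intro nn_integral_mono mult_right_mono ennreal_leI norm_bker_le) (auto simp: norm_mult)
    also have "\<dots> = ennreal (2 * pi * B0)" 
      by (subst nn_integral_cmult) (auto simp: ennreal_mult''[symmetric] mult.commute)
    also have "\<dots> \<le> ennreal (A / tail \<omega> s)"
    proof (intro ennreal_leI)
      have B0: "B0 \<ge> 0" unfolding B0_def using s0 bcoef_pos[OF rw] Dh
        by (intro suminf_nonneg bcoef_summable) (auto intro: less_imp_le)
      have "2 * pi * B0 * tail \<omega> s \<le> 2 * pi * B0 * tail \<omega> 0" using ts B0 by (intro mult_left_mono) auto
      also have "\<dots> \<le> A" by (simp add: A_def)
      finally show "2 * pi * B0 \<le> A / tail \<omega> s" using ts by (simp add: field_simps)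
    qed
    finally show ?thesis .
  qed
  have ind: "\<forall>s. 0 \<le> s \<and> s \<le> 1 - 1 / K ^ k \<longrightarrow> circ (\<lambda>u. ennreal (cmod (bker \<omega> u))) (of_real s) \<le> ennreal (A / tail \<omega> s)" for k
  proof (induction k)
    case 0
    then show ?case using base s0 by auto
  next
    case (Suc k)
    show ?case
    proof (intro allI impI, elim conjE)
      fix s assume s: "0 \<le> s" "s \<le> 1 - 1 / K ^ Suc k"
      show "circ (\<lambda>u. ennreal (cmod (bker \<omega> u))) (of_real s) \<le> ennreal (A / tail \<omega> s)"
      proof (cases "s \<le> s0")
        case True
        then show ?thesis using base s by simp
      next
        case False
        have "1 / K ^ Suc k > 0" using K(1) by simp
        then have s1: "s < 1" using s by linarith
        have ts: "0 < tail \<omega> s" using tail_pos[OF rw] s s1 by auto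
        define r where "r = 1 - K * (1 - s)"
        have "K * (1 - s) \<le> K * (1 / (2 * K))" using False K(1) by (intro mult_left_mono) (auto simp: s0_def)
        then have r1: "1/2 \<le> r" using K(1) by (simp add: r_def)
        have "1 * (1 - s) \<le> K * (1 - s)" using K(1) s1 by (intro mult_right_mono) auto
        then have r2: "r \<le> s" by (simp add: r_def)
        have "K * (1 / K ^ Suc k) \<le> K * (1 - s)" using s K(1) by (intro mult_left_mono) auto
        then have r3: "r \<le> 1 - 1 / K ^ k" using K(1) by (simp add: r_def)
        have r4: "r < 1" using r2 s1 by simp
        have tr: "C0 * tail \<omega> s \<le> tail \<omega> r" using K(3)[of r] r1 r4 K(1) by (simp add: r_def)
        define q where "q = r / s"
        have q: "0 \<le> q" "q \<le> 1" using r1 r2 s s0 False by (auto simp: q_def)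
        have qs: "q * s = r" using r1 r2 by (simp add: q_def)
        have "1 - q = (s - r) / s" using r1 r2 by (simp add: q_def field_simps)
        also have "\<dots> \<le> (s - r) / (1/2)" using r1 r2 by (intro divide_left_mono) auto
        also have "\<dots> \<le> 2 * K * (1 - s)" using s1 by (simp add: r_def)
        finally have q3: "1 - q \<le> 2 * K * (1 - s)" .
        have "circ (\<lambda>u. ennreal (cmod (bker \<omega> u))) (of_real s) \<le>
          circ (\<lambda>u. ennreal (cmod (bker \<omega> u - bker \<omega> (of_real q * u))) + ennreal (cmod (bker \<omega> (of_real q * u)))) (of_real s)"
          unfolding circ_def
          by (intro nn_integral_mono mult_right_mono)
             (auto simp: ennreal_plus[symmetric] add.commute intro!: ennreal_leI norm_triangle_sub simp del: ennreal_plus)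
        also have "\<dots> = circ (\<lambda>u. ennreal (cmod (bker \<omega> u - bker \<omega> (of_real q * u)))) (of_real s)
          + circ (\<lambda>u. ennreal (cmod (bker \<omega> (of_real q * u)))) (of_real s)"
          unfolding circ_def distrib_right by (rule nn_integral_add) measurable
        also have "circ (\<lambda>u. ennreal (cmod (bker \<omega> (of_real q * u)))) (of_real s) = circ (\<lambda>u. ennreal (cmod (bker \<omega> u))) (of_real r)"
          unfolding circ_def qs[symmetric] by (simp add: mult_ac)
        also have "circ (\<lambda>u. ennreal (cmod (bker \<omega> u - bker \<omega> (of_real q * u)))) (of_real s) + circ (\<lambda>u. ennreal (cmod (bker \<omega> u))) (of_real r)
          \<le> ennreal (C / tail \<omega> s) + ennreal (A / tail \<omega> r)"
          using Suc r1 r3 q q3 s1 r2 by (intro add_mono C(2)) auto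
        also have "\<dots> = ennreal (C / tail \<omega> s + A / tail \<omega> r)"
          using C(1) Apos ts tail_pos[OF rw, of r] r1 r4 by (subst ennreal_plus) auto
        also have "\<dots> \<le> ennreal (A / tail \<omega> s)"
        proof (intro ennreal_leI)
          have "A / tail \<omega> r \<le> A / (C0 * tail \<omega> s)"
            using tr Apos K(2) ts tail_pos[OF rw, of r] r1 r4 by (intro divide_left_mono mult_pos_pos) auto
          then have "C / tail \<omega> s + A / tail \<omega> r \<le> (C + A / C0) / tail \<omega> s"
            using K(2) by (simp add: add_divide_distrib)
          also have "C + A / C0 \<le> A"
          proof -
            have "C * C0 / (C0 - 1) \<le> A" by (simp add: A_def)
            then show ?thesis using K(2) by (simp add: field_simps)
          qed
          then have "(C + A / C0) / tail \<omega> s \<le> A / tail \<omega> s" using ts by (intro divide_right_mono) auto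
          finally show "C / tail \<omega> s + A / tail \<omega> r \<le> A / tail \<omega> s" .
        qed
        finally show ?thesis .
      qed
    qed
  qed
  have "circ (\<lambda>u. ennreal (cmod (bker \<omega> u))) (of_real x) \<le> ennreal (A / tail \<omega> x)" if x: "0 \<le> x" "x < 1" for x
  proof -
    obtain k where "1 / (1 - x) < K ^ k" using real_arch_pow[OF K(1)] by auto
    then have "1 / K ^ k \<le> 1 - x" using x K(1) by (simp add: field_simps)
    then show ?thesis using ind[of k] x by auto
  qed
  then show ?thesis using that Apos by blast
qed

section \<open>Powers and Hoelder's inequality for extended nonnegative reals\<close>

lemma epowr_ennreal: "ennreal x epowr a = ennreal (x powr a)" if "0 \<le> x"
  using that by (simp add: epowr_def)

lemma epowr_top [simp]: "top epowr a = top"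
  by (simp add: epowr_def)

lemma epowr_zero [simp]: "0 epowr a = 0"
  by (simp add: epowr_def)

lemma epowr_eq_top_iff [simp]: "x epowr a = top \<longleftrightarrow> x = top"
  by (simp add: epowr_def)

lemma epowr_less_top_iff [simp]: "x epowr a < top \<longleftrightarrow> x < top"
  by (simp add: less_top[symmetric])

lemma epowr_eq_0_iff [simp]: "x epowr a = 0 \<longleftrightarrow> x = 0"
  by (auto simp: epowr_def enn2real_eq_0_iff ennreal_eq_zero_iff)

lemma epowr_measurable [measurable]:
  assumes [measurable]: "f \<in> borel_measurable M"
  shows "(\<lambda>x. f x epowr a) \<in> borel_measurable M"
  unfolding epowr_def by measurable

lemma epowr_mono: "x \<le> y \<Longrightarrow> 0 \<le> a \<Longrightarrow> x epowr a \<le> y epowr a"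
  by (cases x; cases y) (auto simp: epowr_ennreal ennreal_le_iff powr_mono2 top_unique)

lemma epowr_epowr: "(x epowr a) epowr b = x epowr (a * b)"
  by (cases x) (auto simp: epowr_ennreal powr_powr)

lemma epowr_one [simp]: "x epowr 1 = x"
  by (cases x) (auto simp: epowr_ennreal)

lemma epowr_mult: "0 < a \<Longrightarrow> (ennreal c * x) epowr a = ennreal (c powr a) * x epowr a" if "0 \<le> c"
  using that by (cases x; cases "c = 0") (auto simp: epowr_ennreal ennreal_mult[symmetric] powr_mult ennreal_mult_top)

lemma conj_exponent_props:
  assumes "1 < p"
  shows "1 < conj_exponent p" "1 / p + 1 / conj_exponent p = 1"
    "conj_exponent p / p = conj_exponent p - 1" "p / conj_exponent p = p - 1"
  using assms by (auto simp: conj_exponent_def field_simps)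

text \<open>Takes real bounds in place of the norms themselves; a zero bound forces the product to
  vanish almost everywhere. Otherwise it is Young's inequality for \<open>f / A\<close> and
  \<open>g / B\<close>, multiplied by \<open>A * B\<close> and integrated.\<close>

lemma holder_nn_integral:
  fixes f g :: "'a \<Rightarrow> ennreal"
  assumes p: "1 < p" and q: "q = conj_exponent p"
    and [measurable]: "f \<in> borel_measurable M" "g \<in> borel_measurable M"
    and A: "0 \<le> A" "(\<integral>\<^sup>+x. f x epowr p \<partial>M) \<le> ennreal (A powr p)"
    and B: "0 \<le> B" "(\<integral>\<^sup>+x. g x epowr q \<partial>M) \<le> ennreal (B powr q)"
  shows "(\<integral>\<^sup>+x. f x * g x \<partial>M) \<le> ennreal (A * B)"
proof -
  note pq = conj_exponent_props[OF p, folded q]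
  have z: "(\<integral>\<^sup>+x. f x * g x \<partial>M) = 0" if "A = 0 \<or> B = 0"
  proof -
    have "(AE x in M. f x epowr p = 0) \<or> (AE x in M. g x epowr q = 0)"
      using that A(2) B(2) by (subst (1 2) nn_integral_0_iff_AE[symmetric]) auto
    then have "AE x in M. f x * g x = 0" by (auto elim!: eventually_mono)
    then show ?thesis by (subst nn_integral_0_iff_AE) auto
  qed
  show ?thesis
  proof (cases "A = 0 \<or> B = 0")
    case False
    then have AB: "A > 0" "B > 0" using A B by auto
    define c d where "c = A * B / (p * A powr p)" and "d = A * B / (q * B powr q)"
    have cd: "c > 0" "d > 0" using AB p pq by (auto simp: c_def d_def)
    have "(\<integral>\<^sup>+x. f x * g x \<partial>M) \<le> (\<integral>\<^sup>+x. ennreal c * f x epowr p + ennreal d * g x epowr q \<partial>M)"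
    proof (intro nn_integral_mono)
      fix x
      show "f x * g x \<le> ennreal c * f x epowr p + ennreal d * g x epowr q"
      proof (cases "f x = top \<or> g x = top")
        case True
        then show ?thesis using cd by (auto simp: ennreal_mult_top)
      next
        case False
        then obtain a b where ab: "f x = ennreal a" "a \<ge> 0" "g x = ennreal b" "b \<ge> 0"
          by (cases "f x"; cases "g x") auto
        have "(a / A) * (b / B) \<le> (a / A) powr p / p + (b / B) powr q / q"
          using p pq ab AB by (intro Youngs_inequality) auto
        then have "A * B * ((a / A) * (b / B)) \<le> A * B * ((a / A) powr p / p + (b / B) powr q / q)"
          using AB by (intro mult_left_mono) auto
        also have "\<dots> = c * a powr p + d * b powr q"
          using AB ab by (simp add: c_def d_def powr_divide algebra_simps)
        also have "A * B * ((a / A) * (b / B)) = a * b" using AB by simp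
        finally have "a * b \<le> c * a powr p + d * b powr q" .
        then show ?thesis using ab cd
          by (simp add: epowr_ennreal ennreal_mult[symmetric] ennreal_plus[symmetric] ennreal_leI del: ennreal_plus)
      qed
    qed
    also have "\<dots> = ennreal c * (\<integral>\<^sup>+x. f x epowr p \<partial>M) + ennreal d * (\<integral>\<^sup>+x. g x epowr q \<partial>M)"
      by (simp add: nn_integral_add nn_integral_cmult)
    also have "\<dots> \<le> ennreal c * ennreal (A powr p) + ennreal d * ennreal (B powr q)"
      using A B by (intro add_mono mult_left_mono) auto
    also have "\<dots> = ennreal (c * A powr p + d * B powr q)"
      using cd by (simp add: ennreal_mult[symmetric] ennreal_plus[symmetric] del: ennreal_plus)
    also have "c * A powr p + d * B powr q = A * B * (1 / p + 1 / q)"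
      using AB p pq(1) by (simp add: c_def d_def distrib_left)
    also have "\<dots> = A * B" using pq by simp
    finally show ?thesis .
  qed (use z in auto)
qed

section \<open>Geometric decay and dyadic summation\<close>

text \<open>The point occurring in \<open>class_Dcheck\<close>: the distance to the boundary is
  divided by \<open>K\<close>, so iteration multiplies the parameters.\<close>

definition shrink :: "real \<Rightarrow> real \<Rightarrow> real" where
  "shrink K r = 1 - (1 - r) / K"

lemma shrink_bounds:
  assumes "1 < K" "r < 1"
  shows "r < shrink K r" "shrink K r < 1"
proof -
  have "(1 - r) / K < (1 - r) / 1" using assms by (intro divide_strict_left_mono) auto
  then show "r < shrink K r" by (simp add: shrink_def)
  show "shrink K r < 1" using assms by (simp add: shrink_def)
qed

text \<open>Iteration turns a decay factor below 1 into an arbitrarily small one at the price of a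
  larger \<open>K\<close>; monotonicity of \<open>T\<close> extends the result to all larger
  parameters.\<close>

lemma decay_iterate:
  fixes T :: "real \<Rightarrow> real"
  assumes K: "1 < K" and th: "\<theta> < 1"
    and dec: "\<And>r. 0 \<le> r \<Longrightarrow> r < 1 \<Longrightarrow> T (shrink K r) \<le> \<theta> * T r"
    and mono: "\<And>r s. 0 \<le> r \<Longrightarrow> r \<le> s \<Longrightarrow> s < 1 \<Longrightarrow> T s \<le> T r"
    and pos: "\<And>r. 0 \<le> r \<Longrightarrow> r < 1 \<Longrightarrow> 0 < T r"
    and e: "0 < e"
  obtains K0 where "1 < K0" "\<And>L r. K0 \<le> L \<Longrightarrow> 0 \<le> r \<Longrightarrow> r < 1 \<Longrightarrow> T (shrink L r) \<le> e * T r"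
proof -
  have th0: "0 < \<theta>"
  proof -
    have "0 < T (shrink K 0)" using K by (intro pos) (auto simp: shrink_def field_simps)
    then have "0 < \<theta> * T 0" using dec[of 0] by simp
    then show ?thesis using pos[of 0] by (simp add: zero_less_mult_iff)
  qed
  have it: "T (shrink (K ^ k) r) \<le> \<theta> ^ k * T r" if r: "0 \<le> r" "r < 1" for k r
  proof (induction k)
    case (Suc k)
    let ?s = "shrink (K ^ k) r"
    have "0 < (1 - r) / K ^ k" "(1 - r) / K ^ k \<le> 1"
    proof -
      have "1 \<le> K ^ k" using K by (simp add: one_le_power)
      then have "0 < K ^ k" "1 - r \<le> K ^ k" using r by linarith+
      then show "0 < (1 - r) / K ^ k" "(1 - r) / K ^ k \<le> 1" using r by (auto simp: divide_le_eq)
    qed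
    then have s: "0 \<le> ?s" "?s < 1" by (auto simp: shrink_def)
    have "shrink (K ^ Suc k) r = shrink K ?s" by (simp add: shrink_def)
    then have "T (shrink (K ^ Suc k) r) \<le> \<theta> * T ?s" using dec[OF s] by simp
    also have "\<dots> \<le> \<theta> * (\<theta> ^ k * T r)" using Suc th0 by (intro mult_left_mono) auto
    finally show ?case by simp
  qed (simp add: shrink_def)
  obtain k where k: "\<theta> ^ k < e" using real_arch_pow_inv[OF e th] by auto
  \<comment> \<open>The exponent \<open>Suc k\<close> ensures that the threshold exceeds 1 also when
    \<open>k = 0\<close>.\<close>
  have "T (shrink L r) \<le> e * T r" if L: "K ^ Suc k \<le> L" and r: "0 \<le> r" "r < 1" for L r
  proof -
    have "K ^ k \<le> K ^ Suc k" using K by (intro power_increasing) auto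
    then have "K ^ k \<le> L" using L by simp
    moreover have "1 \<le> K ^ k" using K by (simp add: one_le_power)
    ultimately have l: "0 < K ^ k" "0 < L" "K ^ k \<le> L" "1 - r \<le> K ^ k" using r by linarith+
    then have "(1 - r) / L \<le> (1 - r) / K ^ k" using r by (intro divide_left_mono) auto
    with l have sh: "0 \<le> shrink (K ^ k) r" "shrink (K ^ k) r \<le> shrink L r" "shrink L r < 1"
      using r by (auto simp: shrink_def divide_le_eq)
    have "T (shrink L r) \<le> T (shrink (K ^ k) r)" using sh by (intro mono) auto
    also have "\<dots> \<le> \<theta> ^ k * T r" using it r by auto
    also have "\<dots> \<le> e * T r" using k pos[of r] r by (intro mult_right_mono) auto
    finally show ?thesis .
  qed
  moreover have "1 < K ^ Suc k" using K by (intro one_less_power) auto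
  ultimately show ?thesis using that by blast
qed

lemma split_integral:
  fixes f :: "real \<Rightarrow> ennreal"
  assumes m: "(\<lambda>t. f t * indicator {0..<1} t) \<in> borel_measurable lebesgue" and "0 \<le> a" "a \<le> b" "b \<le> c" "c \<le> 1"
  shows "(\<integral>\<^sup>+t\<in>{a..<c}. f t \<partial>lebesgue) = (\<integral>\<^sup>+t\<in>{a..<b}. f t \<partial>lebesgue) + (\<integral>\<^sup>+t\<in>{b..<c}. f t \<partial>lebesgue)"
proof -
  have m': "(\<lambda>t. f t * indicator {x..<y} t) \<in> borel_measurable lebesgue" if "0 \<le> x" "y \<le> 1" for x y
  proof -
    have "(\<lambda>t. f t * indicator {0..<1} t * indicator {x..<y} t) \<in> borel_measurable lebesgue"
      by (intro borel_measurable_times_ennreal m borel_measurable_indicator) auto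
    also have "(\<lambda>t. f t * indicator {0..<1} t * indicator {x..<y} t) = (\<lambda>t. f t * indicator {x..<y} t)"
      using that by (auto simp: indicator_def)
    finally show ?thesis .
  qed
  have "(\<integral>\<^sup>+t\<in>{a..<c}. f t \<partial>lebesgue) = (\<integral>\<^sup>+t. f t * indicator {a..<b} t + f t * indicator {b..<c} t \<partial>lebesgue)"
    using assms by (intro nn_integral_cong) (auto simp: indicator_def)
  also have "\<dots> = (\<integral>\<^sup>+t\<in>{a..<b}. f t \<partial>lebesgue) + (\<integral>\<^sup>+t\<in>{b..<c}. f t \<partial>lebesgue)"
    using assms by (intro nn_integral_add m') auto
  finally show ?thesis .
qed

text \<open>The block bounds \<open>C / G r\<close> grow geometrically towards the boundary, so the
  integral up to \<open>s\<close> is controlled by its last block.\<close>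

lemma dyadic_sum_below:
  fixes f :: "real \<Rightarrow> ennreal" and G :: "real \<Rightarrow> real"
  assumes m: "(\<lambda>t. f t * indicator {0..<1} t) \<in> borel_measurable lebesgue"
    and K: "1 < K" and th: "\<theta> < 1" "0 \<le> C"
    and block: "\<And>r. 0 \<le> r \<Longrightarrow> r < 1 \<Longrightarrow> (\<integral>\<^sup>+t\<in>{r..<shrink K r}. f t \<partial>lebesgue) \<le> ennreal (C / G r)"
    and dec: "\<And>r. 0 \<le> r \<Longrightarrow> r < 1 \<Longrightarrow> G (shrink K r) \<le> \<theta> * G r"
    and mono: "\<And>r s. 0 \<le> r \<Longrightarrow> r \<le> s \<Longrightarrow> s < 1 \<Longrightarrow> G s \<le> G r"
    and pos: "\<And>r. 0 \<le> r \<Longrightarrow> r < 1 \<Longrightarrow> 0 < G r"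
  obtains B where "0 < B" "\<And>s. 0 \<le> s \<Longrightarrow> s < 1 \<Longrightarrow> (\<integral>\<^sup>+t\<in>{0..<s}. f t \<partial>lebesgue) \<le> ennreal (B / G s)"
proof -
  have th0: "0 < \<theta>"
  proof -
    have "0 < G (shrink K 0)" using K by (intro pos) (auto simp: shrink_def field_simps)
    then have "0 < \<theta> * G 0" using dec[of 0] by simp
    then show ?thesis using pos[of 0] by (simp add: zero_less_mult_iff)
  qed
  \<comment> \<open>Any \<open>B\<close> with \<open>\<theta> * (B + C) \<le> B\<close> survives the
    induction step, which the last entry ensures; the others give positivity and the first
    block.\<close>
  define B where "B = max 1 (max C (\<theta> * C / (1 - \<theta>)))"
  have B: "1 \<le> B" "C \<le> B" "\<theta> * (B + C) \<le> B"
  proof -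
    have "\<theta> * C / (1 - \<theta>) \<le> B" by (simp add: B_def)
    then have "\<theta> * C \<le> B * (1 - \<theta>)" using th by (simp add: field_simps)
    then show "\<theta> * (B + C) \<le> B" by (simp add: algebra_simps)
  qed (auto simp: B_def)
  have base: "(\<integral>\<^sup>+t\<in>{0..<s}. f t \<partial>lebesgue) \<le> ennreal (B / G s)" if s: "0 \<le> s" "s \<le> 1 - 1 / K" for s
  proof -
    have s1: "s < 1" using s K by (smt (verit) divide_pos_pos)
    have "(\<integral>\<^sup>+t\<in>{0..<s}. f t \<partial>lebesgue) \<le> (\<integral>\<^sup>+t\<in>{0..<shrink K 0}. f t \<partial>lebesgue)"
      using s by (intro nn_integral_mono) (auto simp: indicator_def shrink_def)
    also have "\<dots> \<le> ennreal (C / G 0)" by (rule block) auto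
    also have "\<dots> \<le> ennreal (B / G s)"
      using mono[of 0 s] pos[of s] pos[of 0] B s s1 th by (intro ennreal_leI frac_le) auto
    finally show ?thesis .
  qed
  have ind: "\<forall>s. 0 \<le> s \<and> s \<le> 1 - 1 / K ^ k \<longrightarrow> (\<integral>\<^sup>+t\<in>{0..<s}. f t \<partial>lebesgue) \<le> ennreal (B / G s)" for k
  proof (induction k)
    case 0
    then show ?case using base K by auto
  next
    case (Suc k)
    show ?case
    proof (intro allI impI, elim conjE)
      fix s assume s: "0 \<le> s" "s \<le> 1 - 1 / K ^ Suc k"
      show "(\<integral>\<^sup>+t\<in>{0..<s}. f t \<partial>lebesgue) \<le> ennreal (B / G s)"
      proof (cases "s \<le> 1 - 1 / K")
        case False
        have "1 / K ^ Suc k > 0" using K by simp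
        then have s1: "s < 1" using s by linarith
        define r where "r = 1 - K * (1 - s)"
        have sr: "shrink K r = s" using K by (simp add: shrink_def r_def)
        have "K * (1 - s) \<le> K * (1 / K)" using False K by (intro mult_left_mono) auto
        then have r1: "0 \<le> r" using K by (simp add: r_def)
        have "1 * (1 - s) \<le> K * (1 - s)" using K s1 by (intro mult_right_mono) auto
        then have r2: "r \<le> s" by (simp add: r_def)
        have "K * (1 / K ^ Suc k) \<le> K * (1 - s)" using s K by (intro mult_left_mono) auto
        then have r3: "r \<le> 1 - 1 / K ^ k" using K by (simp add: r_def)
        have r4: "r < 1" using r2 s1 by simp
        have "(\<integral>\<^sup>+t\<in>{0..<s}. f t \<partial>lebesgue) = (\<integral>\<^sup>+t\<in>{0..<r}. f t \<partial>lebesgue) + (\<integral>\<^sup>+t\<in>{r..<s}. f t \<partial>lebesgue)"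
          using r1 r2 s1 by (intro split_integral m) auto
        also have "\<dots> \<le> ennreal (B / G r) + ennreal (C / G r)"
          using Suc r1 r3 block[OF r1 r4] sr by (intro add_mono) auto
        also have "\<dots> = ennreal ((B + C) / G r)"
          using B th pos[OF r1 r4] by (simp add: ennreal_plus[symmetric] add_divide_distrib del: ennreal_plus)
        also have "\<dots> \<le> ennreal (B / G s)"
        proof (intro ennreal_leI)
          have "(B + C) * G s \<le> (B + C) * (\<theta> * G r)"
            using dec[OF r1 r4] sr B th by (intro mult_left_mono) auto
          also have "\<dots> = (\<theta> * (B + C)) * G r" by simp
          also have "\<dots> \<le> B * G r" using B pos[OF r1 r4] by (intro mult_right_mono) auto
          finally show "(B + C) / G r \<le> B / G s"
            using pos[OF r1 r4] pos[OF s(1) s1] by (simp add: field_simps)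
        qed
        finally show ?thesis .
      qed (use base s in auto)
    qed
  qed
  have "(\<integral>\<^sup>+t\<in>{0..<x}. f t \<partial>lebesgue) \<le> ennreal (B / G x)" if x: "0 \<le> x" "x < 1" for x
  proof -
    obtain k where "1 / (1 - x) < K ^ k" using real_arch_pow[OF K] by auto
    then have "1 / K ^ k \<le> 1 - x" using x K by (simp add: field_simps)
    then show ?thesis using ind[of k] x by auto
  qed
  then show ?thesis using that[of B] B by auto
qed

text \<open>Here the block bounds \<open>C * G r\<close> decrease geometrically, so the first block
  dominates. Finite unions of blocks are summed by induction and exhaust \<open>{s..<1}\<close> by
  monotone convergence.\<close>

lemma dyadic_sum_above:
  fixes f :: "real \<Rightarrow> ennreal" and G :: "real \<Rightarrow> real"
  assumes m: "(\<lambda>t. f t * indicator {0..<1} t) \<in> borel_measurable lebesgue"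
    and K: "1 < K" and th: "\<theta> < 1" "0 \<le> C"
    and block: "\<And>r. 0 \<le> r \<Longrightarrow> r < 1 \<Longrightarrow> (\<integral>\<^sup>+t\<in>{r..<shrink K r}. f t \<partial>lebesgue) \<le> ennreal (C * G r)"
    and dec: "\<And>r. 0 \<le> r \<Longrightarrow> r < 1 \<Longrightarrow> G (shrink K r) \<le> \<theta> * G r"
    and pos: "\<And>r. 0 \<le> r \<Longrightarrow> r < 1 \<Longrightarrow> 0 < G r"
  obtains B where "0 < B" "\<And>s. 0 \<le> s \<Longrightarrow> s < 1 \<Longrightarrow> (\<integral>\<^sup>+t\<in>{s..<1}. f t \<partial>lebesgue) \<le> ennreal (B * G s)"
proof -
  \<comment> \<open>\<open>C / (1 - \<theta>)\<close> solves \<open>B = C + \<theta> * B\<close>;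
    adding 1 keeps \<open>B\<close> positive when \<open>C = 0\<close>.\<close>
  define B where "B = C / (1 - \<theta>) + 1"
  have B: "C + \<theta> * B \<le> B" "0 < B"
  proof -
    have "C / (1 - \<theta>) * (1 - \<theta>) = C" using th by simp
    then have "B * (1 - \<theta>) = C + (1 - \<theta>)" by (simp only: B_def distrib_right mult_1)
    then show "C + \<theta> * B \<le> B" using th by (simp add: algebra_simps)
    show "0 < B" using th by (auto simp: B_def intro!: add_nonneg_pos divide_nonneg_pos)
  qed
  have fin: "(\<integral>\<^sup>+t\<in>{s..<shrink (K ^ k) s}. f t \<partial>lebesgue) \<le> ennreal (B * G s)" if s: "0 \<le> s" "s < 1" for s k
    using s
  proof (induction k arbitrary: s)
    case 0
    then show ?case by (simp add: shrink_def)
  next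
    case (Suc k)
    let ?r = "shrink K s"
    have r: "s < ?r" "?r < 1" using shrink_bounds[OF K] Suc by auto
    have eq: "shrink (K ^ Suc k) s = shrink (K ^ k) ?r" by (simp add: shrink_def mult_ac)
    have "(1 - ?r) / K ^ k \<le> 1 - ?r" using r K one_le_power[of K k] by (simp add: divide_le_eq)
    then have r2: "?r \<le> shrink (K ^ k) ?r" by (simp add: shrink_def)
    have "0 < (1 - ?r) / K ^ k" using r K by simp
    then have r3: "shrink (K ^ k) ?r < 1" by (simp add: shrink_def)
    have "(\<integral>\<^sup>+t\<in>{s..<shrink (K ^ Suc k) s}. f t \<partial>lebesgue)
      = (\<integral>\<^sup>+t\<in>{s..<?r}. f t \<partial>lebesgue) + (\<integral>\<^sup>+t\<in>{?r..<shrink (K ^ k) ?r}. f t \<partial>lebesgue)"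
      unfolding eq using Suc r r2 r3 by (intro split_integral m) auto
    also have "\<dots> \<le> ennreal (C * G s) + ennreal (B * G ?r)"
      using Suc r by (intro add_mono block) auto
    also have "\<dots> = ennreal (C * G s + B * G ?r)"
      using th B pos[of s] pos[of ?r] Suc r by (simp add: ennreal_plus[symmetric] del: ennreal_plus)
    also have "\<dots> \<le> ennreal (B * G s)"
    proof (intro ennreal_leI)
      have "B * G ?r \<le> B * (\<theta> * G s)" using dec[of s] Suc B by (intro mult_left_mono) auto
      then have "C * G s + B * G ?r \<le> (C + \<theta> * B) * G s" by (simp add: algebra_simps)
      also have "\<dots> \<le> B * G s" using B pos[of s] Suc by (intro mult_right_mono) auto
      finally show "C * G s + B * G ?r \<le> B * G s" .
    qed
    finally show ?case .
  qed
  have "(\<integral>\<^sup>+t\<in>{s..<1}. f t \<partial>lebesgue) \<le> ennreal (B * G s)" if s: "0 \<le> s" "s < 1" for s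
  proof -
    have K1: "1 \<le> K ^ k" for k using K by (simp add: one_le_power)
    have sup: "(SUP k. f t * indicator {s..<shrink (K ^ k) s} t) = f t * indicator {s..<1} t" for t
    proof (cases "s \<le> t \<and> t < 1")
      case True
      obtain k where k: "(1 - s) / (1 - t) < K ^ k" using real_arch_pow[OF K] by auto
      have "0 < K ^ k" using K1[of k] by linarith
      then have "(1 - s) / K ^ k < 1 - t" using k True by (simp add: divide_less_eq mult.commute)
      then have t: "t < shrink (K ^ k) s" by (simp add: shrink_def)
      show ?thesis
      proof (rule antisym)
        show "(SUP k. f t * indicator {s..<shrink (K ^ k) s} t) \<le> f t * indicator {s..<1} t"
          using True by (intro SUP_least) (auto simp: indicator_def)
        show "f t * indicator {s..<1} t \<le> (SUP k. f t * indicator {s..<shrink (K ^ k) s} t)"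
          using True t by (intro SUP_upper2[of k]) (auto simp: indicator_def)
      qed
    next
      case False
      have "shrink (K ^ k) s \<le> 1" for k using s K1[of k] by (simp add: shrink_def)
      then have "t \<notin> {s..<shrink (K ^ k) s}" for k using False less_le_trans[of t "shrink (K ^ k) s" 1] by auto
      then have a: "indicator {s..<shrink (K ^ k) s} t = (0::ennreal)" for k by (simp add: indicator_def)
      have b: "indicator {s..<1} t = (0::ennreal)" using False by (auto simp: indicator_def)
      show ?thesis unfolding a b by simp
    qed
    have sh: "shrink (K ^ k) s \<le> shrink (K ^ l) s" if "k \<le> l" for k l
      using s K1 that K by (auto simp: shrink_def intro!: divide_left_mono power_increasing mult_pos_pos)
    have "(\<integral>\<^sup>+t\<in>{s..<1}. f t \<partial>lebesgue) = (\<integral>\<^sup>+t. (SUP k. f t * indicator {s..<shrink (K ^ k) s} t) \<partial>lebesgue)"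
      unfolding sup ..
    also have "\<dots> = (SUP k. (\<integral>\<^sup>+t. f t * indicator {s..<shrink (K ^ k) s} t \<partial>lebesgue))"
    proof (rule nn_integral_monotone_convergence_SUP)
      show "incseq (\<lambda>k t. f t * indicator {s..<shrink (K ^ k) s} t)"
        using sh by (auto simp: incseq_def le_fun_def indicator_def intro: less_le_trans)
      fix k
      have "(\<lambda>t. f t * indicator {0..<1} t * indicator {s..<shrink (K ^ k) s} t) \<in> borel_measurable lebesgue"
        by (intro borel_measurable_times_ennreal m borel_measurable_indicator) auto
      also have "(\<lambda>t. f t * indicator {0..<1} t * indicator {s..<shrink (K ^ k) s} t) = (\<lambda>t. f t * indicator {s..<shrink (K ^ k) s} t)"
      proof -
        have "shrink (K ^ k) s \<le> 1" using s K1[of k] by (simp add: shrink_def)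
        then show ?thesis using s by (auto simp: indicator_def fun_eq_iff)
      qed
      finally show "(\<lambda>t. f t * indicator {s..<shrink (K ^ k) s} t) \<in> borel_measurable lebesgue" .
    qed
    also have "\<dots> \<le> ennreal (B * G s)" using fin[OF s] by (intro SUP_least)
    finally show ?thesis .
  qed
  then show ?thesis using that B by blast
qed


text \<open>With \<open>X\<^sup>q\<close> a tail of \<open>m\<close>, the weight \<open>X\<^sup>1\<^sup>-\<^sup>q\<close> makes both the part below and
  the part above \<open>s\<close> into geometric sums dominated by their terms at \<open>s\<close>.\<close>

lemma schur_radial:
  fixes m :: "real \<Rightarrow> ennreal" and X Y :: "real \<Rightarrow> real"
  assumes m: "(\<lambda>t. m t * indicator {0..<1} t) \<in> borel_measurable lebesgue"
    and mX: "(\<lambda>t. X t * indicator {0..<1} t) \<in> borel_measurable lebesgue"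
    and mY: "(\<lambda>t. Y t * indicator {0..<1} t) \<in> borel_measurable lebesgue"
    and K: "1 < K" and th: "\<theta> < 1" and q: "1 < q"
    and Xdec: "\<And>r. 0 \<le> r \<Longrightarrow> r < 1 \<Longrightarrow> X (shrink K r) \<le> \<theta> * X r"
    and Ydec: "\<And>r. 0 \<le> r \<Longrightarrow> r < 1 \<Longrightarrow> Y (shrink K r) \<le> \<theta> * Y r"
    and Xdb: "\<And>r. 0 \<le> r \<Longrightarrow> r < 1 \<Longrightarrow> X r \<le> D * X (shrink K r)"
    and Ydb: "\<And>r. 0 \<le> r \<Longrightarrow> r < 1 \<Longrightarrow> Y r \<le> D * Y (shrink K r)"
    and Xmono: "\<And>r s. 0 \<le> r \<Longrightarrow> r \<le> s \<Longrightarrow> s < 1 \<Longrightarrow> X s \<le> X r"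
    and Ymono: "\<And>r s. 0 \<le> r \<Longrightarrow> r \<le> s \<Longrightarrow> s < 1 \<Longrightarrow> Y s \<le> Y r"
    and Xpos: "\<And>r. 0 \<le> r \<Longrightarrow> r < 1 \<Longrightarrow> 0 < X r"
    and Ypos: "\<And>r. 0 \<le> r \<Longrightarrow> r < 1 \<Longrightarrow> 0 < Y r"
    and mass: "\<And>r. 0 \<le> r \<Longrightarrow> r < 1 \<Longrightarrow> (\<integral>\<^sup>+t\<in>{r..<1}. m t \<partial>lebesgue) \<le> ennreal (X r powr q)"
  obtains B where "0 < B" "\<And>s. 0 \<le> s \<Longrightarrow> s < 1 \<Longrightarrow>
    (\<integral>\<^sup>+t\<in>{0..<1}. m t * ennreal (X t powr (1 - q)) * ennreal (1 / (X (min s t) * Y (min s t))) \<partial>lebesgue) \<le> ennreal (B / Y s)"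
proof -
  have D: "0 < D"
    using Xdb[of 0] Xpos[of 0] Xpos[of "shrink K 0"] shrink_bounds[OF K, of 0] by (auto simp: zero_less_mult_iff dest: less_le_trans)
  define f where "f t = m t * ennreal (X t powr (1 - q))" for t
  define g where "g t = f t * ennreal (1 / (X t * Y t))" for t
  have mf: "(\<lambda>t. f t * indicator {0..<1} t) \<in> borel_measurable lebesgue"
  proof -
    have "(\<lambda>t. ennreal ((X t * indicator {0..<1} t) powr (1 - q))) \<in> borel_measurable lebesgue"
      by (rule measurable_compose[OF mX]) measurable
    from borel_measurable_times_ennreal[OF m this]
    have "(\<lambda>t. (m t * indicator {0..<1} t) * ennreal ((X t * indicator {0..<1} t) powr (1 - q))) \<in> borel_measurable lebesgue" .
    also have "(\<lambda>t. (m t * indicator {0..<1} t) * ennreal ((X t * indicator {0..<1} t) powr (1 - q))) = (\<lambda>t. f t * indicator {0..<1} t)"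
      by (auto simp: f_def indicator_def)
    finally show ?thesis .
  qed
  have mg: "(\<lambda>t. g t * indicator {0..<1} t) \<in> borel_measurable lebesgue"
  proof -
    have "(\<lambda>t. ennreal (1 / ((X t * indicator {0..<1} t) * (Y t * indicator {0..<1} t)))) \<in> borel_measurable lebesgue"
      by (rule measurable_compose[OF borel_measurable_times[OF mX mY]]) measurable
    from borel_measurable_times_ennreal[OF mf this]
    have "(\<lambda>t. (f t * indicator {0..<1} t) * ennreal (1 / ((X t * indicator {0..<1} t) * (Y t * indicator {0..<1} t)))) \<in> borel_measurable lebesgue" .
    also have "(\<lambda>t. (f t * indicator {0..<1} t) * ennreal (1 / ((X t * indicator {0..<1} t) * (Y t * indicator {0..<1} t)))) = (\<lambda>t. g t * indicator {0..<1} t)"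
      by (auto simp: g_def indicator_def)
    finally show ?thesis .
  qed
  \<comment> \<open>Doubling makes \<open>X\<close> constant on a block up to the factor
    \<open>D\<close>, and a mass of at most \<open>X r powr q\<close> weighted by
    \<open>X r powr (1 - q)\<close> leaves \<open>X r\<close>.\<close>
  have fblock: "(\<integral>\<^sup>+t\<in>{r..<shrink K r}. f t \<partial>lebesgue) \<le> ennreal (D powr (q - 1) * X r)" if r: "0 \<le> r" "r < 1" for r
  proof -
    let ?s = "shrink K r"
    have s: "r < ?s" "?s < 1" using shrink_bounds[OF K r(2)] by auto
    have pw: "X t powr (1 - q) \<le> D powr (q - 1) * X r powr (1 - q)" if "r \<le> t" "t < ?s" for t
    proof -
      have t: "0 \<le> t" "t < 1" using that r s by auto
      have "X r \<le> D * X ?s" using Xdb r by auto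
      also have "\<dots> \<le> D * X t" using D Xmono[of t ?s] that r s by (intro mult_left_mono) auto
      finally have "X r / D \<le> X t" using D by (simp add: field_simps)
      then have "X t powr (1 - q) \<le> (X r / D) powr (1 - q)" using Xpos[OF r] D q by (intro powr_mono2') auto
      also have "\<dots> = D powr (q - 1) * X r powr (1 - q)"
        using Xpos[OF r] D powr_minus_divide[of D "q - 1"] by (simp add: powr_divide)
      finally show ?thesis .
    qed
    have "(\<integral>\<^sup>+t\<in>{r..<?s}. f t \<partial>lebesgue) \<le> (\<integral>\<^sup>+t. ennreal (D powr (q - 1) * X r powr (1 - q)) * ((m t * indicator {0..<1} t) * indicator {r..<1} t) \<partial>lebesgue)"
      using pw r s by (intro nn_integral_mono) (auto simp: f_def indicator_def mult.commute intro!: mult_left_mono ennreal_leI)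
    also have "\<dots> = ennreal (D powr (q - 1) * X r powr (1 - q)) * (\<integral>\<^sup>+t. (m t * indicator {0..<1} t) * indicator {r..<1} t \<partial>lebesgue)"
      by (intro nn_integral_cmult borel_measurable_times_ennreal m borel_measurable_indicator) auto
    also have "(\<integral>\<^sup>+t. (m t * indicator {0..<1} t) * indicator {r..<1} t \<partial>lebesgue) = (\<integral>\<^sup>+t\<in>{r..<1}. m t \<partial>lebesgue)"
      using r by (intro nn_integral_cong) (auto simp: indicator_def)
    also have "ennreal (D powr (q - 1) * X r powr (1 - q)) * \<dots> \<le> ennreal (D powr (q - 1) * X r powr (1 - q)) * ennreal (X r powr q)"
      using mass[OF r] by (rule mult_left_mono) simp
    also have "\<dots> = ennreal (D powr (q - 1) * X r)"
      using Xpos[OF r] by (simp add: ennreal_mult[symmetric] mult.assoc powr_add[symmetric])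
    finally show ?thesis .
  qed
  \<comment> \<open>Division by \<open>X * Y\<close>, again constant on the block up to factors
    \<open>D\<close>, leaves \<open>1 / Y r\<close>, which grows towards the boundary.\<close>
  have gblock: "(\<integral>\<^sup>+t\<in>{r..<shrink K r}. g t \<partial>lebesgue) \<le> ennreal ((D powr (q - 1) * D * D) / Y r)" if r: "0 \<le> r" "r < 1" for r
  proof -
    let ?s = "shrink K r"
    have s: "r < ?s" "?s < 1" using shrink_bounds[OF K r(2)] by auto
    have pw: "1 / (X t * Y t) \<le> D * D / (X r * Y r)" if "r \<le> t" "t < ?s" for t
    proof -
      have t: "0 \<le> t" "t < 1" using that r s by auto
      have "X r \<le> D * X ?s" using Xdb r by auto
      also have "\<dots> \<le> D * X t" using D Xmono[of t ?s] that r s by (intro mult_left_mono) auto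
      finally have x: "X r \<le> D * X t" .
      have "Y r \<le> D * Y ?s" using Ydb r by auto
      also have "\<dots> \<le> D * Y t" using D Ymono[of t ?s] that r s by (intro mult_left_mono) auto
      finally have y: "Y r \<le> D * Y t" .
      have "X r * Y r \<le> (D * X t) * (D * Y t)" using x y Xpos[OF r] Ypos[OF r] D Xpos[OF t] by (intro mult_mono) auto
      then show ?thesis using Xpos[OF r] Ypos[OF r] Xpos[OF t] Ypos[OF t] by (simp add: divide_simps mult_ac)
    qed
    have "(\<integral>\<^sup>+t\<in>{r..<?s}. g t \<partial>lebesgue) \<le> (\<integral>\<^sup>+t. ennreal (D * D / (X r * Y r)) * ((f t * indicator {0..<1} t) * indicator {r..<?s} t) \<partial>lebesgue)"
      using pw r s by (intro nn_integral_mono) (auto simp: g_def indicator_def mult.commute intro!: mult_left_mono ennreal_leI)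
    also have "\<dots> = ennreal (D * D / (X r * Y r)) * (\<integral>\<^sup>+t. (f t * indicator {0..<1} t) * indicator {r..<?s} t \<partial>lebesgue)"
      by (intro nn_integral_cmult borel_measurable_times_ennreal mf borel_measurable_indicator) auto
    also have "(\<integral>\<^sup>+t. (f t * indicator {0..<1} t) * indicator {r..<?s} t \<partial>lebesgue) = (\<integral>\<^sup>+t\<in>{r..<?s}. f t \<partial>lebesgue)"
      using r s by (intro nn_integral_cong) (auto simp: indicator_def)
    also have "ennreal (D * D / (X r * Y r)) * \<dots> \<le> ennreal (D * D / (X r * Y r)) * ennreal (D powr (q - 1) * X r)"
      using fblock[OF r] by (rule mult_left_mono) simp
    also have "\<dots> = ennreal ((D powr (q - 1) * D * D) / Y r)"
      using Xpos[OF r] Ypos[OF r] D by (simp add: ennreal_mult[symmetric])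
    finally show ?thesis .
  qed
  obtain B1 where B1: "0 < B1" "\<And>s. 0 \<le> s \<Longrightarrow> s < 1 \<Longrightarrow> (\<integral>\<^sup>+t\<in>{0..<s}. g t \<partial>lebesgue) \<le> ennreal (B1 / Y s)"
    using dyadic_sum_below[OF mg K th _ gblock Ydec Ymono Ypos] D by auto
  obtain B2 where B2: "0 < B2" "\<And>s. 0 \<le> s \<Longrightarrow> s < 1 \<Longrightarrow> (\<integral>\<^sup>+t\<in>{s..<1}. f t \<partial>lebesgue) \<le> ennreal (B2 * X s)"
    using dyadic_sum_above[OF mf K th _ fblock Xdec Xpos] D by auto
  have "(\<integral>\<^sup>+t\<in>{0..<1}. m t * ennreal (X t powr (1 - q)) * ennreal (1 / (X (min s t) * Y (min s t))) \<partial>lebesgue)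
     \<le> ennreal ((B1 + B2) / Y s)" if s: "0 \<le> s" "s < 1" for s
  proof -
    \<comment> \<open>The minimum splits the integral at \<open>s\<close>: below \<open>s\<close>
      the kernel varies with \<open>t\<close>, above it the kernel is frozen at
      \<open>s\<close>.\<close>
    have "(\<integral>\<^sup>+t\<in>{0..<1}. m t * ennreal (X t powr (1 - q)) * ennreal (1 / (X (min s t) * Y (min s t))) \<partial>lebesgue)
      = (\<integral>\<^sup>+t. (g t * indicator {0..<1} t) * indicator {0..<s} t + ennreal (1 / (X s * Y s)) * ((f t * indicator {0..<1} t) * indicator {s..<1} t) \<partial>lebesgue)"
      using s by (intro nn_integral_cong) (auto simp: indicator_def f_def g_def min_def mult_ac)
    also have "\<dots> = (\<integral>\<^sup>+t. (g t * indicator {0..<1} t) * indicator {0..<s} t \<partial>lebesgue)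
        + ennreal (1 / (X s * Y s)) * (\<integral>\<^sup>+t. (f t * indicator {0..<1} t) * indicator {s..<1} t \<partial>lebesgue)"
    proof (subst nn_integral_add)
      show "(\<lambda>t. g t * indicator {0..<1} t * indicator {0..<s} t) \<in> borel_measurable lebesgue"
        by (intro borel_measurable_times_ennreal mg borel_measurable_indicator) auto
      have i: "(\<lambda>t. f t * indicator {0..<1} t * indicator {s..<1} t) \<in> borel_measurable lebesgue"
        by (intro borel_measurable_times_ennreal mf borel_measurable_indicator) auto
      then show "(\<lambda>t. ennreal (1 / (X s * Y s)) * (f t * indicator {0..<1} t * indicator {s..<1} t)) \<in> borel_measurable lebesgue"
        by (intro borel_measurable_times_ennreal[OF borel_measurable_const])
    qed (intro arg_cong2[where f="(+)"] refl nn_integral_cmult borel_measurable_times_ennreal mf borel_measurable_indicator, auto)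
    also have "(\<integral>\<^sup>+t. (g t * indicator {0..<1} t) * indicator {0..<s} t \<partial>lebesgue) = (\<integral>\<^sup>+t\<in>{0..<s}. g t \<partial>lebesgue)"
      using s by (intro nn_integral_cong) (auto simp: indicator_def)
    also have "(\<integral>\<^sup>+t. (f t * indicator {0..<1} t) * indicator {s..<1} t \<partial>lebesgue) = (\<integral>\<^sup>+t\<in>{s..<1}. f t \<partial>lebesgue)"
      using s by (intro nn_integral_cong) (auto simp: indicator_def)
    also have "(\<integral>\<^sup>+t\<in>{0..<s}. g t \<partial>lebesgue) + ennreal (1 / (X s * Y s)) * (\<integral>\<^sup>+t\<in>{s..<1}. f t \<partial>lebesgue)
      \<le> ennreal (B1 / Y s) + ennreal (1 / (X s * Y s)) * ennreal (B2 * X s)"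
      using B1 B2 s by (intro add_mono mult_left_mono) auto
    also have "\<dots> = ennreal ((B1 + B2) / Y s)"
      using B1(1) B2(1) Xpos[OF s] Ypos[OF s]
      by (simp add: ennreal_mult[symmetric] ennreal_plus[symmetric] add_divide_distrib del: ennreal_plus)
    finally show ?thesis .
  qed
  then show ?thesis using that[of "B1 + B2"] B1(1) B2(1) by auto
qed

section \<open>Two weights\<close>

lemma restrict_measurable:
  fixes h :: "real \<Rightarrow> ennreal"
  assumes m: "(\<lambda>t. h t * indicator {0..<1} t) \<in> borel_measurable lebesgue" and "0 \<le> a" "b \<le> 1"
  shows "(\<lambda>t. h t * indicator {a..<b} t) \<in> borel_measurable lebesgue"
proof -
  have "(\<lambda>t. h t * indicator {0..<1} t * indicator {a..<b} t) \<in> borel_measurable lebesgue"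
    by (intro borel_measurable_times_ennreal m borel_measurable_indicator) auto
  also have "(\<lambda>t. h t * indicator {0..<1} t * indicator {a..<b} t) = (\<lambda>t. h t * indicator {a..<b} t)"
    using assms by (auto simp: indicator_def)
  finally show ?thesis .
qed

text \<open>The definition grants some factor below 1; later arguments need a prescribed one that
  beats given comparison constants.\<close>

lemma Dcheck_decay:
  assumes "\<omega> \<in> class_Dcheck" "0 < e"
  obtains K0 where "1 < K0" "\<And>L r. K0 \<le> L \<Longrightarrow> 0 \<le> r \<Longrightarrow> r < 1 \<Longrightarrow> tail \<omega> (shrink L r) \<le> e * tail \<omega> r"
proof -
  have rw: "radial_weight \<omega>" using assms by (simp add: class_Dcheck_def)
  obtain K C where K: "K > 1" "C > 1" "\<And>r. 0 \<le> r \<Longrightarrow> r < 1 \<Longrightarrow> tail \<omega> r \<ge> C * tail \<omega> (1 - (1 - r) / K)"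
    using assms by (auto simp: class_Dcheck_def)
  have "tail \<omega> (shrink K r) \<le> 1 / C * tail \<omega> r" if "0 \<le> r" "r < 1" for r
    using K(3)[OF that] K(2) by (simp add: shrink_def field_simps)
  moreover have "1 / C < 1" using K(2) by simp
  ultimately show ?thesis
    using decay_iterate[of K "1 / C" "tail \<omega>" e] K(1) tail_antimono[OF rw] tail_pos[OF rw] assms(2) that by blast
qed

lemma DcheckI:
  assumes "radial_weight \<omega>" "1 < K" "\<theta> < 1" "\<And>r. 0 \<le> r \<Longrightarrow> r < 1 \<Longrightarrow> tail \<omega> (shrink K r) \<le> \<theta> * tail \<omega> r"
  shows "\<omega> \<in> class_Dcheck"
proof -
  \<comment> \<open>The constant in \<open>class_Dcheck\<close> is the reciprocal of the decay
    factor, which must therefore be kept away from 0.\<close>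
  define t where "t = max \<theta> (1/2)"
  have t: "0 < t" "t < 1" using assms by (auto simp: t_def)
  have le: "(1 / t) * tail \<omega> (1 - (1 - r) / K) \<le> tail \<omega> r" if r: "0 \<le> r" "r < 1" for r
  proof -
    have "tail \<omega> (shrink K r) \<le> \<theta> * tail \<omega> r" using assms(4) r by auto
    also have "\<dots> \<le> t * tail \<omega> r" using tail_pos[OF assms(1) r] by (intro mult_right_mono) (auto simp: t_def)
    finally show ?thesis using t by (simp add: shrink_def field_simps)
  qed
  show ?thesis
    unfolding class_Dcheck_def using assms(1,2) t le
    by (intro CollectI conjI exI[of _ K] exI[of _ "1 / t"] ballI) auto
qed

text \<open>For doubling weights \<open>moment \<omega> x\<close> and
  \<open>tail \<omega> (1 - 1 / x)\<close> are comparable, and multiplying \<open>x\<close> by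
  \<open>K\<close> corresponds to \<open>shrink K\<close>. Passing from one to the other and back
  loses \<open>A * B\<close>, so the decay is first amplified until it beats
  \<open>2 * A * B\<close>.\<close>

lemma Dhat_M_iff_Dcheck:
  assumes "\<omega> \<in> class_Dhat"
  shows "\<omega> \<in> class_M \<longleftrightarrow> \<omega> \<in> class_Dcheck"
proof -
  note rw = Dhat_radial[OF assms]
  obtain A where A: "A > 0" "\<And>x. x \<ge> 1 \<Longrightarrow> moment \<omega> x \<le> A * tail \<omega> (1 - 1 / x)"
    using moment_le_tail[OF assms] by auto
  obtain B where B: "B > 0" "\<And>x. x \<ge> 1 \<Longrightarrow> tail \<omega> (1 - 1 / x) \<le> B * moment \<omega> x"
    using tail_le_moment_Dhat[OF assms] by auto
  show ?thesis
  proof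
    assume "\<omega> \<in> class_M"
    then obtain C K where CK: "C > 1" "K > 1" "\<And>x. x \<ge> 1 \<Longrightarrow> moment \<omega> x \<ge> C * moment \<omega> (K * x)"
      by (auto simp: class_M_def)
    have it: "C ^ k * moment \<omega> (K ^ k * x) \<le> moment \<omega> x" if "x \<ge> 1" for k x
    proof (induction k)
      case (Suc k)
      have "1 * 1 \<le> K ^ k * x" using CK(2) that by (intro mult_mono) (auto simp: one_le_power)
      then have "C * moment \<omega> (K * (K ^ k * x)) \<le> moment \<omega> (K ^ k * x)" by (intro CK(3)) auto
      then have "C ^ k * (C * moment \<omega> (K * (K ^ k * x))) \<le> C ^ k * moment \<omega> (K ^ k * x)"
        using CK(1) by (intro mult_left_mono) auto
      with Suc show ?case by (simp add: mult_ac)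
    qed simp
    obtain k where k: "2 * A * B < C ^ k" using real_arch_pow[OF CK(1)] by auto
    have "C ^ k \<le> C ^ Suc k" using CK(1) by (intro power_increasing) auto
    then have k': "2 * A * B < C ^ Suc k" using k by linarith
    show "\<omega> \<in> class_Dcheck"
    proof (rule DcheckI[OF rw, of "K ^ Suc k" "1/2"])
      show "1 < K ^ Suc k" using CK(2) by (intro one_less_power) auto
      fix r :: real assume r: "0 \<le> r" "r < 1"
      define x where "x = 1 / (1 - r)"
      have x: "x \<ge> 1" "1 - 1 / x = r" using r by (auto simp: x_def field_simps)
      have "1 * 1 \<le> K ^ Suc k * x" using CK(2) x by (intro mult_mono one_le_power) auto
      then have Kx: "K ^ Suc k * x \<ge> 1" by simp
      have sh: "shrink (K ^ Suc k) r = 1 - 1 / (K ^ Suc k * x)" using r by (simp add: shrink_def x_def)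
      have "(2 * A * B) * tail \<omega> (shrink (K ^ Suc k) r) \<le> (2 * A * B) * (B * moment \<omega> (K ^ Suc k * x))"
        unfolding sh using A(1) B(1) B(2)[OF Kx] by (intro mult_left_mono) auto
      also have "\<dots> \<le> C ^ Suc k * (B * moment \<omega> (K ^ Suc k * x))"
        using k' B(1) moment_pos[OF rw, of "K ^ Suc k * x"] Kx by (intro mult_right_mono) auto
      also have "\<dots> = B * (C ^ Suc k * moment \<omega> (K ^ Suc k * x))" by simp
      also have "\<dots> \<le> B * moment \<omega> x" using it[OF x(1), of "Suc k"] B(1) by (intro mult_left_mono) auto
      also have "\<dots> \<le> B * (A * tail \<omega> r)" using A(2)[OF x(1)] x B(1) by (intro mult_left_mono) auto
      finally have "(A * B) * (2 * tail \<omega> (shrink (K ^ Suc k) r)) \<le> (A * B) * tail \<omega> r" by (simp add: mult_ac)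
      then show "tail \<omega> (shrink (K ^ Suc k) r) \<le> 1 / 2 * tail \<omega> r" using A(1) B(1) by simp
    qed simp
  next
    assume d: "\<omega> \<in> class_Dcheck"
    have e: "0 < 1 / (2 * A * B)" using A(1) B(1) by simp
    obtain K where K: "1 < K" "\<And>L r. K \<le> L \<Longrightarrow> 0 \<le> r \<Longrightarrow> r < 1 \<Longrightarrow> tail \<omega> (shrink L r) \<le> 1 / (2 * A * B) * tail \<omega> r"
      using Dcheck_decay[OF d e] by blast
    have "moment \<omega> x \<ge> 2 * moment \<omega> (K * x)" if x: "x \<ge> 1" for x
    proof -
      have "1 * 1 \<le> K * x" using K(1) x by (intro mult_mono) auto
      then have "moment \<omega> (K * x) \<le> A * tail \<omega> (1 - 1 / (K * x))" by (intro A(2)) simp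
      also have "1 - 1 / (K * x) = shrink K (1 - 1 / x)" using x by (simp add: shrink_def)
      also have "A * tail \<omega> (shrink K (1 - 1 / x)) \<le> A * (1 / (2 * A * B) * tail \<omega> (1 - 1 / x))"
        using K(2)[of K "1 - 1/x"] x A(1) by (intro mult_left_mono) auto
      also have "\<dots> \<le> A * (1 / (2 * A * B) * (B * moment \<omega> x))"
        using B(2)[OF x] A(1) B(1) by (intro mult_left_mono) auto
      also have "\<dots> = moment \<omega> x / 2" using A(1) B(1) by simp
      finally show ?thesis by simp
    qed
    moreover have "(2::real) > 1" by simp
    ultimately show "\<omega> \<in> class_M" using rw K(1) unfolding class_M_def by blast
  qed
qed

section \<open>The dual weight \<open>\<sigma>\<close> and Hoelder's inequality between
  tails\<close>

locale two_weights =
  fixes p :: real and \<omega> \<nu> :: "real \<Rightarrow> real"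
  assumes p: "1 < p" and rw: "radial_weight \<omega>" and rn: "radial_weight \<nu>"
begin

abbreviation q :: real where "q \<equiv> conj_exponent p"

lemma q: "1 < q" "1 / p + 1 / q = 1" "q / p = q - 1" "p / q = p - 1"
  using conj_exponent_props[OF p] by auto

lemma weight_measurable_real:
  assumes "radial_weight w"
  shows "(\<lambda>t. w t * indicator {0..<1} t) \<in> borel_measurable lebesgue"
proof -
  have "(\<lambda>t. indicator {0..<1} t *\<^sub>R w t) \<in> borel_measurable lebesgue"
    using assms by (auto simp: radial_weight_def set_integrable_def)
  then show ?thesis by (simp add: mult.commute)
qed

lemma ratio_measurable:
  "(\<lambda>t. ennreal (\<omega> t) / ennreal (\<nu> t powr (1 / p)) * indicator {0..<1} t) \<in> borel_measurable lebesgue"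
proof -
  have "(\<lambda>t. ennreal ((\<nu> t * indicator {0..<1} t) powr (1 / p))) \<in> borel_measurable lebesgue"
    by (rule measurable_compose[OF weight_measurable_real[OF rn]]) measurable
  from borel_measurable_divide_ennreal[OF radial_weight_measurable[OF rw] this]
  have "(\<lambda>t. ennreal (\<omega> t) * indicator {0..<1} t / ennreal ((\<nu> t * indicator {0..<1} t) powr (1 / p))) \<in> borel_measurable lebesgue" .
  also have "(\<lambda>t. ennreal (\<omega> t) * indicator {0..<1} t / ennreal ((\<nu> t * indicator {0..<1} t) powr (1 / p)))
     = (\<lambda>t. ennreal (\<omega> t) / ennreal (\<nu> t powr (1 / p)) * indicator {0..<1} t)"
    by (auto simp: indicator_def)
  finally show ?thesis .
qed

lemma sigma_measurable: "(\<lambda>t. sigma_weight p \<omega> \<nu> t * indicator {0..<1} t) \<in> borel_measurable lebesgue"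
proof -
  have i: "(\<lambda>t. ennreal t) \<in> borel_measurable lebesgue" by (intro measurable_completion) measurable
  have "(\<lambda>t. ennreal t * (ennreal (\<omega> t) / ennreal (\<nu> t powr (1 / p)) * indicator {0..<1} t) epowr q) \<in> borel_measurable lebesgue"
    by (intro borel_measurable_times_ennreal i epowr_measurable ratio_measurable)
  also have "(\<lambda>t. ennreal t * (ennreal (\<omega> t) / ennreal (\<nu> t powr (1 / p)) * indicator {0..<1} t) epowr q)
     = (\<lambda>t. sigma_weight p \<omega> \<nu> t * indicator {0..<1} t)"
    by (auto simp: indicator_def sigma_weight_def)
  finally show ?thesis .
qed

text \<open>Real-valued tail of \<open>\<sigma>\<close>. Since \<open>enn2real\<close> sends
  infinity to 0, it carries information only under the assumption of
  \<open>two_weights_fin\<close>.\<close>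

definition sg :: "real \<Rightarrow> real" where
  "sg r = enn2real (sigma_tail p \<omega> \<nu> r)"

text \<open>\<open>fN\<close> and \<open>fE\<close> are the two factors in the numerator of
  \<open>A_const\<close>; they serve as the functions \<open>X\<close> and \<open>Y\<close> of
  \<open>schur_radial\<close>.\<close>

definition fN :: "real \<Rightarrow> real" where "fN r = tail \<nu> r powr (1 / p)"
definition fE :: "real \<Rightarrow> real" where "fE r = sg r powr (1 / q)"

end

locale two_weights_fin = two_weights +
  assumes sf: "sigma_tail p \<omega> \<nu> 0 < \<infinity>"
begin

lemma sigma_tail_mono: "0 \<le> r \<Longrightarrow> r \<le> s \<Longrightarrow> sigma_tail p \<omega> \<nu> s \<le> sigma_tail p \<omega> \<nu> r"
  unfolding sigma_tail_def by (intro nn_integral_mono) (auto simp: indicator_def)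

lemma ennreal_sg: "0 \<le> r \<Longrightarrow> ennreal (sg r) = sigma_tail p \<omega> \<nu> r"
  unfolding sg_def using sigma_tail_mono[of 0 r] sf
  by (intro ennreal_enn2real) (auto simp: top.not_eq_extremum infinity_ennreal_def less_le_trans[OF le_less_trans])

lemma sg_nonneg [simp]: "0 \<le> sg r"
  by (simp add: sg_def)

lemma sg_antimono: "0 \<le> r \<Longrightarrow> r \<le> s \<Longrightarrow> sg s \<le> sg r"
  using sigma_tail_mono[of r s] by (simp add: ennreal_sg[symmetric])

lemma sigma_split:
  assumes "0 \<le> a" "a \<le> b" "b \<le> 1"
  shows "(\<integral>\<^sup>+t\<in>{a..<b}. sigma_weight p \<omega> \<nu> t \<partial>lebesgue) = ennreal (sg a - sg b)"
proof -
  have "ennreal (sg a) = (\<integral>\<^sup>+t\<in>{a..<b}. sigma_weight p \<omega> \<nu> t \<partial>lebesgue) + ennreal (sg b)"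
    using assms split_integral[OF sigma_measurable, of a b 1] by (simp add: ennreal_sg sigma_tail_def)
  then have "(\<integral>\<^sup>+t\<in>{a..<b}. sigma_weight p \<omega> \<nu> t \<partial>lebesgue) = ennreal (sg a) - ennreal (sg b)"
    by simp
  then show ?thesis by (simp add: ennreal_minus)
qed

lemma weight_split:
  assumes "radial_weight w" "0 \<le> a" "a \<le> b" "b \<le> 1"
  shows "(\<integral>\<^sup>+t\<in>{a..<b}. ennreal (w t) \<partial>lebesgue) = ennreal (tail w a - tail w b)"
proof -
  have nn: "0 \<le> tail w b" using assms(1) tail_pos[of w b] assms by (cases "b = 1") (auto simp: tail_def set_lebesgue_integral_def)
  have "ennreal (tail w a) = (\<integral>\<^sup>+t\<in>{a..<b}. ennreal (w t) \<partial>lebesgue) + ennreal (tail w b)"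
    using assms split_integral[OF radial_weight_measurable, of w a b 1] by (simp add: tail_nn)
  then have "(\<integral>\<^sup>+t\<in>{a..<b}. ennreal (w t) \<partial>lebesgue) = ennreal (tail w a) - ennreal (tail w b)"
    by simp
  then show ?thesis using nn by (simp add: ennreal_minus)
qed

text \<open>Where \<open>\<nu>\<close> vanishes and \<open>\<omega>\<close> does not, division by
  zero makes \<open>\<sigma>\<close> infinite, and a finite integral allows this on a null set only.
  The point 0 is excluded because of the factor \<open>r\<close> in \<open>\<sigma>\<close>.\<close>

lemma sigma_finite_AE: "AE t in lebesgue. t \<in> {0<..<1} \<longrightarrow> \<omega> t = 0 \<or> 0 < \<nu> t"
proof -
  have "(\<integral>\<^sup>+t. sigma_weight p \<omega> \<nu> t * indicator {0..<1} t \<partial>lebesgue) \<noteq> \<infinity>"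
    using sf by (simp add: sigma_tail_def)
  then have "AE t in lebesgue. sigma_weight p \<omega> \<nu> t * indicator {0..<1} t \<noteq> \<infinity>"
    using sigma_measurable by (rule nn_integral_PInf_AE[rotated])
  then show ?thesis
  proof (rule eventually_mono, intro impI)
    fix t assume t: "sigma_weight p \<omega> \<nu> t * indicator {0..<1} t \<noteq> \<infinity>" "t \<in> {0<..<1}"
    then have s: "sigma_weight p \<omega> \<nu> t \<noteq> top" by simp
    have nn: "0 \<le> \<omega> t" "0 \<le> \<nu> t" using t rw rn by (auto simp: radial_weight_def)
    show "\<omega> t = 0 \<or> 0 < \<nu> t"
    proof (rule ccontr)
      assume "\<not> ?thesis"
      then have "\<nu> t = 0" "0 < \<omega> t" using nn by auto
      then have "sigma_weight p \<omega> \<nu> t = top"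
        using t p by (simp add: sigma_weight_def ennreal_divide_zero ennreal_mult_top)
      with s show False by simp
    qed
  qed
qed

text \<open>Hoelder's inequality on \<open>{a..<b}\<close> for \<open>\<omega>\<close> factored as
  \<open>\<nu> powr (1 / p)\<close> times the quotient in \<open>\<sigma>\<close>. The restriction
  \<open>1/2 \<le> a\<close> pays for the factor \<open>t\<close> in \<open>\<sigma>\<close>, since
  \<open>1 \<le> 2 * t\<close> there. The annular form, with differences of tails, is what
  \<open>fN_fE_decay\<close> exploits.\<close>

lemma weight_holder:
  assumes ab: "1/2 \<le> a" "a \<le> b" "b \<le> 1"
  shows "tail \<omega> a - tail \<omega> b \<le> 2 * ((tail \<nu> a - tail \<nu> b) powr (1 / p) * (sg a - sg b) powr (1 / q))"
proof -
  define X where "X = (tail \<nu> a - tail \<nu> b) powr (1 / p)"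
  define Y where "Y = (2 * (sg a - sg b)) powr (1 / q)"
  define f where "f t = ennreal (\<nu> t powr (1 / p)) * indicator {a..<b} t" for t
  define g where "g t = ennreal (\<omega> t) / ennreal (\<nu> t powr (1 / p)) * indicator {a..<b} t" for t
  have fm: "f \<in> borel_measurable lebesgue"
  proof -
    have "(\<lambda>t. ennreal ((\<nu> t * indicator {0..<1} t) powr (1 / p))) \<in> borel_measurable lebesgue"
      by (rule measurable_compose[OF weight_measurable_real[OF rn]]) measurable
    also have "(\<lambda>t. ennreal ((\<nu> t * indicator {0..<1} t) powr (1 / p))) = (\<lambda>t. ennreal (\<nu> t powr (1 / p)) * indicator {0..<1} t)"
      by (auto simp: indicator_def)
    finally show ?thesis unfolding f_def by (rule restrict_measurable) (use ab in auto)
  qed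
  have gm: "g \<in> borel_measurable lebesgue"
    unfolding g_def by (rule restrict_measurable[OF ratio_measurable]) (use ab in auto)
  have nn: "0 \<le> \<nu> t" "0 \<le> \<omega> t" if "0 \<le> t" "t < 1" for t using that rw rn by (auto simp: radial_weight_def)
  have "ennreal (tail \<omega> a - tail \<omega> b) = (\<integral>\<^sup>+t\<in>{a..<b}. ennreal (\<omega> t) \<partial>lebesgue)"
    using ab rw by (simp add: weight_split)
  also have "\<dots> \<le> (\<integral>\<^sup>+t. f t * g t \<partial>lebesgue)"
  proof (rule nn_integral_mono_AE)
    show "AE t in lebesgue. ennreal (\<omega> t) * indicator {a..<b} t \<le> f t * g t"
      using sigma_finite_AE
    proof eventually_elim
      case (elim t)
      show ?case
      proof (cases "t \<in> {a..<b}")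
        case True
        then have t: "0 < t" "t < 1" using ab by auto
        with elim consider "\<omega> t = 0" | "0 < \<nu> t" by auto
        then show ?thesis
        proof cases
          case 2
          define n where "n = \<nu> t powr (1 / p)"
          have n: "0 < n" using 2 by (simp add: n_def)
          have "ennreal n * (ennreal (\<omega> t) / ennreal n) = ennreal n * ennreal (\<omega> t / n)"
            using nn[of t] t n by (simp only: divide_ennreal)
          also have "\<dots> = ennreal (n * (\<omega> t / n))" using n by (intro ennreal_mult'[symmetric]) auto
          also have "n * (\<omega> t / n) = \<omega> t" using n by simp
          finally show ?thesis using True by (simp add: f_def g_def n_def)
        qed simp
      qed simp
    qed
  qed
  also have "\<dots> \<le> ennreal (X * Y)"
  proof (rule holder_nn_integral[OF p refl fm gm])
    show "0 \<le> X" "0 \<le> Y" by (auto simp: X_def Y_def)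
    have d: "0 \<le> tail \<nu> a - tail \<nu> b" "0 \<le> sg a - sg b"
      using tail_antimono[OF rn, of a b] sg_antimono[of a b] ab by auto
    have "(\<integral>\<^sup>+t. f t epowr p \<partial>lebesgue) = (\<integral>\<^sup>+t\<in>{a..<b}. ennreal (\<nu> t) \<partial>lebesgue)"
    proof (intro nn_integral_cong)
      fix t show "f t epowr p = ennreal (\<nu> t) * indicator {a..<b} t"
        using p ab nn[of t] by (auto simp: f_def indicator_def epowr_ennreal powr_powr)
    qed
    also have "\<dots> = ennreal (X powr p)"
      using ab rn p d by (simp add: weight_split X_def powr_powr)
    finally show "(\<integral>\<^sup>+t. f t epowr p \<partial>lebesgue) \<le> ennreal (X powr p)" by simp
    have "(\<integral>\<^sup>+t. g t epowr q \<partial>lebesgue) \<le> (\<integral>\<^sup>+t. ennreal 2 * (sigma_weight p \<omega> \<nu> t * indicator {a..<b} t) \<partial>lebesgue)"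
    proof (intro nn_integral_mono)
      fix t
      show "g t epowr q \<le> ennreal 2 * (sigma_weight p \<omega> \<nu> t * indicator {a..<b} t)"
      proof (cases "t \<in> {a..<b}")
        case True
        have "ennreal 1 \<le> ennreal (2 * t)" using True ab by (intro ennreal_leI) auto
        then have "1 \<le> ennreal 2 * ennreal t" by (subst ennreal_mult'[symmetric]) auto
        then have "1 * g t epowr q \<le> (ennreal 2 * ennreal t) * g t epowr q"
          by (rule mult_right_mono) simp
        then show ?thesis using True by (simp add: g_def sigma_weight_def mult.assoc)
      qed (simp add: g_def)
    qed
    also have "\<dots> = ennreal 2 * (\<integral>\<^sup>+t\<in>{a..<b}. sigma_weight p \<omega> \<nu> t \<partial>lebesgue)"
      by (rule nn_integral_cmult, rule restrict_measurable[OF sigma_measurable]) (use ab in auto)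
    also have "\<dots> = ennreal (Y powr q)"
      using ab q d ennreal_mult'[of 2 "sg a - sg b"] by (simp add: sigma_split Y_def powr_powr)
    finally show "(\<integral>\<^sup>+t. g t epowr q \<partial>lebesgue) \<le> ennreal (Y powr q)" .
  qed
  finally have "tail \<omega> a - tail \<omega> b \<le> X * Y"
    by (subst (asm) ennreal_le_iff) (auto simp: X_def Y_def)
  also have "Y \<le> 2 * (sg a - sg b) powr (1 / q)"
  proof -
    have "0 \<le> sg a - sg b" using sg_antimono[of a b] ab by auto
    have "Y = 2 powr (1 / q) * (sg a - sg b) powr (1 / q)" unfolding Y_def by (rule powr_mult)
    also have "2 powr (1 / q) \<le> (2::real) powr 1" using q by (intro powr_mono) auto
    finally show ?thesis by (simp add: mult_right_mono)
  qed
  then have "X * Y \<le> X * (2 * (sg a - sg b) powr (1 / q))" by (intro mult_left_mono) (auto simp: X_def)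
  finally show ?thesis by (simp add: X_def mult_ac)
qed

lemma tail_one [simp]: "tail w 1 = 0"
  by (simp add: tail_def set_lebesgue_integral_def)

lemma sg_one [simp]: "sg 1 = 0"
  by (simp add: sg_def sigma_tail_def)

lemma tail_le_fN_fE_half: "1/2 \<le> r \<Longrightarrow> r < 1 \<Longrightarrow> tail \<omega> r \<le> 2 * (fN r * fE r)"
  using weight_holder[of r 1] by (simp add: fN_def fE_def)

text \<open>Positivity is inherited from \<open>tail \<omega>\<close> through Hoelder's inequality,
  applied at \<open>max r (1/2)\<close> where it is available.\<close>

lemma sg_pos: "0 \<le> r \<Longrightarrow> r < 1 \<Longrightarrow> 0 < sg r"
proof -
  assume r: "0 \<le> r" "r < 1"
  let ?s = "max r (1/2)"
  have "0 < tail \<omega> ?s" using r by (intro tail_pos rw) auto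
  also have "\<dots> \<le> 2 * (fN ?s * fE ?s)" using r by (intro tail_le_fN_fE_half) auto
  finally have "fE ?s \<noteq> 0" by auto
  then have "0 < sg ?s" using sg_nonneg[of ?s] by (auto simp: fE_def less_le)
  also have "\<dots> \<le> sg r" using r by (intro sg_antimono) auto
  finally show "0 < sg r" .
qed

lemma fN_pos: "0 \<le> r \<Longrightarrow> r < 1 \<Longrightarrow> 0 < fN r"
  using tail_pos[OF rn, of r] by (simp add: fN_def)

lemma fE_pos: "0 \<le> r \<Longrightarrow> r < 1 \<Longrightarrow> 0 < fE r"
  using sg_pos[of r] by (simp add: fE_def)

lemma tail_nonneg: "radial_weight w \<Longrightarrow> 0 \<le> r \<Longrightarrow> r \<le> 1 \<Longrightarrow> 0 \<le> tail w r"
  using tail_pos[of w r] by (cases "r = 1") (auto intro: less_imp_le)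

lemma fN_antimono: "0 \<le> r \<Longrightarrow> r \<le> s \<Longrightarrow> s < 1 \<Longrightarrow> fN s \<le> fN r"
  unfolding fN_def using p tail_antimono[OF rn, of r s] tail_nonneg[OF rn, of s] by (intro powr_mono2) auto

lemma fE_antimono: "0 \<le> r \<Longrightarrow> r \<le> s \<Longrightarrow> fE s \<le> fE r"
  unfolding fE_def using q sg_antimono[of r s] by (intro powr_mono2) auto

lemma fN_powr: "0 \<le> r \<Longrightarrow> r \<le> 1 \<Longrightarrow> fN r powr p = tail \<nu> r"
  using p tail_nonneg[OF rn, of r] by (simp add: fN_def powr_powr)

lemma fE_powr: "fE r powr q = sg r"
  using q by (simp add: fE_def powr_powr)

lemma antimono_measurable:
  fixes f :: "real \<Rightarrow> real"
  assumes "\<And>r s. 0 \<le> r \<Longrightarrow> r \<le> s \<Longrightarrow> s < 1 \<Longrightarrow> f s \<le> f r"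
  shows "(\<lambda>t. f t * indicator {0..<1} t) \<in> borel_measurable lebesgue"
proof (intro measurable_completion)
  have "mono_on {0..<1} (\<lambda>t. - f t)" using assms by (auto intro!: mono_onI)
  then have "(\<lambda>t. - f t) \<in> borel_measurable (restrict_space borel {0..<1})"
    by (rule borel_measurable_mono_on_fnc)
  then have "(\<lambda>t. - (- f t)) \<in> borel_measurable (restrict_space borel {0..<1})"
    by (rule borel_measurable_uminus)
  then show "(\<lambda>t. f t * indicator {0..<1} t) \<in> borel_measurable lborel"
    by (simp add: borel_measurable_restrict_space_iff mult.commute)
qed

lemma fN_measurable: "(\<lambda>t. fN t * indicator {0..<1} t) \<in> borel_measurable lebesgue"
  by (rule antimono_measurable) (rule fN_antimono)

lemma fE_measurable: "(\<lambda>t. fE t * indicator {0..<1} t) \<in> borel_measurable lebesgue"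
  by (rule antimono_measurable) (rule fE_antimono)

end

section \<open>Consequences of a finite \<open>A_const\<close>: doubling and decay of both
  tails\<close>

context two_weights
begin

text \<open>Turns the extended supremum into a real inequality. An infinite tail of
  \<open>\<sigma>\<close> would already make the term at \<open>r = 0\<close> infinite, because
  \<open>fN 0\<close> is positive and \<open>tail \<omega> 0\<close> is a real number.\<close>

lemma A_const_finite_iff:
  "A_const p \<omega> \<nu> < \<infinity> \<longleftrightarrow> sigma_tail p \<omega> \<nu> 0 < \<infinity> \<and> (\<exists>A>0. \<forall>r\<in>{0..<1}. fN r * fE r \<le> A * tail \<omega> r)"
proof
  assume fin: "A_const p \<omega> \<nu> < \<infinity>"
  have trm: "ennreal (fN r) * sigma_tail p \<omega> \<nu> r epowr (1 / q) / ennreal (tail \<omega> r) \<le> A_const p \<omega> \<nu>" if "r \<in> {0..<1}" for r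
    unfolding A_const_def fN_def using that by (rule SUP_upper)
  have "sigma_tail p \<omega> \<nu> 0 \<noteq> top"
  proof
    assume t: "sigma_tail p \<omega> \<nu> 0 = top"
    have "0 < fN 0" using tail_pos[OF rn, of 0] by (simp add: fN_def)
    then have "ennreal (fN 0) * sigma_tail p \<omega> \<nu> 0 epowr (1 / q) = top" by (simp add: t ennreal_mult_top)
    then have "top / ennreal (tail \<omega> 0) < top" using le_less_trans[OF trm[of 0] fin] by simp
    then show False by (simp add: ennreal_top_divide)
  qed
  then have sf: "sigma_tail p \<omega> \<nu> 0 < \<infinity>" by (simp add: less_top)
  then interpret two_weights_fin p \<omega> \<nu> by unfold_locales
  define A where "A = enn2real (A_const p \<omega> \<nu>) + 1"
  have "fN r * fE r \<le> A * tail \<omega> r" if r: "r \<in> {0..<1}" for r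
  proof -
    have tp: "0 < tail \<omega> r" using r tail_pos[OF rw, of r] by auto
    have "ennreal (fN r * fE r / tail \<omega> r) = ennreal (fN r) * sigma_tail p \<omega> \<nu> r epowr (1 / q) / ennreal (tail \<omega> r)"
      using r tp by (simp add: ennreal_sg[symmetric] epowr_ennreal fE_def ennreal_mult[symmetric] divide_ennreal fN_def)
    also have "\<dots> \<le> ennreal A" 
    proof -
      have "A_const p \<omega> \<nu> = ennreal (enn2real (A_const p \<omega> \<nu>))" using fin by simp
      also have "\<dots> \<le> ennreal A" unfolding A_def by (intro ennreal_leI) auto
      finally show ?thesis using trm[OF r] by (rule order_trans[rotated])
    qed
    finally have "fN r * fE r / tail \<omega> r \<le> A"
      by (subst (asm) ennreal_le_iff) (auto simp: A_def)
    then show ?thesis using tp by (simp add: field_simps)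
  qed
  moreover have "A > 0" by (simp add: A_def add_nonneg_pos)
  ultimately show "sigma_tail p \<omega> \<nu> 0 < \<infinity> \<and> (\<exists>A>0. \<forall>r\<in>{0..<1}. fN r * fE r \<le> A * tail \<omega> r)"
    using sf by blast
next
  assume "sigma_tail p \<omega> \<nu> 0 < \<infinity> \<and> (\<exists>A>0. \<forall>r\<in>{0..<1}. fN r * fE r \<le> A * tail \<omega> r)"
  then obtain A where sf: "sigma_tail p \<omega> \<nu> 0 < \<infinity>" and A: "A > 0" "\<forall>r\<in>{0..<1}. fN r * fE r \<le> A * tail \<omega> r"
    by auto
  from sf interpret two_weights_fin p \<omega> \<nu> by unfold_locales
  have "A_const p \<omega> \<nu> \<le> ennreal A"
    unfolding A_const_def
  proof (rule SUP_least)
    fix r :: real assume r: "r \<in> {0..<1}"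
    have tp: "0 < tail \<omega> r" using r tail_pos[OF rw, of r] by auto
    have "ennreal (tail \<nu> r powr (1 / p)) * sigma_tail p \<omega> \<nu> r epowr (1 / q) / ennreal (tail \<omega> r) = ennreal (fN r * fE r / tail \<omega> r)"
      using r tp by (simp add: ennreal_sg[symmetric] epowr_ennreal fE_def ennreal_mult[symmetric] divide_ennreal fN_def)
    also have "\<dots> \<le> ennreal A" using A r tp by (intro ennreal_leI) (auto simp: field_simps)
    finally show "ennreal (tail \<nu> r powr (1 / p)) * sigma_tail p \<omega> \<nu> r epowr (1 / q) / ennreal (tail \<omega> r) \<le> ennreal A" .
  qed
  then show "A_const p \<omega> \<nu> < \<infinity>" by (simp add: le_less_trans)
qed

end

text \<open>If the drop \<open>x - y\<close> is at least a fixed fraction of \<open>x\<close>, the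
  remainder \<open>y\<close> is at most a fixed fraction below 1. The maximum with 0 keeps the base
  of the power nonnegative when \<open>c < 1\<close>.\<close>

lemma powr_decay:
  fixes x y c u :: real
  assumes "0 \<le> y" "y \<le> x" "0 < c" "1 < u" "x powr (1 / u) \<le> c * (x - y) powr (1 / u)"
  shows "y powr (1 / u) \<le> (max 0 (1 - c powr (- u))) powr (1 / u) * x powr (1 / u)"
proof -
  have "(x powr (1 / u)) powr u \<le> (c * (x - y) powr (1 / u)) powr u" using assms by (intro powr_mono2) auto
  then have "x \<le> c powr u * (x - y)" using assms by (simp add: powr_powr powr_mult)
  then have "c powr (- u) * x \<le> c powr (- u) * (c powr u * (x - y))" by (intro mult_left_mono) auto
  also have "\<dots> = x - y" using assms by (simp add: powr_minus)
  finally have "y \<le> (1 - c powr (- u)) * x" by (simp add: algebra_simps)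
  also have "\<dots> \<le> max 0 (1 - c powr (- u)) * x" using assms by (intro mult_right_mono) auto
  finally have "y powr (1 / u) \<le> (max 0 (1 - c powr (- u)) * x) powr (1 / u)"
    using assms by (intro powr_mono2) auto
  also have "\<dots> = (max 0 (1 - c powr (- u))) powr (1 / u) * x powr (1 / u)" by (rule powr_mult)
  finally show ?thesis .
qed

lemma powr_decay_const_less: "0 < c \<Longrightarrow> 1 < u \<Longrightarrow> (max 0 (1 - c powr (- u))) powr (1 / u) < (1::real)"
proof -
  assume "0 < c" "1 < u"
  then have "max 0 (1 - c powr (- u)) < 1" by auto
  then have "(max 0 (1 - c powr (- u))) powr (1 / u) < 1 powr (1 / u)"
    using \<open>1 < u\<close> by (intro powr_less_mono2) auto
  then show ?thesis by simp
qed

locale two_weights_A = two_weights_fin +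
  fixes A :: real
  assumes wD: "\<omega> \<in> class_Dhat" and A: "0 < A" and AN: "\<And>r. 0 \<le> r \<Longrightarrow> r < 1 \<Longrightarrow> fN r * fE r \<le> A * tail \<omega> r"
begin

text \<open>Hoelder's inequality is available from \<open>1/2\<close> on; doubling of
  \<open>\<omega>\<close> replaces \<open>r\<close> by \<open>(1 + r) / 2\<close>, which lies
  there.\<close>

lemma tail_le_fN_fE:
  obtains B where "B > 0" "\<And>r. 0 \<le> r \<Longrightarrow> r < 1 \<Longrightarrow> tail \<omega> r \<le> B * (fN r * fE r)"
proof -
  obtain C where C: "C \<ge> 1" "\<And>r s. 0 \<le> r \<Longrightarrow> r < 1 \<Longrightarrow> 1 - r \<le> 2 * (1 - s) \<Longrightarrow> 0 \<le> s \<Longrightarrow> tail \<omega> r \<le> C * tail \<omega> s"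
    using Dhat_ratio[OF wD, of 2] by auto
  have "tail \<omega> r \<le> (C * 2) * (fN r * fE r)" if r: "0 \<le> r" "r < 1" for r
  proof -
    let ?s = "(1 + r) / 2"
    have "tail \<omega> r \<le> C * tail \<omega> ?s" using r by (intro C(2)) (auto simp: field_simps)
    also have "\<dots> \<le> C * (2 * (fN ?s * fE ?s))" using r C(1) by (intro mult_left_mono tail_le_fN_fE_half) auto
    also have "\<dots> \<le> C * (2 * (fN r * fE r))"
      using r C(1) fN_pos[of r] fE_pos[of ?s] by (intro mult_left_mono mult_mono fN_antimono fE_antimono) auto
    finally show ?thesis by simp
  qed
  then show ?thesis using that[of "C * 2"] C(1) by auto
qed

text \<open>The product \<open>fN * fE\<close> doubles because it is comparable to
  \<open>tail \<omega>\<close>. Both factors decrease, so replacing one factor at \<open>s\<close>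
  by its larger value at \<open>r\<close> and cancelling it leaves doubling of the other.\<close>

lemma fN_fE_doubling:
  assumes "1 \<le> K"
  obtains D where "D > 0"
    "\<And>r s. 0 \<le> r \<Longrightarrow> r \<le> s \<Longrightarrow> s < 1 \<Longrightarrow> 1 - r \<le> K * (1 - s) \<Longrightarrow> fN r \<le> D * fN s"
    "\<And>r s. 0 \<le> r \<Longrightarrow> r \<le> s \<Longrightarrow> s < 1 \<Longrightarrow> 1 - r \<le> K * (1 - s) \<Longrightarrow> fE r \<le> D * fE s"
proof -
  obtain C where C: "C \<ge> 1" "\<And>r s. 0 \<le> r \<Longrightarrow> r < 1 \<Longrightarrow> 1 - r \<le> K * (1 - s) \<Longrightarrow> 0 \<le> s \<Longrightarrow> tail \<omega> r \<le> C * tail \<omega> s"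
    using Dhat_ratio[OF wD assms] by auto
  obtain B where B: "B > 0" "\<And>r. 0 \<le> r \<Longrightarrow> r < 1 \<Longrightarrow> tail \<omega> r \<le> B * (fN r * fE r)"
    using tail_le_fN_fE by blast
  have main: "fN r * fE r \<le> (A * C * B) * (fN s * fE s)" if "0 \<le> r" "r \<le> s" "s < 1" "1 - r \<le> K * (1 - s)" for r s
  proof -
    have "fN r * fE r \<le> A * tail \<omega> r" using that by (intro AN) auto
    also have "\<dots> \<le> A * (C * tail \<omega> s)" using that A by (intro mult_left_mono C(2)) auto
    also have "\<dots> \<le> A * (C * (B * (fN s * fE s)))" using that A C(1) by (intro mult_left_mono B(2)) auto
    finally show ?thesis by simp
  qed
  have D: "0 < A * C * B" using A C(1) B(1) by simp
  have n: "fN r \<le> (A * C * B) * fN s" if "0 \<le> r" "r \<le> s" "s < 1" "1 - r \<le> K * (1 - s)" for r s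
  proof -
    have "fN r * fE r \<le> (A * C * B) * (fN s * fE s)" using main that by auto
    also have "\<dots> \<le> (A * C * B) * (fN s * fE r)"
      using D that fN_pos[of s] by (intro mult_left_mono fE_antimono) auto
    finally have "fN r * fE r \<le> ((A * C * B) * fN s) * fE r" by simp
    then show ?thesis using fE_pos[of r] that by simp
  qed
  have e: "fE r \<le> (A * C * B) * fE s" if "0 \<le> r" "r \<le> s" "s < 1" "1 - r \<le> K * (1 - s)" for r s
  proof -
    have "fN r * fE r \<le> (A * C * B) * (fN s * fE s)" using main that by auto
    also have "\<dots> \<le> (A * C * B) * (fN r * fE s)"
      using D that fE_pos[of s] by (intro mult_left_mono mult_right_mono fN_antimono) auto
    finally have "fN r * fE r \<le> fN r * ((A * C * B) * fE s)" by (simp add: mult_ac)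
    then show ?thesis using fN_pos[of r] that by simp
  qed
  show ?thesis using that[OF D] n e by blast
qed

lemma nu_Dhat: "\<nu> \<in> class_Dhat"
proof -
  obtain D where D: "D > 0" "\<And>r s. 0 \<le> r \<Longrightarrow> r \<le> s \<Longrightarrow> s < 1 \<Longrightarrow> 1 - r \<le> 2 * (1 - s) \<Longrightarrow> fN r \<le> D * fN s"
    using fN_fE_doubling[of 2] by (metis one_le_numeral)
  have "tail \<nu> r \<le> max 1 (D powr p) * tail \<nu> ((1 + r) / 2)" if r: "r \<in> {0..<1}" for r
  proof -
    let ?s = "(1 + r) / 2"
    have "fN r \<le> D * fN ?s" using r by (intro D(2)) (auto simp: field_simps)
    then have "fN r powr p \<le> (D * fN ?s) powr p" using p r fN_pos[of r] by (intro powr_mono2) auto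
    also have "\<dots> = D powr p * fN ?s powr p" by (rule powr_mult)
    finally have "tail \<nu> r \<le> D powr p * tail \<nu> ?s" using r by (simp add: fN_powr)
    also have "\<dots> \<le> max 1 (D powr p) * tail \<nu> ?s" using r tail_nonneg[OF rn, of ?s] by (intro mult_right_mono) auto
    finally show ?thesis .
  qed
  then show ?thesis unfolding class_Dhat_def using rn
    by (intro CollectI conjI exI[of _ "max 1 (D powr p)"]) auto
qed

text \<open>Hoelder's inequality on the annulus from \<open>(1 + r) / 2\<close> to
  \<open>shrink K r\<close>. Decay and doubling of \<open>\<omega>\<close> put a fixed part of
  \<open>tail \<omega> r\<close> there, so the product of the drops of the two tails, to the powers
  \<open>1 / p\<close> and \<open>1 / q\<close>, is at least a multiple of
  \<open>fN r * fE r\<close>. Neither drop exceeds its full value, hence each is a fixed fraction of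
  it.\<close>

lemma fN_fE_decay:
  assumes "\<omega> \<in> class_Dcheck"
  obtains K \<theta> where "1 < K" "0 \<le> \<theta>" "\<theta> < 1"
    "\<And>r. 0 \<le> r \<Longrightarrow> r < 1 \<Longrightarrow> fN (shrink K r) \<le> \<theta> * fN r"
    "\<And>r. 0 \<le> r \<Longrightarrow> r < 1 \<Longrightarrow> fE (shrink K r) \<le> \<theta> * fE r"
proof -
  obtain C where C: "C \<ge> 1" "\<And>r s. 0 \<le> r \<Longrightarrow> r < 1 \<Longrightarrow> 1 - r \<le> 2 * (1 - s) \<Longrightarrow> 0 \<le> s \<Longrightarrow> tail \<omega> r \<le> C * tail \<omega> s"
    using Dhat_ratio[OF wD, of 2] by auto
  \<comment> \<open>The factor \<open>1 / (2 * C)\<close> makes \<open>C\<close> times the tail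
    beyond the annulus at most half of \<open>tail \<omega> r\<close>.\<close>
  obtain K0 where K0: "1 < K0" "\<And>L r. K0 \<le> L \<Longrightarrow> 0 \<le> r \<Longrightarrow> r < 1 \<Longrightarrow> tail \<omega> (shrink L r) \<le> 1 / (2 * C) * tail \<omega> r"
    using Dcheck_decay[OF assms, of "1 / (2 * C)"] C(1) by auto
  \<comment> \<open>\<open>K \<ge> 2\<close> places \<open>(1 + r) / 2\<close> before
    \<open>shrink K r\<close>.\<close>
  define K where "K = max K0 2"
  have K: "1 < K" "2 \<le> K" "K0 \<le> K" using K0 by (auto simp: K_def)
  \<comment> \<open>Collects \<open>A\<close> from the bound on \<open>A_const\<close>,
    \<open>2 * C\<close> from the annulus and 2 from \<open>weight_holder\<close>.\<close>
  define c where "c = 4 * A * C"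
  have c: "0 < c" using A C(1) by (simp add: c_def)
  define \<theta> where "\<theta> = max ((max 0 (1 - c powr (- p))) powr (1 / p)) ((max 0 (1 - c powr (- q))) powr (1 / q))"
  have th: "0 \<le> \<theta>" "\<theta> < 1" using powr_decay_const_less[OF c p] powr_decay_const_less[OF c q(1)] by (auto simp: \<theta>_def le_max_iff_disj)
  have key: "fN r \<le> c * (tail \<nu> r - tail \<nu> (shrink K r)) powr (1 / p) \<and> fE r \<le> c * (sg r - sg (shrink K r)) powr (1 / q)"
    if r: "0 \<le> r" "r < 1" for r
  proof -
    let ?s = "(1 + r) / 2" and ?t = "shrink K r"
    have "(1 - r) / K \<le> (1 - r) / 2" using K r by (intro divide_left_mono) auto
    then have st: "?s \<le> ?t" by (simp add: shrink_def field_simps)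
    have t1: "?t < 1" "r < ?t" using shrink_bounds[OF K(1) r(2)] by auto
    define dn ds where "dn = (tail \<nu> r - tail \<nu> ?t) powr (1 / p)" and "ds = (sg r - sg ?t) powr (1 / q)"
    have "tail \<omega> r \<le> C * tail \<omega> ?s" using r by (intro C(2)) (auto simp: field_simps)
    moreover have "C * tail \<omega> ?t \<le> C * (1 / (2 * C) * tail \<omega> r)" using K0(2)[of K r] K r C(1) by (intro mult_left_mono) auto
    moreover have "C * (1 / (2 * C) * tail \<omega> r) = tail \<omega> r / 2" using C(1) by simp
    ultimately have "tail \<omega> r \<le> 2 * C * (tail \<omega> ?s - tail \<omega> ?t)" by (simp add: algebra_simps)
    also have "\<dots> \<le> 2 * C * (2 * ((tail \<nu> ?s - tail \<nu> ?t) powr (1 / p) * (sg ?s - sg ?t) powr (1 / q)))"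
      using st t1 r C(1) by (intro mult_left_mono weight_holder) auto
    also have "\<dots> \<le> 2 * C * (2 * (dn * ds))"
    proof -
      have "tail \<nu> ?s \<le> tail \<nu> r" "tail \<nu> ?t \<le> tail \<nu> ?s" using r st by (auto intro!: tail_antimono[OF rn])
      moreover have "sg ?s \<le> sg r" "sg ?t \<le> sg ?s" using r st by (auto intro!: sg_antimono)
      ultimately show ?thesis unfolding dn_def ds_def using C(1) p q
        by (intro mult_left_mono mult_mono powr_mono2) auto
    qed
    finally have w: "tail \<omega> r \<le> 4 * C * (dn * ds)" by simp
    have "fN r * fE r \<le> A * tail \<omega> r" using AN r by auto
    also have "\<dots> \<le> A * (4 * C * (dn * ds))" using w A by (intro mult_left_mono) auto
    finally have m: "fN r * fE r \<le> c * (dn * ds)" by (simp add: c_def mult_ac)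
    have dnn: "0 \<le> dn" "0 \<le> ds" by (auto simp: dn_def ds_def)
    have "dn \<le> fN r"
      unfolding dn_def fN_def using r t1 p tail_antimono[OF rn, of r ?t] tail_nonneg[OF rn, of ?t]
      by (intro powr_mono2) auto
    then have "c * (dn * ds) \<le> c * (fN r * ds)" using c dnn by (intro mult_left_mono mult_right_mono) auto
    then have "fN r * fE r \<le> fN r * (c * ds)" using m by (simp add: mult_ac)
    then have e: "fE r \<le> c * ds" using fN_pos[OF r] by simp
    have "ds \<le> fE r"
      unfolding ds_def fE_def using r t1 q sg_antimono[of r ?t] by (intro powr_mono2) auto
    then have "c * (dn * ds) \<le> c * (dn * fE r)" using c dnn by (intro mult_left_mono) auto
    then have "fN r * fE r \<le> (c * dn) * fE r" using m by (simp add: mult_ac)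
    then have "fN r \<le> c * dn" using fE_pos[OF r] by simp
    with e show ?thesis by (simp add: dn_def ds_def)
  qed
  have dN: "fN (shrink K r) \<le> \<theta> * fN r" if r: "0 \<le> r" "r < 1" for r
  proof -
    have t1: "shrink K r < 1" "r < shrink K r" using shrink_bounds[OF K(1) r(2)] by auto
    have "fN (shrink K r) \<le> (max 0 (1 - c powr (- p))) powr (1 / p) * fN r"
      unfolding fN_def using key[OF r] t1 r c p tail_antimono[OF rn, of r "shrink K r"] tail_nonneg[OF rn, of "shrink K r"]
      by (intro powr_decay) (auto simp: fN_def)
    also have "\<dots> \<le> \<theta> * fN r" using fN_pos[OF r] by (intro mult_right_mono) (auto simp: \<theta>_def)
    finally show ?thesis .
  qed
  have dE: "fE (shrink K r) \<le> \<theta> * fE r" if r: "0 \<le> r" "r < 1" for r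
  proof -
    have t1: "shrink K r < 1" "r < shrink K r" using shrink_bounds[OF K(1) r(2)] by auto
    have "fE (shrink K r) \<le> (max 0 (1 - c powr (- q))) powr (1 / q) * fE r"
      unfolding fE_def using key[OF r] t1 r c q sg_antimono[of r "shrink K r"]
      by (intro powr_decay) (auto simp: fE_def)
    also have "\<dots> \<le> \<theta> * fE r" using fE_pos[OF r] by (intro mult_right_mono) (auto simp: \<theta>_def)
    finally show ?thesis .
  qed
  show ?thesis using that[OF K(1) th dN dE] by blast
qed

lemma nu_Dcheck:
  assumes "\<omega> \<in> class_Dcheck"
  shows "\<nu> \<in> class_Dcheck"
proof -
  obtain K \<theta> where K: "1 < K" "0 \<le> \<theta>" "\<theta> < 1"
    "\<And>r. 0 \<le> r \<Longrightarrow> r < 1 \<Longrightarrow> fN (shrink K r) \<le> \<theta> * fN r"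
    "\<And>r. 0 \<le> r \<Longrightarrow> r < 1 \<Longrightarrow> fE (shrink K r) \<le> \<theta> * fE r"
    using fN_fE_decay[OF assms] by blast
  show ?thesis
  proof (rule DcheckI[OF rn K(1)])
    show "\<theta> powr p < 1" using K p powr_less_mono2[of p \<theta> 1] by simp
    fix r :: real assume r: "0 \<le> r" "r < 1"
    have t1: "shrink K r < 1" "r < shrink K r" using shrink_bounds[OF K(1) r(2)] by auto
    have "fN (shrink K r) powr p \<le> (\<theta> * fN r) powr p"
      using K(4)[OF r] p fN_pos[of "shrink K r"] t1 r by (intro powr_mono2) auto
    also have "\<dots> = \<theta> powr p * fN r powr p" by (rule powr_mult)
    finally show "tail \<nu> (shrink K r) \<le> \<theta> powr p * tail \<nu> r" using r t1 by (simp add: fN_powr)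
  qed
qed

text \<open>The factor \<open>fN\<close> decays and \<open>fE\<close> does not increase, so their
  product decays; it is comparable to \<open>tail \<omega>\<close> from both sides, and
  \<open>e\<close> is chosen to beat the two comparison constants.\<close>

lemma omega_Dcheck:
  assumes "\<nu> \<in> class_Dcheck"
  shows "\<omega> \<in> class_Dcheck"
proof -
  obtain B where B: "B > 0" "\<And>r. 0 \<le> r \<Longrightarrow> r < 1 \<Longrightarrow> tail \<omega> r \<le> B * (fN r * fE r)"
    using tail_le_fN_fE by blast
  define e where "e = 1 / (2 * A * B)"
  have e: "0 < e" using A B by (simp add: e_def)
  obtain K where K: "1 < K" "\<And>L r. K \<le> L \<Longrightarrow> 0 \<le> r \<Longrightarrow> r < 1 \<Longrightarrow> tail \<nu> (shrink L r) \<le> e powr p * tail \<nu> r"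
    using Dcheck_decay[OF assms, of "e powr p"] e by auto
  show ?thesis
  proof (rule DcheckI[OF rw K(1), of "1/2"])
    fix r :: real assume r: "0 \<le> r" "r < 1"
    let ?t = "shrink K r"
    have t1: "?t < 1" "r < ?t" using shrink_bounds[OF K(1) r(2)] by auto
    have "fN ?t \<le> (e powr p * tail \<nu> r) powr (1 / p)"
      unfolding fN_def using K(2)[of K r] r t1 p tail_nonneg[OF rn, of ?t] by (intro powr_mono2) auto
    also have "\<dots> = (e powr p) powr (1 / p) * fN r" unfolding fN_def by (rule powr_mult)
    also have "\<dots> = e * fN r" using e p by (simp add: powr_powr)
    finally have n: "fN ?t \<le> e * fN r" .
    have "tail \<omega> ?t \<le> B * (fN ?t * fE ?t)" using B(2) r t1 by auto
    also have "\<dots> \<le> B * ((e * fN r) * fE r)"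
      using n B(1) r t1 e fN_pos[OF r] fE_pos[of ?t] by (intro mult_left_mono mult_mono fE_antimono) auto
    also have "\<dots> = B * e * (fN r * fE r)" by simp
    also have "\<dots> \<le> B * e * (A * tail \<omega> r)" using AN[OF r] B e by (intro mult_left_mono) auto
    also have "\<dots> = 1 / 2 * tail \<omega> r" using A B(1) by (simp add: e_def)
    finally show "tail \<omega> ?t \<le> 1 / 2 * tail \<omega> r" .
  qed simp
qed

text \<open>The two dual Schur estimates: \<open>schur_radial\<close> is used once for
  \<open>\<sigma>\<close> with exponent \<open>q\<close> and once for \<open>\<nu>\<close> with
  exponent \<open>p\<close>, the roles of \<open>fE\<close> and \<open>fN\<close> exchanged.\<close>

lemma schur_sigma:
  assumes "\<omega> \<in> class_Dcheck"
  obtains B where "0 < B" "\<And>s. 0 \<le> s \<Longrightarrow> s < 1 \<Longrightarrow>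
    (\<integral>\<^sup>+t\<in>{0..<1}. sigma_weight p \<omega> \<nu> t * ennreal (fE t powr (1 - q)) * ennreal (1 / (fE (min s t) * fN (min s t))) \<partial>lebesgue) \<le> ennreal (B / fN s)"
    "\<And>s. 0 \<le> s \<Longrightarrow> s < 1 \<Longrightarrow>
    (\<integral>\<^sup>+t\<in>{0..<1}. ennreal (\<nu> t) * ennreal (fN t powr (1 - p)) * ennreal (1 / (fN (min s t) * fE (min s t))) \<partial>lebesgue) \<le> ennreal (B / fE s)"
proof -
  obtain K \<theta> where K: "1 < K" "0 \<le> \<theta>" "\<theta> < 1"
    "\<And>r. 0 \<le> r \<Longrightarrow> r < 1 \<Longrightarrow> fN (shrink K r) \<le> \<theta> * fN r"
    "\<And>r. 0 \<le> r \<Longrightarrow> r < 1 \<Longrightarrow> fE (shrink K r) \<le> \<theta> * fE r"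
    using fN_fE_decay[OF assms] by blast
  obtain D where D: "D > 0"
    "\<And>r s. 0 \<le> r \<Longrightarrow> r \<le> s \<Longrightarrow> s < 1 \<Longrightarrow> 1 - r \<le> K * (1 - s) \<Longrightarrow> fN r \<le> D * fN s"
    "\<And>r s. 0 \<le> r \<Longrightarrow> r \<le> s \<Longrightarrow> s < 1 \<Longrightarrow> 1 - r \<le> K * (1 - s) \<Longrightarrow> fE r \<le> D * fE s"
    using fN_fE_doubling[of K] K(1) by auto
  have sh: "1 - r \<le> K * (1 - shrink K r)" for r using K(1) by (simp add: shrink_def)
  have db: "fN r \<le> D * fN (shrink K r)" "fE r \<le> D * fE (shrink K r)" if "0 \<le> r" "r < 1" for r
    using D(2,3)[of r "shrink K r"] sh[of r] shrink_bounds[OF K(1), of r] that by auto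
  have m1: "(\<integral>\<^sup>+t\<in>{r..<1}. sigma_weight p \<omega> \<nu> t \<partial>lebesgue) \<le> ennreal (fE r powr q)" if "0 \<le> r" "r < 1" for r
    using that sigma_split[of r 1] by (simp add: fE_powr)
  have m2: "(\<integral>\<^sup>+t\<in>{r..<1}. ennreal (\<nu> t) \<partial>lebesgue) \<le> ennreal (fN r powr p)" if "0 \<le> r" "r < 1" for r
    using that by (simp add: fN_powr tail_nn rn)
  obtain B1 where B1: "0 < B1" "\<And>s. 0 \<le> s \<Longrightarrow> s < 1 \<Longrightarrow>
    (\<integral>\<^sup>+t\<in>{0..<1}. sigma_weight p \<omega> \<nu> t * ennreal (fE t powr (1 - q)) * ennreal (1 / (fE (min s t) * fN (min s t))) \<partial>lebesgue) \<le> ennreal (B1 / fN s)"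
  proof (rule schur_radial[OF sigma_measurable fE_measurable fN_measurable K(1,3) q(1) K(5,4) db(2,1) fE_antimono fN_antimono fE_pos fN_pos m1])
    fix B1 :: real assume "0 < B1" and B1: "\<And>s. 0 \<le> s \<Longrightarrow> s < 1 \<Longrightarrow>
      (\<integral>\<^sup>+t\<in>{0..<1}. sigma_weight p \<omega> \<nu> t * ennreal (fE t powr (1 - q)) * ennreal (1 / (fE (min s t) * fN (min s t))) \<partial>lebesgue) \<le> ennreal (B1 / fN s)"
    show thesis by (rule that[OF \<open>0 < B1\<close> B1])
  qed
  obtain B2 where B2: "0 < B2" "\<And>s. 0 \<le> s \<Longrightarrow> s < 1 \<Longrightarrow>
    (\<integral>\<^sup>+t\<in>{0..<1}. ennreal (\<nu> t) * ennreal (fN t powr (1 - p)) * ennreal (1 / (fN (min s t) * fE (min s t))) \<partial>lebesgue) \<le> ennreal (B2 / fE s)"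
  proof (rule schur_radial[OF radial_weight_measurable[OF rn] fN_measurable fE_measurable K(1,3) p K(4,5) db(1,2) fN_antimono fE_antimono fN_pos fE_pos m2])
    fix B2 :: real assume "0 < B2" and B2: "\<And>s. 0 \<le> s \<Longrightarrow> s < 1 \<Longrightarrow>
      (\<integral>\<^sup>+t\<in>{0..<1}. ennreal (\<nu> t) * ennreal (fN t powr (1 - p)) * ennreal (1 / (fN (min s t) * fE (min s t))) \<partial>lebesgue) \<le> ennreal (B2 / fE s)"
    show thesis by (rule that[OF \<open>0 < B2\<close> B2])
  qed
  show ?thesis
  proof (rule that[of "max B1 B2"])
    fix s :: real assume s: "0 \<le> s" "s < 1"
    have "B1 / fN s \<le> max B1 B2 / fN s" using fN_pos[OF s] by (intro divide_right_mono) auto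
    with B1(2)[OF s] show "(\<integral>\<^sup>+t\<in>{0..<1}. sigma_weight p \<omega> \<nu> t * ennreal (fE t powr (1 - q)) * ennreal (1 / (fE (min s t) * fN (min s t))) \<partial>lebesgue) \<le> ennreal (max B1 B2 / fN s)"
      by (meson ennreal_leI order_trans)
    have "B2 / fE s \<le> max B1 B2 / fE s" using fE_pos[OF s] by (intro divide_right_mono) auto
    with B2(2)[OF s] show "(\<integral>\<^sup>+t\<in>{0..<1}. ennreal (\<nu> t) * ennreal (fN t powr (1 - p)) * ennreal (1 / (fN (min s t) * fE (min s t))) \<partial>lebesgue) \<le> ennreal (max B1 B2 / fE s)"
      by (meson ennreal_leI order_trans)
  qed (use B1(1) in auto)
qed

end

section \<open>Comparison of \<open>A_const\<close> and \<open>M_const\<close>\<close>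

context two_weights_A
begin

text \<open>On a block \<open>tail \<omega>\<close> is at least a multiple of
  \<open>fN r * fE r\<close> and the mass of \<open>\<nu>\<close> is at most
  \<open>fN r powr p\<close>, so the integral in \<open>M_const\<close> over it is at most a
  constant over \<open>fE r powr p\<close>. These bounds grow geometrically, so the whole integral
  up to \<open>r\<close> is bounded in the same way, and the second factor of \<open>M_const\<close>
  cancels \<open>1 / fE r\<close>.\<close>

lemma M_const_finite:
  assumes "\<omega> \<in> class_Dcheck"
  shows "M_const p \<omega> \<nu> < \<infinity>"
proof -
  obtain K \<theta> where K: "1 < K" "0 \<le> \<theta>" "\<theta> < 1"
    "\<And>r. 0 \<le> r \<Longrightarrow> r < 1 \<Longrightarrow> fN (shrink K r) \<le> \<theta> * fN r"
    "\<And>r. 0 \<le> r \<Longrightarrow> r < 1 \<Longrightarrow> fE (shrink K r) \<le> \<theta> * fE r"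
    using fN_fE_decay[OF assms] by blast
  obtain C where C: "C \<ge> 1" "\<And>r s. 0 \<le> r \<Longrightarrow> r < 1 \<Longrightarrow> 1 - r \<le> K * (1 - s) \<Longrightarrow> 0 \<le> s \<Longrightarrow> tail \<omega> r \<le> C * tail \<omega> s"
    using Dhat_ratio[OF wD less_imp_le[OF K(1)]] by blast
  define f where "f t = ennreal (\<nu> t / tail \<omega> t powr p)" for t
  have tm: "(\<lambda>t. tail \<omega> t * indicator {0..<1} t) \<in> borel_measurable lebesgue"
    by (rule antimono_measurable) (rule tail_antimono[OF rw])
  have fm: "(\<lambda>t. f t * indicator {0..<1} t) \<in> borel_measurable lebesgue"
  proof -
    have "(\<lambda>t. (tail \<omega> t * indicator {0..<1} t) powr p) \<in> borel_measurable lebesgue"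
      by (rule measurable_compose[OF tm]) measurable
    from borel_measurable_divide[OF weight_measurable_real[OF rn] this]
    have "(\<lambda>t. ennreal ((\<nu> t * indicator {0..<1} t) / (tail \<omega> t * indicator {0..<1} t) powr p)) \<in> borel_measurable lebesgue"
      by (rule measurable_compose) measurable
    also have "(\<lambda>t. ennreal ((\<nu> t * indicator {0..<1} t) / (tail \<omega> t * indicator {0..<1} t) powr p)) = (\<lambda>t. f t * indicator {0..<1} t)"
      by (auto simp: f_def indicator_def)
    finally show ?thesis .
  qed
  have block: "(\<integral>\<^sup>+t\<in>{r..<shrink K r}. f t \<partial>lebesgue) \<le> ennreal ((A * C) powr p / (fE r powr p))" if r: "0 \<le> r" "r < 1" for r
  proof -
    let ?s = "shrink K r"
    have s: "r < ?s" "?s < 1" using shrink_bounds[OF K(1) r(2)] by auto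
    have ts: "0 < tail \<omega> ?s" using tail_pos[OF rw] r s by auto
    have low: "fN r * fE r / (A * C) \<le> tail \<omega> ?s"
    proof -
      have "tail \<omega> r \<le> C * tail \<omega> ?s" using r s K(1) by (intro C(2)) (auto simp: shrink_def)
      then have "A * tail \<omega> r \<le> A * (C * tail \<omega> ?s)" using A by (intro mult_left_mono) auto
      with AN[OF r] have "fN r * fE r \<le> (A * C) * tail \<omega> ?s" by simp
      then show ?thesis using A C(1) by (simp add: divide_le_eq mult.commute)
    qed
    have pos: "0 < fN r * fE r / (A * C)" using fN_pos[OF r] fE_pos[OF r] A C(1) by simp
    have "(\<integral>\<^sup>+t\<in>{r..<?s}. f t \<partial>lebesgue) \<le> (\<integral>\<^sup>+t. ennreal (1 / (fN r * fE r / (A * C)) powr p) * (ennreal (\<nu> t) * indicator {r..<1} t) \<partial>lebesgue)"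
    proof (intro nn_integral_mono)
      fix t
      show "f t * indicator {r..<?s} t \<le> ennreal (1 / (fN r * fE r / (A * C)) powr p) * (ennreal (\<nu> t) * indicator {r..<1} t)"
      proof (cases "t \<in> {r..<?s}")
        case True
        then have t: "0 \<le> t" "t < 1" "t \<le> ?s" using r s by auto
        have "fN r * fE r / (A * C) \<le> tail \<omega> t" using low tail_antimono[OF rw t(1,3)] by simp
        then have "(fN r * fE r / (A * C)) powr p \<le> tail \<omega> t powr p" using pos p by (intro powr_mono2) auto
        then have "\<nu> t / tail \<omega> t powr p \<le> \<nu> t / (fN r * fE r / (A * C)) powr p"
          using t rn pos by (intro divide_left_mono mult_pos_pos) (auto simp: radial_weight_def intro: less_le_trans)
        then have "f t \<le> ennreal (1 / (fN r * fE r / (A * C)) powr p) * ennreal (\<nu> t)"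
          unfolding f_def by (subst ennreal_mult'[symmetric]) (auto intro!: ennreal_leI)
        then show ?thesis using True s by simp
      qed simp
    qed
    also have "\<dots> = ennreal (1 / (fN r * fE r / (A * C)) powr p) * (\<integral>\<^sup>+t\<in>{r..<1}. ennreal (\<nu> t) \<partial>lebesgue)"
      by (rule nn_integral_cmult, rule restrict_measurable[OF radial_weight_measurable[OF rn]]) (use r in auto)
    also have "\<dots> = ennreal (1 / (fN r * fE r / (A * C)) powr p * fN r powr p)"
      using r by (simp add: tail_nn rn fN_powr ennreal_mult'[symmetric] del: powr_powr)
    also have "1 / (fN r * fE r / (A * C)) powr p * fN r powr p = (A * C) powr p / fE r powr p"
      using fN_pos[OF r] fE_pos[OF r] A C(1) by (simp add: powr_divide powr_mult)
    finally show ?thesis .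
  qed
  have dec: "fE (shrink K r) powr p \<le> \<theta> powr p * fE r powr p" if r: "0 \<le> r" "r < 1" for r
  proof -
    have "fE (shrink K r) powr p \<le> (\<theta> * fE r) powr p"
      using K(5)[OF r] p by (intro powr_mono2) (auto simp: fE_def)
    then show ?thesis by (simp only: powr_mult)
  qed
  have mono: "fE s powr p \<le> fE r powr p" if "0 \<le> r" "r \<le> s" for r s
    using fE_antimono[OF that] p by (intro powr_mono2) (auto simp: fE_def)
  have th: "\<theta> powr p < 1" using K p powr_less_mono2[of p \<theta> 1] by simp
  obtain B where B: "0 < B" "\<And>s. 0 \<le> s \<Longrightarrow> s < 1 \<Longrightarrow> (\<integral>\<^sup>+t\<in>{0..<s}. f t \<partial>lebesgue) \<le> ennreal (B / fE s powr p)"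
  proof (rule dyadic_sum_below[of f K "\<theta> powr p" "(A * C) powr p" "\<lambda>r. fE r powr p", OF fm K(1) th _ block dec mono])
    show "0 < fE r powr p" if "0 \<le> r" "r < 1" for r using fE_pos[OF that] by simp
    fix B assume "0 < B" and B: "\<And>s. 0 \<le> s \<Longrightarrow> s < 1 \<Longrightarrow> (\<integral>\<^sup>+t\<in>{0..<s}. f t \<partial>lebesgue) \<le> ennreal (B / fE s powr p)"
    show thesis by (rule that[OF \<open>0 < B\<close> B])
  qed auto
  \<comment> \<open>The second summand absorbs the \<open>+ 1\<close> in \<open>M_const\<close>,
    because \<open>fE r \<le> fE 0\<close>.\<close>
  define c where "c = B + fE 0 powr p"
  have "M_const p \<omega> \<nu> \<le> ennreal (c powr (1 / p))"
    unfolding M_const_def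
  proof (rule SUP_least)
    fix r :: real assume r: "r \<in> {0<..<1}"
    have Er: "0 < fE r" using r fE_pos[of r] by auto
    have "(\<integral>\<^sup>+s\<in>{0..r}. ennreal (\<nu> s / tail \<omega> s powr p * s) \<partial>lebesgue) \<le> (\<integral>\<^sup>+s\<in>{0..<r}. f s \<partial>lebesgue)"
    proof (rule nn_integral_mono_AE)
      have "AE s in lebesgue. s \<noteq> r" by (rule AE_completion, rule AE_lborel_singleton)
      then show "AE s in lebesgue. ennreal (\<nu> s / tail \<omega> s powr p * s) * indicator {0..r} s \<le> f s * indicator {0..<r} s"
      proof eventually_elim
        case (elim s)
        show ?case
        proof (cases "0 \<le> s \<and> s \<le> r")
          case True
          have "0 \<le> \<nu> s" using True r rn by (auto simp: radial_weight_def)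
          then have "\<nu> s / tail \<omega> s powr p * s \<le> \<nu> s / tail \<omega> s powr p * 1"
            using True r by (intro mult_left_mono) auto
          then show ?thesis using True elim by (auto simp: f_def intro!: ennreal_leI)
        qed (auto simp: indicator_def)
      qed
    qed
    also have "\<dots> \<le> ennreal (B / fE r powr p)" using B(2)[of r] r by auto
    finally have "(\<integral>\<^sup>+s\<in>{0..r}. ennreal (\<nu> s / tail \<omega> s powr p * s) \<partial>lebesgue) + 1 \<le> ennreal (B / fE r powr p) + 1"
      by (rule add_right_mono)
    also have "\<dots> = ennreal (B / fE r powr p + 1)" using B(1) by (simp add: ennreal_plus)
    also have "\<dots> \<le> ennreal (c / fE r powr p)"
      using mono[of 0 r] r Er by (intro ennreal_leI) (simp add: c_def add_divide_distrib)
    finally have "((\<integral>\<^sup>+s\<in>{0..r}. ennreal (\<nu> s / tail \<omega> s powr p * s) \<partial>lebesgue) + 1) epowr (1 / p) \<le> ennreal (c / fE r powr p) epowr (1 / p)"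
      using p by (intro epowr_mono) auto
    also have "\<dots> = ennreal (c powr (1 / p) / fE r)"
      using B(1) p Er by (simp add: epowr_ennreal c_def powr_divide powr_powr)
    finally have "((\<integral>\<^sup>+s\<in>{0..r}. ennreal (\<nu> s / tail \<omega> s powr p * s) \<partial>lebesgue) + 1) epowr (1 / p) * sigma_tail p \<omega> \<nu> r epowr (1 / q)
        \<le> ennreal (c powr (1 / p) / fE r) * ennreal (fE r)"
      using r by (intro mult_mono) (auto simp: ennreal_sg[symmetric] epowr_ennreal fE_def)
    also have "\<dots> = ennreal (c powr (1 / p))" using Er by (simp add: ennreal_mult'[symmetric])
    finally show "((\<integral>\<^sup>+s\<in>{0..r}. ennreal (\<nu> s / tail \<omega> s powr p * s) \<partial>lebesgue) + 1) epowr (1 / p) * sigma_tail p \<omega> \<nu> r epowr (1 / q)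
        \<le> ennreal (c powr (1 / p))" .
  qed
  then show ?thesis by (simp add: le_less_trans)
qed

end

context two_weights
begin

text \<open>Decay of \<open>\<nu>\<close> makes \<open>tail \<nu> r\<close> at most a multiple of
  the mass of \<open>\<nu>\<close> on the annulus from \<open>a = 1 - K * (1 - r)\<close> to
  \<open>r\<close>, and there \<open>tail \<omega>\<close> is comparable to
  \<open>tail \<omega> r\<close> by doubling. Hence the integral in \<open>M_const\<close> dominates
  a multiple of \<open>tail \<nu> r / tail \<omega> r powr p\<close> for \<open>r\<close> near
  1.\<close>

lemma A_const_finite_of_M_const:
  assumes wD: "\<omega> \<in> class_Dhat" and nD: "\<nu> \<in> class_Dcheck" and M: "M_const p \<omega> \<nu> < \<infinity>"
  shows "A_const p \<omega> \<nu> < \<infinity>"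
proof -
  define I where "I r = (\<integral>\<^sup>+s\<in>{0..r}. ennreal (\<nu> s / tail \<omega> s powr p * s) \<partial>lebesgue)" for r
  have trm: "(I r + 1) epowr (1 / p) * sigma_tail p \<omega> \<nu> r epowr (1 / q) \<le> M_const p \<omega> \<nu>" if "r \<in> {0<..<1}" for r
    unfolding M_const_def I_def using that by (rule SUP_upper)
  have I1: "1 \<le> (I r + 1) epowr (1 / p)" for r
    using epowr_mono[of 1 "I r + 1" "1 / p"] p epowr_ennreal[of 1 "1 / p"] by (simp add: add_increasing)
  have st: "sigma_tail p \<omega> \<nu> r \<le> M_const p \<omega> \<nu> epowr q" if r: "r \<in> {0<..<1}" for r
  proof -
    have "1 * sigma_tail p \<omega> \<nu> r epowr (1 / q) \<le> (I r + 1) epowr (1 / p) * sigma_tail p \<omega> \<nu> r epowr (1 / q)"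
      using I1 by (rule mult_right_mono) simp
    also have "\<dots> \<le> M_const p \<omega> \<nu>" using trm[OF r] .
    finally have "(sigma_tail p \<omega> \<nu> r epowr (1 / q)) epowr q \<le> M_const p \<omega> \<nu> epowr q"
      using q by (intro epowr_mono) auto
    then show ?thesis using q by (simp add: epowr_epowr)
  qed
  \<comment> \<open>The supremum in \<open>M_const\<close> leaves out \<open>r = 0\<close>;
    finiteness there follows from the uniform bound for \<open>r > 0\<close> by monotone
    convergence.\<close>
  have "sigma_tail p \<omega> \<nu> 0 = (\<integral>\<^sup>+t. (SUP n. sigma_weight p \<omega> \<nu> t * indicator {1 / real (n + 2)..<1} t) \<partial>lebesgue)"
    unfolding sigma_tail_def
  proof (rule nn_integral_cong)
    fix t :: real
    show "sigma_weight p \<omega> \<nu> t * indicator {0..<1} t = (SUP n. sigma_weight p \<omega> \<nu> t * indicator {1 / real (n + 2)..<1} t)"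
    proof (cases "0 < t \<and> t < 1")
      case True
      obtain n where n: "1 / t < real n" using reals_Archimedean2 by blast
      have "1 / real (n + 2) \<le> t" using n True by (simp add: field_simps)
      show ?thesis
      proof (rule antisym)
        show "sigma_weight p \<omega> \<nu> t * indicator {0..<1} t \<le> (SUP n. sigma_weight p \<omega> \<nu> t * indicator {1 / real (n + 2)..<1} t)"
          using True \<open>1 / real (n + 2) \<le> t\<close> by (intro SUP_upper2[of n]) (auto simp: indicator_def)
        show "(SUP n. sigma_weight p \<omega> \<nu> t * indicator {1 / real (n + 2)..<1} t) \<le> sigma_weight p \<omega> \<nu> t * indicator {0..<1} t"
          using True by (intro SUP_least) (auto simp: indicator_def)
      qed
    next
      case False
      have "sigma_weight p \<omega> \<nu> t * indicator {0..<1} t = 0"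
      proof (cases "t = 0")
        case True
        then show ?thesis by (simp add: sigma_weight_def)
      next
        case f: False
        then show ?thesis using False by (auto simp: indicator_def)
      qed
      moreover have "indicator {1 / real (n + 2)..<1} t = (0::ennreal)" for n
      proof -
        have "0 < 1 / real (n + 2)" by simp
        then have "t < 1 / real (n + 2) \<or> 1 \<le> t" using False by linarith
        then have "t \<notin> {1 / real (n + 2)..<1}" by (auto simp del: of_nat_add)
        then show ?thesis by (simp add: indicator_def)
      qed
      ultimately show ?thesis by simp
    qed
  qed
  also have "\<dots> = (SUP n. (\<integral>\<^sup>+t. sigma_weight p \<omega> \<nu> t * indicator {1 / real (n + 2)..<1} t \<partial>lebesgue))"
  proof (rule nn_integral_monotone_convergence_SUP)
    show "incseq (\<lambda>n t. sigma_weight p \<omega> \<nu> t * indicator {1 / real (n + 2)..<1} t)"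
    proof (intro incseq_SucI le_funI mult_left_mono)
      fix n t
      have "1 / real (Suc n + 2) \<le> 1 / real (n + 2)" by (intro divide_left_mono) auto
      then show "indicator {1 / real (n + 2)..<1} t \<le> (indicator {1 / real (Suc n + 2)..<1} t :: ennreal)"
        by (auto simp: indicator_def simp del: of_nat_add of_nat_Suc)
    qed simp
    show "(\<lambda>t. sigma_weight p \<omega> \<nu> t * indicator {1 / real (n + 2)..<1} t) \<in> borel_measurable lebesgue" for n
      by (rule restrict_measurable[OF sigma_measurable]) auto
  qed
  also have "\<dots> \<le> M_const p \<omega> \<nu> epowr q"
    using st by (intro SUP_least) (auto simp: sigma_tail_def[symmetric] simp del: of_nat_add)
  finally have sf: "sigma_tail p \<omega> \<nu> 0 < \<infinity>" using M by (auto simp: infinity_ennreal_def intro: le_less_trans)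
  then interpret two_weights_fin p \<omega> \<nu> by unfold_locales
  obtain K C where K: "K > 1" "C > 1" "\<And>r. 0 \<le> r \<Longrightarrow> r < 1 \<Longrightarrow> tail \<nu> r \<ge> C * tail \<nu> (1 - (1 - r) / K)"
    using nD by (auto simp: class_Dcheck_def)
  obtain Cw where Cw: "Cw \<ge> 1" "\<And>r s. 0 \<le> r \<Longrightarrow> r < 1 \<Longrightarrow> 1 - r \<le> K * (1 - s) \<Longrightarrow> 0 \<le> s \<Longrightarrow> tail \<omega> r \<le> Cw * tail \<omega> s"
    using Dhat_ratio[OF wD less_imp_le[OF K(1)]] by blast
  define m where "m = enn2real (M_const p \<omega> \<nu>)"
  have m: "M_const p \<omega> \<nu> = ennreal m" "0 \<le> m" using M by (auto simp: m_def)
  \<comment> \<open>Here 2 comes from \<open>t \<ge> 1/2\<close> in the integrand, \<open>Cw\<close>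
    from doubling of \<open>\<omega>\<close>, and \<open>C - 1\<close> from the drop of
    \<open>tail \<nu>\<close> across the annulus.\<close>
  define c where "c = 2 * Cw powr p / (C - 1)"
  have c: "0 < c" using K(2) Cw(1) by (simp add: c_def)
  \<comment> \<open>From \<open>r1\<close> on, the inner radius \<open>a\<close> of the annulus is
    at least \<open>1/2\<close>.\<close>
  define r1 where "r1 = 1 - 1 / (2 * K)"
  have r1: "0 < r1" "r1 < 1" using K(1) by (auto simp: r1_def)
  have big: "fN r * fE r \<le> (c powr (1 / p) * m) * tail \<omega> r" if r: "r1 \<le> r" "r < 1" for r
  proof -
    have r0: "r \<in> {0<..<1}" using r r1 by auto
    define a where "a = 1 - K * (1 - r)"
    have ra: "1 - (1 - a) / K = r" using K(1) by (simp add: a_def)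
    have "K * (1 - r) \<le> K * (1 / (2 * K))" using r K(1) by (intro mult_left_mono) (auto simp: r1_def)
    then have a1: "1/2 \<le> a" using K(1) by (simp add: a_def)
    have "1 * (1 - r) \<le> K * (1 - r)" using K(1) r by (intro mult_right_mono) auto
    then have a2: "a \<le> r" by (simp add: a_def)
    have ta: "0 < tail \<omega> a" "0 < tail \<omega> r" using tail_pos[OF rw] a1 a2 r r1 by auto
    have "C * tail \<nu> r \<le> tail \<nu> a" using K(3)[of a] ra a1 a2 r by auto
    then have d: "(C - 1) * tail \<nu> r \<le> tail \<nu> a - tail \<nu> r" by (simp add: algebra_simps)
    have tw: "tail \<omega> a \<le> Cw * tail \<omega> r" using a1 a2 r by (intro Cw(2)) (auto simp: a_def)
    have "ennreal (1 / (2 * tail \<omega> a powr p) * (tail \<nu> a - tail \<nu> r)) = ennreal (1 / (2 * tail \<omega> a powr p)) * (\<integral>\<^sup>+t\<in>{a..<r}. ennreal (\<nu> t) \<partial>lebesgue)"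
      using a1 a2 r rn by (simp add: weight_split ennreal_mult'[symmetric])
    also have "\<dots> = (\<integral>\<^sup>+t. ennreal (1 / (2 * tail \<omega> a powr p)) * (ennreal (\<nu> t) * indicator {a..<r} t) \<partial>lebesgue)"
      by (rule nn_integral_cmult[symmetric], rule restrict_measurable[OF radial_weight_measurable[OF rn]]) (use a1 r in auto)
    also have "\<dots> \<le> I r"
      unfolding I_def
    proof (intro nn_integral_mono)
      fix t
      show "ennreal (1 / (2 * tail \<omega> a powr p)) * (ennreal (\<nu> t) * indicator {a..<r} t) \<le> ennreal (\<nu> t / tail \<omega> t powr p * t) * indicator {0..r} t"
      proof (cases "t \<in> {a..<r}")
        case True
        then have t: "1/2 \<le> t" "t < 1" "a \<le> t" "t < r" using a1 r by auto
        have nn: "0 \<le> \<nu> t" using t rn by (auto simp: radial_weight_def)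
        have tt: "0 < tail \<omega> t" "tail \<omega> t \<le> tail \<omega> a" using tail_pos[OF rw, of t] tail_antimono[OF rw, of a t] t a1 by auto
        then have "tail \<omega> t powr p \<le> tail \<omega> a powr p" using p by (intro powr_mono2) auto
        then have "1 / tail \<omega> a powr p \<le> 1 / tail \<omega> t powr p" using tt ta by (intro divide_left_mono) auto
        then have "(1 / tail \<omega> a powr p) * (1 / 2) \<le> (1 / tail \<omega> t powr p) * t" using t by (intro mult_mono) auto
        then have "((1 / tail \<omega> a powr p) * (1 / 2)) * \<nu> t \<le> ((1 / tail \<omega> t powr p) * t) * \<nu> t" using nn by (rule mult_right_mono)
        then have "1 / (2 * tail \<omega> a powr p) * \<nu> t \<le> \<nu> t / tail \<omega> t powr p * t" by (simp add: mult_ac)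
        then have "ennreal (1 / (2 * tail \<omega> a powr p)) * ennreal (\<nu> t) \<le> ennreal (\<nu> t / tail \<omega> t powr p * t)"
          by (subst ennreal_mult'[symmetric]) (auto intro: ennreal_leI)
        then show ?thesis using True a1 by simp
      qed simp
    qed
    finally have Ir: "ennreal (1 / (2 * tail \<omega> a powr p) * (tail \<nu> a - tail \<nu> r)) \<le> I r" .
    have "tail \<nu> r / tail \<omega> r powr p = c * (1 / (2 * (Cw * tail \<omega> r) powr p) * ((C - 1) * tail \<nu> r))"
      using K(2) Cw(1) ta by (simp add: c_def powr_mult)
    also have "\<dots> \<le> c * (1 / (2 * tail \<omega> a powr p) * (tail \<nu> a - tail \<nu> r))"
    proof (intro mult_left_mono mult_mono d)
      have "tail \<omega> a powr p \<le> (Cw * tail \<omega> r) powr p" using tw ta p by (intro powr_mono2) auto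
      then show "1 / (2 * (Cw * tail \<omega> r) powr p) \<le> 1 / (2 * tail \<omega> a powr p)"
        using ta Cw(1) by (intro divide_left_mono) auto
    qed (use c K(2) tail_pos[OF rn, of r] r r1 in auto)
    finally have "ennreal (tail \<nu> r / tail \<omega> r powr p) \<le> ennreal (c * (1 / (2 * tail \<omega> a powr p) * (tail \<nu> a - tail \<nu> r)))"
      by (rule ennreal_leI)
    also have "\<dots> = ennreal c * ennreal (1 / (2 * tail \<omega> a powr p) * (tail \<nu> a - tail \<nu> r))" using c by (intro ennreal_mult') auto
    also have "\<dots> \<le> ennreal c * (I r + 1)" using Ir by (intro mult_left_mono) (auto intro: order_trans)
    finally have "ennreal (tail \<nu> r / tail \<omega> r powr p) epowr (1 / p) \<le> (ennreal c * (I r + 1)) epowr (1 / p)"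
      using p by (intro epowr_mono) auto
    also have "\<dots> = ennreal (c powr (1 / p)) * (I r + 1) epowr (1 / p)" using p c by (intro epowr_mult) auto
    finally have e: "ennreal (tail \<nu> r / tail \<omega> r powr p) epowr (1 / p) \<le> ennreal (c powr (1 / p)) * (I r + 1) epowr (1 / p)" .
    have "ennreal (tail \<nu> r / tail \<omega> r powr p) epowr (1 / p) = ennreal (fN r / tail \<omega> r)"
      using ta p tail_pos[OF rn, of r] r r1 by (simp add: epowr_ennreal fN_def powr_divide powr_powr)
    then have "ennreal (fN r / tail \<omega> r) * ennreal (fE r) \<le> (ennreal (c powr (1 / p)) * (I r + 1) epowr (1 / p)) * sigma_tail p \<omega> \<nu> r epowr (1 / q)"
      using e r0 by (intro mult_mono) (auto simp: ennreal_sg[symmetric] epowr_ennreal fE_def)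
    also have "\<dots> \<le> ennreal (c powr (1 / p)) * ennreal m"
      using trm[OF r0] m by (simp add: mult.assoc mult_left_mono)
    finally have "ennreal (fN r / tail \<omega> r * fE r) \<le> ennreal (c powr (1 / p) * m)"
      using ta m by (simp add: ennreal_mult[symmetric] fN_def fE_def)
    then have "fN r / tail \<omega> r * fE r \<le> c powr (1 / p) * m" using m by (subst (asm) ennreal_le_iff) auto
    then show ?thesis using ta by (simp add: field_simps)
  qed
  \<comment> \<open>Below \<open>r1\<close> the product \<open>fN * fE\<close> is at most its value
    at 0 and \<open>tail \<omega>\<close> is at least its value at \<open>r1\<close>.\<close>
  define A where "A = max (c powr (1 / p) * m) (fN 0 * fE 0 / tail \<omega> r1)"
  have "fN r * fE r \<le> A * tail \<omega> r" if r: "0 \<le> r" "r < 1" for r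
  proof (cases "r1 \<le> r")
    case True
    have "(c powr (1 / p) * m) * tail \<omega> r \<le> A * tail \<omega> r"
      using tail_pos[OF rw r] by (intro mult_right_mono) (auto simp: A_def)
    then show ?thesis using big[OF True r(2)] by simp
  next
    case False
    have t: "0 < tail \<omega> r1" "tail \<omega> r1 \<le> tail \<omega> r" using tail_pos[OF rw, of r1] tail_antimono[OF rw, of r r1] r1 False r by auto
    have "fN r * fE r \<le> fN 0 * fE 0"
      using r fN_pos[of 0] fE_pos[of r] by (intro mult_mono fN_antimono fE_antimono) auto
    also have "\<dots> = (fN 0 * fE 0 / tail \<omega> r1) * tail \<omega> r1" using t by simp
    also have "\<dots> \<le> A * tail \<omega> r"
      using t fN_pos[of 0] fE_pos[of 0] by (intro mult_mono) (auto simp: A_def le_max_iff_disj)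
    finally show ?thesis .
  qed
  moreover have "0 < A" using fN_pos[of 0] fE_pos[of 0] tail_pos[OF rw, of r1] r1 by (auto simp: A_def less_max_iff_disj)
  ultimately show ?thesis unfolding A_const_finite_iff using sf by auto
qed

end

section \<open>Integral operators on the disc\<close>

text \<open>Finiteness of the measure provides the sigma-finiteness behind Fubini's theorem and
  behind the measurability of parametrised integrals on the disc.\<close>

lemma emeasure_disc_area: "emeasure disc_area (space disc_area) = 1"
proof -
  have "emeasure disc_area (space disc_area) = (\<integral>\<^sup>+z. 1 \<partial>disc_area)" by simp
  also have "\<dots> = (\<integral>\<^sup>+t\<in>{0..<1}. ennreal (2 * t) * 1 \<partial>lebesgue)"
    by (rule nn_integral_radial) (auto intro!: borel_measurable_indicator)
  also have "\<dots> = (\<integral>\<^sup>+t\<in>{0..<1}. ennreal (2 * t) \<partial>lborel)"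
    by (simp add: nn_integral_completion)
  also have "\<dots> = (\<integral>\<^sup>+t\<in>{0..1}. ennreal (2 * t) \<partial>lborel)"
    using AE_lborel_singleton[of "1::real"] by (intro nn_integral_cong_AE) (auto simp: indicator_def elim!: eventually_mono)
  also have "\<dots> = ennreal (1^2 - 0^2)"
    by (intro nn_integral_FTC_Icc) (auto intro!: derivative_eq_intros)
  finally show ?thesis by simp
qed

interpretation disc: finite_measure disc_area
  by (rule finite_measureI) (use emeasure_disc_area in simp)

interpretation disc_pair: pair_sigma_finite disc_area disc_area ..

lemma id_disc_measurable [measurable]: "(\<lambda>z. z) \<in> borel_measurable disc_area"
  by (rule borel_measurable_disc_areaI) simp

lemma radial_real_measurable:
  fixes g :: "real \<Rightarrow> real"
  assumes "(\<lambda>t. g t * indicator {0..<1} t) \<in> borel_measurable lebesgue"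
  shows "(\<lambda>z. g (cmod z)) \<in> borel_measurable disc_area"
proof -
  have "(\<lambda>z. g (cmod z) * indicator {0..<1} (cmod z)) \<in> borel_measurable (lebesgue_on (ball 0 1))"
    by (intro measurable_restrict_space1 measurable_compose[OF cmod_measurable_lebesgue assms])
  then show ?thesis unfolding measurable_disc_area_iff
    by (rule measurable_cong[THEN iffD1, rotated]) (auto simp: indicator_def)
qed

lemma bker_cnj:
  assumes "\<omega> \<in> class_Dhat" "cmod w < 1"
  shows "bker \<omega> (cnj w) = cnj (bker \<omega> w)"
proof -
  have "summable (\<lambda>n. complex_of_real (bcoef \<omega> n) * w ^ n)"
    using bker_summable_norm[OF assms] by (rule summable_norm_cancel)
  then have "(\<lambda>n. complex_of_real (bcoef \<omega> n) * w ^ n) sums bker \<omega> w" unfolding bker_def by (rule summable_sums)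
  then have "(\<lambda>n. cnj (complex_of_real (bcoef \<omega> n) * w ^ n)) sums cnj (bker \<omega> w)" by (simp only: sums_cnj)
  then show ?thesis unfolding bker_def by (simp add: sums_iff)
qed

lemma Lp_space_iff:
  "f \<in> Lp_space p \<nu> \<longleftrightarrow> f \<in> borel_measurable disc_area \<and> (\<integral>\<^sup>+z. ennreal (cmod (f z) powr p * \<nu> (cmod z)) \<partial>disc_area) < \<infinity>"
  by (simp add: Lp_space_def Lp_norm_def)

lemma Lp_norm_mono:
  assumes "0 < p" "\<And>t. 0 \<le> t \<Longrightarrow> t < 1 \<Longrightarrow> 0 \<le> \<nu> t" "\<And>z. z \<in> ball 0 1 \<Longrightarrow> cmod (f z) \<le> cmod (g z)"
  shows "Lp_norm p \<nu> f \<le> Lp_norm p \<nu> g"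
  unfolding Lp_norm_def
proof (intro epowr_mono nn_integral_mono)
  fix z assume "z \<in> space disc_area"
  then have z: "z \<in> ball 0 1" by simp
  then show "ennreal (cmod (f z) powr p * \<nu> (cmod z)) \<le> ennreal (cmod (g z) powr p * \<nu> (cmod z))"
    using assms z by (intro ennreal_leI mult_right_mono powr_mono2) auto
qed (use assms in auto)

lemma Lp_norm_cong:
  assumes "\<And>z. z \<in> ball 0 1 \<Longrightarrow> cmod (f z) = cmod (g z)"
  shows "Lp_norm p \<nu> f = Lp_norm p \<nu> g"
proof -
  have "(\<integral>\<^sup>+z. ennreal (cmod (f z) powr p * \<nu> (cmod z)) \<partial>disc_area) = (\<integral>\<^sup>+z. ennreal (cmod (g z) powr p * \<nu> (cmod z)) \<partial>disc_area)"
    using assms by (intro nn_integral_cong) auto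
  then show ?thesis by (simp add: Lp_norm_def)
qed

context two_weights
begin

lemma nonneg [simp]: "0 \<le> t \<Longrightarrow> t < 1 \<Longrightarrow> 0 \<le> \<omega> t" "0 \<le> t \<Longrightarrow> t < 1 \<Longrightarrow> 0 \<le> \<nu> t"
  using rw rn by (auto simp: radial_weight_def)

lemma omega_disc_measurable [measurable]: "(\<lambda>z. \<omega> (cmod z)) \<in> borel_measurable disc_area"
  by (intro radial_real_measurable weight_measurable_real rw)

lemma nu_disc_measurable [measurable]: "(\<lambda>z. \<nu> (cmod z)) \<in> borel_measurable disc_area"
  by (intro radial_real_measurable weight_measurable_real rn)

lemma integral_op_measurable:
  fixes k :: "complex \<Rightarrow> complex \<Rightarrow> complex"
  assumes [measurable]: "f \<in> borel_measurable disc_area"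
    and k: "(\<lambda>(z, \<zeta>). k z \<zeta>) \<in> borel_measurable (borel \<Otimes>\<^sub>M borel)"
  shows "integral_op \<omega> k f \<in> borel_measurable disc_area"
proof -
  have [measurable]: "(\<lambda>x. k (fst x) (snd x)) \<in> borel_measurable (disc_area \<Otimes>\<^sub>M disc_area)"
  proof -
    have "(\<lambda>x. (fst x, snd x)) \<in> disc_area \<Otimes>\<^sub>M disc_area \<rightarrow>\<^sub>M borel \<Otimes>\<^sub>M borel" by measurable
    from measurable_compose[OF this k] show ?thesis by simp
  qed
  show ?thesis unfolding integral_op_def[abs_def]
    by (rule disc.borel_measurable_lebesgue_integral) (simp add: split_beta')
qed

lemma bergman_kernel_pair_measurable:
  "(\<lambda>(z, \<zeta>). cnj (bergman_kernel \<omega> z \<zeta>)) \<in> borel_measurable (borel \<Otimes>\<^sub>M borel)"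
  "(\<lambda>(z, \<zeta>). complex_of_real (cmod (bergman_kernel \<omega> z \<zeta>))) \<in> borel_measurable (borel \<Otimes>\<^sub>M borel)"
proof -
  have [measurable]: "cnj \<in> borel_measurable borel"
    by (intro borel_measurable_continuous_onI continuous_intros)
  show "(\<lambda>(z, \<zeta>). cnj (bergman_kernel \<omega> z \<zeta>)) \<in> borel_measurable (borel \<Otimes>\<^sub>M borel)"
    "(\<lambda>(z, \<zeta>). complex_of_real (cmod (bergman_kernel \<omega> z \<zeta>))) \<in> borel_measurable (borel \<Otimes>\<^sub>M borel)"
    unfolding bergman_kernel_eq by measurable
qed

lemma Lp_norm_of_norm:
  "Lp_norm p \<nu> (\<lambda>z. complex_of_real (cmod (f z))) = Lp_norm p \<nu> f"
  by (intro Lp_norm_cong) simp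

lemma Lp_space_of_norm:
  "f \<in> Lp_space p \<nu> \<Longrightarrow> (\<lambda>z. complex_of_real (cmod (f z))) \<in> Lp_space p \<nu>"
  using Lp_norm_of_norm[of f] unfolding Lp_space_def by auto

text \<open>Boundedness of the maximal projection is applied to \<open>\<bar>f\<bar>\<close>: its
  integrand is then the modulus of the integrand of the Bergman projection of \<open>f\<close>,
  which gives both convergence and domination.\<close>

lemma norm_bergman_proj_le:
  assumes "max_bergman_proj_bounded p \<omega> \<nu>" "f \<in> Lp_space p \<nu>" "z \<in> ball 0 1"
  shows "integrable disc_area (\<lambda>\<zeta>. f \<zeta> * cnj (bergman_kernel \<omega> z \<zeta>) * complex_of_real (\<omega> (cmod \<zeta>)))"
    "cmod (bergman_proj \<omega> f z) \<le> cmod (max_bergman_proj \<omega> (\<lambda>z. complex_of_real (cmod (f z))) z)"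
proof -
  let ?g = "\<lambda>\<zeta>. complex_of_real (cmod (f \<zeta>)) * complex_of_real (cmod (bergman_kernel \<omega> z \<zeta>)) * complex_of_real (\<omega> (cmod \<zeta>))"
  have i: "integrable disc_area ?g"
    using assms Lp_space_of_norm[OF assms(2)] unfolding max_bergman_proj_bounded_def integral_op_bounded_def by auto
  have [measurable]: "f \<in> borel_measurable disc_area" using assms(2) by (simp add: Lp_space_def)
  have [measurable]: "(\<lambda>\<zeta>. bergman_kernel \<omega> z \<zeta>) \<in> borel_measurable disc_area"
    unfolding bergman_kernel_eq by measurable
  have [measurable]: "cnj \<in> borel_measurable borel"
    by (intro borel_measurable_continuous_onI continuous_intros)
  have eq: "cmod (f \<zeta> * cnj (bergman_kernel \<omega> z \<zeta>) * complex_of_real (\<omega> (cmod \<zeta>))) = cmod (?g \<zeta>)" for \<zeta>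
    by (simp add: norm_mult)
  show i': "integrable disc_area (\<lambda>\<zeta>. f \<zeta> * cnj (bergman_kernel \<omega> z \<zeta>) * complex_of_real (\<omega> (cmod \<zeta>)))"
    by (rule Bochner_Integration.integrable_bound[OF i]) (auto simp: eq)
  define h where "h \<zeta> = cmod (f \<zeta>) * cmod (bergman_kernel \<omega> z \<zeta>) * \<omega> (cmod \<zeta>)" for \<zeta>
  have gh: "?g = (\<lambda>\<zeta>. complex_of_real (h \<zeta>))" by (simp add: h_def)
  have "cmod (bergman_proj \<omega> f z) \<le> (LINT \<zeta>|disc_area. cmod (f \<zeta> * cnj (bergman_kernel \<omega> z \<zeta>) * complex_of_real (\<omega> (cmod \<zeta>))))"
    unfolding bergman_proj_def integral_op_def by (rule integral_norm_bound)
  also have "\<dots> = (LINT \<zeta>|disc_area. h \<zeta>)"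
    by (intro Bochner_Integration.integral_cong) (auto simp: h_def norm_mult)
  also have "\<dots> \<le> cmod (complex_of_real (LINT \<zeta>|disc_area. h \<zeta>))" by simp
  also have "complex_of_real (LINT \<zeta>|disc_area. h \<zeta>) = max_bergman_proj \<omega> (\<lambda>z. complex_of_real (cmod (f z))) z"
    unfolding max_bergman_proj_def integral_op_def gh by (rule integral_complex_of_real[symmetric])
  finally show "cmod (bergman_proj \<omega> f z) \<le> cmod (max_bergman_proj \<omega> (\<lambda>z. complex_of_real (cmod (f z))) z)" .
qed

lemma Lp_norm_bergman_proj_le:
  assumes "max_bergman_proj_bounded p \<omega> \<nu>" "f \<in> Lp_space p \<nu>"
  shows "Lp_norm p \<nu> (bergman_proj \<omega> f) \<le> Lp_norm p \<nu> (max_bergman_proj \<omega> (\<lambda>z. complex_of_real (cmod (f z))))"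
  using p norm_bergman_proj_le(2)[OF assms] by (intro Lp_norm_mono) auto

lemma bergman_proj_bounded_of_max:
  assumes "max_bergman_proj_bounded p \<omega> \<nu>"
  shows "bergman_proj_bounded p \<omega> \<nu>"
  unfolding bergman_proj_bounded_def integral_op_bounded_def
proof (intro conjI ballI)
  fix f z assume "f \<in> Lp_space p \<nu>" "z \<in> ball (0::complex) 1"
  then show "integrable disc_area (\<lambda>\<zeta>. f \<zeta> * cnj (bergman_kernel \<omega> z \<zeta>) * complex_of_real (\<omega> (cmod \<zeta>)))"
    using norm_bergman_proj_le(1)[OF assms] by auto
next
  fix f assume f: "f \<in> Lp_space p \<nu>"
  have "max_bergman_proj \<omega> (\<lambda>z. complex_of_real (cmod (f z))) \<in> Lp_space p \<nu>"
    using assms Lp_space_of_norm[OF f] unfolding max_bergman_proj_bounded_def integral_op_bounded_def max_bergman_proj_def by auto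
  then have "Lp_norm p \<nu> (bergman_proj \<omega> f) < \<infinity>"
    using le_less_trans[OF Lp_norm_bergman_proj_le[OF assms f]] by (simp add: Lp_space_def)
  moreover have "bergman_proj \<omega> f \<in> borel_measurable disc_area"
    unfolding bergman_proj_def using f by (intro integral_op_measurable bergman_kernel_pair_measurable) (simp add: Lp_space_def)
  ultimately show "integral_op \<omega> (\<lambda>z \<zeta>. cnj (bergman_kernel \<omega> z \<zeta>)) f \<in> Lp_space p \<nu>"
    by (simp add: Lp_space_def bergman_proj_def)
next
  obtain C where C: "C \<ge> 0" "\<And>f. f \<in> Lp_space p \<nu> \<Longrightarrow> Lp_norm p \<nu> (max_bergman_proj \<omega> f) \<le> ennreal C * Lp_norm p \<nu> f"
    using assms unfolding max_bergman_proj_bounded_def integral_op_bounded_def max_bergman_proj_def by auto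
  have "Lp_norm p \<nu> (bergman_proj \<omega> f) \<le> ennreal C * Lp_norm p \<nu> f" if f: "f \<in> Lp_space p \<nu>" for f
    using Lp_norm_bergman_proj_le[OF assms f] C(2)[OF Lp_space_of_norm[OF f]] by (simp add: Lp_norm_of_norm)
  then show "\<exists>C\<ge>0. \<forall>f\<in>Lp_space p \<nu>. Lp_norm p \<nu> (integral_op \<omega> (\<lambda>z \<zeta>. cnj (bergman_kernel \<omega> z \<zeta>)) f) \<le> ennreal C * Lp_norm p \<nu> f"
    using C(1) unfolding bergman_proj_def by blast
qed

lemma Lp_opnorm_bergman_le:
  assumes "max_bergman_proj_bounded p \<omega> \<nu>"
  shows "Lp_opnorm p \<nu> (bergman_proj \<omega>) \<le> Lp_opnorm p \<nu> (max_bergman_proj \<omega>)"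
  unfolding Lp_opnorm_def
proof (rule SUP_least)
  fix f assume "f \<in> {f \<in> Lp_space p \<nu>. Lp_norm p \<nu> f \<le> 1}"
  then have f: "f \<in> Lp_space p \<nu>" "Lp_norm p \<nu> f \<le> 1" by auto
  show "Lp_norm p \<nu> (bergman_proj \<omega> f) \<le> (SUP f\<in>{f \<in> Lp_space p \<nu>. Lp_norm p \<nu> f \<le> 1}. Lp_norm p \<nu> (max_bergman_proj \<omega> f))"
    using Lp_norm_bergman_proj_le[OF assms f(1)] Lp_space_of_norm[OF f(1)] f(2)
    by (intro SUP_upper2[of "\<lambda>z. complex_of_real (cmod (f z))"]) (auto simp: Lp_norm_of_norm)
qed

end

section \<open>Sufficiency: a Schur test\<close>

text \<open>Turns the circle bound into a kernel in \<open>min (cmod w) t\<close>, the form that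
  \<open>schur_radial\<close> integrates. The radius \<open>cmod w * t\<close> lies below the
  minimum, and \<open>1 / tail \<omega>\<close> increases; the factor \<open>1 / pi\<close> is
  estimated by 1.\<close>

lemma nn_integral_kernel_le:
  fixes g :: "real \<Rightarrow> ennreal"
  assumes g: "(\<lambda>t. g t * indicator {0..<1} t) \<in> borel_measurable lebesgue"
    and A0: "0 \<le> A0" "\<And>x. 0 \<le> x \<Longrightarrow> x < 1 \<Longrightarrow> circ (\<lambda>u. ennreal (cmod (bker \<omega> u))) (of_real x) \<le> ennreal (A0 / tail \<omega> x)"
    and rw: "radial_weight \<omega>"
    and w: "cmod w < 1"
  shows "(\<integral>\<^sup>+\<zeta>. g (cmod \<zeta>) * ennreal (cmod (bker \<omega> (w * \<zeta>))) \<partial>disc_area)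
    \<le> (\<integral>\<^sup>+t\<in>{0..<1}. ennreal (t * A0 / tail \<omega> (min (cmod w) t)) * g t \<partial>lebesgue)"
proof -
  have "(\<integral>\<^sup>+\<zeta>. g (cmod \<zeta>) * ennreal (cmod (bker \<omega> (w * \<zeta>))) \<partial>disc_area)
     = (\<integral>\<^sup>+t\<in>{0..<1}. ennreal (t / pi) * (g t * circ (\<lambda>u. ennreal (cmod (bker \<omega> u))) (complex_of_real (cmod w * t))) \<partial>lebesgue)"
    by (rule nn_integral_kernel_radial[OF g, where K = "\<lambda>u. ennreal (cmod (bker \<omega> u))"]) measurable
  also have "\<dots> \<le> (\<integral>\<^sup>+t\<in>{0..<1}. ennreal (t * A0 / tail \<omega> (min (cmod w) t)) * g t \<partial>lebesgue)"
  proof (rule nn_integral_mono)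
    fix t
    show "ennreal (t / pi) * (g t * circ (\<lambda>u. ennreal (cmod (bker \<omega> u))) (complex_of_real (cmod w * t))) * indicator {0..<1} t
      \<le> ennreal (t * A0 / tail \<omega> (min (cmod w) t)) * g t * indicator {0..<1} t"
    proof (cases "t \<in> {0..<1}")
      case True
      have le: "cmod w * t \<le> min (cmod w) t" using True w by (auto simp: mult_left_le mult_left_le_one_le)
      have nn: "0 \<le> cmod w * t" using True by simp
      have m1: "min (cmod w) t < 1" using w by auto
      then have lt: "cmod w * t < 1" using le by linarith
      have tp: "0 < tail \<omega> (min (cmod w) t)" using True w by (intro tail_pos[OF rw]) auto
      have "circ (\<lambda>u. ennreal (cmod (bker \<omega> u))) (complex_of_real (cmod w * t)) \<le> ennreal (A0 / tail \<omega> (cmod w * t))"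
        by (rule A0(2)[OF nn lt])
      also have "\<dots> \<le> ennreal (A0 / tail \<omega> (min (cmod w) t))"
        using tail_antimono[OF rw nn le] tp A0(1) by (intro ennreal_leI divide_left_mono) (auto intro: mult_pos_pos)
      finally have "ennreal (t / pi) * (g t * circ (\<lambda>u. ennreal (cmod (bker \<omega> u))) (complex_of_real (cmod w * t)))
         \<le> ennreal (t / pi) * (g t * ennreal (A0 / tail \<omega> (min (cmod w) t)))"
        by (intro mult_left_mono) auto
      also have "\<dots> = ennreal (t / pi * (A0 / tail \<omega> (min (cmod w) t))) * g t"
        using True A0(1) tp by (subst ennreal_mult) (auto simp: mult_ac)
      also have "\<dots> \<le> ennreal (t * A0 / tail \<omega> (min (cmod w) t)) * g t"
      proof (intro mult_right_mono ennreal_leI)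
        have "t / pi \<le> t / 1" using True pi_gt3 by (intro divide_left_mono) auto
        then have "t / pi * (A0 / tail \<omega> (min (cmod w) t)) \<le> t / 1 * (A0 / tail \<omega> (min (cmod w) t))"
          using A0(1) tp by (intro mult_right_mono) auto
        then show "t / pi * (A0 / tail \<omega> (min (cmod w) t)) \<le> t * A0 / tail \<omega> (min (cmod w) t)" by simp
      qed simp
      finally show ?thesis using True by simp
    qed simp
  qed
  finally show ?thesis .
qed

context two_weights_fin
begin

definition ratio :: "real \<Rightarrow> ennreal" where
  "ratio t = ennreal (\<omega> t) / ennreal (\<nu> t powr (1 / p))"

lemma ratio_meas: "(\<lambda>t. ratio t * indicator {0..<1} t) \<in> borel_measurable lebesgue"
  unfolding ratio_def by (rule ratio_measurable)

lemma ratio_disc_measurable [measurable]: "(\<lambda>z. ratio (cmod z)) \<in> borel_measurable disc_area"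
  by (rule radial_measurable[OF ratio_meas])

lemma sigma_eq_ratio: "sigma_weight p \<omega> \<nu> t = ennreal t * ratio t epowr q"
  by (simp add: sigma_weight_def ratio_def)

text \<open>It fails only where \<open>\<nu> = 0 < \<omega>\<close>, where the right side is the
  product of 0 and infinity, which is 0; finiteness of the tail of \<open>\<sigma>\<close> makes
  this set null.\<close>

lemma omega_le_ratio: "AE z in disc_area. ennreal (\<omega> (cmod z)) \<le> ennreal (\<nu> (cmod z) powr (1 / p)) * ratio (cmod z)"
proof -
  have "AE t in lborel. t \<in> {0<..<1} \<longrightarrow> \<omega> t = 0 \<or> 0 < \<nu> t"
    using sigma_finite_AE by (simp add: AE_completion_iff)
  then have 1: "AE z in disc_area. cmod z \<in> {0<..<1} \<longrightarrow> \<omega> (cmod z) = 0 \<or> 0 < \<nu> (cmod z)"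
    by (rule AE_disc_area_cmod)
  have 2: "AE z in disc_area. cmod z \<noteq> 0"
    by (rule AE_disc_area_cmod) (rule AE_lborel_singleton)
  show ?thesis using 1 2 AE_space
  proof eventually_elim
    case (elim z)
    let ?t = "cmod z"
    have t: "0 < ?t" "?t < 1" using elim by auto
    then consider "\<omega> ?t = 0" | "0 < \<nu> ?t" using elim by auto
    then show ?case
    proof cases
      case 2
      define n where "n = \<nu> ?t powr (1 / p)"
      have n: "0 < n" using 2 by (simp add: n_def)
      have "ennreal n * ratio ?t = ennreal n * ennreal (\<omega> ?t / n)"
        unfolding ratio_def n_def[symmetric] using t n by (simp only: divide_ennreal nonneg less_imp_le)
      also have "\<dots> = ennreal (n * (\<omega> ?t / n))" using n by (intro ennreal_mult'[symmetric]) auto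
      also have "n * (\<omega> ?t / n) = \<omega> ?t" using n by simp
      finally show ?thesis by (simp add: n_def)
    qed simp
  qed
qed

text \<open>Hoelder's inequality on the whole disc. Unlike in \<open>weight_holder\<close> the
  origin causes no difficulty, because area integration itself supplies the factor \<open>t\<close>
  contained in \<open>\<sigma>\<close>.\<close>

lemma Lp_omega_integrable:
  assumes f: "f \<in> Lp_space p \<nu>"
  shows "(\<integral>\<^sup>+z. ennreal (cmod (f z) * \<omega> (cmod z)) \<partial>disc_area) < \<infinity>"
proof -
  have [measurable]: "f \<in> borel_measurable disc_area" using f by (simp add: Lp_space_def)
  define X where "X = (\<integral>\<^sup>+z. ennreal (cmod (f z) powr p * \<nu> (cmod z)) \<partial>disc_area)"
  have X: "X < \<infinity>" using f by (simp add: X_def Lp_space_iff)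
  have Y: "(\<integral>\<^sup>+z. ratio (cmod z) epowr q \<partial>disc_area) = ennreal (2 * sg 0)"
  proof -
    have m: "(\<lambda>t. ratio t epowr q * indicator {0..<1} t) \<in> borel_measurable lebesgue"
    proof -
      have "(\<lambda>t. (ratio t * indicator {0..<1} t) epowr q) \<in> borel_measurable lebesgue"
        by (intro epowr_measurable ratio_meas)
      also have "(\<lambda>t. (ratio t * indicator {0..<1} t) epowr q) = (\<lambda>t. ratio t epowr q * indicator {0..<1} t)"
        by (auto simp: indicator_def)
      finally show ?thesis .
    qed
    have "(\<integral>\<^sup>+z. ratio (cmod z) epowr q \<partial>disc_area) = (\<integral>\<^sup>+t\<in>{0..<1}. ennreal (2 * t) * ratio t epowr q \<partial>lebesgue)"
      by (rule nn_integral_radial[OF m])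
    also have "\<dots> = (\<integral>\<^sup>+t. ennreal 2 * (sigma_weight p \<omega> \<nu> t * indicator {0..<1} t) \<partial>lebesgue)"
      by (intro nn_integral_cong) (auto simp: sigma_eq_ratio indicator_def ennreal_mult' mult.assoc)
    also have "\<dots> = ennreal 2 * (\<integral>\<^sup>+t\<in>{0..<1}. sigma_weight p \<omega> \<nu> t \<partial>lebesgue)"
      by (rule nn_integral_cmult[OF sigma_measurable])
    also have "\<dots> = ennreal (2 * sg 0)" 
      using sigma_split[of 0 1] by (simp add: ennreal_mult')
    finally show ?thesis .
  qed
  have "(\<integral>\<^sup>+z. ennreal (cmod (f z) * \<omega> (cmod z)) \<partial>disc_area)
     \<le> (\<integral>\<^sup>+z. ennreal (cmod (f z) * \<nu> (cmod z) powr (1 / p)) * ratio (cmod z) \<partial>disc_area)"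
    using omega_le_ratio
  proof (rule nn_integral_mono_AE[OF eventually_mono])
    fix z assume "ennreal (\<omega> (cmod z)) \<le> ennreal (\<nu> (cmod z) powr (1 / p)) * ratio (cmod z)"
    then have "ennreal (cmod (f z)) * ennreal (\<omega> (cmod z)) \<le> ennreal (cmod (f z)) * (ennreal (\<nu> (cmod z) powr (1 / p)) * ratio (cmod z))"
      by (rule mult_left_mono) simp
    then show "ennreal (cmod (f z) * \<omega> (cmod z)) \<le> ennreal (cmod (f z) * \<nu> (cmod z) powr (1 / p)) * ratio (cmod z)"
      by (simp add: ennreal_mult' mult.assoc)
  qed
  also have "\<dots> \<le> ennreal (enn2real X powr (1 / p) * (2 * sg 0) powr (1 / q))"
  proof (rule holder_nn_integral[OF p refl])
    have "(\<integral>\<^sup>+z. ennreal (cmod (f z) * \<nu> (cmod z) powr (1 / p)) epowr p \<partial>disc_area) = X"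
      unfolding X_def
    proof (rule nn_integral_cong)
      fix z assume "z \<in> space disc_area"
      then have "0 \<le> \<nu> (cmod z)" by simp
      then show "ennreal (cmod (f z) * \<nu> (cmod z) powr (1 / p)) epowr p = ennreal (cmod (f z) powr p * \<nu> (cmod z))"
        using p by (simp add: epowr_ennreal powr_mult powr_powr)
    qed
    then show "(\<integral>\<^sup>+z. ennreal (cmod (f z) * \<nu> (cmod z) powr (1 / p)) epowr p \<partial>disc_area) \<le> ennreal ((enn2real X powr (1 / p)) powr p)"
      using X p by (simp add: powr_powr)
    show "(\<integral>\<^sup>+z. ratio (cmod z) epowr q \<partial>disc_area) \<le> ennreal (((2 * sg 0) powr (1 / q)) powr q)"
      using q by (simp add: Y powr_powr)
  qed auto
  finally show ?thesis by (simp add: le_less_trans)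
qed

end

context two_weights_A
begin

text \<open>The Schur weight is \<open>fE powr (1 / p)\<close>. Hoelder's inequality in
  \<open>\<zeta>\<close> separates \<open>X z\<close>, the integral of
  \<open>\<bar>f\<bar> powr p * \<nu> * fE\<close> against the kernel, from a factor that the first
  estimate of \<open>schur_sigma\<close> bounds by \<open>c * B / fN\<close>; raised to the power
  \<open>p / q = p - 1\<close> this yields the weight \<open>fN powr (1 - p)\<close> in
  \<open>z\<close>. After Fubini's theorem the second estimate of \<open>schur_sigma\<close>
  produces \<open>1 / fE\<close>, which cancels.\<close>

lemma schur_test:
  assumes Dc: "\<omega> \<in> class_Dcheck"
  obtains C where "0 < C" "\<And>f. f \<in> borel_measurable disc_area \<Longrightarrow>
    (\<integral>\<^sup>+z. (\<integral>\<^sup>+\<zeta>. ennreal (cmod (f \<zeta>) * cmod (bker \<omega> (cnj z * \<zeta>)) * \<omega> (cmod \<zeta>)) \<partial>disc_area) epowr p * ennreal (\<nu> (cmod z)) \<partial>disc_area)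
      \<le> ennreal C * (\<integral>\<^sup>+z. ennreal (cmod (f z) powr p * \<nu> (cmod z)) \<partial>disc_area)"
proof -
  have wcD: "\<omega> \<in> class_D" using wD Dc by (simp add: class_D_def)
  obtain A0 where A0: "A0 > 0" "\<And>x. 0 \<le> x \<Longrightarrow> x < 1 \<Longrightarrow> circ (\<lambda>u. ennreal (cmod (bker \<omega> u))) (of_real x) \<le> ennreal (A0 / tail \<omega> x)"
    using circ_bker_upper[OF wcD] by blast
  obtain B where B: "0 < B" "\<And>s. 0 \<le> s \<Longrightarrow> s < 1 \<Longrightarrow>
    (\<integral>\<^sup>+t\<in>{0..<1}. sigma_weight p \<omega> \<nu> t * ennreal (fE t powr (1 - q)) * ennreal (1 / (fE (min s t) * fN (min s t))) \<partial>lebesgue) \<le> ennreal (B / fN s)"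
    "\<And>s. 0 \<le> s \<Longrightarrow> s < 1 \<Longrightarrow>
    (\<integral>\<^sup>+t\<in>{0..<1}. ennreal (\<nu> t) * ennreal (fN t powr (1 - p)) * ennreal (1 / (fN (min s t) * fE (min s t))) \<partial>lebesgue) \<le> ennreal (B / fE s)"
    using schur_sigma[OF Dc] by blast
  define c where "c = A0 * A"
  have c: "0 < c" using A0 A by (simp add: c_def)
  \<comment> \<open>The bound on \<open>A_const\<close> replaces \<open>1 / tail \<omega>\<close> by
    the product kernel of \<open>schur_sigma\<close>.\<close>
  have inv: "A0 / tail \<omega> s \<le> c * (1 / (fE s * fN s))" if "0 \<le> s" "s < 1" for s
  proof -
    have "fN s * fE s \<le> A * tail \<omega> s" using AN that by auto
    then have "A0 * (fN s * fE s) \<le> A0 * (A * tail \<omega> s)" using A0(1) by (intro mult_left_mono) auto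
    then show ?thesis using fN_pos[OF that] fE_pos[OF that] tail_pos[OF rw that] by (simp add: c_def field_simps)
  qed
  have mE: "(\<lambda>t. ennreal (fE t powr e) * indicator {0..<1} t) \<in> borel_measurable lebesgue" for e
  proof -
    have "(\<lambda>t. ennreal ((fE t * indicator {0..<1} t) powr e)) \<in> borel_measurable lebesgue"
      by (rule measurable_compose[OF fE_measurable]) measurable
    also have "(\<lambda>t. ennreal ((fE t * indicator {0..<1} t) powr e)) = (\<lambda>t. ennreal (fE t powr e) * indicator {0..<1} t)"
      by (auto simp: indicator_def)
    finally show ?thesis .
  qed
  have mN: "(\<lambda>t. ennreal (fN t powr e) * indicator {0..<1} t) \<in> borel_measurable lebesgue" for e
  proof -
    have "(\<lambda>t. ennreal ((fN t * indicator {0..<1} t) powr e)) \<in> borel_measurable lebesgue"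
      by (rule measurable_compose[OF fN_measurable]) measurable
    also have "(\<lambda>t. ennreal ((fN t * indicator {0..<1} t) powr e)) = (\<lambda>t. ennreal (fN t powr e) * indicator {0..<1} t)"
      by (auto simp: indicator_def)
    finally show ?thesis .
  qed
  have mR: "(\<lambda>t. ratio t epowr q * indicator {0..<1} t) \<in> borel_measurable lebesgue"
  proof -
    have "(\<lambda>t. (ratio t * indicator {0..<1} t) epowr q) \<in> borel_measurable lebesgue"
      by (intro epowr_measurable ratio_meas)
    also have "(\<lambda>t. (ratio t * indicator {0..<1} t) epowr q) = (\<lambda>t. ratio t epowr q * indicator {0..<1} t)"
      by (auto simp: indicator_def)
    finally show ?thesis .
  qed
  have mRE: "(\<lambda>t. (ratio t epowr q * ennreal (fE t powr (1 - q))) * indicator {0..<1} t) \<in> borel_measurable lebesgue"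
  proof -
    have "(\<lambda>t. (ratio t epowr q * indicator {0..<1} t) * (ennreal (fE t powr (1 - q)) * indicator {0..<1} t)) \<in> borel_measurable lebesgue"
      by (rule borel_measurable_times_ennreal[OF mR mE])
    also have "(\<lambda>t. (ratio t epowr q * indicator {0..<1} t) * (ennreal (fE t powr (1 - q)) * indicator {0..<1} t))
       = (\<lambda>t. (ratio t epowr q * ennreal (fE t powr (1 - q))) * indicator {0..<1} t)"
      by (auto simp: indicator_def)
    finally show ?thesis .
  qed
  have mNN: "(\<lambda>t. (ennreal (\<nu> t) * ennreal (fN t powr (1 - p))) * indicator {0..<1} t) \<in> borel_measurable lebesgue"
  proof -
    have "(\<lambda>t. (ennreal (\<nu> t) * indicator {0..<1} t) * (ennreal (fN t powr (1 - p)) * indicator {0..<1} t)) \<in> borel_measurable lebesgue"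
      by (rule borel_measurable_times_ennreal[OF radial_weight_measurable[OF rn] mN])
    also have "(\<lambda>t. (ennreal (\<nu> t) * indicator {0..<1} t) * (ennreal (fN t powr (1 - p)) * indicator {0..<1} t))
       = (\<lambda>t. (ennreal (\<nu> t) * ennreal (fN t powr (1 - p))) * indicator {0..<1} t)"
      by (auto simp: indicator_def)
    finally show ?thesis .
  qed
  have gen: "(\<integral>\<^sup>+\<zeta>. h (cmod \<zeta>) * ennreal (cmod (bker \<omega> (w * \<zeta>))) \<partial>disc_area)
      \<le> ennreal c * (\<integral>\<^sup>+t\<in>{0..<1}. (ennreal t * h t) * ennreal (1 / (fE (min (cmod w) t) * fN (min (cmod w) t))) \<partial>lebesgue)"
    if w: "cmod w < 1" and mh: "(\<lambda>t. h t * indicator {0..<1} t) \<in> borel_measurable lebesgue" for w :: complex and h :: "real \<Rightarrow> ennreal"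
  proof -
    let ?k = "\<lambda>t. 1 / (fE (min (cmod w) t) * fN (min (cmod w) t))"
    have mk: "(\<lambda>t. ennreal (?k t) * indicator {0..<1} t) \<in> borel_measurable lebesgue"
    proof -
      have e: "(\<lambda>t. fE (min (cmod w) t) * indicator {0..<1} t) \<in> borel_measurable lebesgue"
        using w by (intro antimono_measurable fE_antimono) auto
      have n: "(\<lambda>t. fN (min (cmod w) t) * indicator {0..<1} t) \<in> borel_measurable lebesgue"
        using w by (intro antimono_measurable fN_antimono) auto
      have "(\<lambda>t. ennreal (1 / ((fE (min (cmod w) t) * indicator {0..<1} t) * (fN (min (cmod w) t) * indicator {0..<1} t)))) \<in> borel_measurable lebesgue"
        by (rule measurable_compose[OF borel_measurable_times[OF e n]]) measurable
      also have "(\<lambda>t. ennreal (1 / ((fE (min (cmod w) t) * indicator {0..<1} t) * (fN (min (cmod w) t) * indicator {0..<1} t))))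
        = (\<lambda>t. ennreal (?k t) * indicator {0..<1} t)"
        by (auto simp: indicator_def)
      finally show ?thesis .
    qed
    have mi: "(\<lambda>t. ennreal t) \<in> borel_measurable lebesgue" by (intro measurable_completion) measurable
    have "(\<integral>\<^sup>+\<zeta>. h (cmod \<zeta>) * ennreal (cmod (bker \<omega> (w * \<zeta>))) \<partial>disc_area)
      \<le> (\<integral>\<^sup>+t\<in>{0..<1}. ennreal (t * A0 / tail \<omega> (min (cmod w) t)) * h t \<partial>lebesgue)"
      using A0 by (intro nn_integral_kernel_le[OF mh _ _ rw w]) auto
    also have "\<dots> \<le> (\<integral>\<^sup>+t. ennreal c * ((ennreal t * h t) * ennreal (?k t) * indicator {0..<1} t) \<partial>lebesgue)"
    proof (rule nn_integral_mono)
      fix t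
      show "ennreal (t * A0 / tail \<omega> (min (cmod w) t)) * h t * indicator {0..<1} t \<le> ennreal c * ((ennreal t * h t) * ennreal (?k t) * indicator {0..<1} t)"
      proof (cases "t \<in> {0..<1}")
        case True
        let ?m = "min (cmod w) t"
        have m: "0 \<le> ?m" "?m < 1" using True w by auto
        have t0: "0 \<le> t" using True by simp
        have "t * (A0 / tail \<omega> ?m) \<le> t * (c * ?k t)" using inv[OF m] t0 by (intro mult_left_mono) auto
        then have "ennreal (t * A0 / tail \<omega> ?m) \<le> ennreal (t * (c * ?k t))" by (intro ennreal_leI) simp
        also have "\<dots> = ennreal t * (ennreal c * ennreal (?k t))"
          by (simp only: ennreal_mult'[OF t0] ennreal_mult'[OF less_imp_le[OF c]])
        finally have "ennreal (t * A0 / tail \<omega> ?m) * h t \<le> ennreal t * (ennreal c * ennreal (?k t)) * h t"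
          by (rule mult_right_mono) simp
        then show ?thesis using True by (simp add: mult_ac)
      qed simp
    qed
    also have "\<dots> = ennreal c * (\<integral>\<^sup>+t\<in>{0..<1}. (ennreal t * h t) * ennreal (?k t) \<partial>lebesgue)"
    proof (rule nn_integral_cmult)
      have "(\<lambda>t. ennreal t * (h t * indicator {0..<1} t) * (ennreal (?k t) * indicator {0..<1} t)) \<in> borel_measurable lebesgue"
        by (rule borel_measurable_times_ennreal[OF borel_measurable_times_ennreal[OF mi mh] mk])
      also have "(\<lambda>t. ennreal t * (h t * indicator {0..<1} t) * (ennreal (?k t) * indicator {0..<1} t)) = (\<lambda>t. (ennreal t * h t) * ennreal (?k t) * indicator {0..<1} t)"
        by (auto simp: indicator_def)
      finally show "(\<lambda>t. (ennreal t * h t) * ennreal (?k t) * indicator {0..<1} t) \<in> borel_measurable lebesgue" .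
    qed
    finally show ?thesis .
  qed
  have Y: "(\<integral>\<^sup>+\<zeta>. (ratio (cmod \<zeta>) epowr q * ennreal (fE (cmod \<zeta>) powr (1 - q))) * ennreal (cmod (bker \<omega> (w * \<zeta>))) \<partial>disc_area)
      \<le> ennreal (c * B / fN (cmod w))" if w: "cmod w < 1" for w
  proof -
    note gen[OF w mRE]
    also have "(\<integral>\<^sup>+t\<in>{0..<1}. (ennreal t * (ratio t epowr q * ennreal (fE t powr (1 - q)))) * ennreal (1 / (fE (min (cmod w) t) * fN (min (cmod w) t))) \<partial>lebesgue)
      = (\<integral>\<^sup>+t\<in>{0..<1}. sigma_weight p \<omega> \<nu> t * ennreal (fE t powr (1 - q)) * ennreal (1 / (fE (min (cmod w) t) * fN (min (cmod w) t))) \<partial>lebesgue)"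
      by (simp only: sigma_eq_ratio mult.assoc)
    also have "ennreal c * \<dots> \<le> ennreal c * ennreal (B / fN (cmod w))" using B(2)[of "cmod w"] w by (intro mult_left_mono) auto
    also have "\<dots> = ennreal (c * B / fN (cmod w))" using c by (simp add: ennreal_mult'[symmetric])
    finally show ?thesis .
  qed
  \<comment> \<open>The factor \<open>t\<close> of area integration is bounded by 1 here, whereas in
    \<open>Y\<close> it belongs to \<open>\<sigma>\<close>.\<close>
  have Z: "(\<integral>\<^sup>+\<zeta>. (ennreal (\<nu> (cmod \<zeta>)) * ennreal (fN (cmod \<zeta>) powr (1 - p))) * ennreal (cmod (bker \<omega> (w * \<zeta>))) \<partial>disc_area)
      \<le> ennreal (c * B / fE (cmod w))" if w: "cmod w < 1" for w
  proof -
    note gen[OF w mNN]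
    also have "(\<integral>\<^sup>+t\<in>{0..<1}. (ennreal t * (ennreal (\<nu> t) * ennreal (fN t powr (1 - p)))) * ennreal (1 / (fE (min (cmod w) t) * fN (min (cmod w) t))) \<partial>lebesgue)
      \<le> (\<integral>\<^sup>+t\<in>{0..<1}. ennreal (\<nu> t) * ennreal (fN t powr (1 - p)) * ennreal (1 / (fN (min (cmod w) t) * fE (min (cmod w) t))) \<partial>lebesgue)"
    proof (rule nn_integral_mono)
      fix t
      show "(ennreal t * (ennreal (\<nu> t) * ennreal (fN t powr (1 - p)))) * ennreal (1 / (fE (min (cmod w) t) * fN (min (cmod w) t))) * indicator {0..<1} t
        \<le> ennreal (\<nu> t) * ennreal (fN t powr (1 - p)) * ennreal (1 / (fN (min (cmod w) t) * fE (min (cmod w) t))) * indicator {0..<1} t"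
      proof (cases "t \<in> {0..<1}")
        case True
        then have "ennreal t \<le> 1" by (simp add: ennreal_le_1)
        then have "ennreal t * (ennreal (\<nu> t) * ennreal (fN t powr (1 - p)) * ennreal (1 / (fN (min (cmod w) t) * fE (min (cmod w) t))))
          \<le> 1 * (ennreal (\<nu> t) * ennreal (fN t powr (1 - p)) * ennreal (1 / (fN (min (cmod w) t) * fE (min (cmod w) t))))"
          by (rule mult_right_mono) simp
        then show ?thesis using True by (simp add: mult.assoc mult.commute[of "fE _"])
      qed simp
    qed
    also have "ennreal c * \<dots> \<le> ennreal c * ennreal (B / fE (cmod w))" using B(3)[of "cmod w"] w by (intro mult_left_mono) auto
    also have "\<dots> = ennreal (c * B / fE (cmod w))" using c by (simp add: ennreal_mult'[symmetric])
    finally show ?thesis by (simp add: mult_left_mono)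
  qed
  have [measurable]: "(\<lambda>z. fE (cmod z)) \<in> borel_measurable disc_area" "(\<lambda>z. fN (cmod z)) \<in> borel_measurable disc_area"
    by (intro radial_real_measurable fE_measurable fN_measurable)+
  have [measurable]: "cnj \<in> borel_measurable borel"
    by (intro borel_measurable_continuous_onI continuous_intros)
  have cB: "0 < c * B" using c B(1) by simp
  have main: "(\<integral>\<^sup>+z. (\<integral>\<^sup>+\<zeta>. ennreal (cmod (f \<zeta>) * cmod (bker \<omega> (cnj z * \<zeta>)) * \<omega> (cmod \<zeta>)) \<partial>disc_area) epowr p * ennreal (\<nu> (cmod z)) \<partial>disc_area)
      \<le> ennreal ((c * B) powr p) * (\<integral>\<^sup>+z. ennreal (cmod (f z) powr p * \<nu> (cmod z)) \<partial>disc_area)"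
    if [measurable]: "f \<in> borel_measurable disc_area" for f
  proof -
    define G where "G \<zeta> = ennreal (cmod (f \<zeta>) powr p * \<nu> (cmod \<zeta>) * fE (cmod \<zeta>))" for \<zeta>
    have [measurable]: "G \<in> borel_measurable disc_area" unfolding G_def by measurable
    define b where "b z \<zeta> = cmod (bker \<omega> (cnj z * \<zeta>))" for z \<zeta>
    have bm [measurable]: "(\<lambda>x. b (fst x) (snd x)) \<in> borel_measurable (disc_area \<Otimes>\<^sub>M disc_area)" unfolding b_def by measurable
    have bm2 [measurable]: "(\<lambda>x. b (snd x) (fst x)) \<in> borel_measurable (disc_area \<Otimes>\<^sub>M disc_area)" unfolding b_def by measurable
    have bm' [measurable]: "b z \<in> borel_measurable disc_area" for z unfolding b_def by measurable
    have bnn: "0 \<le> b z \<zeta>" for z \<zeta> by (simp add: b_def)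
    define X where "X z = (\<integral>\<^sup>+\<zeta>. G \<zeta> * ennreal (b z \<zeta>) \<partial>disc_area)" for z
    define F where "F z = (\<integral>\<^sup>+\<zeta>. ennreal (cmod (f \<zeta>) * b z \<zeta> * \<omega> (cmod \<zeta>)) \<partial>disc_area)" for z
    have FX: "F z epowr p \<le> ennreal ((c * B) powr (p - 1)) * (ennreal (fN (cmod z) powr (1 - p)) * X z)" if z: "z \<in> ball 0 1" for z
    proof -
      have zz: "0 \<le> cmod z" "cmod z < 1" using z by auto
      have Np: "0 < fN (cmod z)" using fN_pos[OF zz] .
      show ?thesis
      \<comment> \<open>\<open>holder_nn_integral\<close> needs real bounds; an infinite
        \<open>X z\<close> makes the right side infinite, since both constants in front of it are
        positive.\<close>
      proof (cases "X z = top")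
        case True
        have "0 < ennreal ((c * B) powr (p - 1))" "0 < ennreal (fN (cmod z) powr (1 - p))" using cB Np by auto
        then show ?thesis by (simp add: True ennreal_mult_top)
      next
        case False
        define x where "x = enn2real (X z)"
        have x: "X z = ennreal x" "0 \<le> x" using False by (auto simp: x_def less_top)
        define f1 where "f1 \<zeta> = ennreal (cmod (f \<zeta>) * \<nu> (cmod \<zeta>) powr (1 / p) * fE (cmod \<zeta>) powr (1 / p) * b z \<zeta> powr (1 / p))" for \<zeta>
        define g1 where "g1 \<zeta> = ennreal (fE (cmod \<zeta>) powr (- (1 / p)) * b z \<zeta> powr (1 / q)) * ratio (cmod \<zeta>)" for \<zeta>
        have "F z \<le> (\<integral>\<^sup>+\<zeta>. f1 \<zeta> * g1 \<zeta> \<partial>disc_area)"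
          unfolding F_def
        proof (rule nn_integral_mono_AE)
          show "AE \<zeta> in disc_area. ennreal (cmod (f \<zeta>) * b z \<zeta> * \<omega> (cmod \<zeta>)) \<le> f1 \<zeta> * g1 \<zeta>"
            using omega_le_ratio AE_space
          proof eventually_elim
            case (elim \<zeta>)
            then have E: "0 < fE (cmod \<zeta>)" by (intro fE_pos) auto
            have bb: "b z \<zeta> powr (1 / p) * b z \<zeta> powr (1 / q) = b z \<zeta>"
              using bnn q(2) by (simp add: powr_add[symmetric])
            have ee: "fE (cmod \<zeta>) powr (1 / p) * fE (cmod \<zeta>) powr (- (1 / p)) = 1"
              using E by (simp add: powr_add[symmetric])
            have "ennreal (cmod (f \<zeta>) * b z \<zeta> * \<omega> (cmod \<zeta>)) = ennreal (cmod (f \<zeta>) * b z \<zeta>) * ennreal (\<omega> (cmod \<zeta>))"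
              using bnn by (simp add: ennreal_mult')
            also have "\<dots> \<le> ennreal (cmod (f \<zeta>) * b z \<zeta>) * (ennreal (\<nu> (cmod \<zeta>) powr (1 / p)) * ratio (cmod \<zeta>))"
              using elim by (intro mult_left_mono) auto
            also have "\<dots> = ennreal (cmod (f \<zeta>) * b z \<zeta> * \<nu> (cmod \<zeta>) powr (1 / p)) * ratio (cmod \<zeta>)"
              using bnn by (simp add: ennreal_mult' mult.assoc)
            also have "cmod (f \<zeta>) * b z \<zeta> * \<nu> (cmod \<zeta>) powr (1 / p)
              = (cmod (f \<zeta>) * \<nu> (cmod \<zeta>) powr (1 / p) * fE (cmod \<zeta>) powr (1 / p) * b z \<zeta> powr (1 / p)) * (fE (cmod \<zeta>) powr (- (1 / p)) * b z \<zeta> powr (1 / q))"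
            proof -
              have "cmod (f \<zeta>) * b z \<zeta> * \<nu> (cmod \<zeta>) powr (1 / p) = cmod (f \<zeta>) * \<nu> (cmod \<zeta>) powr (1 / p) * (fE (cmod \<zeta>) powr (1 / p) * fE (cmod \<zeta>) powr (- (1 / p))) * (b z \<zeta> powr (1 / p) * b z \<zeta> powr (1 / q))"
                unfolding bb ee by simp
              then show ?thesis by (simp only: mult_ac)
            qed
            also have "ennreal \<dots> * ratio (cmod \<zeta>) = f1 \<zeta> * g1 \<zeta>"
              unfolding f1_def g1_def by (subst ennreal_mult) (auto simp: mult.assoc)
            finally show ?case .
          qed
        qed
        also have "\<dots> \<le> ennreal (x powr (1 / p) * (c * B / fN (cmod z)) powr (1 / q))"
        proof (rule holder_nn_integral[OF p refl])
          show "f1 \<in> borel_measurable disc_area" "g1 \<in> borel_measurable disc_area" unfolding f1_def g1_def by measurable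
          have "(\<integral>\<^sup>+\<zeta>. f1 \<zeta> epowr p \<partial>disc_area) = X z"
            unfolding X_def
          proof (rule nn_integral_cong)
            fix \<zeta> assume "\<zeta> \<in> space disc_area"
            then have "0 \<le> \<nu> (cmod \<zeta>)" "0 < fE (cmod \<zeta>)" by (auto intro: fE_pos)
            then show "f1 \<zeta> epowr p = G \<zeta> * ennreal (b z \<zeta>)"
              using p bnn by (simp add: f1_def G_def epowr_ennreal powr_mult powr_powr ennreal_mult[symmetric])
          qed
          then show "(\<integral>\<^sup>+\<zeta>. f1 \<zeta> epowr p \<partial>disc_area) \<le> ennreal ((x powr (1 / p)) powr p)"
            using x p by (simp add: powr_powr)
          have "(\<integral>\<^sup>+\<zeta>. g1 \<zeta> epowr q \<partial>disc_area) = (\<integral>\<^sup>+\<zeta>. (ratio (cmod \<zeta>) epowr q * ennreal (fE (cmod \<zeta>) powr (1 - q))) * ennreal (cmod (bker \<omega> (cnj z * \<zeta>))) \<partial>disc_area)"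
          proof (rule nn_integral_cong)
            fix \<zeta> assume "\<zeta> \<in> space disc_area"
            then have E: "0 < fE (cmod \<zeta>)" by (auto intro: fE_pos)
            have "g1 \<zeta> epowr q = ennreal ((fE (cmod \<zeta>) powr (- (1 / p)) * b z \<zeta> powr (1 / q)) powr q) * ratio (cmod \<zeta>) epowr q"
              unfolding g1_def using q by (intro epowr_mult) auto
            also have "(fE (cmod \<zeta>) powr (- (1 / p)) * b z \<zeta> powr (1 / q)) powr q = fE (cmod \<zeta>) powr (1 - q) * b z \<zeta>"
            proof -
              \<comment> \<open>The exponent of \<open>fE\<close> in \<open>g1\<close> is chosen so
                that its \<open>q\<close>-th power is the weight \<open>fE powr (1 - q)\<close> of
                \<open>schur_sigma\<close>.\<close>
              have "- (1 / p) * q = 1 - q" using q(3) by simp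
              then show ?thesis using q(1) bnn by (simp add: powr_mult powr_powr)
            qed
            finally show "g1 \<zeta> epowr q = (ratio (cmod \<zeta>) epowr q * ennreal (fE (cmod \<zeta>) powr (1 - q))) * ennreal (cmod (bker \<omega> (cnj z * \<zeta>)))"
              by (simp add: ennreal_mult' b_def mult_ac)
          qed
          also have "\<dots> \<le> ennreal (c * B / fN (cmod (cnj z)))" using zz by (intro Y) simp
          finally show "(\<integral>\<^sup>+\<zeta>. g1 \<zeta> epowr q \<partial>disc_area) \<le> ennreal (((c * B / fN (cmod z)) powr (1 / q)) powr q)"
            using q cB Np by (simp add: powr_powr)
        qed auto
        finally have "F z epowr p \<le> ennreal (x powr (1 / p) * (c * B / fN (cmod z)) powr (1 / q)) epowr p"
          using p by (intro epowr_mono) auto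
        also have "\<dots> = ennreal ((x powr (1 / p) * (c * B / fN (cmod z)) powr (1 / q)) powr p)"
          by (simp add: epowr_ennreal)
        also have "(x powr (1 / p) * (c * B / fN (cmod z)) powr (1 / q)) powr p = (c * B) powr (p - 1) * (fN (cmod z) powr (1 - p) * x)"
        proof -
          have "1 / q * p = p - 1" using q(4) by simp
          then have "(x powr (1 / p) * (c * B / fN (cmod z)) powr (1 / q)) powr p = x * (c * B / fN (cmod z)) powr (p - 1)"
            using p x by (simp add: powr_mult powr_powr)
          also have "(c * B / fN (cmod z)) powr (p - 1) = (c * B) powr (p - 1) * fN (cmod z) powr (1 - p)"
            using Np cB powr_minus_divide[of "fN (cmod z)" "p - 1"] by (simp add: powr_divide)
          finally show ?thesis by simp
        qed
        also have "ennreal ((c * B) powr (p - 1) * (fN (cmod z) powr (1 - p) * x)) = ennreal ((c * B) powr (p - 1)) * (ennreal (fN (cmod z) powr (1 - p)) * X z)"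
          using x by (simp add: ennreal_mult')
        finally show ?thesis .
      qed
    qed
    have Xm [measurable]: "X \<in> borel_measurable disc_area" unfolding X_def
      by (rule disc.borel_measurable_nn_integral) measurable
    define H where "H z = ennreal (\<nu> (cmod z)) * ennreal (fN (cmod z) powr (1 - p))" for z
    have [measurable]: "H \<in> borel_measurable disc_area" unfolding H_def by measurable
    have "(\<integral>\<^sup>+z. F z epowr p * ennreal (\<nu> (cmod z)) \<partial>disc_area) \<le> (\<integral>\<^sup>+z. ennreal ((c * B) powr (p - 1)) * (H z * X z) \<partial>disc_area)"
    proof (rule nn_integral_mono)
      fix z assume "z \<in> space disc_area"
      then have "F z epowr p * ennreal (\<nu> (cmod z)) \<le> (ennreal ((c * B) powr (p - 1)) * (ennreal (fN (cmod z) powr (1 - p)) * X z)) * ennreal (\<nu> (cmod z))"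
        using FX[of z] by (intro mult_right_mono) auto
      then show "F z epowr p * ennreal (\<nu> (cmod z)) \<le> ennreal ((c * B) powr (p - 1)) * (H z * X z)"
        by (simp add: H_def mult_ac)
    qed
    also have "\<dots> = ennreal ((c * B) powr (p - 1)) * (\<integral>\<^sup>+z. H z * X z \<partial>disc_area)"
      by (rule nn_integral_cmult) measurable
    also have "(\<integral>\<^sup>+z. H z * X z \<partial>disc_area) = (\<integral>\<^sup>+z. (\<integral>\<^sup>+\<zeta>. H z * (G \<zeta> * ennreal (b z \<zeta>)) \<partial>disc_area) \<partial>disc_area)"
      unfolding X_def by (intro nn_integral_cong nn_integral_cmult[symmetric]) measurable
    also have "\<dots> = (\<integral>\<^sup>+\<zeta>. (\<integral>\<^sup>+z. H z * (G \<zeta> * ennreal (b z \<zeta>)) \<partial>disc_area) \<partial>disc_area)"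
      by (rule disc_pair.Fubini') (simp add: split_beta')
    also have "\<dots> \<le> (\<integral>\<^sup>+\<zeta>. ennreal (c * B) * ennreal (cmod (f \<zeta>) powr p * \<nu> (cmod \<zeta>)) \<partial>disc_area)"
    proof (rule nn_integral_mono)
      fix \<zeta> assume "\<zeta> \<in> space disc_area"
      then have ze: "cmod \<zeta> < 1" by simp
      have E: "0 < fE (cmod \<zeta>)" using ze by (intro fE_pos) auto
      have "(\<integral>\<^sup>+z. H z * (G \<zeta> * ennreal (b z \<zeta>)) \<partial>disc_area) = (\<integral>\<^sup>+z. G \<zeta> * (H z * ennreal (cmod (bker \<omega> (cnj \<zeta> * z)))) \<partial>disc_area)"
      proof (rule nn_integral_cong)
        fix z assume "z \<in> space disc_area"
        then have "cmod (cnj \<zeta> * z) < 1"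
          using ze mult_strict_mono[of "cmod \<zeta>" 1 "cmod z" 1] by (simp add: norm_mult)
        \<comment> \<open>The kernel has real coefficients, so exchanging \<open>z\<close> and
          \<open>\<zeta>\<close> conjugates its value and keeps the modulus.\<close>
        from bker_cnj[OF wD this] have "b z \<zeta> = cmod (bker \<omega> (cnj \<zeta> * z))"
          by (simp add: b_def mult.commute)
        then show "H z * (G \<zeta> * ennreal (b z \<zeta>)) = G \<zeta> * (H z * ennreal (cmod (bker \<omega> (cnj \<zeta> * z))))"
          by (simp add: mult_ac)
      qed
      also have "\<dots> = G \<zeta> * (\<integral>\<^sup>+z. H z * ennreal (cmod (bker \<omega> (cnj \<zeta> * z))) \<partial>disc_area)"
        by (rule nn_integral_cmult) measurable
      also have "\<dots> \<le> G \<zeta> * ennreal (c * B / fE (cmod (cnj \<zeta>)))"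
        unfolding H_def using ze by (intro mult_left_mono Z) auto
      also have "\<dots> = ennreal (c * B) * ennreal (cmod (f \<zeta>) powr p * \<nu> (cmod \<zeta>))"
        using E cB ze by (simp add: G_def ennreal_mult[symmetric])
      finally show "(\<integral>\<^sup>+z. H z * (G \<zeta> * ennreal (b z \<zeta>)) \<partial>disc_area) \<le> ennreal (c * B) * ennreal (cmod (f \<zeta>) powr p * \<nu> (cmod \<zeta>))" .
    qed
    also have "\<dots> = ennreal (c * B) * (\<integral>\<^sup>+\<zeta>. ennreal (cmod (f \<zeta>) powr p * \<nu> (cmod \<zeta>)) \<partial>disc_area)"
      by (rule nn_integral_cmult) measurable
    also have "ennreal ((c * B) powr (p - 1)) * (ennreal (c * B) * (\<integral>\<^sup>+\<zeta>. ennreal (cmod (f \<zeta>) powr p * \<nu> (cmod \<zeta>)) \<partial>disc_area))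
      = ennreal ((c * B) powr p) * (\<integral>\<^sup>+\<zeta>. ennreal (cmod (f \<zeta>) powr p * \<nu> (cmod \<zeta>)) \<partial>disc_area)"
    proof -
      have "(c * B) powr (p - 1) * (c * B) = (c * B) powr p"
        using cB powr_add[of "c * B" "p - 1" 1] by simp
      then show ?thesis using cB by (simp add: mult.assoc[symmetric] ennreal_mult'[symmetric])
    qed
    finally show ?thesis by (simp add: F_def b_def mult_left_mono)
  qed
  show ?thesis
    by (rule that[of "(c * B) powr p"]) (use cB main in auto)
qed

end

context two_weights_A
begin

text \<open>For fixed \<open>z\<close> the kernel is bounded on the disc, so each defining integral
  converges by \<open>Lp_omega_integrable\<close>; the norm estimate is
  \<open>schur_test\<close>.\<close>

lemma max_bergman_proj_bounded_of_A:
  assumes Dc: "\<omega> \<in> class_Dcheck"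
  shows "max_bergman_proj_bounded p \<omega> \<nu>"
proof -
  obtain C where C: "0 < C" "\<And>f. f \<in> borel_measurable disc_area \<Longrightarrow>
    (\<integral>\<^sup>+z. (\<integral>\<^sup>+\<zeta>. ennreal (cmod (f \<zeta>) * cmod (bker \<omega> (cnj z * \<zeta>)) * \<omega> (cmod \<zeta>)) \<partial>disc_area) epowr p * ennreal (\<nu> (cmod z)) \<partial>disc_area)
      \<le> ennreal C * (\<integral>\<^sup>+z. ennreal (cmod (f z) powr p * \<nu> (cmod z)) \<partial>disc_area)"
    using schur_test[OF Dc] by blast
  let ?k = "\<lambda>z \<zeta>. complex_of_real (cmod (bergman_kernel \<omega> z \<zeta>))"
  have int: "integrable disc_area (\<lambda>\<zeta>. f \<zeta> * ?k z \<zeta> * complex_of_real (\<omega> (cmod \<zeta>)))"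
    if f: "f \<in> Lp_space p \<nu>" and z: "z \<in> ball 0 1" for f z
  proof (rule integrableI_bounded)
    have [measurable]: "f \<in> borel_measurable disc_area" using f by (simp add: Lp_space_def)
    have [measurable]: "(\<lambda>\<zeta>. bergman_kernel \<omega> z \<zeta>) \<in> borel_measurable disc_area"
      unfolding bergman_kernel_eq by measurable
    show "(\<lambda>\<zeta>. f \<zeta> * ?k z \<zeta> * complex_of_real (\<omega> (cmod \<zeta>))) \<in> borel_measurable disc_area" by measurable
    define S where "S = (\<Sum>n. bcoef \<omega> n * cmod z ^ n)"
    have "(\<integral>\<^sup>+\<zeta>. ennreal (norm (f \<zeta> * ?k z \<zeta> * complex_of_real (\<omega> (cmod \<zeta>)))) \<partial>disc_area)
      \<le> (\<integral>\<^sup>+\<zeta>. ennreal S * ennreal (cmod (f \<zeta>) * \<omega> (cmod \<zeta>)) \<partial>disc_area)"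
    proof (rule nn_integral_mono)
      fix \<zeta> assume "\<zeta> \<in> space disc_area"
      then have ze: "cmod \<zeta> < 1" by simp
      have "cmod (cnj z * \<zeta>) \<le> cmod z" using ze by (simp add: norm_mult mult_left_le)
      then have b: "cmod (bergman_kernel \<omega> z \<zeta>) \<le> S"
        unfolding bergman_kernel_eq S_def using z by (intro norm_bker_le wD) auto
      then have S0: "0 \<le> S" using norm_ge_zero order_trans by blast
      have "norm (f \<zeta> * ?k z \<zeta> * complex_of_real (\<omega> (cmod \<zeta>))) = cmod (bergman_kernel \<omega> z \<zeta>) * (cmod (f \<zeta>) * \<omega> (cmod \<zeta>))"
        using ze by (simp add: norm_mult)
      also have "\<dots> \<le> S * (cmod (f \<zeta>) * \<omega> (cmod \<zeta>))" using b ze by (intro mult_right_mono) auto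
      finally have "ennreal (norm (f \<zeta> * ?k z \<zeta> * complex_of_real (\<omega> (cmod \<zeta>)))) \<le> ennreal (S * (cmod (f \<zeta>) * \<omega> (cmod \<zeta>)))"
        by (rule ennreal_leI)
      also have "\<dots> = ennreal S * ennreal (cmod (f \<zeta>) * \<omega> (cmod \<zeta>))" using S0 by (rule ennreal_mult')
      finally show "ennreal (norm (f \<zeta> * ?k z \<zeta> * complex_of_real (\<omega> (cmod \<zeta>)))) \<le> ennreal S * ennreal (cmod (f \<zeta>) * \<omega> (cmod \<zeta>))" .
    qed
    also have "\<dots> = ennreal S * (\<integral>\<^sup>+\<zeta>. ennreal (cmod (f \<zeta>) * \<omega> (cmod \<zeta>)) \<partial>disc_area)"
      by (rule nn_integral_cmult) measurable
    also have "\<dots> < \<infinity>" using Lp_omega_integrable[OF f] by (simp add: ennreal_mult_less_top)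
    finally show "(\<integral>\<^sup>+\<zeta>. ennreal (norm (f \<zeta> * ?k z \<zeta> * complex_of_real (\<omega> (cmod \<zeta>)))) \<partial>disc_area) < \<infinity>" .
  qed
  have bound: "Lp_norm p \<nu> (integral_op \<omega> ?k f) \<le> ennreal (C powr (1 / p)) * Lp_norm p \<nu> f" if f: "f \<in> Lp_space p \<nu>" for f
  proof -
    have fm: "f \<in> borel_measurable disc_area" using f by (simp add: Lp_space_def)
    let ?F = "\<lambda>z. (\<integral>\<^sup>+\<zeta>. ennreal (cmod (f \<zeta>) * cmod (bker \<omega> (cnj z * \<zeta>)) * \<omega> (cmod \<zeta>)) \<partial>disc_area)"
    have "(\<integral>\<^sup>+z. ennreal (cmod (integral_op \<omega> ?k f z) powr p * \<nu> (cmod z)) \<partial>disc_area) \<le> (\<integral>\<^sup>+z. ?F z epowr p * ennreal (\<nu> (cmod z)) \<partial>disc_area)"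
    proof (rule nn_integral_mono)
      fix z assume "z \<in> space disc_area"
      then have z: "z \<in> ball 0 1" by simp
      have "ennreal (cmod (integral_op \<omega> ?k f z)) \<le> (\<integral>\<^sup>+\<zeta>. ennreal (norm (f \<zeta> * ?k z \<zeta> * complex_of_real (\<omega> (cmod \<zeta>)))) \<partial>disc_area)"
        unfolding integral_op_def using int[OF f z] by (rule integral_norm_bound_ennreal)
      also have "\<dots> = ?F z"
        by (intro nn_integral_cong) (simp add: norm_mult bergman_kernel_eq)
      finally have "ennreal (cmod (integral_op \<omega> ?k f z)) epowr p \<le> ?F z epowr p" using p by (intro epowr_mono) auto
      then have "ennreal (cmod (integral_op \<omega> ?k f z) powr p) * ennreal (\<nu> (cmod z)) \<le> ?F z epowr p * ennreal (\<nu> (cmod z))"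
        by (intro mult_right_mono) (auto simp: epowr_ennreal)
      then show "ennreal (cmod (integral_op \<omega> ?k f z) powr p * \<nu> (cmod z)) \<le> ?F z epowr p * ennreal (\<nu> (cmod z))"
        by (simp add: ennreal_mult')
    qed
    also have "\<dots> \<le> ennreal C * (\<integral>\<^sup>+z. ennreal (cmod (f z) powr p * \<nu> (cmod z)) \<partial>disc_area)" by (rule C(2)[OF fm])
    finally have "Lp_norm p \<nu> (integral_op \<omega> ?k f) \<le> (ennreal C * (\<integral>\<^sup>+z. ennreal (cmod (f z) powr p * \<nu> (cmod z)) \<partial>disc_area)) epowr (1 / p)"
      unfolding Lp_norm_def using p by (intro epowr_mono) auto
    also have "\<dots> = ennreal (C powr (1 / p)) * Lp_norm p \<nu> f"
      unfolding Lp_norm_def using p C(1) by (intro epowr_mult) auto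
    finally show ?thesis .
  qed
  have "integral_op \<omega> ?k f \<in> Lp_space p \<nu>" if f: "f \<in> Lp_space p \<nu>" for f
  proof -
    have "Lp_norm p \<nu> (integral_op \<omega> ?k f) < \<infinity>"
      using le_less_trans[OF bound[OF f]] f by (simp add: Lp_space_def ennreal_mult_less_top)
    moreover have "integral_op \<omega> ?k f \<in> borel_measurable disc_area"
      using f by (intro integral_op_measurable bergman_kernel_pair_measurable) (simp add: Lp_space_def)
    ultimately show ?thesis by (simp add: Lp_space_def)
  qed
  then show ?thesis
    unfolding max_bergman_proj_bounded_def integral_op_bounded_def
    using int bound by (intro conjI ballI exI[of _ "C powr (1 / p)"]) auto
qed

end

section \<open>Necessity: test functions\<close>

lemma distr_disc_area_rotate:
  assumes "cmod c = 1"
  shows "distr disc_area borel (\<lambda>z. c * z) = distr disc_area borel (\<lambda>z. z)"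
proof (rule measure_eqI)
  have m: "(\<lambda>z. c * z) \<in> disc_area \<rightarrow>\<^sub>M borel" by (rule borel_measurable_disc_areaI) measurable
  fix X :: "complex set" assume "X \<in> sets (distr disc_area borel (\<lambda>z. c * z))"
  then have X: "X \<in> sets borel" by simp
  have "emeasure (distr disc_area borel (\<lambda>z. c * z)) X = (\<integral>\<^sup>+z. indicator X z \<partial>distr disc_area borel (\<lambda>z. c * z))"
    using X by simp
  also have "\<dots> = (\<integral>\<^sup>+z. indicator X (c * z) \<partial>disc_area)"
    using X m by (subst nn_integral_distr) auto
  also have "\<dots> = (\<integral>\<^sup>+z. indicator X z \<partial>disc_area)"
    using X assms by (intro nn_integral_disc_area_rotate) auto
  also have "\<dots> = (\<integral>\<^sup>+z. indicator X z \<partial>distr disc_area borel (\<lambda>z. z))"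
    using X by (subst nn_integral_distr) auto
  also have "\<dots> = emeasure (distr disc_area borel (\<lambda>z. z)) X" using X by simp
  finally show "emeasure (distr disc_area borel (\<lambda>z. c * z)) X = emeasure (distr disc_area borel (\<lambda>z. z)) X" .
qed simp

lemma integral_disc_area_rotate:
  fixes h :: "complex \<Rightarrow> complex"
  assumes [measurable]: "h \<in> borel_measurable borel" and c: "cmod c = 1"
  shows "(LINT z|disc_area. h (c * z)) = (LINT z|disc_area. h z)"
proof -
  have m: "(\<lambda>z. c * z) \<in> disc_area \<rightarrow>\<^sub>M borel" by (rule borel_measurable_disc_areaI) measurable
  have "(LINT z|disc_area. h (c * z)) = (LINT z|distr disc_area borel (\<lambda>z. c * z). h z)"
    using m by (subst integral_distr) auto
  also have "\<dots> = (LINT z|distr disc_area borel (\<lambda>z. z). h z)" unfolding distr_disc_area_rotate[OF c] ..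
  also have "\<dots> = (LINT z|disc_area. h z)" by (subst integral_distr) auto
  finally show ?thesis .
qed

text \<open>Rotation by \<open>a = pi / (n - k)\<close> multiplies the integrand by
  \<open>cis ((n - k) * a) = - 1\<close> and preserves area, so the integral equals its own
  negative. The radial factor is first replaced by a Borel representative, to which rotation
  invariance applies.\<close>

lemma integral_angular_zero:
  fixes \<phi> :: "real \<Rightarrow> real"
  assumes m: "(\<lambda>t. \<phi> t * indicator {0..<1} t) \<in> borel_measurable lebesgue" and nk: "n \<noteq> k"
  shows "(LINT \<zeta>|disc_area. complex_of_real (\<phi> (cmod \<zeta>)) * (sgn \<zeta> ^ n * cnj \<zeta> ^ k)) = 0"
proof -
  obtain \<psi> where \<psi>: "\<psi> \<in> borel_measurable lborel" "AE t in lborel. \<phi> t * indicator {0..<1} t = \<psi> t"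
    using completion_ex_borel_measurable_real[OF m] by auto
  have [measurable]: "\<psi> \<in> borel_measurable borel" using \<psi>(1) by simp
  have [measurable]: "cnj \<in> borel_measurable borel"
    by (intro borel_measurable_continuous_onI continuous_intros)
  define h where "h \<zeta> = complex_of_real (\<psi> (cmod \<zeta>)) * ((\<zeta> / complex_of_real (cmod \<zeta>)) ^ n * cnj \<zeta> ^ k)" for \<zeta>
  have hm [measurable]: "h \<in> borel_measurable borel" unfolding h_def by measurable
  have sg: "sgn \<zeta> = \<zeta> / complex_of_real (cmod \<zeta>)" for \<zeta> :: complex by (simp add: sgn_eq)
  have "(LINT \<zeta>|disc_area. complex_of_real (\<phi> (cmod \<zeta>)) * (sgn \<zeta> ^ n * cnj \<zeta> ^ k)) = (LINT \<zeta>|disc_area. h \<zeta>)"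
  proof (rule integral_cong_AE)
    have [measurable]: "(\<lambda>z. \<phi> (cmod z)) \<in> borel_measurable disc_area" by (rule radial_real_measurable[OF m])
    show "(\<lambda>\<zeta>. complex_of_real (\<phi> (cmod \<zeta>)) * (sgn \<zeta> ^ n * cnj \<zeta> ^ k)) \<in> borel_measurable disc_area"
      unfolding sg by measurable
    show "h \<in> borel_measurable disc_area" by (rule borel_measurable_disc_areaI[OF hm])
    show "AE \<zeta> in disc_area. complex_of_real (\<phi> (cmod \<zeta>)) * (sgn \<zeta> ^ n * cnj \<zeta> ^ k) = h \<zeta>"
      using AE_disc_area_cmod[OF \<psi>(2)] AE_space
      by eventually_elim (auto simp: h_def sg)
  qed
  moreover have "(LINT \<zeta>|disc_area. h \<zeta>) = 0"
  proof -
    define a where "a = pi / (real n - real k)"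
    have "real n - real k \<noteq> 0" using nk by simp
    then have na: "real n * a - real k * a = pi"
      unfolding a_def by (metis left_diff_distrib nonzero_mult_div_cancel_left times_divide_eq_right)
    have hr: "h (cis a * \<zeta>) = - h \<zeta>" for \<zeta>
    proof -
      have "cis a ^ n * cnj (cis a) ^ k = cis (real n * a - real k * a)"
        by (simp add: cis_cnj Complex.DeMoivre cis_mult)
      also have "\<dots> = - 1" by (simp add: na)
      finally have e: "cis a ^ n * cnj (cis a) ^ k = - 1" .
      have "h (cis a * \<zeta>) = (cis a ^ n * cnj (cis a) ^ k) * h \<zeta>"
        by (simp add: h_def norm_mult power_mult_distrib power_divide)
      then show ?thesis by (simp add: e)
    qed
    have "(LINT \<zeta>|disc_area. h \<zeta>) = (LINT \<zeta>|disc_area. h (cis a * \<zeta>))"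
      by (rule integral_disc_area_rotate[symmetric]) auto
    also have "\<dots> = - (LINT \<zeta>|disc_area. h \<zeta>)" by (simp add: hr)
    finally show ?thesis by simp
  qed
  ultimately show ?thesis by simp
qed

context two_weights
begin

text \<open>On the annulus beyond \<open>\<rho> \<ge> 1/2\<close> the area density
  \<open>2 * t\<close> is at least 1, so its mass under \<open>\<nu>\<close> is at least
  \<open>tail \<nu> \<rho>\<close>.\<close>

lemma Lp_norm_ge_annulus:
  assumes "0 \<le> m" and \<rho>: "1/2 \<le> \<rho>" "\<rho> < 1" and h: "\<And>z. \<rho> \<le> cmod z \<Longrightarrow> cmod z < 1 \<Longrightarrow> m \<le> cmod (h z)"
  shows "ennreal (m * fN \<rho>) \<le> Lp_norm p \<nu> h"
proof -
  have mm: "(\<lambda>t. ennreal (\<nu> t) * indicator {\<rho>..<1} t) \<in> borel_measurable lebesgue"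
    by (rule restrict_measurable[OF radial_weight_measurable[OF rn]]) (use \<rho> in auto)
  have mm': "(\<lambda>t. (ennreal (m powr p) * (ennreal (\<nu> t) * indicator {\<rho>..<1} t)) * indicator {0..<1} t) \<in> borel_measurable lebesgue"
    by (intro borel_measurable_times_ennreal borel_measurable_const mm borel_measurable_indicator) auto
  have "ennreal (m powr p * tail \<nu> \<rho>) = ennreal (m powr p) * (\<integral>\<^sup>+t\<in>{\<rho>..<1}. ennreal (\<nu> t) \<partial>lebesgue)"
    using \<rho> by (simp add: tail_nn[OF rn] ennreal_mult')
  also have "\<dots> = (\<integral>\<^sup>+t. ennreal (m powr p) * (ennreal (\<nu> t) * indicator {\<rho>..<1} t) \<partial>lebesgue)"
    by (rule nn_integral_cmult[symmetric, OF mm])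
  also have "\<dots> \<le> (\<integral>\<^sup>+t\<in>{0..<1}. ennreal (2 * t) * (ennreal (m powr p) * (ennreal (\<nu> t) * indicator {\<rho>..<1} t)) \<partial>lebesgue)"
  proof (rule nn_integral_mono)
    fix t
    show "ennreal (m powr p) * (ennreal (\<nu> t) * indicator {\<rho>..<1} t) \<le> ennreal (2 * t) * (ennreal (m powr p) * (ennreal (\<nu> t) * indicator {\<rho>..<1} t)) * indicator {0..<1} t"
    proof (cases "t \<in> {\<rho>..<1}")
      case True
      then have "ennreal 1 \<le> ennreal (2 * t)" using \<rho> by (intro ennreal_leI) auto
      then have "1 * (ennreal (m powr p) * ennreal (\<nu> t)) \<le> ennreal (2 * t) * (ennreal (m powr p) * ennreal (\<nu> t))"
        by (intro mult_right_mono) auto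
      then show ?thesis using True \<rho> by simp
    qed simp
  qed
  also have "\<dots> = (\<integral>\<^sup>+z. ennreal (m powr p) * (ennreal (\<nu> (cmod z)) * indicator {\<rho>..<1} (cmod z)) \<partial>disc_area)"
    by (rule nn_integral_radial[OF mm', symmetric])
  also have "\<dots> \<le> (\<integral>\<^sup>+z. ennreal (cmod (h z) powr p * \<nu> (cmod z)) \<partial>disc_area)"
  proof (rule nn_integral_mono)
    fix z assume "z \<in> space disc_area"
    then have z: "cmod z < 1" by simp
    show "ennreal (m powr p) * (ennreal (\<nu> (cmod z)) * indicator {\<rho>..<1} (cmod z)) \<le> ennreal (cmod (h z) powr p * \<nu> (cmod z))"
    proof (cases "\<rho> \<le> cmod z")
      case True
      then have "m powr p * \<nu> (cmod z) \<le> cmod (h z) powr p * \<nu> (cmod z)"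
        using h[OF True z] assms(1) p z by (intro mult_right_mono powr_mono2) auto
      then show ?thesis using True z by (simp add: ennreal_mult'[symmetric] ennreal_leI)
    qed (simp add: indicator_def)
  qed
  finally have "ennreal (m powr p * tail \<nu> \<rho>) epowr (1 / p) \<le> Lp_norm p \<nu> h"
    unfolding Lp_norm_def using p by (intro epowr_mono) auto
  moreover have "ennreal (m powr p * tail \<nu> \<rho>) epowr (1 / p) = ennreal (m * fN \<rho>)"
  proof -
    have "0 \<le> m powr p * tail \<nu> \<rho>" using tail_pos[OF rn, of \<rho>] \<rho> by (auto intro: less_imp_le)
    then show ?thesis using p assms(1) by (simp add: epowr_ennreal fN_def powr_mult powr_powr)
  qed
  ultimately show ?thesis by simp
qed

text \<open>Testing against truncations of \<open>(\<omega>/\<nu>)\<^sup>1\<^sup>/\<^sup>(\<^sup>p\<^sup>-\<^sup>1\<^sup>)\<close>, for which \<open>g\<^sup>p \<nu> \<le> g \<omega>\<close>; where \<open>\<nu>\<close> vanishes the truncation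
  level itself is used.\<close>

lemma sigma_tail_le_of_test:
  assumes r: "0 \<le> r" "r < 1" and \<kappa>: "0 \<le> \<kappa>"
    and test: "\<And>g b. (\<lambda>t. g t * indicator {0..<1} t) \<in> borel_measurable lebesgue \<Longrightarrow> (\<And>t. 0 \<le> g t) \<Longrightarrow> (\<And>t. g t \<le> b)
      \<Longrightarrow> (\<And>t. t < r \<Longrightarrow> g t = 0) \<Longrightarrow>
      ennreal \<kappa> * (\<integral>\<^sup>+t\<in>{0..<1}. ennreal (2 * t) * ennreal (g t * \<omega> t) \<partial>lebesgue)
        \<le> (\<integral>\<^sup>+t\<in>{0..<1}. ennreal (2 * t) * ennreal (g t powr p * \<nu> t) \<partial>lebesgue) epowr (1 / p)"
  shows "ennreal \<kappa> * sigma_tail p \<omega> \<nu> r epowr (1 / q) \<le> 1"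
proof (cases "\<kappa> = 0")
  case False
  then have k: "0 < \<kappa>" using \<kappa> by simp
  \<comment> \<open>With this exponent \<open>g = (\<omega> / \<nu>) powr e\<close> satisfies
    \<open>g powr p * \<nu> = g * \<omega>\<close>, and \<open>t * g * \<omega>\<close> is
    \<open>\<sigma>\<close>, where both weights are positive.\<close>
  define e where "e = 1 / (p - 1)"
  have e: "0 < e" "e * p = e + 1" "1 + e = q" using p by (auto simp: e_def conj_exponent_def field_simps)
  define g where "g n t = (if r \<le> t \<and> t < 1 \<and> \<omega> t \<noteq> 0 then if \<nu> t = 0 then real n else min (real n) ((\<omega> t / \<nu> t) powr e) else 0)" for n t
  have g0: "0 \<le> g n t" "g n t \<le> real n" "t < r \<Longrightarrow> g n t = 0" for n t by (auto simp: g_def)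
  have gm: "(\<lambda>t. g n t * indicator {0..<1} t) \<in> borel_measurable lebesgue" for n
  proof -
    have [measurable]: "(\<lambda>t. \<omega> t * indicator {0..<1} t) \<in> borel_measurable lebesgue" "(\<lambda>t. \<nu> t * indicator {0..<1} t) \<in> borel_measurable lebesgue"
      by (intro weight_measurable_real rw rn)+
    have i: "(\<lambda>t. indicator {r..<1} t :: real) \<in> borel_measurable lebesgue" by (intro borel_measurable_indicator) auto
    have [measurable]: "(\<lambda>t. \<omega> t * indicator {0..<1} t / (\<nu> t * indicator {0..<1} t)) \<in> borel_measurable lebesgue"
      by (intro borel_measurable_divide weight_measurable_real rw rn)
    have "(\<lambda>t. (if \<omega> t * indicator {0..<1} t = 0 then 0 else if \<nu> t * indicator {0..<1} t = 0 then real n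
        else min (real n) ((\<omega> t * indicator {0..<1} t / (\<nu> t * indicator {0..<1} t)) powr e)) :: real) \<in> borel_measurable lebesgue"
      by measurable
    from borel_measurable_times[OF i this]
    have "(\<lambda>t. indicator {r..<1} t * (if \<omega> t * indicator {0..<1} t = 0 then 0 else if \<nu> t * indicator {0..<1} t = 0 then real n
        else min (real n) ((\<omega> t * indicator {0..<1} t / (\<nu> t * indicator {0..<1} t)) powr e)) :: real) \<in> borel_measurable lebesgue" .
    also have "(\<lambda>t. indicator {r..<1} t * (if \<omega> t * indicator {0..<1} t = 0 then 0 else if \<nu> t * indicator {0..<1} t = 0 then real n
        else min (real n) ((\<omega> t * indicator {0..<1} t / (\<nu> t * indicator {0..<1} t)) powr e)) :: real) = (\<lambda>t. g n t * indicator {0..<1} t)"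
      using r by (auto simp: g_def indicator_def fun_eq_iff)
    finally show ?thesis .
  qed
  define I where "I n = (\<integral>\<^sup>+t\<in>{0..<1}. ennreal (2 * t) * ennreal (g n t * \<omega> t) \<partial>lebesgue)" for n
  have gp: "g n t powr p * \<nu> t \<le> g n t * \<omega> t" if t: "0 \<le> t" "t < 1" for n t
  proof (cases "r \<le> t \<and> \<omega> t \<noteq> 0 \<and> \<nu> t \<noteq> 0")
    case True
    then have pos: "0 < \<omega> t" "0 < \<nu> t" using nonneg[OF t] by auto
    have g: "g n t = min (real n) ((\<omega> t / \<nu> t) powr e)" using True t by (simp add: g_def)
    show ?thesis
    proof (cases "g n t = 0")
      case False
      then have gpos: "0 < g n t" using g0(1)[of n t] by simp
      have "g n t powr (p - 1) \<le> ((\<omega> t / \<nu> t) powr e) powr (p - 1)"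
        using p gpos by (intro powr_mono2) (auto simp: g)
      also have "\<dots> = \<omega> t / \<nu> t" using p pos by (simp add: powr_powr e_def)
      finally have "g n t * (g n t powr (p - 1) * \<nu> t) \<le> g n t * \<omega> t"
        using pos gpos by (intro mult_left_mono) (auto simp: field_simps)
      moreover have "g n t powr p = g n t * g n t powr (p - 1)"
        using gpos powr_add[of "g n t" 1 "p - 1"] by simp
      ultimately show ?thesis by (simp add: mult.assoc)
    qed simp
  next
    case False
    then have "g n t = 0 \<or> \<nu> t = 0" by (auto simp: g_def)
    then show ?thesis using nonneg[OF t] g0(1)[of n t] by auto
  qed
  \<comment> \<open>Truncation at \<open>n\<close> makes the integral finite, which allows dividing
    by a power of it in the next step.\<close>
  have Ifin: "I n < \<infinity>" for n
  proof -
    have "I n \<le> (\<integral>\<^sup>+t. ennreal (2 * real n) * (ennreal (\<omega> t) * indicator {0..<1} t) \<partial>lebesgue)"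
      unfolding I_def
    proof (rule nn_integral_mono)
      fix t
      show "ennreal (2 * t) * ennreal (g n t * \<omega> t) * indicator {0..<1} t \<le> ennreal (2 * real n) * (ennreal (\<omega> t) * indicator {0..<1} t)"
      proof (cases "t \<in> {0..<1}")
        case True
        then have "(2 * t) * (g n t * \<omega> t) \<le> 2 * (real n * \<omega> t)" using g0(1,2)[of n t] by (intro mult_mono) auto
        then have "ennreal ((2 * t) * (g n t * \<omega> t)) \<le> ennreal ((2 * real n) * \<omega> t)" by (intro ennreal_leI) simp
        then show ?thesis using True by (simp add: ennreal_mult')
      qed simp
    qed
    also have "\<dots> = ennreal (2 * real n) * (\<integral>\<^sup>+t\<in>{0..<1}. ennreal (\<omega> t) \<partial>lebesgue)"
      by (rule nn_integral_cmult[OF radial_weight_measurable[OF rw]])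
    also have "\<dots> = ennreal (2 * real n) * ennreal (tail \<omega> 0)" by (simp add: tail_nn[OF rw])
    also have "\<dots> < \<infinity>" by (simp add: ennreal_mult_less_top)
    finally show ?thesis .
  qed
  \<comment> \<open>The test gives \<open>\<kappa> * I \<le> I powr (1 / p)\<close>; dividing leaves
    \<open>I powr (1 / q) \<le> 1 / \<kappa>\<close>, a bound independent of the truncation.\<close>
  have Ibound: "I n \<le> ennreal (\<kappa> powr (- q))" for n
  proof -
    define i where "i = enn2real (I n)"
    have i: "I n = ennreal i" "0 \<le> i" using Ifin[of n] by (auto simp: i_def)
    have "ennreal \<kappa> * I n \<le> (\<integral>\<^sup>+t\<in>{0..<1}. ennreal (2 * t) * ennreal (g n t powr p * \<nu> t) \<partial>lebesgue) epowr (1 / p)"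
      unfolding I_def using test[OF gm g0(1,2,3)] .
    also have "\<dots> \<le> I n epowr (1 / p)"
      unfolding I_def using p gp
      by (intro epowr_mono nn_integral_mono) (auto simp: indicator_def intro!: mult_left_mono ennreal_leI)
    finally have "ennreal (\<kappa> * i) \<le> ennreal (i powr (1 / p))" using i k by (simp add: epowr_ennreal ennreal_mult')
    then have le: "\<kappa> * i \<le> i powr (1 / p)" by (subst (asm) ennreal_le_iff) auto
    have "i \<le> \<kappa> powr (- q)"
    proof (cases "i = 0")
      case False
      then have ip: "0 < i" using i by simp
      have "i = i powr (1 / p) * i powr (1 / q)" using ip q(2) by (simp add: powr_add[symmetric])
      then have "(\<kappa> * i powr (1 / q)) * i powr (1 / p) \<le> 1 * i powr (1 / p)" using le by (simp add: mult_ac)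
      then have "\<kappa> * i powr (1 / q) \<le> 1" using ip by (subst (asm) mult_le_cancel_right) auto
      then have "i powr (1 / q) \<le> 1 / \<kappa>" using k by (simp add: field_simps)
      then have "(i powr (1 / q)) powr q \<le> (1 / \<kappa>) powr q" using q(1) by (intro powr_mono2) auto
      then show ?thesis using q(1) ip k by (simp add: powr_powr powr_divide powr_minus_divide)
    qed simp
    then show ?thesis using i by (simp add: ennreal_leI)
  qed
  have "ennreal 2 * sigma_tail p \<omega> \<nu> r \<le> (\<integral>\<^sup>+t. (SUP n. ennreal (2 * t) * ennreal (g n t * \<omega> t) * indicator {0..<1} t) \<partial>lebesgue)"
  proof -
    have "ennreal 2 * sigma_tail p \<omega> \<nu> r = (\<integral>\<^sup>+t. ennreal 2 * (sigma_weight p \<omega> \<nu> t * indicator {r..<1} t) \<partial>lebesgue)"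
      unfolding sigma_tail_def
      by (rule nn_integral_cmult[symmetric], rule restrict_measurable[OF sigma_measurable]) (use r in auto)
    also have "\<dots> \<le> (\<integral>\<^sup>+t. (SUP n. ennreal (2 * t) * ennreal (g n t * \<omega> t) * indicator {0..<1} t) \<partial>lebesgue)"
    proof (rule nn_integral_mono)
      fix t
      show "ennreal 2 * (sigma_weight p \<omega> \<nu> t * indicator {r..<1} t) \<le> (SUP n. ennreal (2 * t) * ennreal (g n t * \<omega> t) * indicator {0..<1} t)"
      proof (cases "r \<le> t \<and> t < 1 \<and> t \<noteq> 0 \<and> \<omega> t \<noteq> 0")
        case True
        then have t: "0 < t" "t < 1" "r \<le> t" using r by auto
        then have "0 \<le> \<omega> t" by (intro nonneg) auto
        then have wp: "0 < \<omega> t" using True by linarith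
        show ?thesis
        proof (cases "\<nu> t = 0")
          \<comment> \<open>Here \<open>g n t = n\<close>, so the supremum is infinite, matching the
            infinite value of \<open>\<sigma>\<close>.\<close>
          case nz: True
          have "(SUP n. ennreal (2 * t) * ennreal (g n t * \<omega> t) * indicator {0..<1} t) = top"
          proof (rule ennreal_SUP_eq_top)
            fix N :: nat
            obtain n where n: "real N / (2 * t * \<omega> t) \<le> real n" using real_arch_simple by blast
            have "real N \<le> 2 * t * (real n * \<omega> t)" using n t wp by (simp add: field_simps)
            then have "of_nat N \<le> ennreal (2 * t) * ennreal (real n * \<omega> t)"
              using t by (simp add: ennreal_mult'[symmetric] ennreal_of_nat_eq_real_of_nat ennreal_leI)
            then show "\<exists>n\<in>UNIV. of_nat N \<le> ennreal (2 * t) * ennreal (g n t * \<omega> t) * indicator {0..<1} t"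
              using True nz t by (intro bexI[of _ n]) (auto simp: g_def)
          qed
          then show ?thesis by (simp only: top_greatest)
        next
          case False
          have "0 \<le> \<nu> t" using t by (intro nonneg) auto
          then have np: "0 < \<nu> t" using False by linarith
          obtain n where n: "(\<omega> t / \<nu> t) powr e \<le> real n" using real_arch_simple by blast
          have g: "g n t = (\<omega> t / \<nu> t) powr e" using True False n by (simp add: g_def)
          have "sigma_weight p \<omega> \<nu> t = ennreal t * ennreal ((\<omega> t / \<nu> t powr (1 / p)) powr q)"
            using wp np by (simp add: sigma_weight_def divide_ennreal epowr_ennreal)
          also have "(\<omega> t / \<nu> t powr (1 / p)) powr q = g n t * \<omega> t"
          proof -
            have "q / p = e" using q(3) e(3) by simp
            then have "(\<omega> t / \<nu> t powr (1 / p)) powr q = \<omega> t powr q / \<nu> t powr e"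
              using wp np by (simp add: powr_divide powr_powr)
            also have "\<omega> t powr q = \<omega> t powr e * \<omega> t" using wp e(3) powr_add[of "\<omega> t" e 1] by (simp add: add.commute)
            finally show ?thesis using wp np by (simp add: g powr_divide)
          qed
          finally have "ennreal 2 * sigma_weight p \<omega> \<nu> t = ennreal (2 * t) * ennreal (g n t * \<omega> t)"
            by (simp add: ennreal_mult' mult.assoc)
          then have "ennreal 2 * (sigma_weight p \<omega> \<nu> t * indicator {r..<1} t) \<le> ennreal (2 * t) * ennreal (g n t * \<omega> t) * indicator {0..<1} t"
            using t by simp
          also have "\<dots> \<le> (SUP n. ennreal (2 * t) * ennreal (g n t * \<omega> t) * indicator {0..<1} t)" by (rule SUP_upper) simp
          finally show ?thesis .
        qed
      next
        case False
        have "sigma_weight p \<omega> \<nu> t * indicator {r..<1} t = 0"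
        proof (cases "t \<in> {r..<1}")
          case True
          then have "t = 0 \<or> \<omega> t = 0" using False by auto
          then show ?thesis by (auto simp: sigma_weight_def)
        qed simp
        show ?thesis unfolding \<open>sigma_weight p \<omega> \<nu> t * indicator {r..<1} t = 0\<close> by simp
      qed
    qed
    finally show ?thesis .
  qed
  also have "\<dots> = (SUP n. \<integral>\<^sup>+t. ennreal (2 * t) * ennreal (g n t * \<omega> t) * indicator {0..<1} t \<partial>lebesgue)"
  proof (rule nn_integral_monotone_convergence_SUP)
    show "incseq (\<lambda>n t. ennreal (2 * t) * ennreal (g n t * \<omega> t) * indicator {0..<1} t)"
    proof (intro incseq_SucI le_funI)
      fix n t
      show "ennreal (2 * t) * ennreal (g n t * \<omega> t) * indicator {0..<1} t \<le> ennreal (2 * t) * ennreal (g (Suc n) t * \<omega> t) * indicator {0..<1} t"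
      proof (cases "t \<in> {0..<1}")
        case True
        have "g n t \<le> g (Suc n) t" by (auto simp: g_def)
        then have "g n t * \<omega> t \<le> g (Suc n) t * \<omega> t" using True by (intro mult_right_mono) auto
        then show ?thesis using True by (auto intro!: mult_left_mono ennreal_leI)
      qed simp
    qed
    fix n
    have i: "(\<lambda>t. ennreal (2 * t)) \<in> borel_measurable lebesgue" by (intro measurable_completion) measurable
    have "(\<lambda>t. ennreal ((g n t * indicator {0..<1} t) * (\<omega> t * indicator {0..<1} t))) \<in> borel_measurable lebesgue"
      by (rule measurable_compose[OF borel_measurable_times[OF gm weight_measurable_real[OF rw]]]) measurable
    from borel_measurable_times_ennreal[OF i this]
    have "(\<lambda>t. ennreal (2 * t) * ennreal ((g n t * indicator {0..<1} t) * (\<omega> t * indicator {0..<1} t))) \<in> borel_measurable lebesgue" .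
    also have "(\<lambda>t. ennreal (2 * t) * ennreal ((g n t * indicator {0..<1} t) * (\<omega> t * indicator {0..<1} t))) = (\<lambda>t. ennreal (2 * t) * ennreal (g n t * \<omega> t) * indicator {0..<1} t)"
      by (auto simp: indicator_def)
    finally show "(\<lambda>t. ennreal (2 * t) * ennreal (g n t * \<omega> t) * indicator {0..<1} t) \<in> borel_measurable lebesgue" .
  qed
  also have "\<dots> \<le> ennreal (\<kappa> powr (- q))" using Ibound by (intro SUP_least) (simp add: I_def)
  finally have s: "ennreal 2 * sigma_tail p \<omega> \<nu> r \<le> ennreal (\<kappa> powr (- q))" .
  have "1 * sigma_tail p \<omega> \<nu> r \<le> ennreal 2 * sigma_tail p \<omega> \<nu> r" by (intro mult_right_mono) auto
  with s have "sigma_tail p \<omega> \<nu> r \<le> ennreal (\<kappa> powr (- q))" by simp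
  then have "sigma_tail p \<omega> \<nu> r epowr (1 / q) \<le> ennreal (\<kappa> powr (- q)) epowr (1 / q)" using q(1) by (intro epowr_mono) auto
  also have "\<dots> = ennreal (\<kappa> powr (- 1))" using q(1) by (simp add: epowr_ennreal powr_powr)
  also have "\<kappa> powr (- 1) = 1 / \<kappa>" using k by (simp add: powr_minus_divide)
  finally have "ennreal \<kappa> * sigma_tail p \<omega> \<nu> r epowr (1 / q) \<le> ennreal \<kappa> * ennreal (1 / \<kappa>)" by (intro mult_left_mono) auto
  then show ?thesis using k by (simp add: ennreal_mult'[symmetric])
qed simp

end

context two_weights
begin

lemma test_function_Lp:
  assumes gm: "(\<lambda>t. g t * indicator {0..<1} t) \<in> borel_measurable lebesgue" and g: "\<And>t. 0 \<le> g t" "\<And>t. g t \<le> b"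
    and f: "f \<in> borel_measurable disc_area" "\<And>z. cmod (f z) \<le> g (cmod z)"
  shows "f \<in> Lp_space p \<nu>"
    "Lp_norm p \<nu> f \<le> (\<integral>\<^sup>+t\<in>{0..<1}. ennreal (2 * t) * ennreal (g t powr p * \<nu> t) \<partial>lebesgue) epowr (1 / p)"
proof -
  have gn: "(\<lambda>t. ennreal (g t powr p * \<nu> t) * indicator {0..<1} t) \<in> borel_measurable lebesgue"
  proof -
    have "(\<lambda>t. (g t * indicator {0..<1} t) powr p) \<in> borel_measurable lebesgue"
      by (rule measurable_compose[OF gm]) measurable
    from borel_measurable_times[OF this weight_measurable_real[OF rn]]
    have "(\<lambda>t. ennreal ((g t * indicator {0..<1} t) powr p * (\<nu> t * indicator {0..<1} t))) \<in> borel_measurable lebesgue"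
      by (rule measurable_compose) measurable
    also have "(\<lambda>t. ennreal ((g t * indicator {0..<1} t) powr p * (\<nu> t * indicator {0..<1} t))) = (\<lambda>t. ennreal (g t powr p * \<nu> t) * indicator {0..<1} t)"
      by (auto simp: indicator_def)
    finally show ?thesis .
  qed
  let ?J = "\<integral>\<^sup>+t\<in>{0..<1}. ennreal (2 * t) * ennreal (g t powr p * \<nu> t) \<partial>lebesgue"
  have "(\<integral>\<^sup>+z. ennreal (cmod (f z) powr p * \<nu> (cmod z)) \<partial>disc_area) \<le> (\<integral>\<^sup>+z. ennreal (g (cmod z) powr p * \<nu> (cmod z)) \<partial>disc_area)"
    using f(2) p by (intro nn_integral_mono ennreal_leI mult_right_mono powr_mono2) auto
  also have "\<dots> = ?J" by (rule nn_integral_radial[OF gn])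
  finally have le: "(\<integral>\<^sup>+z. ennreal (cmod (f z) powr p * \<nu> (cmod z)) \<partial>disc_area) \<le> ?J" .
  have "?J \<le> (\<integral>\<^sup>+t. ennreal (2 * b powr p) * (ennreal (\<nu> t) * indicator {0..<1} t) \<partial>lebesgue)"
  proof (rule nn_integral_mono)
    fix t
    show "ennreal (2 * t) * ennreal (g t powr p * \<nu> t) * indicator {0..<1} t \<le> ennreal (2 * b powr p) * (ennreal (\<nu> t) * indicator {0..<1} t)"
    proof (cases "t \<in> {0..<1}")
      case True
      then have "(2 * t) * (g t powr p * \<nu> t) \<le> 2 * (b powr p * \<nu> t)"
        using g[of t] p by (intro mult_mono powr_mono2) auto
      then have "ennreal ((2 * t) * (g t powr p * \<nu> t)) \<le> ennreal ((2 * b powr p) * \<nu> t)" by (intro ennreal_leI) simp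
      then show ?thesis using True by (simp add: ennreal_mult')
    qed simp
  qed
  also have "\<dots> = ennreal (2 * b powr p) * (\<integral>\<^sup>+t\<in>{0..<1}. ennreal (\<nu> t) \<partial>lebesgue)"
    by (rule nn_integral_cmult[OF radial_weight_measurable[OF rn]])
  also have "\<dots> = ennreal (2 * b powr p) * ennreal (tail \<nu> 0)" by (simp add: tail_nn[OF rn])
  also have "\<dots> < \<infinity>" by (simp add: ennreal_mult_less_top)
  finally have "?J < \<infinity>" .
  then show "f \<in> Lp_space p \<nu>" using f(1) le by (auto simp: Lp_space_iff intro: le_less_trans)
  show "Lp_norm p \<nu> f \<le> ?J epowr (1 / p)"
    unfolding Lp_norm_def using p le by (intro epowr_mono) auto
qed

lemma radial_omega_integral:
  assumes gm: "(\<lambda>t. g t * indicator {0..<1} t) \<in> borel_measurable lebesgue"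
  shows "(\<lambda>t. (g t * \<omega> t) * indicator {0..<1} t) \<in> borel_measurable lebesgue"
    "(\<integral>\<^sup>+z. ennreal (g (cmod z) * \<omega> (cmod z)) \<partial>disc_area) = (\<integral>\<^sup>+t\<in>{0..<1}. ennreal (2 * t) * ennreal (g t * \<omega> t) \<partial>lebesgue)"
proof -
  have "(\<lambda>t. (g t * indicator {0..<1} t) * (\<omega> t * indicator {0..<1} t)) \<in> borel_measurable lebesgue"
    by (rule borel_measurable_times[OF gm weight_measurable_real[OF rw]])
  also have "(\<lambda>t. (g t * indicator {0..<1} t) * (\<omega> t * indicator {0..<1} t)) = (\<lambda>t. (g t * \<omega> t) * indicator {0..<1} t)"
    by (auto simp: indicator_def)
  finally show m: "(\<lambda>t. (g t * \<omega> t) * indicator {0..<1} t) \<in> borel_measurable lebesgue" .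
  have "(\<lambda>t. ennreal ((g t * \<omega> t) * indicator {0..<1} t)) \<in> borel_measurable lebesgue"
    by (rule measurable_compose[OF m]) measurable
  also have "(\<lambda>t. ennreal ((g t * \<omega> t) * indicator {0..<1} t)) = (\<lambda>t. ennreal (g t * \<omega> t) * indicator {0..<1} t)"
    by (auto simp: indicator_def)
  finally show "(\<integral>\<^sup>+z. ennreal (g (cmod z) * \<omega> (cmod z)) \<partial>disc_area) = (\<integral>\<^sup>+t\<in>{0..<1}. ennreal (2 * t) * ennreal (g t * \<omega> t) \<partial>lebesgue)"
    by (rule nn_integral_radial)
qed

text \<open>Angular integration against \<open>sgn \<zeta> ^ n\<close> annihilates every term of the
  kernel series except the \<open>n\<close>-th. Termwise integration is justified because all terms
  \<open>h k\<close> are dominated by the same integrable \<open>\<phi>\<close> and the factors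
  \<open>a k\<close> are absolutely summable.\<close>

lemma bergman_proj_monomial:
  assumes wD: "\<omega> \<in> class_Dhat" and z: "z \<in> ball 0 1"
    and gm: "(\<lambda>t. g t * indicator {0..<1} t) \<in> borel_measurable lebesgue" and g: "\<And>t. 0 \<le> g t"
    and fin: "(\<integral>\<^sup>+z. ennreal (g (cmod z) * \<omega> (cmod z)) \<partial>disc_area) < \<infinity>"
  shows "bergman_proj \<omega> (\<lambda>\<zeta>. complex_of_real (g (cmod \<zeta>)) * sgn \<zeta> ^ n) z
    = complex_of_real (bcoef \<omega> n) * z ^ n * complex_of_real (LINT \<zeta>|disc_area. g (cmod \<zeta>) * cmod \<zeta> ^ n * \<omega> (cmod \<zeta>))"
proof -
  note m = radial_omega_integral(1)[OF gm]
  have [measurable]: "(\<lambda>\<zeta>. g (cmod \<zeta>) * \<omega> (cmod \<zeta>)) \<in> borel_measurable disc_area"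
    by (rule radial_real_measurable[OF m])
  have [measurable]: "cnj \<in> borel_measurable borel"
    by (intro borel_measurable_continuous_onI continuous_intros)
  have sg: "sgn \<zeta> = \<zeta> / complex_of_real (cmod \<zeta>)" for \<zeta> :: complex by (simp add: sgn_eq)
  define \<phi> where "\<phi> t = g t * \<omega> t" for t
  have [measurable]: "(\<lambda>\<zeta>. \<phi> (cmod \<zeta>)) \<in> borel_measurable disc_area" unfolding \<phi>_def by measurable
  have \<phi>0: "0 \<le> \<phi> (cmod \<zeta>)" if "\<zeta> \<in> space disc_area" for \<zeta> using g that by (simp add: \<phi>_def)
  have \<phi>i: "integrable disc_area (\<lambda>\<zeta>. \<phi> (cmod \<zeta>))"
  proof (rule integrableI_bounded)
    have "(\<integral>\<^sup>+\<zeta>. ennreal (norm (\<phi> (cmod \<zeta>))) \<partial>disc_area) = (\<integral>\<^sup>+z. ennreal (g (cmod z) * \<omega> (cmod z)) \<partial>disc_area)"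
      using \<phi>0 by (intro nn_integral_cong) (simp add: \<phi>_def)
    then show "(\<integral>\<^sup>+\<zeta>. ennreal (norm (\<phi> (cmod \<zeta>))) \<partial>disc_area) < \<infinity>" using fin by simp
  qed measurable
  define h where "h k \<zeta> = complex_of_real (\<phi> (cmod \<zeta>)) * (sgn \<zeta> ^ n * cnj \<zeta> ^ k)" for k \<zeta>
  have hm [measurable]: "h k \<in> borel_measurable disc_area" for k unfolding h_def sg by measurable
  have sl: "cmod (sgn \<zeta>) \<le> 1" for \<zeta> :: complex by (simp add: norm_sgn)
  have hb: "norm (h k \<zeta>) \<le> norm (\<phi> (cmod \<zeta>))" if "\<zeta> \<in> space disc_area" for k \<zeta>
  proof -
    have "cmod (sgn \<zeta>) ^ n * cmod \<zeta> ^ k \<le> 1 * 1"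
      using that sl by (intro mult_mono power_le_one) auto
    then have "\<bar>\<phi> (cmod \<zeta>)\<bar> * (cmod (sgn \<zeta>) ^ n * cmod \<zeta> ^ k) \<le> \<bar>\<phi> (cmod \<zeta>)\<bar> * 1"
      by (intro mult_left_mono) auto
    then show ?thesis by (simp add: h_def norm_mult norm_power)
  qed
  have hi: "integrable disc_area (h k)" for k
    by (rule Bochner_Integration.integrable_bound[OF \<phi>i hm]) (use hb in \<open>auto intro: AE_I2\<close>)
  define a where "a k = complex_of_real (bcoef \<omega> k) * z ^ k" for k
  have as: "summable (\<lambda>k. norm (a k))" unfolding a_def using z by (intro bker_summable_norm wD) auto
  have eq: "complex_of_real (g (cmod \<zeta>)) * sgn \<zeta> ^ n * cnj (bergman_kernel \<omega> z \<zeta>) * complex_of_real (\<omega> (cmod \<zeta>)) = (\<Sum>k. a k * h k \<zeta>)"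
    if "\<zeta> \<in> space disc_area" for \<zeta>
  proof -
    have lt: "cmod (cnj z * \<zeta>) < 1"
      using that z mult_strict_mono[of "cmod z" 1 "cmod \<zeta>" 1] by (simp add: norm_mult)
    have c: "cnj (bergman_kernel \<omega> z \<zeta>) = bker \<omega> (z * cnj \<zeta>)"
      unfolding bergman_kernel_eq using bker_cnj[OF wD lt] by simp
    have s: "summable (\<lambda>k. complex_of_real (bcoef \<omega> k) * (z * cnj \<zeta>) ^ k)"
      using lt by (intro summable_norm_cancel[OF bker_summable_norm[OF wD]]) (simp add: norm_mult)
    have "complex_of_real (g (cmod \<zeta>)) * sgn \<zeta> ^ n * cnj (bergman_kernel \<omega> z \<zeta>) * complex_of_real (\<omega> (cmod \<zeta>))
      = (complex_of_real (\<phi> (cmod \<zeta>)) * sgn \<zeta> ^ n) * bker \<omega> (z * cnj \<zeta>)"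
      by (simp add: c \<phi>_def)
    also have "\<dots> = (\<Sum>k. (complex_of_real (\<phi> (cmod \<zeta>)) * sgn \<zeta> ^ n) * (complex_of_real (bcoef \<omega> k) * (z * cnj \<zeta>) ^ k))"
      unfolding bker_def by (rule suminf_mult[OF s, symmetric])
    also have "\<dots> = (\<Sum>k. a k * h k \<zeta>)" by (simp add: a_def h_def power_mult_distrib mult_ac)
    finally show ?thesis .
  qed
  have hz: "(LINT \<zeta>|disc_area. h k \<zeta>) = 0" if "k \<noteq> n" for k
    unfolding h_def using that m by (intro integral_angular_zero) (auto simp: \<phi>_def)
  have hn: "(LINT \<zeta>|disc_area. h n \<zeta>) = complex_of_real (LINT \<zeta>|disc_area. g (cmod \<zeta>) * cmod \<zeta> ^ n * \<omega> (cmod \<zeta>))"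
  proof -
    have "sgn \<zeta> * cnj \<zeta> = complex_of_real (cmod \<zeta>)" for \<zeta> :: complex
    proof (cases "\<zeta> = 0")
      case False
      have "sgn \<zeta> * cnj \<zeta> = (\<zeta> * cnj \<zeta>) / complex_of_real (cmod \<zeta>)" by (simp add: sg)
      also have "\<zeta> * cnj \<zeta> = complex_of_real (cmod \<zeta>) * complex_of_real (cmod \<zeta>)"
        using complex_norm_square[of \<zeta>] by (simp add: power2_eq_square)
      finally show ?thesis using False by simp
    qed simp
    then have "h n \<zeta> = complex_of_real (g (cmod \<zeta>) * cmod \<zeta> ^ n * \<omega> (cmod \<zeta>))" for \<zeta>
      unfolding h_def power_mult_distrib[symmetric] by (simp add: \<phi>_def)
    then have "(LINT \<zeta>|disc_area. h n \<zeta>) = (LINT \<zeta>|disc_area. complex_of_real (g (cmod \<zeta>) * cmod \<zeta> ^ n * \<omega> (cmod \<zeta>)))" by (simp only:)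
    then show ?thesis by (simp only: integral_complex_of_real)
  qed
  have "bergman_proj \<omega> (\<lambda>\<zeta>. complex_of_real (g (cmod \<zeta>)) * sgn \<zeta> ^ n) z = (LINT \<zeta>|disc_area. (\<Sum>k. a k * h k \<zeta>))"
    unfolding bergman_proj_def integral_op_def by (intro Bochner_Integration.integral_cong refl eq)
  also have "\<dots> = (\<Sum>k. LINT \<zeta>|disc_area. a k * h k \<zeta>)"
  proof (rule integral_suminf)
    show "integrable disc_area (\<lambda>\<zeta>. a k * h k \<zeta>)" for k using hi by simp
    show "AE \<zeta> in disc_area. summable (\<lambda>k. norm (a k * h k \<zeta>))"
    proof (rule AE_I2)
      fix \<zeta> assume ze: "\<zeta> \<in> space disc_area"
      show "summable (\<lambda>k. norm (a k * h k \<zeta>))"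
      proof (rule summable_comparison_test'[where N=0])
        show "summable (\<lambda>k. norm (a k) * norm (\<phi> (cmod \<zeta>)))" using as by (rule summable_mult2)
        show "norm (norm (a k * h k \<zeta>)) \<le> norm (a k) * norm (\<phi> (cmod \<zeta>))" for k
          using hb[OF ze, of k] by (simp add: norm_mult mult_left_mono)
      qed
    qed
    show "summable (\<lambda>k. LINT \<zeta>|disc_area. norm (a k * h k \<zeta>))"
    proof (rule summable_comparison_test'[where N=0])
      show "summable (\<lambda>k. norm (a k) * (LINT \<zeta>|disc_area. norm (\<phi> (cmod \<zeta>))))" using as by (rule summable_mult2)
      fix k
      have "(LINT \<zeta>|disc_area. norm (a k * h k \<zeta>)) \<le> (LINT \<zeta>|disc_area. norm (a k) * norm (\<phi> (cmod \<zeta>)))"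
        using hi \<phi>i hb by (intro integral_mono) (auto simp: norm_mult intro!: mult_left_mono)
      then show "norm (LINT \<zeta>|disc_area. norm (a k * h k \<zeta>)) \<le> norm (a k) * (LINT \<zeta>|disc_area. norm (\<phi> (cmod \<zeta>)))"
        by simp
    qed
  qed
  also have "\<dots> = (\<Sum>k. if k = n then a n * (LINT \<zeta>|disc_area. h n \<zeta>) else 0)"
    using hz by (intro suminf_cong) auto
  also have "\<dots> = a n * (LINT \<zeta>|disc_area. h n \<zeta>)" using sums_unique[OF sums_single[of n "\<lambda>_. a n * (LINT \<zeta>|disc_area. h n \<zeta>)"]] by simp
  finally show ?thesis by (simp add: a_def hn)
qed

lemma omega_integral_finite:
  assumes gm: "(\<lambda>t. g t * indicator {0..<1} t) \<in> borel_measurable lebesgue" and g: "\<And>t. 0 \<le> g t" "\<And>t. g t \<le> b"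
  shows "(\<integral>\<^sup>+z. ennreal (g (cmod z) * \<omega> (cmod z)) \<partial>disc_area) < \<infinity>"
proof -
  have b0: "0 \<le> b" using g[of 0] by linarith
  have "(\<integral>\<^sup>+z. ennreal (g (cmod z) * \<omega> (cmod z)) \<partial>disc_area) \<le> (\<integral>\<^sup>+t. ennreal (2 * b) * (ennreal (\<omega> t) * indicator {0..<1} t) \<partial>lebesgue)"
    unfolding radial_omega_integral(2)[OF gm]
  proof (rule nn_integral_mono)
    fix t
    show "ennreal (2 * t) * ennreal (g t * \<omega> t) * indicator {0..<1} t \<le> ennreal (2 * b) * (ennreal (\<omega> t) * indicator {0..<1} t)"
    proof (cases "t \<in> {0..<1}")
      case True
      then have "(2 * t) * (g t * \<omega> t) \<le> 2 * (b * \<omega> t)" using g[of t] by (intro mult_mono) auto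
      then have "ennreal ((2 * t) * (g t * \<omega> t)) \<le> ennreal ((2 * b) * \<omega> t)" by (intro ennreal_leI) simp
      then show ?thesis using True b0 by (simp add: ennreal_mult')
    qed simp
  qed
  also have "\<dots> = ennreal (2 * b) * (\<integral>\<^sup>+t\<in>{0..<1}. ennreal (\<omega> t) \<partial>lebesgue)"
    by (rule nn_integral_cmult[OF radial_weight_measurable[OF rw]])
  also have "\<dots> = ennreal (2 * b) * ennreal (tail \<omega> 0)" by (simp add: tail_nn[OF rw])
  also have "\<dots> < \<infinity>" by (simp add: ennreal_mult_less_top)
  finally show ?thesis .
qed

text \<open>The test function is \<open>g (cmod \<zeta>) * sgn \<zeta> ^ n\<close>, with projection
  \<open>bcoef \<omega> n * G * z ^ n\<close>. One factor \<open>r ^ n\<close> comes from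
  \<open>cmod z ^ n\<close> on the annulus where the norm is bounded below, the other from
  \<open>cmod \<zeta> ^ n\<close> inside \<open>G\<close> on the support of
  \<open>g\<close>.\<close>

lemma bergman_proj_test:
  assumes wD: "\<omega> \<in> class_Dhat" and Cb: "0 < Cb" "\<And>f. f \<in> Lp_space p \<nu> \<Longrightarrow> Lp_norm p \<nu> (bergman_proj \<omega> f) \<le> ennreal Cb * Lp_norm p \<nu> f"
    and r: "0 \<le> r" "r < 1"
  shows "ennreal (bcoef \<omega> n * r ^ n * r ^ n * fN (max r (1/2)) / Cb) * sigma_tail p \<omega> \<nu> r epowr (1 / q) \<le> 1"
proof (rule sigma_tail_le_of_test[OF r])
  let ?\<rho> = "max r (1/2)"
  have c0: "0 \<le> bcoef \<omega> n" using bcoef_pos[OF rw, of n] by simp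
  have N0: "0 \<le> fN ?\<rho>" by (simp add: fN_def)
  show "0 \<le> bcoef \<omega> n * r ^ n * r ^ n * fN ?\<rho> / Cb" using c0 N0 r Cb(1) by simp
  fix g :: "real \<Rightarrow> real" and b :: real assume gm: "(\<lambda>t. g t * indicator {0..<1} t) \<in> borel_measurable lebesgue"
    and g: "\<And>t. 0 \<le> g t" "\<And>t. g t \<le> b" "\<And>t. t < r \<Longrightarrow> g t = 0"
  let ?J = "\<integral>\<^sup>+t\<in>{0..<1}. ennreal (2 * t) * ennreal (g t powr p * \<nu> t) \<partial>lebesgue"
  let ?I = "\<integral>\<^sup>+t\<in>{0..<1}. ennreal (2 * t) * ennreal (g t * \<omega> t) \<partial>lebesgue"
  define f where "f \<zeta> = complex_of_real (g (cmod \<zeta>)) * sgn \<zeta> ^ n" for \<zeta>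
  have sg: "sgn \<zeta> = \<zeta> / complex_of_real (cmod \<zeta>)" for \<zeta> :: complex by (simp add: sgn_eq)
  have [measurable]: "(\<lambda>\<zeta>. g (cmod \<zeta>)) \<in> borel_measurable disc_area" by (rule radial_real_measurable[OF gm])
  have fm: "f \<in> borel_measurable disc_area" unfolding f_def sg by measurable
  have fb: "cmod (f \<zeta>) \<le> g (cmod \<zeta>)" for \<zeta>
  proof -
    have "cmod (sgn \<zeta>) ^ n \<le> 1" by (intro power_le_one) (auto simp: norm_sgn)
    then have "g (cmod \<zeta>) * cmod (sgn \<zeta>) ^ n \<le> g (cmod \<zeta>) * 1" using g(1) by (intro mult_left_mono) auto
    then show ?thesis using g(1)[of "cmod \<zeta>"] by (simp add: f_def norm_mult norm_power)
  qed
  note fL = test_function_Lp[OF gm g(1,2) fm fb]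
  have fin: "(\<integral>\<^sup>+z. ennreal (g (cmod z) * \<omega> (cmod z)) \<partial>disc_area) < \<infinity>"
    by (rule omega_integral_finite[OF gm g(1,2)])
  define G where "G = (LINT \<zeta>|disc_area. g (cmod \<zeta>) * cmod \<zeta> ^ n * \<omega> (cmod \<zeta>))"
  have [measurable]: "(\<lambda>\<zeta>. g (cmod \<zeta>) * \<omega> (cmod \<zeta>)) \<in> borel_measurable disc_area" by measurable
  have gnn: "0 \<le> g (cmod \<zeta>) * cmod \<zeta> ^ n * \<omega> (cmod \<zeta>)" if "\<zeta> \<in> space disc_area" for \<zeta> using g(1) that by simp
  have Gi: "integrable disc_area (\<lambda>\<zeta>. g (cmod \<zeta>) * cmod \<zeta> ^ n * \<omega> (cmod \<zeta>))"
  proof (rule integrableI_bounded)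
    have "(\<integral>\<^sup>+\<zeta>. ennreal (norm (g (cmod \<zeta>) * cmod \<zeta> ^ n * \<omega> (cmod \<zeta>))) \<partial>disc_area) \<le> (\<integral>\<^sup>+z. ennreal (g (cmod z) * \<omega> (cmod z)) \<partial>disc_area)"
    proof (intro nn_integral_mono ennreal_leI)
      fix \<zeta> assume ze: "\<zeta> \<in> space disc_area"
      have "cmod \<zeta> ^ n \<le> 1" using ze by (intro power_le_one) auto
      then have "(g (cmod \<zeta>) * \<omega> (cmod \<zeta>)) * cmod \<zeta> ^ n \<le> (g (cmod \<zeta>) * \<omega> (cmod \<zeta>)) * 1"
        using g(1) ze by (intro mult_left_mono) auto
      then show "norm (g (cmod \<zeta>) * cmod \<zeta> ^ n * \<omega> (cmod \<zeta>)) \<le> g (cmod \<zeta>) * \<omega> (cmod \<zeta>)"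
        using gnn[OF ze] by (simp add: mult_ac)
    qed
    then show "(\<integral>\<^sup>+\<zeta>. ennreal (norm (g (cmod \<zeta>) * cmod \<zeta> ^ n * \<omega> (cmod \<zeta>))) \<partial>disc_area) < \<infinity>" using fin by (rule le_less_trans)
  qed measurable
  have G0: "0 \<le> G" unfolding G_def using gnn by (intro Bochner_Integration.integral_nonneg) auto
  have GI: "ennreal (r ^ n) * ?I \<le> ennreal G"
  proof -
    have "ennreal (r ^ n) * ?I = (\<integral>\<^sup>+z. ennreal (r ^ n) * ennreal (g (cmod z) * \<omega> (cmod z)) \<partial>disc_area)"
      unfolding radial_omega_integral(2)[OF gm, symmetric] by (rule nn_integral_cmult[symmetric]) measurable
    also have "\<dots> \<le> (\<integral>\<^sup>+\<zeta>. ennreal (g (cmod \<zeta>) * cmod \<zeta> ^ n * \<omega> (cmod \<zeta>)) \<partial>disc_area)"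
    proof (rule nn_integral_mono)
      fix \<zeta> assume ze: "\<zeta> \<in> space disc_area"
      show "ennreal (r ^ n) * ennreal (g (cmod \<zeta>) * \<omega> (cmod \<zeta>)) \<le> ennreal (g (cmod \<zeta>) * cmod \<zeta> ^ n * \<omega> (cmod \<zeta>))"
      proof (cases "cmod \<zeta> < r")
        case False
        then have "r ^ n \<le> cmod \<zeta> ^ n" using r by (intro power_mono) auto
        then have "r ^ n * (g (cmod \<zeta>) * \<omega> (cmod \<zeta>)) \<le> cmod \<zeta> ^ n * (g (cmod \<zeta>) * \<omega> (cmod \<zeta>))"
          using g(1) ze by (intro mult_right_mono) auto
        then have "ennreal (r ^ n * (g (cmod \<zeta>) * \<omega> (cmod \<zeta>))) \<le> ennreal (g (cmod \<zeta>) * cmod \<zeta> ^ n * \<omega> (cmod \<zeta>))"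
          by (intro ennreal_leI) (simp add: mult_ac)
        then show ?thesis using r by (simp add: ennreal_mult')
      qed (simp add: g(3))
    qed
    also have "\<dots> = ennreal G" unfolding G_def using Gi gnn by (intro nn_integral_eq_integral) auto
    finally show ?thesis .
  qed
  have "ennreal ((bcoef \<omega> n * r ^ n * G) * fN ?\<rho>) \<le> Lp_norm p \<nu> (bergman_proj \<omega> f)"
  proof (rule Lp_norm_ge_annulus)
    show "0 \<le> bcoef \<omega> n * r ^ n * G" using c0 r G0 by simp
    show "1 / 2 \<le> ?\<rho>" "?\<rho> < 1" using r by auto
    fix z :: complex assume z: "?\<rho> \<le> cmod z" "cmod z < 1"
    have "bergman_proj \<omega> f z = complex_of_real (bcoef \<omega> n) * z ^ n * complex_of_real G"
      unfolding f_def G_def using z by (intro bergman_proj_monomial wD gm g(1) fin) auto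
    then have "cmod (bergman_proj \<omega> f z) = bcoef \<omega> n * cmod z ^ n * G"
      using c0 G0 by (simp add: norm_mult norm_power)
    moreover have "r ^ n \<le> cmod z ^ n" using r z by (intro power_mono) auto
    ultimately show "bcoef \<omega> n * r ^ n * G \<le> cmod (bergman_proj \<omega> f z)"
      using c0 G0 by (simp add: mult_left_mono mult_right_mono)
  qed
  also have "\<dots> \<le> ennreal Cb * ?J epowr (1 / p)"
    using Cb(2)[OF fL(1)] fL(2) by (meson mult_left_mono order_trans zero_le)
  finally have 1: "ennreal ((bcoef \<omega> n * r ^ n * G) * fN ?\<rho>) \<le> ennreal Cb * ?J epowr (1 / p)" .
  define k where "k = bcoef \<omega> n * r ^ n * fN ?\<rho> / Cb"
  have k: "0 \<le> k" using c0 N0 r Cb(1) by (simp add: k_def)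
  have "bcoef \<omega> n * r ^ n * r ^ n * fN ?\<rho> / Cb = k * r ^ n" by (simp add: k_def)
  then have "ennreal (bcoef \<omega> n * r ^ n * r ^ n * fN ?\<rho> / Cb) * ?I = ennreal k * (ennreal (r ^ n) * ?I)"
    by (simp only: ennreal_mult'[OF k] mult.assoc)
  also have "\<dots> \<le> ennreal k * ennreal G" using GI by (rule mult_left_mono) simp
  also have "\<dots> = ennreal (k * G)" by (rule ennreal_mult'[OF k, symmetric])
  also have "k * G = 1 / Cb * ((bcoef \<omega> n * r ^ n * G) * fN ?\<rho>)" by (simp add: k_def)
  also have "ennreal \<dots> = ennreal (1 / Cb) * ennreal ((bcoef \<omega> n * r ^ n * G) * fN ?\<rho>)"
    using Cb(1) by (intro ennreal_mult') auto
  also have "\<dots> \<le> ennreal (1 / Cb) * (ennreal Cb * ?J epowr (1 / p))" using 1 by (rule mult_left_mono) simp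
  also have "\<dots> = ?J epowr (1 / p)" using Cb(1) by (simp add: mult.assoc[symmetric] ennreal_mult'[symmetric])
  finally show "ennreal (bcoef \<omega> n * r ^ n * r ^ n * fN ?\<rho> / Cb) * ?I \<le> ?J epowr (1 / p)" .
qed

text \<open>Now \<open>g\<close> is tested without a monomial: the modulus of the kernel enters
  through its circle integral, and \<open>circ_bker_lower\<close> bounds it below by a sum over
  \<open>n\<close> instead of a single coefficient. The radius involved is
  \<open>cmod z * t\<close>, at least \<open>r * r\<close> for \<open>z\<close> in the annulus and
  \<open>t\<close> in the support of \<open>g\<close>.\<close>

lemma max_bergman_proj_test:
  assumes wD: "\<omega> \<in> class_Dhat" and bd: "max_bergman_proj_bounded p \<omega> \<nu>"
    and Cb: "0 < Cb" "\<And>f. f \<in> Lp_space p \<nu> \<Longrightarrow> Lp_norm p \<nu> (max_bergman_proj \<omega> f) \<le> ennreal Cb * Lp_norm p \<nu> f"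
    and r: "0 \<le> r" "r < 1"
  shows "ennreal ((\<Sum>n=1..M. bcoef \<omega> n * (r * r) ^ n / n) / pi * fN (max r (1/2)) / Cb) * sigma_tail p \<omega> \<nu> r epowr (1 / q) \<le> 1"
proof (rule sigma_tail_le_of_test[OF r])
  let ?\<rho> = "max r (1/2)"
  define S where "S = (\<Sum>n=1..M. bcoef \<omega> n * (r * r) ^ n / n)"
  have c0: "0 \<le> bcoef \<omega> n" for n using bcoef_pos[OF rw, of n] by simp
  have N0: "0 \<le> fN ?\<rho>" by (simp add: fN_def)
  have S0: "0 \<le> S" unfolding S_def using c0 r by (intro sum_nonneg) auto
  show "0 \<le> (\<Sum>n=1..M. bcoef \<omega> n * (r * r) ^ n / n) / pi * fN ?\<rho> / Cb" using S0 N0 Cb(1) by (simp add: S_def)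
  fix g :: "real \<Rightarrow> real" and b :: real assume gm: "(\<lambda>t. g t * indicator {0..<1} t) \<in> borel_measurable lebesgue"
    and g: "\<And>t. 0 \<le> g t" "\<And>t. g t \<le> b" "\<And>t. t < r \<Longrightarrow> g t = 0"
  let ?J = "\<integral>\<^sup>+t\<in>{0..<1}. ennreal (2 * t) * ennreal (g t powr p * \<nu> t) \<partial>lebesgue"
  let ?I = "\<integral>\<^sup>+t\<in>{0..<1}. ennreal (2 * t) * ennreal (g t * \<omega> t) \<partial>lebesgue"
  define f where "f \<zeta> = complex_of_real (g (cmod \<zeta>))" for \<zeta>
  have [measurable]: "(\<lambda>\<zeta>. g (cmod \<zeta>)) \<in> borel_measurable disc_area" by (rule radial_real_measurable[OF gm])
  have fm: "f \<in> borel_measurable disc_area" unfolding f_def by measurable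
  have fb: "cmod (f \<zeta>) \<le> g (cmod \<zeta>)" for \<zeta> using g(1) by (simp add: f_def)
  note fL = test_function_Lp[OF gm g(1,2) fm fb]
  have fin: "?I < \<infinity>" using omega_integral_finite[OF gm g(1,2)] unfolding radial_omega_integral(2)[OF gm] .
  define i where "i = enn2real ?I"
  have i: "?I = ennreal i" "0 \<le> i" using fin by (auto simp: i_def)
  have "ennreal ((S / pi * i) * fN ?\<rho>) \<le> Lp_norm p \<nu> (max_bergman_proj \<omega> f)"
  proof (rule Lp_norm_ge_annulus)
    show "0 \<le> S / pi * i" using S0 i by simp
    show "1 / 2 \<le> ?\<rho>" "?\<rho> < 1" using r by auto
    fix z :: complex assume z: "?\<rho> \<le> cmod z" "cmod z < 1"
    let ?k = "\<lambda>\<zeta>. g (cmod \<zeta>) * cmod (bergman_kernel \<omega> z \<zeta>) * \<omega> (cmod \<zeta>)"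
    have "integrable disc_area (\<lambda>\<zeta>. f \<zeta> * complex_of_real (cmod (bergman_kernel \<omega> z \<zeta>)) * complex_of_real (\<omega> (cmod \<zeta>)))"
      using bd fL(1) z unfolding max_bergman_proj_bounded_def integral_op_bounded_def by auto
    then have "integrable disc_area (\<lambda>\<zeta>. complex_of_real (?k \<zeta>))" by (simp add: f_def)
    then have ki: "integrable disc_area ?k" using integrable_Re[of disc_area "\<lambda>\<zeta>. complex_of_real (?k \<zeta>)"] by (simp only: Re_complex_of_real)
    have k0: "0 \<le> ?k \<zeta>" if "\<zeta> \<in> space disc_area" for \<zeta> using g(1) that by simp
    have gw: "(\<lambda>t. ennreal (g t * \<omega> t) * indicator {0..<1} t) \<in> borel_measurable lebesgue"
    proof -
      have "(\<lambda>t. ennreal ((g t * \<omega> t) * indicator {0..<1} t)) \<in> borel_measurable lebesgue"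
        by (rule measurable_compose[OF radial_omega_integral(1)[OF gm]]) measurable
      also have "(\<lambda>t. ennreal ((g t * \<omega> t) * indicator {0..<1} t)) = (\<lambda>t. ennreal (g t * \<omega> t) * indicator {0..<1} t)"
        by (auto simp: indicator_def)
      finally show ?thesis .
    qed
    have i2: "(\<lambda>t. ennreal (2 * t)) \<in> borel_measurable lebesgue" by (intro measurable_completion) measurable
    have gw2: "(\<lambda>t. ennreal (2 * t) * ennreal (g t * \<omega> t) * indicator {0..<1} t) \<in> borel_measurable lebesgue"
      using borel_measurable_times_ennreal[OF i2 gw] by (simp add: mult.assoc)
    have "ennreal (S / pi * i) = ennreal (S / pi) * ?I" unfolding i(1) using S0 by (intro ennreal_mult') auto
    also have "\<dots> = (\<integral>\<^sup>+t. ennreal (S / pi) * (ennreal (2 * t) * ennreal (g t * \<omega> t) * indicator {0..<1} t) \<partial>lebesgue)"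
      by (rule nn_integral_cmult[OF gw2, symmetric])
    also have "\<dots> \<le> (\<integral>\<^sup>+t\<in>{0..<1}. ennreal (t / pi) * (ennreal (g t * \<omega> t) * circ (\<lambda>u. ennreal (cmod (bker \<omega> u))) (complex_of_real (cmod (cnj z) * t))) \<partial>lebesgue)"
    proof (rule nn_integral_mono)
      fix t
      show "ennreal (S / pi) * (ennreal (2 * t) * ennreal (g t * \<omega> t) * indicator {0..<1} t)
        \<le> ennreal (t / pi) * (ennreal (g t * \<omega> t) * circ (\<lambda>u. ennreal (cmod (bker \<omega> u))) (complex_of_real (cmod (cnj z) * t))) * indicator {0..<1} t"
      proof (cases "t \<in> {0..<1} \<and> r \<le> t")
        case True
        then have t: "0 \<le> t" "t < 1" "r \<le> t" by auto
        let ?x = "cmod (cnj z) * t"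
        have x: "0 \<le> ?x" "?x < 1" using t z mult_strict_mono[of "cmod z" 1 t 1] by auto
        have rx: "r * r \<le> ?x" using t z r by (intro mult_mono) auto
        have "S \<le> (\<Sum>n=1..M. bcoef \<omega> n * ?x ^ n / n)"
          unfolding S_def using rx r c0 by (intro sum_mono divide_right_mono mult_left_mono power_mono) auto
        then have "ennreal (2 * S) \<le> ennreal (2 * (\<Sum>n=1..M. bcoef \<omega> n * ?x ^ n / n))" by (intro ennreal_leI) simp
        also have "\<dots> \<le> circ (\<lambda>u. ennreal (cmod (bker \<omega> u))) (complex_of_real ?x)" by (rule circ_bker_lower[OF wD x])
        finally have "ennreal (t / pi) * (ennreal (g t * \<omega> t) * ennreal (2 * S)) \<le> ennreal (t / pi) * (ennreal (g t * \<omega> t) * circ (\<lambda>u. ennreal (cmod (bker \<omega> u))) (complex_of_real ?x))"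
          by (intro mult_left_mono) auto
        moreover have "ennreal (t / pi) * (ennreal (g t * \<omega> t) * ennreal (2 * S)) = ennreal (S / pi) * (ennreal (2 * t) * ennreal (g t * \<omega> t))"
          using t S0 g(1)[of t] by (simp add: ennreal_mult'[symmetric] ennreal_mult''[symmetric] mult_ac)
        ultimately show ?thesis using t by simp
      next
        case False
        then show ?thesis using g(3)[of t] by (cases "t < r") (auto simp: indicator_def)
      qed
    qed
    also have "\<dots> = (\<integral>\<^sup>+\<zeta>. ennreal (g (cmod \<zeta>) * \<omega> (cmod \<zeta>)) * ennreal (cmod (bker \<omega> (cnj z * \<zeta>))) \<partial>disc_area)"
      by (rule nn_integral_kernel_radial[OF gw, where K = "\<lambda>u. ennreal (cmod (bker \<omega> u))", symmetric]) measurable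
    also have "\<dots> = (\<integral>\<^sup>+\<zeta>. ennreal (?k \<zeta>) \<partial>disc_area)"
    proof (rule nn_integral_cong)
      fix \<zeta> assume "\<zeta> \<in> space disc_area"
      then have "0 \<le> g (cmod \<zeta>) * \<omega> (cmod \<zeta>)" using g(1) by simp
      then show "ennreal (g (cmod \<zeta>) * \<omega> (cmod \<zeta>)) * ennreal (cmod (bker \<omega> (cnj z * \<zeta>))) = ennreal (?k \<zeta>)"
        by (simp add: bergman_kernel_eq ennreal_mult[symmetric] mult_ac)
    qed
    also have "\<dots> = ennreal (LINT \<zeta>|disc_area. ?k \<zeta>)" using ki k0 by (intro nn_integral_eq_integral) auto
    finally have "S / pi * i \<le> (LINT \<zeta>|disc_area. ?k \<zeta>)"
      using k0 by (subst (asm) ennreal_le_iff) (auto intro!: Bochner_Integration.integral_nonneg)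
    also have "\<dots> \<le> cmod (complex_of_real (LINT \<zeta>|disc_area. ?k \<zeta>))" by simp
    also have "complex_of_real (LINT \<zeta>|disc_area. ?k \<zeta>) = max_bergman_proj \<omega> f z"
      unfolding max_bergman_proj_def integral_op_def f_def integral_complex_of_real[symmetric] by simp
    finally show "S / pi * i \<le> cmod (max_bergman_proj \<omega> f z)" .
  qed
  also have "\<dots> \<le> ennreal Cb * ?J epowr (1 / p)"
    using Cb(2)[OF fL(1)] fL(2) by (meson mult_left_mono order_trans zero_le)
  finally have 1: "ennreal ((S / pi * i) * fN ?\<rho>) \<le> ennreal Cb * ?J epowr (1 / p)" .
  have "ennreal (S / pi * fN ?\<rho> / Cb) * ?I = ennreal (S / pi * fN ?\<rho> / Cb * i)"
    unfolding i(1) using S0 N0 Cb(1) by (intro ennreal_mult'[symmetric]) auto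
  also have "S / pi * fN ?\<rho> / Cb * i = 1 / Cb * ((S / pi * i) * fN ?\<rho>)" by (simp add: mult_ac)
  also have "ennreal \<dots> = ennreal (1 / Cb) * ennreal ((S / pi * i) * fN ?\<rho>)"
    using Cb(1) by (intro ennreal_mult') auto
  also have "\<dots> \<le> ennreal (1 / Cb) * (ennreal Cb * ?J epowr (1 / p))" using 1 by (rule mult_left_mono) simp
  also have "\<dots> = ?J epowr (1 / p)" using Cb(1) by (simp add: mult.assoc[symmetric] ennreal_mult'[symmetric])
  finally show "ennreal ((\<Sum>n=1..M. bcoef \<omega> n * (r * r) ^ n / n) / pi * fN ?\<rho> / Cb) * ?I \<le> ?J epowr (1 / p)" by (simp add: S_def)
qed

end

section \<open>From the test inequalities to the conditions on the weights\<close>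

lemma ln_le_harmonic_sum:
  assumes "1 \<le> a" "a \<le> Suc M"
  shows "ln (real (Suc M) / real a) \<le> (\<Sum>n=a..M. 1 / real n)"
  using assms
proof (induction M)
  case 0
  then show ?case by simp
next
  case (Suc M)
  show ?case
  proof (cases "a = Suc (Suc M)")
    case True
    then show ?thesis by simp
  next
    case False
    then have a: "a \<le> Suc M" using Suc.prems by simp
    have "0 < real (Suc M) / real a" using Suc.prems by simp
    moreover have "0 < 1 + 1 / real (Suc M)" by (simp add: add_pos_nonneg)
    moreover have "real (Suc (Suc M)) / real a = (real (Suc M) / real a) * (1 + 1 / real (Suc M))"
    proof -
      have "1 + 1 / real (Suc M) = real (Suc (Suc M)) / real (Suc M)" by (simp add: field_simps)
      then show ?thesis by (simp del: of_nat_Suc)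
    qed
    ultimately have "ln (real (Suc (Suc M)) / real a) = ln (real (Suc M) / real a) + ln (1 + 1 / real (Suc M))"
      by (simp only: ln_mult_pos)
    also have "ln (1 + 1 / real (Suc M)) \<le> 1 / real (Suc M)" by (intro ln_add_one_self_le_self) auto
    also have "ln (real (Suc M) / real a) \<le> (\<Sum>n=a..M. 1 / real n)" using Suc.IH Suc.prems a by simp
    finally show ?thesis using a by simp
  qed
qed

text \<open>\<open>powr_ge_exp\<close> with exponent \<open>2 * n\<close>, where
  \<open>2 * (1 - r) * (2 * n) \<le> 4\<close>. In this range of \<open>n\<close> powers of
  \<open>r\<close> cost only a constant.\<close>

lemma floor_inverse_power:
  assumes "1/2 \<le> r" "r < 1" "real n \<le> 1 / (1 - r)"
  shows "exp (-4) \<le> r ^ n * r ^ n"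
proof -
  have "real n * (1 - r) \<le> 1" using assms by (simp add: field_simps)
  then have "exp (-4) \<le> exp (- 2 * (1 - r) * real (n + n))" by (simp add: algebra_simps)
  also have "\<dots> \<le> r powr real (n + n)" using assms by (intro powr_ge_exp) auto
  also have "\<dots> = r ^ n * r ^ n" using assms by (subst powr_realpow) (auto simp: power_add)
  finally show ?thesis .
qed

lemma nat_floor_bounds:
  fixes y :: real
  assumes "0 \<le> y"
  shows "real (nat \<lfloor>y\<rfloor>) \<le> y" "y < real (nat \<lfloor>y\<rfloor>) + 1"
proof -
  have "real (nat \<lfloor>y\<rfloor>) = of_int \<lfloor>y\<rfloor>" using assms by (intro of_nat_nat) simp
  then show "real (nat \<lfloor>y\<rfloor>) \<le> y" "y < real (nat \<lfloor>y\<rfloor>) + 1" by simp_all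
qed

context two_weights
begin

text \<open>The degree \<open>n\<close> is the integer part of \<open>1 / (1 - r)\<close>: large
  enough that \<open>bcoef \<omega> n\<close> is at least a multiple of
  \<open>1 / tail \<omega> r\<close>, small enough that \<open>r ^ n * r ^ n\<close> is at least
  \<open>exp (- 4)\<close>.\<close>

lemma A_const_finite_of_bergman_proj:
  assumes wD: "\<omega> \<in> class_Dhat" and bd: "bergman_proj_bounded p \<omega> \<nu>"
  shows "A_const p \<omega> \<nu> < \<infinity>"
proof -
  obtain C where C: "C \<ge> 0" "\<And>f. f \<in> Lp_space p \<nu> \<Longrightarrow> Lp_norm p \<nu> (bergman_proj \<omega> f) \<le> ennreal C * Lp_norm p \<nu> f"
    using bd unfolding bergman_proj_bounded_def integral_op_bounded_def bergman_proj_def by auto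
  \<comment> \<open>Enlarged by 1 because the tests divide by the operator bound.\<close>
  define Cb where "Cb = C + 1"
  have Cb: "0 < Cb" "\<And>f. f \<in> Lp_space p \<nu> \<Longrightarrow> Lp_norm p \<nu> (bergman_proj \<omega> f) \<le> ennreal Cb * Lp_norm p \<nu> f"
  proof -
    show "0 < Cb" using C(1) by (simp add: Cb_def)
    fix f assume "f \<in> Lp_space p \<nu>"
    then have "Lp_norm p \<nu> (bergman_proj \<omega> f) \<le> ennreal C * Lp_norm p \<nu> f" by (rule C(2))
    also have "\<dots> \<le> ennreal Cb * Lp_norm p \<nu> f" by (intro mult_right_mono ennreal_leI) (auto simp: Cb_def)
    finally show "Lp_norm p \<nu> (bergman_proj \<omega> f) \<le> ennreal Cb * Lp_norm p \<nu> f" .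
  qed
  have cpos: "0 < bcoef \<omega> n" for n using bcoef_pos[OF rw] .
  have Np: "0 < fN s" if "0 \<le> s" "s < 1" for s using tail_pos[OF rn that] by (simp add: fN_def)
  \<comment> \<open>The test with \<open>n = 0\<close> and \<open>r = 0\<close> is informative
    because \<open>0 ^ 0 = 1\<close>; the finiteness it gives opens the real-valued setting of
    \<open>two_weights_fin\<close>.\<close>
  have "sigma_tail p \<omega> \<nu> 0 \<noteq> top"
  proof
    assume t: "sigma_tail p \<omega> \<nu> 0 = top"
    have "0 < bcoef \<omega> 0 * 0 ^ 0 * 0 ^ 0 * fN (max 0 (1/2)) / Cb" using cpos[of 0] Np[of "1/2"] Cb(1) by simp
    then have "ennreal (bcoef \<omega> 0 * 0 ^ 0 * 0 ^ 0 * fN (max 0 (1/2)) / Cb) * sigma_tail p \<omega> \<nu> 0 epowr (1 / q) = top"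
      unfolding t using cpos[of 0] Np[of "1/2"] Cb(1) by (auto simp: ennreal_mult_eq_top_iff)
    then show False using bergman_proj_test[OF wD Cb, of 0 0] by (simp add: top_unique)
  qed
  then have sf: "sigma_tail p \<omega> \<nu> 0 < \<infinity>" by (simp add: less_top)
  then interpret two_weights_fin p \<omega> \<nu> by unfold_locales
  obtain A1 where A1: "A1 > 0" "\<And>x. x \<ge> 1 \<Longrightarrow> moment \<omega> x \<le> A1 * tail \<omega> (1 - 1 / x)"
    using moment_le_tail[OF wD] by auto
  have big: "fN r * fE r \<le> (Cb * 2 * A1 * exp 4) * tail \<omega> r" if r: "1/2 \<le> r" "r < 1" for r
  proof -
    define n where "n = nat \<lfloor>1 / (1 - r)\<rfloor>"
    have x1: "1 \<le> 1 / (1 - r)" using r by (simp add: field_simps)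
    have n: "real n \<le> 1 / (1 - r)" "1 / (1 - r) < real n + 1"
      unfolding n_def by (rule nat_floor_bounds, use x1 in linarith)+
    have "1 / (1 - r) \<le> 2 * real n + 1" using n(2) x1
    proof -
      have "0 < real n" using n(2) x1 by linarith
      then have "1 \<le> real n" by simp
      then show ?thesis using n(2) by linarith
    qed
    then have "1 \<le> (1 - r) * (2 * real n + 1)" using r by (simp add: field_simps)
    then have "r \<le> 1 - 1 / (2 * real n + 1)" by (simp add: field_simps)
    then have "tail \<omega> (1 - 1 / (2 * real n + 1)) \<le> tail \<omega> r" using r by (intro tail_antimono rw) auto
    moreover have "moment \<omega> (2 * real n + 1) \<le> A1 * tail \<omega> (1 - 1 / (2 * real n + 1))" by (rule A1(2)) simp
    ultimately have mt: "moment \<omega> (2 * real n + 1) \<le> A1 * tail \<omega> r" using A1(1) by (smt (verit) mult_left_mono)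
    have mp: "0 < moment \<omega> (2 * real n + 1)" using moment_pos[OF rw] by simp
    have tp: "0 < tail \<omega> r" using tail_pos[OF rw] r by auto
    have e: "exp (-4) \<le> r ^ n * r ^ n" using floor_inverse_power[OF r n(1)] .
    have "ennreal (bcoef \<omega> n * r ^ n * r ^ n * fN (max r (1/2)) / Cb) * sigma_tail p \<omega> \<nu> r epowr (1 / q) \<le> 1"
      using r by (intro bergman_proj_test[OF wD Cb]) auto
    moreover have "sigma_tail p \<omega> \<nu> r epowr (1 / q) = ennreal (fE r)"
      using r by (simp add: ennreal_sg[symmetric] epowr_ennreal fE_def)
    moreover have "max r (1/2) = r" using r by simp
    ultimately have "ennreal (bcoef \<omega> n * r ^ n * r ^ n * fN r / Cb) * ennreal (fE r) \<le> 1" by simp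
    then have "ennreal (bcoef \<omega> n * r ^ n * r ^ n * fN r / Cb * fE r) \<le> 1"
      using cpos[of n] Np[of r] r Cb(1) by (subst ennreal_mult') auto
    then have "bcoef \<omega> n * r ^ n * r ^ n * fN r / Cb * fE r \<le> 1" by (simp add: ennreal_le_1)
    then have "(bcoef \<omega> n * (fN r * fE r)) * (r ^ n * r ^ n) \<le> Cb" using Cb(1) by (simp add: field_simps)
    moreover have "(bcoef \<omega> n * (fN r * fE r)) * exp (-4) \<le> (bcoef \<omega> n * (fN r * fE r)) * (r ^ n * r ^ n)"
      using e cpos[of n] fN_pos[of r] fE_pos[of r] r by (intro mult_left_mono) auto
    ultimately have "(bcoef \<omega> n * (fN r * fE r)) * exp (-4) \<le> Cb" by simp
    then have "fN r * fE r \<le> Cb * exp 4 * (2 * moment \<omega> (2 * real n + 1))"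
      using mp by (simp add: bcoef_def exp_minus field_simps)
    also have "\<dots> \<le> Cb * exp 4 * (2 * (A1 * tail \<omega> r))" using mt Cb(1) by (intro mult_left_mono) auto
    finally show ?thesis by (simp add: mult_ac)
  qed
  define A where "A = max (Cb * 2 * A1 * exp 4) (fN 0 * fE 0 / tail \<omega> (1/2))"
  have "fN r * fE r \<le> A * tail \<omega> r" if r: "0 \<le> r" "r < 1" for r
  proof (cases "1/2 \<le> r")
    case True
    have "(Cb * 2 * A1 * exp 4) * tail \<omega> r \<le> A * tail \<omega> r"
      using tail_pos[OF rw r] by (intro mult_right_mono) (auto simp: A_def)
    then show ?thesis using big[OF True r(2)] by simp
  next
    case False
    have t: "0 < tail \<omega> (1/2)" "tail \<omega> (1/2) \<le> tail \<omega> r" using tail_pos[OF rw, of "1/2"] tail_antimono[OF rw, of r "1/2"] False r by auto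
    have "fN r * fE r \<le> fN 0 * fE 0"
      using r fN_pos[of 0] fE_pos[of r] by (intro mult_mono fN_antimono fE_antimono) auto
    also have "\<dots> = (fN 0 * fE 0 / tail \<omega> (1/2)) * tail \<omega> (1/2)" using t by simp
    also have "\<dots> \<le> A * tail \<omega> r"
      using t fN_pos[of 0] fE_pos[of 0] by (intro mult_mono) (auto simp: A_def le_max_iff_disj)
    finally show ?thesis .
  qed
  moreover have "0 < A" using Cb(1) A1(1) by (auto simp: A_def less_max_iff_disj)
  ultimately show ?thesis unfolding A_const_finite_iff using sf by auto
qed

end

context two_weights_fin
begin

text \<open>The logarithm in the lower bound for the means of the kernel forces the tail of \<open>\<omega>\<close> to decay geometrically.\<close>

lemma Dcheck_of_max_bergman_proj:
  assumes wD: "\<omega> \<in> class_Dhat" and bd: "max_bergman_proj_bounded p \<omega> \<nu>"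
  shows "\<omega> \<in> class_Dcheck"
proof -
  obtain C where C: "C \<ge> 0" "\<And>f. f \<in> Lp_space p \<nu> \<Longrightarrow> Lp_norm p \<nu> (max_bergman_proj \<omega> f) \<le> ennreal C * Lp_norm p \<nu> f"
    using bd unfolding max_bergman_proj_bounded_def integral_op_bounded_def max_bergman_proj_def by auto
  define Cb where "Cb = C + 1"
  have Cb: "0 < Cb" "\<And>f. f \<in> Lp_space p \<nu> \<Longrightarrow> Lp_norm p \<nu> (max_bergman_proj \<omega> f) \<le> ennreal Cb * Lp_norm p \<nu> f"
  proof -
    show "0 < Cb" using C(1) by (simp add: Cb_def)
    fix f assume "f \<in> Lp_space p \<nu>"
    then have "Lp_norm p \<nu> (max_bergman_proj \<omega> f) \<le> ennreal C * Lp_norm p \<nu> f" by (rule C(2))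
    also have "\<dots> \<le> ennreal Cb * Lp_norm p \<nu> f" by (intro mult_right_mono ennreal_leI) (auto simp: Cb_def)
    finally show "Lp_norm p \<nu> (max_bergman_proj \<omega> f) \<le> ennreal Cb * Lp_norm p \<nu> f" .
  qed
  have cpos: "0 < bcoef \<omega> n" for n using bcoef_pos[OF rw] .
  obtain A1 where A1: "A1 > 0" "\<And>x. x \<ge> 1 \<Longrightarrow> moment \<omega> x \<le> A1 * tail \<omega> (1 - 1 / x)"
    using moment_le_tail[OF wD] by auto
  define c where "c = 2 * pi * Cb * exp 4"
  have c: "0 < c" using Cb(1) by (simp add: c_def)
  \<comment> \<open>The test bounds the sum times \<open>fN r * fE r\<close>, and by Hoelder's
    inequality this product is at least \<open>tail \<omega> r / 2\<close>. The condition on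
    \<open>M\<close> keeps the powers of \<open>r\<close> above \<open>exp (- 4)\<close>.\<close>
  have key: "tail \<omega> r * (\<Sum>n=1..M. bcoef \<omega> n / n) \<le> c" if r: "1/2 \<le> r" "r < 1" and M: "real M \<le> 1 / (1 - r)" for r M
  proof -
    define S where "S = (\<Sum>n=1..M. bcoef \<omega> n * (r * r) ^ n / n)"
    have S0: "0 \<le> S" unfolding S_def using less_imp_le[OF cpos] r by (intro sum_nonneg) auto
    have "exp (-4) * (\<Sum>n=1..M. bcoef \<omega> n / n) = (\<Sum>n=1..M. bcoef \<omega> n * exp (-4) / n)"
      by (simp add: sum_distrib_left mult_ac)
    also have "\<dots> \<le> S"
      unfolding S_def
    proof (intro sum_mono divide_right_mono mult_left_mono)
      fix n assume "n \<in> {1..M}"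
      then have "real n \<le> 1 / (1 - r)" using M by (auto intro: order_trans[rotated])
      then show "exp (-4) \<le> (r * r) ^ n" using floor_inverse_power[OF r] by (simp add: power_mult_distrib)
    qed (use less_imp_le[OF cpos] in auto)
    finally have eS: "(\<Sum>n=1..M. bcoef \<omega> n / n) \<le> exp 4 * S" by (simp add: exp_minus field_simps)
    have "ennreal (S / pi * fN (max r (1/2)) / Cb) * sigma_tail p \<omega> \<nu> r epowr (1 / q) \<le> 1"
      unfolding S_def using r by (intro max_bergman_proj_test[OF wD bd Cb]) auto
    moreover have "sigma_tail p \<omega> \<nu> r epowr (1 / q) = ennreal (fE r)"
      using r by (simp add: ennreal_sg[symmetric] epowr_ennreal fE_def)
    moreover have "max r (1/2) = r" using r by simp
    ultimately have "ennreal (S / pi * fN r / Cb) * ennreal (fE r) \<le> 1" by simp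
    then have "ennreal (S / pi * fN r / Cb * fE r) \<le> 1"
      using S0 fN_pos[of r] r Cb(1) by (subst ennreal_mult') auto
    then have "S / pi * fN r / Cb * fE r \<le> 1" by (simp add: ennreal_le_1)
    then have s: "S * (fN r * fE r) \<le> pi * Cb" using Cb(1) by (simp add: field_simps)
    have "tail \<omega> r * (\<Sum>n=1..M. bcoef \<omega> n / n) \<le> (2 * (fN r * fE r)) * (exp 4 * S)"
      using tail_le_fN_fE_half[of r] r eS fN_pos[of r] fE_pos[of r] less_imp_le[OF cpos]
      by (intro mult_mono) (auto intro!: sum_nonneg)
    also have "\<dots> = (2 * exp 4) * (S * (fN r * fE r))" by simp
    also have "\<dots> \<le> (2 * exp 4) * (pi * Cb)" using s by (intro mult_left_mono) auto
    finally show ?thesis by (simp add: c_def mult_ac)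
  qed
  \<comment> \<open>Chosen so that \<open>L / (2 * A1) = 2 * c\<close>, which turns the bound
    \<open>c\<close> of \<open>key\<close> into the decay factor \<open>1/2\<close>.\<close>
  define L where "L = 4 * A1 * c"
  have L: "0 < L" using A1(1) c by (simp add: L_def)
  \<comment> \<open>The sum of \<open>1 / n\<close> between about \<open>x = 1 / (1 - s)\<close> and
    \<open>K * x\<close> is at least \<open>ln (K / 2) = L\<close>; the factor 2 absorbs rounding
    the lower end up to at most \<open>2 * x\<close>.\<close>
  define K where "K = 2 * exp L"
  have K: "2 < K" using L by (simp add: K_def)
  show ?thesis
  proof (rule DcheckI[OF rw, of K "1/2"])
    show "1 < K" using K by simp
    fix s :: real assume s: "0 \<le> s" "s < 1"
    let ?r = "shrink K s"
    have sr: "s < ?r" "?r < 1" using shrink_bounds[of K s] K s by auto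
    have "(1 - s) / K \<le> 1 / 2" using K s by (intro frac_le) auto
    then have r2: "1/2 \<le> ?r" by (simp add: shrink_def)
    define x where "x = 1 / (1 - s)"
    have x: "1 \<le> x" using s by (simp add: x_def field_simps)
    have rx: "1 / (1 - ?r) = K * x" by (simp add: shrink_def x_def)
    define a where "a = nat \<lceil>x\<rceil>"
    have a: "x \<le> real a" "real a \<le> 2 * x" "1 \<le> a" using x by (auto simp: a_def of_nat_nat) linarith+
    define M where "M = nat \<lfloor>K * x\<rfloor>"
    have "0 \<le> K * x" using K x by simp
    then have M: "real M \<le> K * x" "K * x < real M + 1" unfolding M_def by (rule nat_floor_bounds)+
    have "2 * x \<le> K * x" using K x by (intro mult_right_mono) auto
    then have aM: "a \<le> Suc M" using a M by linarith
    have ts: "0 < tail \<omega> s" using tail_pos[OF rw] s by auto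
    have tr: "0 < tail \<omega> ?r" using tail_pos[OF rw] s sr by auto
    have "L = ln (K * x / (2 * x))" using x by (simp add: K_def)
    also have "\<dots> \<le> ln (real (Suc M) / real a)"
    proof (subst ln_le_cancel_iff)
      show "K * x / (2 * x) \<le> real (Suc M) / real a" using M a K x by (intro frac_le) auto
    qed (use K x a in auto)
    also have "\<dots> \<le> (\<Sum>n=a..M. 1 / real n)" by (rule ln_le_harmonic_sum[OF a(3) aM])
    finally have hL: "L \<le> (\<Sum>n=a..M. 1 / real n)" .
    have "L / (2 * A1 * tail \<omega> s) \<le> (\<Sum>n=a..M. 1 / real n) * (1 / (2 * A1 * tail \<omega> s))"
      using mult_right_mono[OF hL, of "1 / (2 * A1 * tail \<omega> s)"] A1(1) ts by simp
    also have "\<dots> = (\<Sum>n=a..M. (1 / (2 * A1 * tail \<omega> s)) / real n)" by (simp add: sum_divide_distrib mult_ac)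
    also have "\<dots> \<le> (\<Sum>n=a..M. bcoef \<omega> n / real n)"
    proof (intro sum_mono divide_right_mono)
      fix n assume "n \<in> {a..M}"
      then have "x \<le> 2 * real n + 1" using a(1) by auto
      then have "1 \<le> (1 - s) * (2 * real n + 1)" using s by (simp add: x_def field_simps)
      then have "s \<le> 1 - 1 / (2 * real n + 1)" by (simp add: field_simps)
      then have "tail \<omega> (1 - 1 / (2 * real n + 1)) \<le> tail \<omega> s" using s by (intro tail_antimono rw) auto
      then have "A1 * tail \<omega> (1 - 1 / (2 * real n + 1)) \<le> A1 * tail \<omega> s" using A1(1) by simp
      then have "moment \<omega> (2 * real n + 1) \<le> A1 * tail \<omega> s" using A1(2)[of "2 * real n + 1"] by simp
      then show "1 / (2 * A1 * tail \<omega> s) \<le> bcoef \<omega> n"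
        unfolding bcoef_def using moment_pos[OF rw, of "2 * real n + 1"] A1(1) ts
        by (intro divide_left_mono) auto
    qed simp
    also have "\<dots> \<le> (\<Sum>n=1..M. bcoef \<omega> n / real n)"
      using a(3) less_imp_le[OF cpos] by (intro sum_mono2) auto
    finally have "tail \<omega> ?r * (L / (2 * A1 * tail \<omega> s)) \<le> tail \<omega> ?r * (\<Sum>n=1..M. bcoef \<omega> n / real n)"
      using tr by (intro mult_left_mono) auto
    also have "\<dots> \<le> c" using key[OF r2 sr(2), of M] M(1) rx by simp
    finally have "tail \<omega> ?r * L \<le> c * (2 * A1 * tail \<omega> s)" using A1(1) ts by (simp add: field_simps)
    also have "\<dots> = (1 / 2 * tail \<omega> s) * L" by (simp add: L_def)
    finally show "tail \<omega> ?r \<le> 1 / 2 * tail \<omega> s" using L by (simp only: mult_le_cancel_right)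
  qed simp
qed

section \<open>Positivity and finiteness of the quantities in the norm estimates\<close>

lemma A_const_pos: "0 < A_const p \<omega> \<nu>"
proof -
  have "0 < ennreal (fN 0 * fE 0 / tail \<omega> 0)" using fN_pos[of 0] fE_pos[of 0] tail_pos[OF rw, of 0] by simp
  also have "ennreal (fN 0 * fE 0 / tail \<omega> 0) = ennreal (tail \<nu> 0 powr (1 / p)) * sigma_tail p \<omega> \<nu> 0 epowr (1 / q) / ennreal (tail \<omega> 0)"
    using tail_pos[OF rw, of 0] by (simp add: ennreal_sg[symmetric] epowr_ennreal fE_def ennreal_mult[symmetric] divide_ennreal fN_def)
  also have "\<dots> \<le> A_const p \<omega> \<nu>" unfolding A_const_def by (intro SUP_upper) auto
  finally show ?thesis .
qed

lemma M_const_pos: "0 < M_const p \<omega> \<nu>"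
proof -
  let ?I = "(\<integral>\<^sup>+s\<in>{0..1/2}. ennreal (\<nu> s / tail \<omega> s powr p * s) \<partial>lebesgue) + 1"
  have "sigma_tail p \<omega> \<nu> (1/2) \<noteq> 0" using sg_pos[of "1/2"] by (simp add: ennreal_sg[symmetric])
  then have "?I epowr (1 / p) * sigma_tail p \<omega> \<nu> (1/2) epowr (1 / q) \<noteq> 0" by simp
  then have "0 < ?I epowr (1 / p) * sigma_tail p \<omega> \<nu> (1/2) epowr (1 / q)" by (simp only: zero_less_iff_neq_zero) simp
  also have "\<dots> \<le> M_const p \<omega> \<nu>" unfolding M_const_def by (intro SUP_upper) auto
  finally show ?thesis .
qed

end

context two_weights
begin

text \<open>A positive constant function is projected to a nonzero constant, by
  \<open>bergman_proj_monomial\<close> with \<open>n = 0\<close>. The value \<open>c\<close> solves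
  \<open>2 * c powr p * tail \<nu> 0 = 1\<close>, which keeps the norm of the test function at most
  1.\<close>

lemma Lp_opnorm_bergman_proj_pos:
  assumes wD: "\<omega> \<in> class_Dhat"
  shows "0 < Lp_opnorm p \<nu> (bergman_proj \<omega>)"
proof -
  have tn: "0 < tail \<nu> 0" using tail_pos[OF rn] by simp
  define c where "c = (1 / (2 * tail \<nu> 0)) powr (1 / p)"
  have c: "0 < c" "c powr p = 1 / (2 * tail \<nu> 0)" using tn p by (auto simp: c_def powr_powr)
  define g where "g t = c" for t :: real
  define f where "f \<zeta> = complex_of_real (g (cmod \<zeta>)) * sgn \<zeta> ^ 0" for \<zeta> :: complex
  have gm: "(\<lambda>t. g t * indicator {0..<1} t) \<in> borel_measurable lebesgue"
    unfolding g_def by (intro borel_measurable_times borel_measurable_const borel_measurable_indicator) auto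
  have g: "0 \<le> g t" "g t \<le> c" for t using c by (auto simp: g_def)
  have "f = (\<lambda>_. complex_of_real c)" by (auto simp: f_def g_def fun_eq_iff)
  then have fm: "f \<in> borel_measurable disc_area" by simp
  have fb: "cmod (f \<zeta>) \<le> g (cmod \<zeta>)" for \<zeta> using c by (simp add: f_def g_def)
  note fL = test_function_Lp[OF gm g fm fb]
  have "(\<integral>\<^sup>+t\<in>{0..<1}. ennreal (2 * t) * ennreal (g t powr p * \<nu> t) \<partial>lebesgue) \<le> (\<integral>\<^sup>+t. ennreal (2 * c powr p) * (ennreal (\<nu> t) * indicator {0..<1} t) \<partial>lebesgue)"
  proof (rule nn_integral_mono)
    fix t
    show "ennreal (2 * t) * ennreal (g t powr p * \<nu> t) * indicator {0..<1} t \<le> ennreal (2 * c powr p) * (ennreal (\<nu> t) * indicator {0..<1} t)"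
    proof (cases "t \<in> {0..<1}")
      case True
      then have "(2 * t) * (c powr p * \<nu> t) \<le> 2 * (c powr p * \<nu> t)" by (intro mult_right_mono) auto
      then have "ennreal ((2 * t) * (g t powr p * \<nu> t)) \<le> ennreal ((2 * c powr p) * \<nu> t)" by (intro ennreal_leI) (simp add: g_def)
      then show ?thesis using True by (simp add: ennreal_mult')
    qed simp
  qed
  also have "\<dots> = ennreal (2 * c powr p) * ennreal (tail \<nu> 0)"
    by (subst nn_integral_cmult[OF radial_weight_measurable[OF rn]]) (simp add: tail_nn[OF rn])
  also have "\<dots> = 1" using tn by (simp add: c(2) ennreal_mult'[symmetric])
  finally have "Lp_norm p \<nu> f \<le> 1 epowr (1 / p)" using fL(2) p by (meson epowr_mono order_trans divide_nonneg_nonneg less_imp_le zero_le_one less_trans zero_less_one)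
  also have "1 epowr (1 / p) = (1::ennreal)" using epowr_ennreal[of 1 "1 / p"] by simp
  finally have f1: "Lp_norm p \<nu> f \<le> 1" .
  define G where "G = (LINT \<zeta>|disc_area. g (cmod \<zeta>) * cmod \<zeta> ^ 0 * \<omega> (cmod \<zeta>))"
  have fin: "(\<integral>\<^sup>+z. ennreal (g (cmod z) * \<omega> (cmod z)) \<partial>disc_area) < \<infinity>"
    by (rule omega_integral_finite[OF gm g])
  have Gpos: "0 < G"
  proof -
    have nn: "0 \<le> g (cmod \<zeta>) * \<omega> (cmod \<zeta>)" if "\<zeta> \<in> space disc_area" for \<zeta> using g(1) that by simp
    have [measurable]: "(\<lambda>\<zeta>. g (cmod \<zeta>) * \<omega> (cmod \<zeta>)) \<in> borel_measurable disc_area"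
      by (rule radial_real_measurable[OF radial_omega_integral(1)[OF gm]])
    have i: "integrable disc_area (\<lambda>\<zeta>. g (cmod \<zeta>) * \<omega> (cmod \<zeta>))"
    proof (rule integrableI_bounded)
      have "(\<integral>\<^sup>+\<zeta>. ennreal (norm (g (cmod \<zeta>) * \<omega> (cmod \<zeta>))) \<partial>disc_area) = (\<integral>\<^sup>+z. ennreal (g (cmod z) * \<omega> (cmod z)) \<partial>disc_area)"
        using nn by (intro nn_integral_cong) simp
      then show "(\<integral>\<^sup>+\<zeta>. ennreal (norm (g (cmod \<zeta>) * \<omega> (cmod \<zeta>))) \<partial>disc_area) < \<infinity>" using fin by simp
    qed measurable
    have "0 < ennreal (c * tail \<omega> (1/2))" using c tail_pos[OF rw, of "1/2"] by simp
    also have "\<dots> = ennreal c * (\<integral>\<^sup>+t\<in>{1/2..<1}. ennreal (\<omega> t) \<partial>lebesgue)" using c by (simp add: tail_nn[OF rw] ennreal_mult')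
    also have "\<dots> = (\<integral>\<^sup>+t. ennreal c * (ennreal (\<omega> t) * indicator {1/2..<1} t) \<partial>lebesgue)"
      by (rule nn_integral_cmult[symmetric], rule restrict_measurable[OF radial_weight_measurable[OF rw]]) auto
    also have "\<dots> \<le> (\<integral>\<^sup>+t\<in>{0..<1}. ennreal (2 * t) * ennreal (g t * \<omega> t) \<partial>lebesgue)"
    proof (rule nn_integral_mono)
      fix t
      show "ennreal c * (ennreal (\<omega> t) * indicator {1/2..<1} t) \<le> ennreal (2 * t) * ennreal (g t * \<omega> t) * indicator {0..<1} t"
      proof (cases "t \<in> {1/2..<1}")
        case True
        then have "1 * (c * \<omega> t) \<le> (2 * t) * (c * \<omega> t)" using c by (intro mult_right_mono) auto
        then have "ennreal (c * \<omega> t) \<le> ennreal ((2 * t) * (g t * \<omega> t))" by (intro ennreal_leI) (simp add: g_def)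
        then show ?thesis using True c by (simp add: ennreal_mult' g_def)
      qed simp
    qed
    also have "\<dots> = (\<integral>\<^sup>+z. ennreal (g (cmod z) * \<omega> (cmod z)) \<partial>disc_area)" by (rule radial_omega_integral(2)[OF gm, symmetric])
    also have "\<dots> = ennreal G" unfolding G_def using i by (subst nn_integral_eq_integral) (auto intro!: AE_I2 nn)
    finally show ?thesis by simp
  qed
  have c0: "0 < bcoef \<omega> 0" using bcoef_pos[OF rw] .
  have "ennreal ((bcoef \<omega> 0 * G) * fN (1/2)) \<le> Lp_norm p \<nu> (bergman_proj \<omega> f)"
  proof (rule Lp_norm_ge_annulus)
    show "0 \<le> bcoef \<omega> 0 * G" using c0 Gpos by simp
    fix z :: complex assume z: "1/2 \<le> cmod z" "cmod z < 1"
    have "bergman_proj \<omega> f z = complex_of_real (bcoef \<omega> 0) * z ^ 0 * complex_of_real G"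
      unfolding f_def G_def using z by (intro bergman_proj_monomial wD gm g(1) fin) auto
    then show "bcoef \<omega> 0 * G \<le> cmod (bergman_proj \<omega> f z)" using c0 Gpos by (simp add: norm_mult)
  qed auto
  moreover have "0 < ennreal ((bcoef \<omega> 0 * G) * fN (1/2))" using c0 Gpos tail_pos[OF rn, of "1/2"] by (simp add: fN_def)
  ultimately have "0 < Lp_norm p \<nu> (bergman_proj \<omega> f)" by (rule less_le_trans[rotated])
  also have "\<dots> \<le> Lp_opnorm p \<nu> (bergman_proj \<omega>)"
    unfolding Lp_opnorm_def using fL(1) f1 by (intro SUP_upper) auto
  finally show ?thesis .
qed

lemma Lp_opnorm_max_bergman_proj_finite:
  assumes "max_bergman_proj_bounded p \<omega> \<nu>"
  shows "Lp_opnorm p \<nu> (max_bergman_proj \<omega>) < \<infinity>"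
proof -
  obtain C where C: "C \<ge> 0" "\<And>f. f \<in> Lp_space p \<nu> \<Longrightarrow> Lp_norm p \<nu> (max_bergman_proj \<omega> f) \<le> ennreal C * Lp_norm p \<nu> f"
    using assms unfolding max_bergman_proj_bounded_def integral_op_bounded_def max_bergman_proj_def by auto
  have "Lp_opnorm p \<nu> (max_bergman_proj \<omega>) \<le> ennreal C"
    unfolding Lp_opnorm_def
  proof (rule SUP_least, clarify)
    fix f assume f: "f \<in> Lp_space p \<nu>" "Lp_norm p \<nu> f \<le> 1"
    have "Lp_norm p \<nu> (max_bergman_proj \<omega> f) \<le> ennreal C * Lp_norm p \<nu> f" using C(2)[OF f(1)] .
    also have "\<dots> \<le> ennreal C * 1" using f(2) by (rule mult_left_mono) simp
    finally show "Lp_norm p \<nu> (max_bergman_proj \<omega> f) \<le> ennreal C" by simp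
  qed
  then show ?thesis by (simp add: le_less_trans)
qed

end

text \<open>If \<open>y\<close> is infinite the constant 1 works; otherwise the quotient does, with
  1 added to keep it positive when \<open>x = 0\<close>.\<close>

lemma ennreal_le_const_mult:
  fixes x y :: ennreal
  assumes "x < \<infinity>" "0 < y"
  shows "\<exists>C>0. x \<le> ennreal C * y"
proof (cases "y = \<infinity>")
  case True
  then show ?thesis by (intro exI[of _ 1]) simp
next
  case False
  then obtain a b where ab: "x = ennreal a" "0 \<le> a" "y = ennreal b" "0 \<le> b"
    using assms(1) by (cases x; cases y) auto
  then have b: "0 < b" using assms(2) by simp
  have "a \<le> (a / b + 1) * b" using b by (simp add: distrib_right)
  then have "x \<le> ennreal (a / b + 1) * y" using ab b by (simp add: ennreal_mult'[symmetric] ennreal_leI del: ennreal_plus)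
  moreover have "0 < a / b + 1" using ab b by (simp add: add_nonneg_pos)
  ultimately show ?thesis by blast
qed

theorem theorem13:
  fixes p :: real and \<omega> \<nu> :: "real \<Rightarrow> real"
  assumes "1 < p" and "\<omega> \<in> class_Dhat" and "radial_weight \<nu>"
  shows
    "(max_bergman_proj_bounded p \<omega> \<nu> \<longleftrightarrow> bergman_proj_bounded p \<omega> \<nu> \<and> \<nu> \<in> class_M) \<and>
     (max_bergman_proj_bounded p \<omega> \<nu> \<longleftrightarrow>
        A_const p \<omega> \<nu> < \<infinity> \<and> \<omega> \<in> class_D \<and> \<nu> \<in> class_D) \<and>
     (max_bergman_proj_bounded p \<omega> \<nu> \<longleftrightarrow>
        M_const p \<omega> \<nu> < \<infinity> \<and> \<omega> \<in> class_D \<and> \<nu> \<in> class_D) \<and>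
     (max_bergman_proj_bounded p \<omega> \<nu> \<longrightarrow>
        (\<exists>C>0. M_const p \<omega> \<nu> epowr (1 - 1 / p) \<le> ennreal C * A_const p \<omega> \<nu>) \<and>
        (\<exists>C>0. A_const p \<omega> \<nu> \<le> ennreal C * Lp_opnorm p \<nu> (bergman_proj \<omega>)) \<and>
        Lp_opnorm p \<nu> (bergman_proj \<omega>) \<le> Lp_opnorm p \<nu> (max_bergman_proj \<omega>) \<and>
        (\<exists>C>0. Lp_opnorm p \<nu> (max_bergman_proj \<omega>) \<le>
                 ennreal C * M_const p \<omega> \<nu> epowr (2 - 1 / p)))"
proof -
  interpret two_weights p \<omega> \<nu>
    using assms Dhat_radial by unfold_locales auto
  note wD = assms(2)
  have from_A: "two_weights_fin p \<omega> \<nu> \<and> (\<exists>A. two_weights_A p \<omega> \<nu> A)" if "A_const p \<omega> \<nu> < \<infinity>"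
  proof -
    from that obtain A where sf: "sigma_tail p \<omega> \<nu> 0 < \<infinity>" and A: "A > 0" "\<forall>r\<in>{0..<1}. fN r * fE r \<le> A * tail \<omega> r"
      unfolding A_const_finite_iff by auto
    from sf interpret two_weights_fin p \<omega> \<nu> by unfold_locales
    have "two_weights_A p \<omega> \<nu> A" using A wD by unfold_locales auto
    then show ?thesis using two_weights_fin_axioms by blast
  qed
  have i_A: "A_const p \<omega> \<nu> < \<infinity>" if "max_bergman_proj_bounded p \<omega> \<nu>"
    using A_const_finite_of_bergman_proj[OF wD bergman_proj_bounded_of_max[OF that]] .
  \<comment> \<open>Decay of \<open>\<omega>\<close> comes first, from the maximal projection;
    \<open>\<nu>\<close> inherits it through the finite \<open>A_const\<close>.\<close>
  have i_iii: "\<omega> \<in> class_Dcheck \<and> \<nu> \<in> class_Dhat \<and> \<nu> \<in> class_Dcheck \<and> M_const p \<omega> \<nu> < \<infinity>" if m: "max_bergman_proj_bounded p \<omega> \<nu>"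
  proof -
    from from_A[OF i_A[OF m]] obtain A where "two_weights_A p \<omega> \<nu> A" by auto
    then interpret two_weights_A p \<omega> \<nu> A .
    have "\<omega> \<in> class_Dcheck" using Dcheck_of_max_bergman_proj[OF wD m] .
    then show ?thesis using nu_Dhat nu_Dcheck M_const_finite by auto
  qed
  have iii_i: "max_bergman_proj_bounded p \<omega> \<nu>" if "A_const p \<omega> \<nu> < \<infinity>" "\<omega> \<in> class_Dcheck"
  proof -
    from from_A[OF that(1)] obtain A where "two_weights_A p \<omega> \<nu> A" by auto
    then interpret two_weights_A p \<omega> \<nu> A .
    show ?thesis using max_bergman_proj_bounded_of_A[OF that(2)] .
  qed
  \<comment> \<open>Finiteness of \<open>A_const\<close> is used twice: it makes
    \<open>\<nu>\<close> doubling, so that \<open>class_M\<close> becomes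
    \<open>class_Dcheck\<close>, and it then carries the decay of \<open>\<nu>\<close> over to
    \<open>\<omega>\<close>.\<close>
  have ii_i: "max_bergman_proj_bounded p \<omega> \<nu>" if b: "bergman_proj_bounded p \<omega> \<nu>" "\<nu> \<in> class_M"
  proof -
    have a: "A_const p \<omega> \<nu> < \<infinity>" using A_const_finite_of_bergman_proj[OF wD b(1)] .
    from from_A[OF a] obtain A where "two_weights_A p \<omega> \<nu> A" by auto
    then interpret two_weights_A p \<omega> \<nu> A .
    have "\<nu> \<in> class_Dcheck" using Dhat_M_iff_Dcheck[OF nu_Dhat] b(2) by simp
    then show ?thesis using iii_i[OF a omega_Dcheck] by simp
  qed
  have 1: "max_bergman_proj_bounded p \<omega> \<nu> \<longleftrightarrow> bergman_proj_bounded p \<omega> \<nu> \<and> \<nu> \<in> class_M"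
    using ii_i bergman_proj_bounded_of_max i_iii Dhat_M_iff_Dcheck by blast
  have 2: "max_bergman_proj_bounded p \<omega> \<nu> \<longleftrightarrow> A_const p \<omega> \<nu> < \<infinity> \<and> \<omega> \<in> class_D \<and> \<nu> \<in> class_D"
    using iii_i i_A i_iii wD unfolding class_D_def by blast
  have 3: "max_bergman_proj_bounded p \<omega> \<nu> \<longleftrightarrow> M_const p \<omega> \<nu> < \<infinity> \<and> \<omega> \<in> class_D \<and> \<nu> \<in> class_D"
    using iii_i A_const_finite_of_M_const[OF wD] i_iii wD unfolding class_D_def by blast
  \<comment> \<open>The constants may depend on the weights, so positivity and finiteness of the four quantities suffice.\<close>
  have 4: "(\<exists>C>0. M_const p \<omega> \<nu> epowr (1 - 1 / p) \<le> ennreal C * A_const p \<omega> \<nu>) \<and>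
        (\<exists>C>0. A_const p \<omega> \<nu> \<le> ennreal C * Lp_opnorm p \<nu> (bergman_proj \<omega>)) \<and>
        Lp_opnorm p \<nu> (bergman_proj \<omega>) \<le> Lp_opnorm p \<nu> (max_bergman_proj \<omega>) \<and>
        (\<exists>C>0. Lp_opnorm p \<nu> (max_bergman_proj \<omega>) \<le> ennreal C * M_const p \<omega> \<nu> epowr (2 - 1 / p))"
    if m: "max_bergman_proj_bounded p \<omega> \<nu>"
  proof -
    from from_A[OF i_A[OF m]] interpret two_weights_fin p \<omega> \<nu> by simp
    have Mf: "M_const p \<omega> \<nu> < \<infinity>" using i_iii[OF m] by simp
    show ?thesis
    proof (intro conjI ennreal_le_const_mult)
      show "M_const p \<omega> \<nu> epowr (1 - 1 / p) < \<infinity>" using Mf by simp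
      show "0 < M_const p \<omega> \<nu> epowr (2 - 1 / p)" using M_const_pos by (simp add: zero_less_iff_neq_zero)
    qed (use A_const_pos i_A[OF m] Lp_opnorm_bergman_proj_pos[OF wD] Lp_opnorm_bergman_le[OF m] Lp_opnorm_max_bergman_proj_finite[OF m] in auto)
  qed
  show ?thesis using 1 2 3 4 by blast
qed

end
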